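(* The problem BoundRep with a prescribed ordering of the components can be solved in time $\mathcal{O}(n^2+nD(r))$, where $n$ is the number of vertices and $r$ the size of the input.
   Context: BoundRep: given a graph $G$ and, for each vertex $v$, a lower bound $\mathrm{lbound}(v)\in\mathbb{Q}\cup\{-\infty\}$ and an upper bound $\mathrm{ubound}(v)\in\mathbb{Q}\cup\{+\infty\}$ (rationals given as fractions), decide whether there is a bounded representation: reals $\ell_v$ with $uv\in E(G)$ iff the closed intervals $[\ell_u,\ell_u+1]$ and $[\ell_v,\ell_v+1]$ intersect, and $\mathrm{lbound}(v)\le\ell_v\le\mathrm{ubound}(v)$ for all $v$ (and construct one if it exists). In the version with prescribed ordering, a linear order $C_1,\dots,C_c$ of the connected components of $G$ is also given, and the intervals of $C_t$ must all lie to the left of the intervals of $C_{t+1}$ for each $t$. $D(r)$ denotes the time needed to multiply or divide two numbers with $\mathcal{O}(r)$ binary digits; arithmetic on numbers with $\mathcal{O}(\log r)$ bits takes constant time. *)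

theory Defs
  imports Complex_Main "HOL-Library.Extended_Real" "HOL-Library.Log_Nat"
begin

section \<open>Bounded unit interval representations\<close>

definition conn_components :: "'v set \<Rightarrow> 'v set set \<Rightarrow> 'v set set" where
  "conn_components V E =
     V // {(u, v). u \<in> V \<and> v \<in> V \<and> (u, v) \<in> {(a, b). {a, b} \<in> E}\<^sup>*}"

abbreviation unit_interval :: "real \<Rightarrow> real set" where
  "unit_interval x \<equiv> {x .. x + 1}"

definition bounded_rep ::
  "'v set \<Rightarrow> 'v set set \<Rightarrow> ('v \<Rightarrow> ereal) \<Rightarrow> ('v \<Rightarrow> ereal) \<Rightarrow> ('v \<Rightarrow> real) \<Rightarrow> bool" where
  "bounded_rep V E lbound ubound l \<longleftrightarrow>
     (\<forall>u\<in>V. \<forall>v\<in>V. u \<noteq> v \<longrightarrow>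
        ({u, v} \<in> E \<longleftrightarrow> unit_interval (l u) \<inter> unit_interval (l v) \<noteq> {})) \<and>
     (\<forall>v\<in>V. lbound v \<le> ereal (l v) \<and> ereal (l v) \<le> ubound v)"

definition left_of :: "real set \<Rightarrow> real set \<Rightarrow> bool" where
  "left_of A B \<longleftrightarrow> (\<forall>x\<in>A. \<forall>y\<in>B. x < y)"

definition respects_order :: "'v set list \<Rightarrow> ('v \<Rightarrow> real) \<Rightarrow> bool" where
  "respects_order Cs l \<longleftrightarrow>
     (\<forall>t. Suc t < length Cs \<longrightarrow>
        (\<forall>u \<in> Cs ! t. \<forall>v \<in> Cs ! Suc t. left_of (unit_interval (l u)) (unit_interval (l v))))"


section \<open>Inputs of BoundRep with a prescribed ordering of the components\<close>

text \<open>The vertices are \<open>0, \<dots>, nv I - 1\<close>. A bound is a fraction (numerator, denominator), not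
  necessarily in lowest terms; \<open>None\<close> stands for an infinite bound.\<close>

record boundrep_input =
  nv :: nat
  edge_list :: "(nat \<times> nat) list"
  lbounds :: "(int \<times> int) option list"
  ubounds :: "(int \<times> int) option list"
  comps :: "nat set list"

definition vertices :: "boundrep_input \<Rightarrow> nat set" where
  "vertices I = {..<nv I}"

definition edges :: "boundrep_input \<Rightarrow> nat set set" where
  "edges I = (\<lambda>(u, v). {u, v}) ` set (edge_list I)"

definition lbound :: "boundrep_input \<Rightarrow> nat \<Rightarrow> ereal" where
  "lbound I v = (case lbounds I ! v of
     None \<Rightarrow> - \<infinity> | Some (p, q) \<Rightarrow> ereal (real_of_int p / real_of_int q))"

definition ubound :: "boundrep_input \<Rightarrow> nat \<Rightarrow> ereal" where
  "ubound I v = (case ubounds I ! v of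
     None \<Rightarrow> \<infinity> | Some (p, q) \<Rightarrow> ereal (real_of_int p / real_of_int q))"

definition valid_input :: "boundrep_input \<Rightarrow> bool" where
  "valid_input I \<longleftrightarrow>
     (\<forall>(u, v) \<in> set (edge_list I). u < nv I \<and> v < nv I \<and> u \<noteq> v) \<and>
     distinct (map (\<lambda>(u, v). {u, v}) (edge_list I)) \<and>
     length (lbounds I) = nv I \<and> length (ubounds I) = nv I \<and>
     (\<forall>p q. Some (p, q) \<in> set (lbounds I) \<union> set (ubounds I) \<longrightarrow> q > 0) \<and>
     distinct (comps I) \<and> set (comps I) = conn_components (vertices I) (edges I)"

definition is_solution :: "boundrep_input \<Rightarrow> (nat \<Rightarrow> real) \<Rightarrow> bool" where
  "is_solution I l \<longleftrightarrow>
     bounded_rep (vertices I) (edges I) (lbound I) (ubound I) l \<and> respects_order (comps I) l"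


section \<open>The machine model\<close>

text \<open>A RAM with structured control and finitely many arrays of integers (a scalar is cell 0 of an
  array). Below, \<open>r\<close> is the size of the input and \<open>c\<close> is a constant of the algorithm: words have
  at most \<open>c\<close> times \<open>\<Theta>(log r)\<close> bits.
  Addresses must be words. Multiplying or dividing two words takes time 1, multiplying
  or dividing two numbers with at most \<open>c * r\<close> bits takes time \<open>D r\<close>, and multiplication or
  division of longer numbers is not available. Every other operation takes time proportional to
  the number of blocks of \<open>\<Theta>(log r)\<close> bits occupied by its operands, hence constant time on
  numbers with \<open>O(log r)\<close> bits.\<close>

datatype aexp =
    Const int
  | Cell string aexp
  | Plus aexp aexp
  | Minus aexp aexp
  | Times aexp aexp
  | Div aexp aexp
  | Mod aexp aexp

datatype bexp = Less aexp aexp | Equal aexp aexp | Not bexp | And bexp bexp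

datatype com =
    Skip
  | Assign string aexp aexp    \<comment> \<open>\<open>Assign x i e\<close> stores \<open>e\<close> in cell \<open>i\<close> of the array \<open>x\<close>\<close>
  | Seq com com
  | If bexp com com
  | While bexp com

type_synonym state = "string \<Rightarrow> nat \<Rightarrow> int"

text \<open>One sign bit plus the binary digits of the absolute value.\<close>
definition nbits :: "int \<Rightarrow> nat" where
  "nbits a = Suc (floorlog 2 (nat \<bar>a\<bar>))"

definition blocks :: "nat \<Rightarrow> int \<Rightarrow> nat" where
  "blocks r a = nbits a div floorlog 2 r + 1"

definition is_word :: "nat \<Rightarrow> nat \<Rightarrow> int \<Rightarrow> bool" where
  "is_word c r a \<longleftrightarrow> nbits a \<le> c * floorlog 2 r"

definition is_address :: "nat \<Rightarrow> nat \<Rightarrow> int \<Rightarrow> bool" where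
  "is_address c r a \<longleftrightarrow> a \<ge> 0 \<and> is_word c r a"

definition muldiv_ok :: "nat \<Rightarrow> nat \<Rightarrow> int \<Rightarrow> int \<Rightarrow> bool" where
  "muldiv_ok c r a b \<longleftrightarrow>
     (is_word c r a \<and> is_word c r b) \<or> (nbits a \<le> c * r \<and> nbits b \<le> c * r)"

definition muldiv_time :: "(nat \<Rightarrow> nat) \<Rightarrow> nat \<Rightarrow> nat \<Rightarrow> int \<Rightarrow> int \<Rightarrow> nat" where
  "muldiv_time D c r a b = (if is_word c r a \<and> is_word c r b then 1 else D r)"

fun aval :: "aexp \<Rightarrow> state \<Rightarrow> int" where
  "aval (Const k) s = k"
| "aval (Cell x e) s = s x (nat (aval e s))"
| "aval (Plus e f) s = aval e s + aval f s"
| "aval (Minus e f) s = aval e s - aval f s"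
| "aval (Times e f) s = aval e s * aval f s"
| "aval (Div e f) s = aval e s div aval f s"
| "aval (Mod e f) s = aval e s mod aval f s"

fun aok :: "nat \<Rightarrow> nat \<Rightarrow> aexp \<Rightarrow> state \<Rightarrow> bool" where
  "aok c r (Const k) s = True"
| "aok c r (Cell x e) s = (aok c r e s \<and> is_address c r (aval e s))"
| "aok c r (Plus e f) s = (aok c r e s \<and> aok c r f s)"
| "aok c r (Minus e f) s = (aok c r e s \<and> aok c r f s)"
| "aok c r (Times e f) s = (aok c r e s \<and> aok c r f s \<and> muldiv_ok c r (aval e s) (aval f s))"
| "aok c r (Div e f) s =
     (aok c r e s \<and> aok c r f s \<and> muldiv_ok c r (aval e s) (aval f s) \<and> aval f s \<noteq> 0)"
| "aok c r (Mod e f) s =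
     (aok c r e s \<and> aok c r f s \<and> muldiv_ok c r (aval e s) (aval f s) \<and> aval f s \<noteq> 0)"

fun atime :: "(nat \<Rightarrow> nat) \<Rightarrow> nat \<Rightarrow> nat \<Rightarrow> aexp \<Rightarrow> state \<Rightarrow> nat" where
  "atime D c r (Const k) s = blocks r k"
| "atime D c r (Cell x e) s = atime D c r e s + blocks r (s x (nat (aval e s)))"
| "atime D c r (Plus e f) s =
     atime D c r e s + atime D c r f s + blocks r (aval e s) + blocks r (aval f s)"
| "atime D c r (Minus e f) s =
     atime D c r e s + atime D c r f s + blocks r (aval e s) + blocks r (aval f s)"
| "atime D c r (Times e f) s =
     atime D c r e s + atime D c r f s + muldiv_time D c r (aval e s) (aval f s)"
| "atime D c r (Div e f) s =
     atime D c r e s + atime D c r f s + muldiv_time D c r (aval e s) (aval f s)"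
| "atime D c r (Mod e f) s =
     atime D c r e s + atime D c r f s + muldiv_time D c r (aval e s) (aval f s)"

fun bval :: "bexp \<Rightarrow> state \<Rightarrow> bool" where
  "bval (Less e f) s = (aval e s < aval f s)"
| "bval (Equal e f) s = (aval e s = aval f s)"
| "bval (Not b) s = (\<not> bval b s)"
| "bval (And b d) s = (bval b s \<and> bval d s)"

fun bok :: "nat \<Rightarrow> nat \<Rightarrow> bexp \<Rightarrow> state \<Rightarrow> bool" where
  "bok c r (Less e f) s = (aok c r e s \<and> aok c r f s)"
| "bok c r (Equal e f) s = (aok c r e s \<and> aok c r f s)"
| "bok c r (Not b) s = bok c r b s"
| "bok c r (And b d) s = (bok c r b s \<and> bok c r d s)"

fun btime :: "(nat \<Rightarrow> nat) \<Rightarrow> nat \<Rightarrow> nat \<Rightarrow> bexp \<Rightarrow> state \<Rightarrow> nat" where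
  "btime D c r (Less e f) s =
     atime D c r e s + atime D c r f s + blocks r (aval e s) + blocks r (aval f s)"
| "btime D c r (Equal e f) s =
     atime D c r e s + atime D c r f s + blocks r (aval e s) + blocks r (aval f s)"
| "btime D c r (Not b) s = btime D c r b s + 1"
| "btime D c r (And b d) s = btime D c r b s + btime D c r d s + 1"

definition store :: "state \<Rightarrow> string \<Rightarrow> nat \<Rightarrow> int \<Rightarrow> state" where
  "store s x i a = s(x := (s x)(i := a))"

text \<open>\<open>exec D c r p s t s'\<close>: started in \<open>s\<close>, the program \<open>p\<close> halts in \<open>s'\<close> after time \<open>t\<close>.
  A program gets stuck (no derivation) on an inadmissible operation.\<close>

inductive exec :: "(nat \<Rightarrow> nat) \<Rightarrow> nat \<Rightarrow> nat \<Rightarrow> com \<Rightarrow> state \<Rightarrow> nat \<Rightarrow> state \<Rightarrow> bool"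
  for D :: "nat \<Rightarrow> nat" and c r :: nat where
  Skip: "exec D c r Skip s 1 s"
| Assign: "\<lbrakk>aok c r i s; is_address c r (aval i s); aok c r e s\<rbrakk> \<Longrightarrow>
    exec D c r (Assign x i e) s (atime D c r i s + atime D c r e s + blocks r (aval e s))
      (store s x (nat (aval i s)) (aval e s))"
| Seq: "\<lbrakk>exec D c r p s t s'; exec D c r q s' t' s''\<rbrakk> \<Longrightarrow>
    exec D c r (Seq p q) s (t + t') s''"
| IfTrue: "\<lbrakk>bok c r b s; bval b s; exec D c r p s t s'\<rbrakk> \<Longrightarrow>
    exec D c r (If b p q) s (btime D c r b s + t) s'"
| IfFalse: "\<lbrakk>bok c r b s; \<not> bval b s; exec D c r q s t s'\<rbrakk> \<Longrightarrow>
    exec D c r (If b p q) s (btime D c r b s + t) s'"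
| WhileFalse: "\<lbrakk>bok c r b s; \<not> bval b s\<rbrakk> \<Longrightarrow>
    exec D c r (While b p) s (btime D c r b s) s"
| WhileTrue: "\<lbrakk>bok c r b s; bval b s; exec D c r p s t s'; exec D c r (While b p) s' t' s''\<rbrakk> \<Longrightarrow>
    exec D c r (While b p) s (btime D c r b s + t + t') s''"


section \<open>Encoding of inputs and outputs\<close>

text \<open>An infinite bound is encoded with denominator 0. The order of the components is given by
  storing, for every vertex, the (0-based) position of its component.\<close>

definition bound_num :: "(int \<times> int) option \<Rightarrow> int" where
  "bound_num b = (case b of None \<Rightarrow> 0 | Some (p, q) \<Rightarrow> p)"

definition bound_den :: "(int \<times> int) option \<Rightarrow> int" where
  "bound_den b = (case b of None \<Rightarrow> 0 | Some (p, q) \<Rightarrow> q)"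

definition comp_index :: "boundrep_input \<Rightarrow> nat \<Rightarrow> nat" where
  "comp_index I v = (THE t. t < length (comps I) \<and> v \<in> comps I ! t)"

definition encode :: "boundrep_input \<Rightarrow> (string \<times> int list) list" where
  "encode I =
    [(''n'', [int (nv I)]),
     (''m'', [int (length (edge_list I))]),
     (''edge_u'', map (int \<circ> fst) (edge_list I)),
     (''edge_v'', map (int \<circ> snd) (edge_list I)),
     (''lb_num'', map bound_num (lbounds I)),
     (''lb_den'', map bound_den (lbounds I)),
     (''ub_num'', map bound_num (ubounds I)),
     (''ub_den'', map bound_den (ubounds I)),
     (''comp'', map (int \<circ> comp_index I) [0..<nv I])]"

definition input_size :: "boundrep_input \<Rightarrow> nat" where
  "input_size I = (\<Sum>(x, as) \<leftarrow> encode I. \<Sum>a \<leftarrow> as. nbits a)"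

definition init_state :: "boundrep_input \<Rightarrow> state" where
  "init_state I x i = (case map_of (encode I) x of
     None \<Rightarrow> 0 | Some as \<Rightarrow> if i < length as then as ! i else 0)"

text \<open>The answer is left in \<open>''yes''\<close>. If it is 1, the left endpoints of a solution are left as
  fractions in \<open>''out_num''\<close> and \<open>''out_den''\<close>.\<close>

definition correct_output :: "boundrep_input \<Rightarrow> state \<Rightarrow> bool" where
  "correct_output I s \<longleftrightarrow>
     s ''yes'' 0 = (if \<exists>l. is_solution I l then 1 else 0) \<and>
     ((\<exists>l. is_solution I l) \<longrightarrow>
        (\<forall>v \<in> vertices I. s ''out_den'' v > 0) \<and>
        is_solution I (\<lambda>v. real_of_int (s ''out_num'' v) / real_of_int (s ''out_den'' v)))"

end

(* The bounds have a common denominator Q with O(r) bits. Only their at most 2n + 1 fractional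
   parts matter, so every solution can be moved to a grid that has n + 1 points per fractional part
   and hence only M = O(n^2) points per unit; coordinates then become integers A * M + j, where only
   A is long. Infinite lower bounds can be replaced by a finite one far to the left.

   The components are placed from left to right, each as far to the left as possible. Two searches
   of a component that prefer vertices of small degree give the order of its intervals, up to
   reversal, so both orientations are tried. For a fixed order the adjacencies are difference
   constraints whose least solution is reached by at most k rounds of relaxation on k vertices;
   prefix maxima make a round linear. Relative to the largest lower bound of the component, all
   coordinates are polynomial in n after clamping, so that they are machine words and only O(n)
   operations on long numbers remain. *)
theory Submission
  imports Defs
begin

section \<open>Running times of structured programs\<close>

text \<open>The time bound pays for only O(1) operations of cost \<open>D r\<close> per vertex, so
  the residues cannot be sorted with every comparison charged at that price. A comparison merely
  reads O(r / log r) blocks, and a binary search makes O(log r) comparisons. Inserting one residue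
  thus costs O(r), which the hypothesis on \<open>D\<close> turns into O(\<open>D r\<close>). What
  an insertion moves are indices, hence words.

  Greedy placement is correct because the components placed so far constrain the rest only through
  their rightmost left endpoint. The least solution for a fixed order minimises all coordinates at
  once, hence also this endpoint. The two orientations may end at different positions, so both are
  run and the better one is kept.

  The order of a component is never certified. If some representation exists, the computed order or
  its reversal suits it; if none exists, the order is arbitrary. Therefore every pair is checked
  after the relaxation: acceptance is sound for any order, and a double rejection shows that there
  is no representation.\<close>

fun wr :: "com \<Rightarrow> string set" where
  "wr Skip = {}"
| "wr (Assign x i e) = {x}"
| "wr (Seq p q) = wr p \<union> wr q"
| "wr (If b p q) = wr p \<union> wr q"
| "wr (While b p) = wr p"

lemma exec_frame: "exec D c r p s t s' \<Longrightarrow> x \<notin> wr p \<Longrightarrow> s' x = s x"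
  by (induction rule: exec.induct) (auto simp: store_def)

text \<open>Counts the charges that \<open>atime\<close> makes: two for a sum or difference, which
  pays for both operands, and one for a product or quotient. If each charge is at most
  \<open>u\<close>, the time is at most \<open>u\<close> times the size.\<close>

fun asize :: "aexp \<Rightarrow> nat" where
  "asize (Const k) = 1"
| "asize (Cell x e) = asize e + 1"
| "asize (Plus e f) = asize e + asize f + 2"
| "asize (Minus e f) = asize e + asize f + 2"
| "asize (Times e f) = asize e + asize f + 1"
| "asize (Div e f) = asize e + asize f + 1"
| "asize (Mod e f) = asize e + asize f + 1"

fun bsize :: "bexp \<Rightarrow> nat" where
  "bsize (Less e f) = asize e + asize f + 2"
| "bsize (Equal e f) = asize e + asize f + 2"
| "bsize (Not b) = bsize b + 1"
| "bsize (And b d) = bsize b + bsize d + 1"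

fun csize :: "com \<Rightarrow> nat" where
  "csize Skip = 1"
| "csize (Assign x i e) = asize i + asize e + 1"
| "csize (Seq p q) = csize p + csize q"
| "csize (If b p q) = bsize b + csize p + csize q"
| "csize (While b p) = 0"

text \<open>In the admissibility predicates below, \<open>A\<close> constrains addresses, \<open>P\<close> all values and
  \<open>M\<close> the operands of multiplications and divisions.\<close>

fun aadm :: "(int \<Rightarrow> bool) \<Rightarrow> (int \<Rightarrow> bool) \<Rightarrow> (int \<Rightarrow> bool) \<Rightarrow> aexp \<Rightarrow> state \<Rightarrow> bool" where
  "aadm A P M (Const k) s = P k"
| "aadm A P M (Cell x e) s = (aadm A P M e s \<and> A (aval e s) \<and> P (s x (nat (aval e s))))"
| "aadm A P M (Plus e f) s = (aadm A P M e s \<and> aadm A P M f s \<and> P (aval e s + aval f s))"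
| "aadm A P M (Minus e f) s = (aadm A P M e s \<and> aadm A P M f s \<and> P (aval e s - aval f s))"
| "aadm A P M (Times e f) s = (aadm A P M e s \<and> aadm A P M f s \<and> M (aval e s) \<and> M (aval f s) \<and>
     P (aval e s * aval f s))"
| "aadm A P M (Div e f) s = (aadm A P M e s \<and> aadm A P M f s \<and> M (aval e s) \<and> M (aval f s) \<and>
     aval f s \<noteq> 0 \<and> P (aval e s div aval f s))"
| "aadm A P M (Mod e f) s = (aadm A P M e s \<and> aadm A P M f s \<and> M (aval e s) \<and> M (aval f s) \<and>
     aval f s \<noteq> 0 \<and> P (aval e s mod aval f s))"

fun badm :: "(int \<Rightarrow> bool) \<Rightarrow> (int \<Rightarrow> bool) \<Rightarrow> (int \<Rightarrow> bool) \<Rightarrow> bexp \<Rightarrow> state \<Rightarrow> bool" where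
  "badm A P M (Less e f) s = (aadm A P M e s \<and> aadm A P M f s)"
| "badm A P M (Equal e f) s = (aadm A P M e s \<and> aadm A P M f s)"
| "badm A P M (Not b) s = badm A P M b s"
| "badm A P M (And b d) s = (badm A P M b s \<and> badm A P M d s)"

text \<open>The weakest precondition of loop-free code, given by recursion so that
  \<open>simp\<close> can execute a program symbolically and collect the admissibility conditions.
  Loops are rejected; they go through rules with invariants.\<close>

fun sl :: "(int \<Rightarrow> bool) \<Rightarrow> (int \<Rightarrow> bool) \<Rightarrow> (int \<Rightarrow> bool) \<Rightarrow> com \<Rightarrow> state \<Rightarrow> (state \<Rightarrow> bool) \<Rightarrow> bool" where
  "sl A P M Skip s Q = Q s"
| "sl A P M (Assign x i e) s Q = (aadm A P M i s \<and> A (aval i s) \<and> aadm A P M e s \<and>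
     Q (store s x (nat (aval i s)) (aval e s)))"
| "sl A P M (Seq p q) s Q = sl A P M p s (\<lambda>s'. sl A P M q s' Q)"
| "sl A P M (If b p q) s Q = (badm A P M b s \<and>
     (bval b s \<longrightarrow> sl A P M p s Q) \<and> (\<not> bval b s \<longrightarrow> sl A P M q s Q))"
| "sl A P M (While b p) s Q = False"

abbreviation Var :: "string \<Rightarrow> aexp" where "Var x \<equiv> Cell x (Const 0)"
abbreviation Put :: "string \<Rightarrow> aexp \<Rightarrow> com" where "Put x e \<equiv> Assign x (Const 0) e"

definition For :: "string \<Rightarrow> string \<Rightarrow> com \<Rightarrow> com" where
  "For x y p = Seq (Put x (Const 0))
     (While (Less (Var x) (Var y)) (Seq p (Put x (Plus (Var x) (Const 1)))))"

lemma wr_For [simp]: "wr (For x y p) = insert x (wr p)"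
  by (auto simp: For_def)

fun seqs :: "com list \<Rightarrow> com" where
  "seqs [] = Skip"
| "seqs [p] = p"
| "seqs (p # q # ps) = Seq p (seqs (q # ps))"

lemma store_same [simp]: "store s x i a x = (s x)(i := a)"
  and store_other [simp]: "y \<noteq> x \<Longrightarrow> store s x i a y = s y"
  by (auto simp: store_def)

section \<open>Words, long numbers and a uniform price per charge\<close>

locale ram =
  fixes D :: "nat \<Rightarrow> nat" and r :: nat
  assumes r2: "r \<ge> 2"
begin

text \<open>The exponent 5 accommodates the clamped coordinates, which are O(n * M) and hence
  O(r^3), together with the constants and sums that occur (\<open>small_wide\<close>). The bound
  \<open>10 * r\<close> in \<open>big\<close> is dictated by the longest numbers, the numerators of
  the output (\<open>out_bounds\<close>).\<close>

definition small :: "int \<Rightarrow> bool" where "small a \<longleftrightarrow> \<bar>a\<bar> \<le> int r ^ 5"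
definition big :: "int \<Rightarrow> bool" where "big a \<longleftrightarrow> \<bar>a\<bar> < 2 ^ (10 * r)"
definition addr :: "int \<Rightarrow> bool" where "addr a \<longleftrightarrow> 0 \<le> a \<and> small a"

text \<open>\<open>H\<close> bounds the blocks of a \<open>big\<close> number and is the price of
  adding or comparing long numbers, about r / log r. \<open>G\<close> also covers a long
  multiplication or division.\<close>

definition H :: nat where "H = (11 * r) div floorlog 2 r + 1"
definition G :: nat where "G = D r + 11 * r + 1"

text \<open>Code whose values satisfy \<open>P\<close> and whose factors and divisors satisfy
  \<open>M\<close> pays at most \<open>u\<close> per charge. Three instances occur: words only
  (\<open>md_W\<close>, constant price), long numbers with long multiplication (\<open>md_B\<close>,
  price \<open>G\<close>), and long numbers that are only added, moved and compared
  (\<open>md_C\<close>, price \<open>H\<close>).\<close>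

definition md :: "(int \<Rightarrow> bool) \<Rightarrow> (int \<Rightarrow> bool) \<Rightarrow> nat \<Rightarrow> bool" where
  "md P M u \<longleftrightarrow> u \<ge> 1 \<and> (\<forall>a. P a \<longrightarrow> blocks r a \<le> u) \<and>
     (\<forall>a b. M a \<longrightarrow> M b \<longrightarrow> muldiv_ok 11 r a b \<and> muldiv_time D 11 r a b \<le> u)"

lemma floorlog_pos: "floorlog 2 r \<ge> 1"
  using r2 by (simp add: floorlog_def)

lemma floorlog_le: "floorlog 2 r \<le> r"
  by (rule floorlog_leI) simp_all

lemma r_less_floorlog: "r < 2 ^ floorlog 2 r"
  by (rule floorlog_leD) simp_all

lemma nbits_le: "\<bar>a\<bar> < 2 ^ k \<Longrightarrow> nbits a \<le> Suc k"
proof -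
  assume "\<bar>a\<bar> < 2 ^ k"
  hence "nat \<bar>a\<bar> < 2 ^ k" by (simp add: nat_less_iff)
  thus ?thesis by (simp add: nbits_def floorlog_le_iff)
qed

text \<open>The fifth power has at most five times as many digits as \<open>r\<close>; the sixth
  multiple pays for the sign bit.\<close>

lemma small_nbits: "small a \<Longrightarrow> nbits a \<le> 6 * floorlog 2 r"
proof -
  assume a: "small a"
  have "int r < 2 ^ floorlog 2 r" using r_less_floorlog by (simp add: of_nat_less_numeral_power_cancel_iff)
  hence "int r ^ 5 < (2 ^ floorlog 2 r) ^ 5" by (intro power_strict_mono) auto
  also have "\<dots> = 2 ^ (5 * floorlog 2 r)" by (simp add: power_mult[symmetric] mult.commute)
  finally have "\<bar>a\<bar> < 2 ^ (5 * floorlog 2 r)" using a by (simp add: small_def)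
  from nbits_le[OF this] show ?thesis using floorlog_pos by simp
qed

text \<open>Digits and sign bit together stay below \<open>11 * r\<close>, which is the origin of
  the machine constant 11.\<close>

lemma big_nbits: "big a \<Longrightarrow> nbits a \<le> 11 * r"
  using nbits_le[of a "10 * r"] r2 by (simp add: big_def)

lemma small_word: "small a \<Longrightarrow> is_word 11 r a"
  using small_nbits[of a] by (simp add: is_word_def)

lemma addr_address: "addr a \<Longrightarrow> is_address 11 r a"
  by (simp add: addr_def is_address_def small_word)

lemma small_blocks: "small a \<Longrightarrow> blocks r a \<le> 7"
proof -
  assume "small a"
  hence "nbits a div floorlog 2 r \<le> 6 * floorlog 2 r div floorlog 2 r"
    by (intro div_le_mono small_nbits)
  thus ?thesis using floorlog_pos by (simp add: blocks_def)
qed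

lemma big_blocks: "big a \<Longrightarrow> blocks r a \<le> H"
  unfolding blocks_def H_def by (intro add_mono div_le_mono big_nbits) simp_all

lemma H_le: "H \<le> 11 * r + 1"
  by (simp add: H_def)

lemma small_big: "small a \<Longrightarrow> big a"
proof -
  assume a: "small a"
  have "int r < 2 ^ r" by (simp add: of_nat_less_numeral_power_cancel_iff)
  hence "int r ^ 5 < (2 ^ r) ^ 5" by (intro power_strict_mono) auto
  also have "\<dots> = 2 ^ (5 * r)" by (simp add: power_mult[symmetric] mult.commute)
  also have "\<dots> \<le> 2 ^ (10 * r)" by (intro power_increasing) auto
  finally show ?thesis using a by (simp add: big_def small_def)
qed

lemma md_W: "md small small 7"
  using small_blocks small_word by (auto simp: md_def muldiv_ok_def muldiv_time_def)

lemma md_B: "md big big G"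
proof -
  have "blocks r a \<le> G" if "big a" for a
    using big_blocks[OF that] H_le by (simp add: G_def)
  thus ?thesis using big_nbits by (auto simp: md_def muldiv_ok_def muldiv_time_def G_def)
qed

lemma md_C: "md big small H"
proof -
  have "1 \<le> H" by (simp add: H_def)
  thus ?thesis using big_blocks small_word by (auto simp: md_def muldiv_ok_def muldiv_time_def)
qed

lemma aadm_ok: "md P M u \<Longrightarrow> aadm addr P M e s \<Longrightarrow>
  aok 11 r e s \<and> atime D 11 r e s \<le> asize e * u \<and> P (aval e s)"
proof (induction e)
  case (Cell x e)
  hence "blocks r (s x (nat (aval e s))) \<le> u" by (auto simp: md_def)
  thus ?case using Cell by (auto simp: addr_address)
next
  case (Plus e f)
  hence "blocks r (aval e s) \<le> u" "blocks r (aval f s) \<le> u" by (auto simp: md_def)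
  thus ?case using Plus by (auto simp: algebra_simps)
next
  case (Minus e f)
  hence "blocks r (aval e s) \<le> u" "blocks r (aval f s) \<le> u" by (auto simp: md_def)
  thus ?case using Minus by (auto simp: algebra_simps)
next
  case (Times e f)
  hence "muldiv_ok 11 r (aval e s) (aval f s) \<and> muldiv_time D 11 r (aval e s) (aval f s) \<le> u"
    by (auto simp: md_def)
  thus ?case using Times by (auto simp: algebra_simps)
next
  case (Div e f)
  hence "muldiv_ok 11 r (aval e s) (aval f s) \<and> muldiv_time D 11 r (aval e s) (aval f s) \<le> u"
    by (auto simp: md_def)
  thus ?case using Div by (auto simp: algebra_simps)
next
  case (Mod e f)
  hence "muldiv_ok 11 r (aval e s) (aval f s) \<and> muldiv_time D 11 r (aval e s) (aval f s) \<le> u"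
    by (auto simp: md_def)
  thus ?case using Mod by (auto simp: algebra_simps)
qed (auto simp: md_def)

lemma badm_ok: "md P M u \<Longrightarrow> badm addr P M b s \<Longrightarrow> bok 11 r b s \<and> btime D 11 r b s \<le> bsize b * u"
proof (induction b)
  case (Less e f)
  hence h: "aadm addr P M e s" "aadm addr P M f s" by auto
  from aadm_ok[OF Less(1) h(1)] aadm_ok[OF Less(1) h(2)] Less(1)
  have "blocks r (aval e s) \<le> u" "blocks r (aval f s) \<le> u" by (auto simp: md_def)
  thus ?case using aadm_ok[OF Less(1) h(1)] aadm_ok[OF Less(1) h(2)] by (auto simp: algebra_simps)
next
  case (Equal e f)
  hence h: "aadm addr P M e s" "aadm addr P M f s" by auto
  from aadm_ok[OF Equal(1) h(1)] aadm_ok[OF Equal(1) h(2)] Equal(1)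
  have "blocks r (aval e s) \<le> u" "blocks r (aval f s) \<le> u" by (auto simp: md_def)
  thus ?case using aadm_ok[OF Equal(1) h(1)] aadm_ok[OF Equal(1) h(2)] by (auto simp: algebra_simps)
next
  case (Not b)
  hence "1 \<le> u" by (simp add: md_def)
  thus ?case using Not by (auto simp: algebra_simps)
next
  case (And b d)
  hence "1 \<le> u" by (simp add: md_def)
  thus ?case using And by (auto simp: algebra_simps)
qed

section \<open>Rules for total correctness with a time bound\<close>

definition wp :: "com \<Rightarrow> state \<Rightarrow> nat \<Rightarrow> (state \<Rightarrow> bool) \<Rightarrow> bool" where
  "wp p s T Q \<longleftrightarrow> (\<exists>t s'. exec D 11 r p s t s' \<and> t \<le> T \<and> Q s')"

text \<open>The frame condition is handed to the new postcondition, so that postconditions need only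
  mention what a program computes; \<open>wp_Seq\<close> does the same.\<close>

lemma wp_mono: "wp p s T Q \<Longrightarrow> T \<le> T' \<Longrightarrow> (\<And>s'. Q s' \<Longrightarrow> (\<And>z. z \<notin> wr p \<Longrightarrow> s' z = s z) \<Longrightarrow> Q' s') \<Longrightarrow>
  wp p s T' Q'"
  unfolding wp_def by (meson exec_frame le_trans)

lemma wp_Skip: "Q s \<Longrightarrow> 1 \<le> T \<Longrightarrow> wp Skip s T Q"
  unfolding wp_def using exec.Skip by blast

lemma wp_Seq:
  assumes "wp p s Tp R"
    and "\<And>s'. R s' \<Longrightarrow> (\<And>z. z \<notin> wr p \<Longrightarrow> s' z = s z) \<Longrightarrow> wp q s' Tq Q"
    and "Tp + Tq \<le> T"
  shows "wp (Seq p q) s T Q"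
proof -
  obtain t s' where 1: "exec D 11 r p s t s'" "t \<le> Tp" "R s'" using assms(1) by (auto simp: wp_def)
  obtain t' s'' where 2: "exec D 11 r q s' t' s''" "t' \<le> Tq" "Q s''"
    using assms(2)[OF 1(3) exec_frame[OF 1(1)]] by (auto simp: wp_def)
  show ?thesis unfolding wp_def
    using exec.Seq[OF 1(1) 2(1)] 1 2 assms(3) by (intro exI[of _ "t + t'"] exI[of _ s'']) auto
qed

lemma wp_sl: "md P M u \<Longrightarrow> sl addr P M p s Q \<Longrightarrow> wp p s (csize p * u) Q"
proof (induction p arbitrary: s Q)
  case Skip
  thus ?case by (auto intro!: wp_Skip simp: md_def)
next
  case (Assign x i e)
  let ?t = "atime D 11 r i s + atime D 11 r e s + blocks r (aval e s)"
  have "exec D 11 r (Assign x i e) s ?t (store s x (nat (aval i s)) (aval e s))"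
    using Assign by (intro exec.Assign) (auto simp: aadm_ok addr_address)
  moreover have "?t \<le> (asize i + asize e + 1) * u"
  proof -
    have "blocks r (aval e s) \<le> u" using Assign aadm_ok[OF Assign(1), of e s] by (auto simp: md_def)
    thus ?thesis using Assign aadm_ok[OF Assign(1), of e s] aadm_ok[OF Assign(1), of i s]
      by (auto simp: algebra_simps)
  qed
  ultimately show ?case using Assign(2) unfolding wp_def by (auto simp del: store_same store_other)
next
  case (Seq p q)
  have "wp p s (csize p * u) (\<lambda>s'. sl addr P M q s' Q)" using Seq by simp
  thus ?case by (rule wp_Seq[where Tq = "csize q * u"]) (use Seq in \<open>auto simp: algebra_simps\<close>)
next
  case (If b p q)
  have b: "bok 11 r b s" "btime D 11 r b s \<le> bsize b * u" using badm_ok[of P M u b s] If by auto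
  show ?case
  proof (cases "bval b s")
    case True
    then obtain t s' where 1: "exec D 11 r p s t s'" "t \<le> csize p * u" "Q s'"
      using If by (fastforce simp: wp_def)
    show ?thesis unfolding wp_def
      using exec.IfTrue[OF b(1) True 1(1)] 1 b by (fastforce simp: algebra_simps)
  next
    case False
    then obtain t s' where 1: "exec D 11 r q s t s'" "t \<le> csize q * u" "Q s'"
      using If by (fastforce simp: wp_def)
    show ?thesis unfolding wp_def
      using exec.IfFalse[OF b(1) False 1(1)] 1 b by (fastforce simp: algebra_simps)
  qed
qed auto

lemma wp_Seq_sl:
  assumes "md P M u" "sl addr P M p s R"
    and "\<And>s'. R s' \<Longrightarrow> (\<And>z. z \<notin> wr p \<Longrightarrow> s' z = s z) \<Longrightarrow> wp q s' Tq Q"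
    and "csize p * u + Tq \<le> T"
  shows "wp (Seq p q) s T Q"
  using wp_Seq[OF wp_sl[OF assms(1,2)] assms(3,4)] .

lemma wp_If:
  assumes "md P M u" "badm addr P M b s"
    and "bval b s \<Longrightarrow> wp p s Tp Q" "\<not> bval b s \<Longrightarrow> wp q s Tp Q" "bsize b * u + Tp \<le> T"
  shows "wp (If b p q) s T Q"
proof -
  have b: "bok 11 r b s" "btime D 11 r b s \<le> bsize b * u" using badm_ok assms by auto
  show ?thesis
  proof (cases "bval b s")
    case True
    then obtain t s' where 1: "exec D 11 r p s t s'" "t \<le> Tp" "Q s'"
      using assms by (auto simp: wp_def)
    show ?thesis unfolding wp_def
      using exec.IfTrue[OF b(1) True 1(1), of q] 1 b assms(5) by (auto intro!: exI[of _ s'])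
  next
    case False
    then obtain t s' where 1: "exec D 11 r q s t s'" "t \<le> Tp" "Q s'"
      using assms by (auto simp: wp_def)
    show ?thesis unfolding wp_def
      using exec.IfFalse[OF b(1) False 1(1), of p] 1 b assms(5) by (auto intro!: exI[of _ s'])
  qed
qed

text \<open>The index \<open>j\<close> of the invariant bounds the iterations that remain; the loop
  may stop earlier. The guard is evaluated at most \<open>j + 1\<close> times. Frame conditions
  refer to the fixed state \<open>st\<close>, so that they do not accumulate over the
  iterations.\<close>

lemma wp_While:
  assumes md: "md P M u"
    and I: "I j s"
    and adm: "\<And>j s. I j s \<Longrightarrow> (\<And>z. z \<notin> wr p \<Longrightarrow> s z = st z) \<Longrightarrow> badm addr P M b s"
    and body: "\<And>j s. I j s \<Longrightarrow> bval b s \<Longrightarrow> (\<And>z. z \<notin> wr p \<Longrightarrow> s z = st z) \<Longrightarrow>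
      \<exists>i. j = Suc i \<and> wp p s (Tb i) (I i)"
    and fin: "\<And>j s. I j s \<Longrightarrow> \<not> bval b s \<Longrightarrow> (\<And>z. z \<notin> wr p \<Longrightarrow> s z = st z) \<Longrightarrow> Q s"
    and fr: "\<And>z. z \<notin> wr p \<Longrightarrow> s z = st z"
    and T: "(\<Sum>i<j. Tb i) + (bsize b * u) * (j + 1) \<le> T"
  shows "wp (While b p) s T Q"
proof -
  have "wp (While b p) s ((\<Sum>i<j. Tb i) + (bsize b * u) * (j + 1)) Q"
    using I fr
  proof (induction j arbitrary: s rule: nat_less_induct)
    case (1 j)
    have b: "bok 11 r b s" "btime D 11 r b s \<le> bsize b * u" using badm_ok[OF md adm] 1(2,3) by auto
    show ?case
    proof (cases "bval b s")
      case True
      then obtain i where i: "j = Suc i" "wp p s (Tb i) (I i)" using body[OF 1(2) True] 1(3) by blast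
      then obtain t s' where e: "exec D 11 r p s t s'" "t \<le> Tb i" "I i s'" by (auto simp: wp_def)
      have "s' z = st z" if "z \<notin> wr p" for z using exec_frame[OF e(1) that] 1(3) that by simp
      then obtain t' s'' where e': "exec D 11 r (While b p) s' t' s''"
        "t' \<le> (\<Sum>i<i. Tb i) + (bsize b * u) * (i + 1)" "Q s''"
        using 1(1) e(3) i(1) unfolding wp_def by blast
      show ?thesis unfolding wp_def
        using exec.WhileTrue[OF b(1) True e(1) e'(1)] e e' b i(1)
        by (intro exI[of _ "btime D 11 r b s + t + t'"] exI[of _ s'']) (auto simp: algebra_simps)
    next
      case False
      show ?thesis unfolding wp_def
        using exec.WhileFalse[OF b(1) False] b fin[OF 1(2) False] 1(3)
        by (intro exI[of _ "btime D 11 r b s"] exI[of _ s]) (auto simp: algebra_simps)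
    qed
  qed
  thus ?thesis by (rule wp_mono) (use T in auto)
qed

lemma wp_For:
  assumes xy: "x \<notin> wr p" "y \<notin> wr p" "x \<noteq> y" and N: "st y 0 = int N" "small (int N)"
    and I0: "I 0 (store st x 0 0)"
    and body: "\<And>k s. k < N \<Longrightarrow> I k s \<Longrightarrow> s x 0 = int k \<Longrightarrow> s y 0 = int N \<Longrightarrow>
      (\<And>z. z \<notin> insert x (wr p) \<Longrightarrow> s z = st z) \<Longrightarrow>
      wp p s (Tb k) (\<lambda>s'. I (Suc k) (store s' x 0 (int (Suc k))))"
    and fin: "\<And>s. I N s \<Longrightarrow> s x 0 = int N \<Longrightarrow> (\<And>z. z \<notin> insert x (wr p) \<Longrightarrow> s z = st z) \<Longrightarrow> Q s"
    and T: "(\<Sum>k<N. Tb k) + 100 * (N + 1) \<le> T"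
  shows "wp (For x y p) st T Q"
proof -
  let ?p = "Seq p (Put x (Plus (Var x) (Const 1)))"
  let ?b = "Less (Var x) (Var y)"
  let ?J = "\<lambda>j s. \<exists>k. k + j = N \<and> I k s \<and> s x 0 = int k"
  have r0: "1 \<le> int r ^ 5" "small 0" "small 1" using r2 by (auto simp: small_def)
  have sm: "small (int k)" if "k \<le> N" for k using N(2) that by (simp add: small_def)
  \<comment> \<open>At price 7, the guard costs 6 * 7 = 42 and the increment 7 * 7 = 49 per
    iteration. The last guard adds 42 and the initialisation 21, so 100 per iteration and 100 once
    suffice.\<close>
  have "wp (While ?b ?p) (store st x 0 0) ((\<Sum>k<N. Tb k) + 91 * N + 42) Q"
  proof (rule wp_While[where I = ?J and j = N and st = st and Tb = "\<lambda>i. Tb (N - Suc i) + 49"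
        and b = ?b and p = ?p and P = small and M = small and u = 7 and Q = Q])
    show "md small small 7" by (rule md_W)
  next
    show "?J N (store st x 0 0)" using I0 by simp
  next
    fix j s assume "?J j s" and f: "\<And>z. z \<notin> wr ?p \<Longrightarrow> s z = st z"
    then obtain k where k: "k + j = N" "I k s" "s x 0 = int k" by blast
    have "s y 0 = int N" using f[of y] xy N by simp
    thus "badm addr small small ?b s" using sm[of k] sm[of N] k r0 by (simp add: addr_def)
  next
    fix j s assume "?J j s" and b: "bval ?b s" and f: "\<And>z. z \<notin> wr ?p \<Longrightarrow> s z = st z"
    then obtain k where k: "k + j = N" "I k s" "s x 0 = int k" by blast
    have y: "s y 0 = int N" using f[of y] xy N by simp
    hence kN: "k < N" using b k by simp
    then obtain i where i: "j = Suc i" using k by (cases j) auto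
    have "wp p s (Tb k) (\<lambda>s'. I (Suc k) (store s' x 0 (int (Suc k))))"
      using kN k y f by (intro body) auto
    hence "wp ?p s (Tb k + 49) (?J i)"
    proof (rule wp_Seq)
      fix s' assume s': "I (Suc k) (store s' x 0 (int (Suc k)))" and "\<And>z. z \<notin> wr p \<Longrightarrow> s' z = s z"
      hence x: "s' x 0 = int k" using xy k by simp
      have "sl addr small small (Put x (Plus (Var x) (Const 1))) s' (?J i)"
        using sm[of "k"] sm[of "Suc k"] kN k r0 i x s'
        by (auto simp: addr_def add.commute intro!: exI[of _ "Suc k"])
      from wp_sl[OF md_W this] show "wp (Put x (Plus (Var x) (Const 1))) s' 49 (?J i)" by simp
    qed simp
    moreover have "k = N - Suc i" using k i by simp
    ultimately show "\<exists>i. j = Suc i \<and> wp ?p s (Tb (N - Suc i) + 49) (?J i)" using i by auto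
  next
    fix j s assume "?J j s" and b: "\<not> bval ?b s" and f: "\<And>z. z \<notin> wr ?p \<Longrightarrow> s z = st z"
    then obtain k where k: "k + j = N" "I k s" "s x 0 = int k" by blast
    have y: "s y 0 = int N" using f[of y] xy N by simp
    hence "k = N" using b k by simp
    thus "Q s" using k f by (intro fin) auto
  next
    fix z assume "z \<notin> wr ?p"
    thus "store st x 0 0 z = st z" by simp
  next
    have "(\<Sum>i<N. Tb (N - Suc i) + 49) = (\<Sum>k<N. Tb k) + 49 * N"
      by (simp add: sum.distrib sum.nat_diff_reindex)
    thus "(\<Sum>i<N. Tb (N - Suc i) + 49) + bsize ?b * 7 * (N + 1) \<le> (\<Sum>k<N. Tb k) + 91 * N + 42" by simp
  qed
  moreover have "wp (Put x (Const 0)) st 21 (\<lambda>s. s = store st x 0 0)"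
    using wp_sl[OF md_W, of "Put x (Const 0)" st] r0 by (simp add: addr_def)
  ultimately show ?thesis unfolding For_def using T 
    by (intro wp_Seq[where Tp = 21 and R = "\<lambda>s. s = store st x 0 0"
          and Tq = "(\<Sum>k<N. Tb k) + 91 * N + 42"]) auto
qed

lemma wp_For_sl:
  assumes "x \<notin> wr p" "y \<notin> wr p" "x \<noteq> y" "st y 0 = int N" "small (int N)"
    and "I 0 (store st x 0 0)"
    and "md P M u"
    and "\<And>k s. k < N \<Longrightarrow> I k s \<Longrightarrow> s x 0 = int k \<Longrightarrow> s y 0 = int N \<Longrightarrow>
      (\<And>z. z \<notin> insert x (wr p) \<Longrightarrow> s z = st z) \<Longrightarrow>
      sl addr P M p s (\<lambda>s'. I (Suc k) (store s' x 0 (int (Suc k))))"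
    and "\<And>s. I N s \<Longrightarrow> s x 0 = int N \<Longrightarrow> (\<And>z. z \<notin> insert x (wr p) \<Longrightarrow> s z = st z) \<Longrightarrow> Q s"
    and "csize p * u * N + 100 * (N + 1) \<le> T"
  shows "wp (For x y p) st T Q"
  using assms(10)
  by (intro wp_For[where I = I and Tb = "\<lambda>_. csize p * u", OF assms(1-6)] wp_sl[OF assms(7)] assms(8,9))
     (auto simp: algebra_simps)

end

section \<open>Difference constraints\<close>

text \<open>The set of coordinates that agree with a solution of minimal coordinate sum grows strictly in
  every round: otherwise all other coordinates of that solution could be decreased by 1.\<close>

lemma relaxation_converges:
  fixes k :: nat and L y :: "nat \<Rightarrow> int" and con :: "nat \<Rightarrow> nat \<Rightarrow> int \<Rightarrow> bool" and F :: "(nat \<Rightarrow> int) \<Rightarrow> nat \<Rightarrow> int"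
  defines "sol \<equiv> \<lambda>y. (\<forall>i<k. L i \<le> y i) \<and> (\<forall>i<k. \<forall>j<k. \<forall>w. con j i w \<longrightarrow> y j + w \<le> y i)"
  assumes incr: "\<And>x i. i < k \<Longrightarrow> x i \<le> F x i"
    and con: "\<And>x i j w. i < k \<Longrightarrow> j < k \<Longrightarrow> con j i w \<Longrightarrow> x j + w \<le> F x i"
    and upper: "\<And>x y i. sol y \<Longrightarrow> (\<forall>i<k. L i \<le> x i) \<Longrightarrow> (\<forall>i<k. x i \<le> y i) \<Longrightarrow> i < k \<Longrightarrow> F x i \<le> y i"
    and y: "sol y"
  shows "sol ((F ^^ k) L) \<and> (\<forall>i<k. (F ^^ k) L i \<le> y i)"
proof -
  have lower: "\<forall>i<k. L i \<le> (F ^^ t) L i" for t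
    by (induction t) (use incr order_trans in \<open>force+\<close>)
  have le: "\<forall>i<k. (F ^^ t) L i \<le> z i" if "sol z" for z t
  proof (induction t)
    case 0
    thus ?case using that by (simp add: sol_def)
  next
    case (Suc t)
    show ?case using upper[OF that lower Suc] by simp
  qed
  obtain m where m: "sol m" "\<And>z. sol z \<Longrightarrow> (\<Sum>i<k. nat (m i - L i)) \<le> (\<Sum>i<k. nat (z i - L i))"
    using ex_has_least_nat[of sol y "\<lambda>z. \<Sum>i<k. nat (z i - L i)"] y by blast
  define S where "S t = {i. i < k \<and> (F ^^ t) L i = m i}" for t
  have fin: "finite (S t)" for t by (simp add: S_def)
  have sub: "S t \<subseteq> S (Suc t)" for t
    unfolding S_def using incr[of _ "(F ^^ t) L"] le[OF m(1), of "Suc t"] by force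
  have grow: "S t \<subset> S (Suc t)" if ne: "S t \<noteq> {..<k}" for t
  proof -
    define z where "z i = (if i \<in> S t then m i else m i - 1)" for i
    have lt: "(F ^^ t) L i < m i" if "i < k" "i \<notin> S t" for i
      using le[OF m(1), of t] that by (force simp: S_def)
    have Lz: "L i \<le> z i" if "i < k" for i
    proof (cases "i \<in> S t")
      case True
      thus ?thesis using m(1) that by (simp add: z_def sol_def)
    next
      case False
      hence "L i < m i" using lower[of t] lt[OF that False] that by force
      thus ?thesis using False by (simp add: z_def)
    qed
    have "S t \<subseteq> {..<k}" by (auto simp: S_def)
    then obtain i0 where i0: "i0 < k" "i0 \<notin> S t" using ne by blast
    have "(\<Sum>i<k. nat (z i - L i)) < (\<Sum>i<k. nat (m i - L i))"
    proof (rule sum_strict_mono_ex1)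
      show "\<exists>i\<in>{..<k}. nat (z i - L i) < nat (m i - L i)"
        using i0 Lz[of i0] by (intro bexI[of _ i0]) (auto simp: z_def)
    qed (auto simp: z_def)
    hence "\<not> sol z" using m(2)[of z] by linarith
    \<comment> \<open>Lowering the coordinates outside \<open>S t\<close> by 1 keeps the bounds
      \<open>L\<close> but must break a constraint. As \<open>m\<close> satisfies it, the constraint
      leads from \<open>S t\<close> to the outside and is tight for \<open>m\<close>; the next round
      then lifts its target to the value of \<open>m\<close>.\<close>
    then obtain i j w where ijw: "i < k" "j < k" "con j i w" "z i < z j + w"
      using Lz by (force simp: sol_def)
    have mc: "m j + w \<le> m i" using m(1) ijw by (auto simp: sol_def)
    hence ij: "j \<in> S t" "i \<notin> S t" "m i = m j + w"
      using ijw(4) by (auto simp: z_def split: if_splits)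
    have "m i \<le> (F ^^ Suc t) L i"
      using con[OF ijw(1-3), of "(F ^^ t) L"] ij by (simp add: S_def)
    moreover have "(F ^^ Suc t) L i \<le> m i" using le[OF m(1), of "Suc t"] ijw(1) by blast
    ultimately have "i \<in> S (Suc t)" using ijw(1) by (simp add: S_def)
    thus ?thesis using sub[of t] ij(2) by blast
  qed
  have "t \<le> card (S t) \<or> S t = {..<k}" for t
  proof (induction t)
    case (Suc t)
    show ?case
    proof (cases "S t = {..<k}")
      case True
      thus ?thesis using sub[of t] by (auto simp: S_def)
    next
      case False
      have "card (S t) < card (S (Suc t))" by (rule psubset_card_mono[OF fin grow[OF False]])
      thus ?thesis using Suc False by simp
    qed
  qed simp
  from this[of k] have "S k = {..<k}"
    using card_subset_eq[of "{..<k}" "S k"] card_mono[of "{..<k}" "S k"] by (force simp: S_def)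
  hence eq: "\<forall>i<k. (F ^^ k) L i = m i" by (auto simp: S_def)
  have "sol ((F ^^ k) L)" using m(1) eq by (auto simp: sol_def)
  thus ?thesis using le[OF y] by blast
qed

primrec prefix_max :: "int \<Rightarrow> (nat \<Rightarrow> int) \<Rightarrow> nat \<Rightarrow> int" where
  "prefix_max c x 0 = c"
| "prefix_max c x (Suc i) = max (prefix_max c x i) (x i)"

lemma prefix_max_ge: "j < i \<Longrightarrow> x j \<le> prefix_max c x i"
  by (induction i) (auto simp: less_Suc_eq)

lemma prefix_max_ge_init: "c \<le> prefix_max c x i"
  by (induction i) auto

lemma prefix_max_le_iff: "prefix_max c x i \<le> b \<longleftrightarrow> c \<le> b \<and> (\<forall>j<i. x j \<le> b)"
  by (induction i) (auto simp: less_Suc_eq)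

lemma prefix_max_attained: "prefix_max c x i = c \<or> (\<exists>j<i. prefix_max c x i = x j)"
  by (induction i) (auto simp: max_def less_Suc_eq)

text \<open>The round for an ordered component. The positions below \<open>hi i\<close> are those up
  to the last neighbour of \<open>i\<close>; they may exceed \<open>i\<close> by at most
  \<open>M\<close>. The positions below \<open>lo i\<close> precede the first neighbour and must
  stay more than \<open>M\<close> to its left. Both sets are prefixes, so two prefix maxima replace
  all single constraints.\<close>

definition relax :: "int \<Rightarrow> int \<Rightarrow> (nat \<Rightarrow> nat) \<Rightarrow> (nat \<Rightarrow> nat) \<Rightarrow> (nat \<Rightarrow> int) \<Rightarrow> nat \<Rightarrow> int" where
  "relax c M lo hi x i =
     max (max (x i) (prefix_max c x (hi i) - M)) (prefix_max c x (lo i) + M + 1)"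

definition window_sol :: "int \<Rightarrow> nat \<Rightarrow> (nat \<Rightarrow> nat) \<Rightarrow> (nat \<Rightarrow> nat) \<Rightarrow> (nat \<Rightarrow> int) \<Rightarrow> (nat \<Rightarrow> int) \<Rightarrow> bool" where
  "window_sol M k lo hi L y \<longleftrightarrow> (\<forall>i<k. L i \<le> y i \<and>
     (\<forall>j<hi i. y j - M \<le> y i) \<and> (\<forall>j<lo i. y j + M + 1 \<le> y i))"

text \<open>The start value \<open>c\<close> of the prefix maxima plays the part of minus infinity:
  as \<open>c + M + 1\<close> lies below all bounds \<open>L\<close>, it never lifts a coordinate
  above a solution.\<close>

lemma relax_converges:
  assumes "window_sol M k lo hi L y" "M \<ge> 0" "\<And>i. i < k \<Longrightarrow> hi i \<le> k \<and> lo i \<le> k"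
    "\<And>i. i < k \<Longrightarrow> c + M + 1 \<le> L i"
  shows "window_sol M k lo hi L ((relax c M lo hi ^^ k) L) \<and> (\<forall>i<k. (relax c M lo hi ^^ k) L i \<le> y i)"
proof -
  define con where "con j i w \<longleftrightarrow> (j < hi i \<and> w = - M) \<or> (j < lo i \<and> w = M + 1)" for j i :: nat and w
  have ws: "window_sol M k lo hi L z \<longleftrightarrow> ((\<forall>i<k. L i \<le> z i) \<and>
      (\<forall>i<k. \<forall>j<k. \<forall>w. con j i w \<longrightarrow> z j + w \<le> z i))" for z
    unfolding window_sol_def con_def using assms(3) by (force simp: add.assoc)
  show ?thesis unfolding ws
  proof (rule relaxation_converges)
    show "x i \<le> relax c M lo hi x i" for x i by (simp add: relax_def)
  next
    fix x i j w assume "con j i w"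
    thus "x j + w \<le> relax c M lo hi x i"
      using prefix_max_ge[of j "hi i" x c] prefix_max_ge[of j "lo i" x c]
      by (auto simp: con_def relax_def)
  next
    fix x z :: "nat \<Rightarrow> int" and i
    assume z: "(\<forall>i<k. L i \<le> z i) \<and> (\<forall>i<k. \<forall>j<k. \<forall>w. con j i w \<longrightarrow> z j + w \<le> z i)"
      and le: "\<forall>i<k. x i \<le> z i" and i: "i < k"
    have wz: "window_sol M k lo hi L z" using z ws by blast
    have w: "\<And>j. j < hi i \<Longrightarrow> z j - M \<le> z i" "\<And>j. j < lo i \<Longrightarrow> z j + M + 1 \<le> z i" "L i \<le> z i"
      using wz i unfolding window_sol_def by blast+
    have c: "c + M + 1 \<le> z i" using w(3) assms(4)[OF i] by linarith
    have "x j \<le> z i + M" if "j < hi i" for j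
    proof -
      have "j < k" using that assms(3)[OF i] by linarith
      thus ?thesis using w(1)[OF that] le by force
    qed
    hence "prefix_max c x (hi i) \<le> z i + M" unfolding prefix_max_le_iff
      using c assms(2) by auto
    moreover have "x j \<le> z i - M - 1" if "j < lo i" for j
    proof -
      have "j < k" using that assms(3)[OF i] by linarith
      thus ?thesis using w(2)[OF that] le by force
    qed
    hence "prefix_max c x (lo i) \<le> z i - M - 1" unfolding prefix_max_le_iff
      using c by auto
    ultimately show "relax c M lo hi x i \<le> z i" using le i by (simp add: relax_def)
  next
    show "(\<forall>i<k. L i \<le> y i) \<and> (\<forall>i<k. \<forall>j<k. \<forall>w. con j i w \<longrightarrow> y j + w \<le> y i)"
      using assms(1) ws by blast
  qed
qed

text \<open>A round raises the maximum by at most \<open>M + 1\<close>, so the coordinates remain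
  polynomial in the number of vertices and rounds.\<close>

lemma relax_bound:
  assumes "\<And>i. i < k \<Longrightarrow> hi i \<le> k \<and> lo i \<le> k" "M \<ge> 0" "c \<le> b" "\<And>i. i < k \<Longrightarrow> c \<le> L i \<and> L i \<le> b"
  shows "i < k \<Longrightarrow> c \<le> (relax c M lo hi ^^ t) L i \<and> (relax c M lo hi ^^ t) L i \<le> b + int t * (M + 1)"
proof (induction t arbitrary: i)
  case (Suc t)
  let ?x = "(relax c M lo hi ^^ t) L"
  have "c \<le> b + int t * (M + 1)" using assms(2,3) by (simp add: add_increasing2)
  hence "prefix_max c ?x j \<le> b + int t * (M + 1)" if "j \<le> k" for j
    using Suc.IH that by (simp add: prefix_max_le_iff)
  from this[of "hi i"] this[of "lo i"]
  have "prefix_max c ?x (hi i) \<le> b + int t * (M + 1)" "prefix_max c ?x (lo i) \<le> b + int t * (M + 1)"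
    using assms(1) Suc.prems by auto
  moreover have "int (Suc t) * (M + 1) = int t * (M + 1) + (M + 1)" by (simp add: algebra_simps)
  ultimately have "relax c M lo hi ?x i \<le> b + int (Suc t) * (M + 1)" "c \<le> relax c M lo hi ?x i"
    using Suc assms(2) unfolding relax_def by (force, force)
  thus ?case by simp
qed (use assms in auto)

section \<open>Orders of a connected unit interval graph\<close>

definition rep_on :: "'v set \<Rightarrow> ('v \<Rightarrow> 'v \<Rightarrow> bool) \<Rightarrow> int \<Rightarrow> ('v \<Rightarrow> int) \<Rightarrow> bool" where
  "rep_on C ad M g \<longleftrightarrow> M \<ge> 0 \<and> (\<forall>u\<in>C. \<forall>v\<in>C. ad u v \<longleftrightarrow> \<bar>g u - g v\<bar> \<le> M)"

text \<open>Connectedness as an induction principle, applied to the set reached so far; this avoids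
  paths.\<close>

definition conn_on :: "'v set \<Rightarrow> ('v \<Rightarrow> 'v \<Rightarrow> bool) \<Rightarrow> bool" where
  "conn_on C ad \<longleftrightarrow> (\<forall>S. S \<inter> C \<noteq> {} \<longrightarrow> (\<forall>u\<in>S \<inter> C. \<forall>v\<in>C. ad u v \<longrightarrow> v \<in> S) \<longrightarrow> C \<subseteq> S)"

lemma rep_on_uminus: "rep_on C ad M g \<Longrightarrow> rep_on C ad M (\<lambda>v. - g v)"
  by (auto simp: rep_on_def abs_minus_commute)

text \<open>While some vertex lies to the right of \<open>g u + t * M\<close>, connectedness
  provides an edge that leaves \<open>S t\<close>, and its far end lies in \<open>S (Suc t)\<close>.
  So these sets gain a vertex at each step until they exhaust \<open>C\<close>.\<close>

lemma rep_span:
  assumes "rep_on C ad M g" "conn_on C ad" "finite C" "u \<in> C" "v \<in> C"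
  shows "g v \<le> g u + int (card C) * M"
proof -
  define S where "S t = {v \<in> C. g v \<le> g u + int t * M}" for t
  have M: "M \<ge> 0" using assms(1) by (simp add: rep_on_def)
  have fin: "finite (S t)" for t using assms(3) by (simp add: S_def)
  have sub: "S t \<subseteq> S (Suc t)" for t using M by (auto simp: S_def algebra_simps)
  have u: "u \<in> S t" for t using M assms(4) by (simp add: S_def)
  have "t \<le> card (S t) \<or> S t = C" for t
  proof (induction t)
    case (Suc t)
    show ?case
    proof (cases "S t = C")
      case True
      thus ?thesis using sub[of t] by (auto simp: S_def)
    next
      case False
      hence "\<not> C \<subseteq> S t" by (auto simp: S_def)
      then obtain x y where xy: "x \<in> S t" "y \<in> C" "ad x y" "y \<notin> S t"
        using assms(2)[unfolded conn_on_def, rule_format, of "S t"] u[of t] assms(4) by blast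
      have "\<bar>g x - g y\<bar> \<le> M" using assms(1) xy by (auto simp: rep_on_def S_def)
      hence "y \<in> S (Suc t)" using xy by (auto simp: S_def algebra_simps)
      hence "S t \<subset> S (Suc t)" using sub[of t] xy(4) by blast
      hence "card (S t) < card (S (Suc t))" by (rule psubset_card_mono[OF fin])
      thus ?thesis using Suc False by simp
    qed
  qed simp
  from this[of "card C"] have "S (card C) = C"
    using card_subset_eq[of C "S (card C)"] card_mono[of C "S (card C)"] assms(3)
    by (force simp: S_def)
  thus ?thesis using assms(5) by (auto simp: S_def)
qed

text \<open>Step \<open>i\<close> expands the \<open>i\<close>-th vertex of the queue, and new
  vertices enter in the order of \<open>ord\<close>. Steps beyond the end change nothing, so a
  search is finished as soon as the length of the queue is at most the number of steps.\<close>

definition bfs_step :: "('v \<Rightarrow> 'v \<Rightarrow> bool) \<Rightarrow> 'v list \<Rightarrow> 'v list \<Rightarrow> nat \<Rightarrow> 'v list" where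
  "bfs_step ad ord Q i = (if i < length Q then Q @ filter (\<lambda>w. ad (Q ! i) w \<and> w \<notin> set Q) ord else Q)"

primrec bfs :: "('v \<Rightarrow> 'v \<Rightarrow> bool) \<Rightarrow> 'v list \<Rightarrow> 'v \<Rightarrow> nat \<Rightarrow> 'v list" where
  "bfs ad ord a 0 = [a]"
| "bfs ad ord a (Suc i) = bfs_step ad ord (bfs ad ord a i) i"

text \<open>The start of the last nonempty batch of vertices that were appended in the same step.\<close>

primrec last_batch :: "('v \<Rightarrow> 'v \<Rightarrow> bool) \<Rightarrow> 'v list \<Rightarrow> 'v \<Rightarrow> nat \<Rightarrow> nat" where
  "last_batch ad ord a 0 = 0"
| "last_batch ad ord a (Suc i) = (if length (bfs ad ord a (Suc i)) = length (bfs ad ord a i)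
     then last_batch ad ord a i else length (bfs ad ord a i))"

text \<open>Only nonadjacent vertices have to appear in the order of \<open>g\<close>. Adjacent ones
  may be swapped, which is what makes the order computable without knowing \<open>g\<close>.\<close>

definition nonadj_sorted :: "('v \<Rightarrow> 'v \<Rightarrow> bool) \<Rightarrow> int \<Rightarrow> ('v \<Rightarrow> int) \<Rightarrow> 'v list \<Rightarrow> bool" where
  "nonadj_sorted ad M g q \<longleftrightarrow> (\<forall>j<length q. \<forall>i<j. \<not> ad (q ! i) (q ! j) \<longrightarrow> g (q ! i) + M < g (q ! j))"

text \<open>The umbrella property that characterises vertex orders of unit interval graphs: every
  closed neighbourhood occupies consecutive positions.\<close>

definition umbrella_free :: "('v \<Rightarrow> 'v \<Rightarrow> bool) \<Rightarrow> 'v list \<Rightarrow> bool" where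
  "umbrella_free ad q \<longleftrightarrow> (\<forall>j<length q. \<forall>l<j. \<forall>i<l. ad (q ! i) (q ! j) \<longrightarrow> ad (q ! i) (q ! l) \<and> ad (q ! l) (q ! j))"

text \<open>\<open>ord\<close> is one degree order of the whole graph, shared by all components;
  \<open>closed\<close> keeps the search inside \<open>C\<close>. As \<open>ad\<close> is reflexive,
  \<open>dg\<close> counts the vertex itself.\<close>

locale conn_graph =
  fixes C :: "'v set" and ad :: "'v \<Rightarrow> 'v \<Rightarrow> bool" and ord :: "'v list" and dg :: "'v \<Rightarrow> nat"
  assumes finC: "finite C"
    and refl: "ad u u" and sym: "ad u v \<Longrightarrow> ad v u"
    and conn: "conn_on C ad"
    and dist: "distinct ord" and Cord: "C \<subseteq> set ord"
    and closed: "u \<in> C \<Longrightarrow> v \<in> set ord \<Longrightarrow> ad u v \<Longrightarrow> v \<in> C"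
    and dg: "v \<in> C \<Longrightarrow> dg v = card {w \<in> C. ad v w}"
    and sorted: "sorted (map dg ord)"
begin

lemma bfs_basic:
  assumes "a \<in> C"
  shows "distinct (bfs ad ord a i) \<and> set (bfs ad ord a i) \<subseteq> C \<and> bfs ad ord a i \<noteq> [] \<and>
    bfs ad ord a i ! 0 = a \<and>
    (\<forall>j<i. j < length (bfs ad ord a i) \<longrightarrow> (\<forall>w\<in>C. ad (bfs ad ord a i ! j) w \<longrightarrow> w \<in> set (bfs ad ord a i)))"
proof (induction i)
  case (Suc i)
  let ?Q = "bfs ad ord a i"
  show ?case
  proof (cases "i < length ?Q")
    case True
    hence mem: "?Q ! i \<in> C" using Suc nth_mem by blast
    define X where "X = filter (\<lambda>w. ad (?Q ! i) w \<and> w \<notin> set ?Q) ord"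
    have Q': "bfs ad ord a (Suc i) = ?Q @ X" using True by (simp add: bfs_step_def X_def)
    have X: "set X \<subseteq> C" "distinct X" "set X \<inter> set ?Q = {}"
      using closed[OF mem] dist by (auto simp: X_def)
    have "w \<in> set (?Q @ X)" if j: "j < Suc i" "w \<in> C" "ad ((?Q @ X) ! j) w" for j w
    proof (cases "j = i")
      case True
      thus ?thesis using j \<open>i < length ?Q\<close> Cord by (auto simp: X_def nth_append)
    next
      case False
      hence "j < i" using j by simp
      thus ?thesis using j \<open>i < length ?Q\<close> Suc by (simp add: nth_append)
    qed
    thus ?thesis unfolding Q' using Suc X by (auto simp: nth_append)
  next
    case False
    thus ?thesis using Suc by (auto simp: bfs_step_def less_Suc_eq)
  qed
qed (use assms in auto)

text \<open>A queue whose vertices have all been expanded is closed under adjacency, so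
  connectedness applies.\<close>

lemma bfs_complete:
  assumes "a \<in> C" "length (bfs ad ord a i) \<le> i"
  shows "set (bfs ad ord a i) = C"
proof -
  note b = bfs_basic[OF assms(1), of i]
  have "C \<subseteq> set (bfs ad ord a i)"
  proof (rule conn[unfolded conn_on_def, rule_format])
    show "set (bfs ad ord a i) \<inter> C \<noteq> {}" using b by (simp add: Int_absorb2)
    fix u v assume u: "u \<in> set (bfs ad ord a i) \<inter> C" and v: "v \<in> C" "ad u v"
    then obtain j where j: "j < length (bfs ad ord a i)" "u = bfs ad ord a i ! j"
      by (metis IntD1 in_set_conv_nth)
    hence "j < i" using assms(2) by simp
    thus "v \<in> set (bfs ad ord a i)" using b j v by blast
  qed
  thus ?thesis using b by blast
qed

lemma bfs_length:
  assumes "a \<in> C"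
  shows "length (bfs ad ord a i) \<le> card C"
proof -
  have "card (set (bfs ad ord a i)) \<le> card C" using bfs_basic[OF assms, of i] finC by (intro card_mono) auto
  thus ?thesis using bfs_basic[OF assms, of i] distinct_card by metis
qed

text \<open>\<open>p\<close> is the position of the parent of the \<open>k\<close>-th queue vertex,
  that is, the step in which it was discovered.\<close>

definition first_nbr :: "'v list \<Rightarrow> nat \<Rightarrow> nat \<Rightarrow> bool" where
  "first_nbr Q k p \<longleftrightarrow> p < k \<and> ad (Q ! p) (Q ! k) \<and> (\<forall>j<p. \<not> ad (Q ! j) (Q ! k))"

lemma first_nbr_append: "k < length Q \<Longrightarrow> first_nbr (Q @ X) k p = first_nbr Q k p"
  by (auto simp: first_nbr_def nth_append)

text \<open>All vertices of the last batch share one parent, and every earlier vertex except the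
  root has a smaller one. The batch begins with a vertex of least degree in it because
  \<open>ord\<close> is sorted by degree.\<close>

lemma bfs_batches:
  assumes "a \<in> C"
  shows "let Q = bfs ad ord a i; z = last_batch ad ord a i in
    z < length Q \<and> (z = 0 \<longrightarrow> length Q = 1) \<and>
    (\<forall>k<length Q. k \<ge> 1 \<longrightarrow> (\<exists>p<i. first_nbr Q k p)) \<and>
    (\<exists>p. (\<forall>k<length Q. k \<ge> 1 \<longrightarrow> z \<le> k \<longrightarrow> first_nbr Q k p \<and> dg (Q ! z) \<le> dg (Q ! k)) \<and>
         (\<forall>k<z. k \<ge> 1 \<longrightarrow> (\<exists>p'<p. first_nbr Q k p')))"
proof (induction i)
  case (Suc i)
  let ?Q = "bfs ad ord a i" and ?z = "last_batch ad ord a i"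
  let ?X = "filter (\<lambda>w. ad (?Q ! i) w \<and> w \<notin> set ?Q) ord"
  note b = bfs_basic[OF assms, of i]
  show ?case
  proof (cases "i < length ?Q \<and> ?X \<noteq> []")
    case False
    hence "bfs ad ord a (Suc i) = ?Q" by (auto simp: bfs_step_def)
    thus ?thesis using Suc by (simp add: Let_def) (meson less_SucI)
  next
    case True
    define X where "X = ?X"
    have Q': "bfs ad ord a (Suc i) = ?Q @ X" using True by (simp add: bfs_step_def X_def)
    have X: "X \<noteq> []" using True X_def by simp
    hence z': "last_batch ad ord a (Suc i) = length ?Q" using Q' by simp
    have mem: "?Q ! i \<in> C" using True b nth_mem by blast
    have new: "first_nbr (?Q @ X) k i \<and> dg ((?Q @ X) ! length ?Q) \<le> dg ((?Q @ X) ! k)"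
      if k: "k < length (?Q @ X)" "length ?Q \<le> k" for k
    proof
      have kX: "(?Q @ X) ! k = X ! (k - length ?Q)" "k - length ?Q < length X"
        using k by (auto simp: nth_append)
      hence m: "(?Q @ X) ! k \<in> set X" by simp
      have "\<not> ad (?Q ! j) ((?Q @ X) ! k)" if "j < i" for j
        using m b that True closed[OF mem] by (auto simp: X_def)
      thus "first_nbr (?Q @ X) k i" using True k m by (auto simp: first_nbr_def nth_append X_def)
      have "sorted (map dg X)" unfolding X_def using sorted by (rule sorted_filter)
      hence "dg (X ! 0) \<le> dg (X ! (k - length ?Q))"
        using sorted_nth_mono[of "map dg X" 0 "k - length ?Q"] kX(2) X by simp
      thus "dg ((?Q @ X) ! length ?Q) \<le> dg ((?Q @ X) ! k)" using kX X by (simp add: nth_append)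
    qed
    have old: "\<exists>p<i. first_nbr (?Q @ X) k p" if "k < length ?Q" "1 \<le> k" for k
      using Suc that by (simp add: Let_def first_nbr_append)
    have all: "\<exists>p<Suc i. first_nbr (?Q @ X) k p" if "k < length (?Q @ X)" "1 \<le> k" for k
      using old[of k] new[of k] that by (cases "k < length ?Q") (auto intro: less_SucI)
    show ?thesis unfolding Let_def z' Q' using b X new old all
      by (intro conjI exI[of _ i]) auto
  qed
qed auto

text \<open>Why one search finds an end of the component up to twins. To the right of the root,
  parents increase along \<open>g\<close>, so the rightmost vertex \<open>s\<close> belongs to the
  last batch. It turns out to be adjacent to \<open>z\<close>, and the neighbourhood of an extreme
  vertex is contained in that of a vertex adjacent to it; since \<open>z\<close> has least degree in
  the batch, the two neighbourhoods coincide.\<close>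

lemma end_vertex_aux:
  assumes rep: "rep_on C ad M g" and a: "a \<in> C" and fin: "length (bfs ad ord a i) \<le> i"
    and z: "z = bfs ad ord a i ! last_batch ad ord a i" and az: "g a \<le> g z"
  shows "\<exists>s\<in>C. (\<forall>v\<in>C. g v \<le> g s) \<and> {w \<in> C. ad z w} = {w \<in> C. ad s w}"
proof -
  let ?Q = "bfs ad ord a i" and ?z = "last_batch ad ord a i"
  note b = bfs_basic[OF a, of i] and QC = bfs_complete[OF a fin] and bt = bfs_batches[OF a, of i, unfolded Let_def]
  have R: "\<And>u v. u \<in> C \<Longrightarrow> v \<in> C \<Longrightarrow> ad u v \<longleftrightarrow> \<bar>g u - g v\<bar> \<le> M" and M: "M \<ge> 0"
    using rep by (auto simp: rep_on_def)
  have zC: "z \<in> C" using z bt QC by (metis nth_mem)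
  have inC: "?Q ! k \<in> C" if "k < length ?Q" for k using that QC nth_mem by blast
  obtain s where s: "s \<in> C" "\<And>v. v \<in> C \<Longrightarrow> g v \<le> g s"
  proof -
    have "Max (g ` C) \<in> g ` C" using a finC by (intro Max_in) auto
    then obtain s where "s \<in> C" "g s = Max (g ` C)" by auto
    thus ?thesis using that[of s] finC by auto
  qed
  show ?thesis
  proof (cases "g z = g s")
    case True
    thus ?thesis using s zC R by (intro bexI[of _ s]) auto
  next
    case False
    hence zs: "g z < g s" using s zC by force
    \<comment> \<open>If the parent of \<open>k'\<close> lies left of \<open>k\<close>, it is also
      adjacent to \<open>k\<close>, so the first neighbour of \<open>k\<close> comes no later.
      Otherwise this parent lies right of \<open>k\<close>, and by induction its own, smaller parent
      is already at least \<open>p\<close>.\<close>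
    have mono: "p \<le> p'" if "first_nbr ?Q k p" "first_nbr ?Q k' p'" "k < length ?Q" "k' < length ?Q"
        "g a \<le> g (?Q ! k)" "g (?Q ! k) \<le> g (?Q ! k')" for k k' p p'
      using that
    proof (induction k' arbitrary: p' rule: less_induct)
      case (less k')
      note f = less.prems(1,2)[unfolded first_nbr_def]
      have p': "p' < k'" "p' < length ?Q" using f less.prems by auto
      show ?case
      proof (cases "g (?Q ! p') \<le> g (?Q ! k)")
        case True
        have "\<bar>g (?Q ! p') - g (?Q ! k')\<bar> \<le> M" using f R inC p' less.prems by blast
        hence "ad (?Q ! p') (?Q ! k)" using R inC p' less.prems True by auto
        thus ?thesis using f by (meson not_le)
      next
        case False
        hence "p' \<noteq> 0" using less.prems(5) b by (metis)
        then obtain p'' where "first_nbr ?Q p' p''" using bt p' by (metis One_nat_def Suc_leI gr0I)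
        hence "p \<le> p''" "p'' < p'" using less.IH[of p' p''] less.prems False p' by (auto simp: first_nbr_def)
        thus ?thesis by simp
      qed
    qed
    obtain ks where ks: "ks < length ?Q" "?Q ! ks = s" using s QC by (metis in_set_conv_nth)
    have ks1: "1 \<le> ks" using ks zs az b by (metis One_nat_def Suc_leI gr0I not_le)
    hence "length ?Q \<noteq> 1" using ks by auto
    hence z1: "1 \<le> ?z" using bt by (metis One_nat_def Suc_leI gr0I)
    obtain p where p: "\<And>k. k < length ?Q \<Longrightarrow> k \<ge> 1 \<Longrightarrow> ?z \<le> k \<Longrightarrow> first_nbr ?Q k p \<and> dg (?Q ! ?z) \<le> dg (?Q ! k)"
      "\<And>k. k < ?z \<Longrightarrow> k \<ge> 1 \<Longrightarrow> (\<exists>p'<p. first_nbr ?Q k p')" using bt by blast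
    have pz: "first_nbr ?Q ?z p" using p(1) z1 bt by blast
    have zks: "?z \<le> ks"
    proof (rule ccontr)
      assume "\<not> ?z \<le> ks"
      hence "ks < ?z" by simp
      then obtain p' where p': "p' < p" "first_nbr ?Q ks p'" using p(2)[OF _ ks1] by blast
      thus False using mono[OF pz p'(2)] bt ks zs az z by force
    qed
    hence ps: "first_nbr ?Q ks p" and ds: "dg z \<le> dg s" using p(1)[of ks] ks ks1 z by auto
    have pl: "p < length ?Q" "p < ?z" using pz bt by (auto simp: first_nbr_def)
    have adp: "ad (?Q ! p) s" using ps ks by (simp add: first_nbr_def)
    \<comment> \<open>Both \<open>z\<close> and \<open>s\<close> are children of position
      \<open>p\<close>. If that vertex lies left of \<open>z\<close>, then \<open>z\<close> lies
      between it and \<open>s\<close>. If it lies right of \<open>z\<close> or level with it,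
      monotonicity applied to it would give a parent not before itself, unless it is the root, whose
      coordinate then equals that of \<open>z\<close>.\<close>
    have adzs: "ad z s"
    proof (cases "g z \<le> g (?Q ! p)")
      case True
      show ?thesis
      proof (cases "p = 0")
        case True
        thus ?thesis using adp R zC s inC[OF pl(1)] \<open>g z \<le> g (?Q ! p)\<close> az b zs by fastforce
      next
        case False
        then obtain p'' where p'': "first_nbr ?Q p p''" using bt pl by (metis One_nat_def Suc_leI gr0I)
        hence "p \<le> p''" using mono[OF pz p''] True az pl bt z by auto
        thus ?thesis using p'' by (simp add: first_nbr_def)
      qed
    next
      case False
      thus ?thesis using adp R zC s inC[OF pl(1)] zs by fastforce
    qed
    \<comment> \<open>Here \<open>s\<close> is rightmost: a neighbour of \<open>s\<close> is either
      between \<open>z\<close> and \<open>s\<close>, or left of \<open>z\<close> by less than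
      \<open>M\<close>.\<close>
    have sub: "{w \<in> C. ad s w} \<subseteq> {w \<in> C. ad z w}"
    proof safe
      fix w assume w: "w \<in> C" "ad s w"
      show "ad z w" using w adzs R zC s zs by (smt (verit))
    qed
    have "card {w \<in> C. ad z w} \<le> card {w \<in> C. ad s w}" using ds dg zC s by simp
    hence "{w \<in> C. ad s w} = {w \<in> C. ad z w}"
      using sub finC by (intro card_seteq) auto
    thus ?thesis using s by (intro bexI[of _ s]) auto
  qed
qed

end

section \<open>The order produced by a search from an end vertex\<close>

locale conn_rep = conn_graph +
  fixes M :: int and g :: "'a \<Rightarrow> int"
  assumes rep: "rep_on C ad M g"
begin

definition LN where "LN v = {w \<in> C. g w + M < g v}"
definition RN where "RN v = {w \<in> C. g v + M < g w}"
text \<open>A total preorder that depends only on the vertices lying completely to the left or to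
  the right. It refines to the order of \<open>g\<close> up to vertices that have the same
  neighbourhood.\<close>

definition before where "before u v \<longleftrightarrow> LN u \<subseteq> LN v \<and> RN v \<subseteq> RN u"

lemma ad_iff: "u \<in> C \<Longrightarrow> v \<in> C \<Longrightarrow> ad u v \<longleftrightarrow> \<bar>g u - g v\<bar> \<le> M" and M0: "M \<ge> 0"
  using rep by (auto simp: rep_on_def)

lemma before_total: "before u v \<or> before v u"
  unfolding before_def LN_def RN_def by (cases "g u \<le> g v") auto

lemma before_refl: "before u u"
  by (simp add: before_def)

lemma before_nonadj: "before u v \<Longrightarrow> u \<in> C \<Longrightarrow> v \<in> C \<Longrightarrow> \<not> ad u v \<Longrightarrow> g u + M < g v"
  using ad_iff[of u v] M0 unfolding before_def LN_def RN_def by (auto simp: subset_iff)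

text \<open>The invariant also says that the queue precedes everything not yet discovered. All
  vertices discovered from position \<open>i\<close> have the same left nonneighbours, the first
  \<open>i\<close> vertices of the queue. Hence within a batch the order is decided by the right
  nonneighbours, and their number is read off from the degree.\<close>

lemma bfs_sorted:
  assumes z: "z \<in> C" "s \<in> C" "\<And>v. v \<in> C \<Longrightarrow> g s \<le> g v" "{w \<in> C. ad z w} = {w \<in> C. ad s w}"
  shows "sorted_wrt before (bfs ad ord z i) \<and>
    (\<forall>v\<in>set (bfs ad ord z i). \<forall>w\<in>C - set (bfs ad ord z i). before v w)"
proof (induction i)
  case 0
  have "before z w" if w: "w \<in> C" for w
  proof -
    have "LN z = {}"
    proof (rule ccontr)
      assume "LN z \<noteq> {}"
      then obtain x where x: "x \<in> C" "g x + M < g z" by (auto simp: LN_def)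
      have "ad z s" using z(2,4) refl[of s] by blast
      hence "g z \<le> g s + M" using ad_iff[of z s] z by auto
      thus False using x z(3)[of x] by simp
    qed
    moreover have "x \<in> RN z" if x: "x \<in> RN w" for x
    proof -
      have xC: "x \<in> C" and "g s + M < g x" using x z(3)[OF w] by (auto simp: RN_def)
      hence "\<not> ad s x" using ad_iff[of s x] z by auto
      hence "\<not> ad z x" using z(4) xC by blast
      hence "g z + M < g x \<or> g x + M < g z" using ad_iff[of z x] z xC by auto
      thus ?thesis using \<open>LN z = {}\<close> xC by (auto simp: RN_def LN_def)
    qed
    ultimately show ?thesis by (auto simp: before_def)
  qed
  thus ?case by simp
next
  case (Suc i)
  let ?Q = "bfs ad ord z i"
  let ?X = "filter (\<lambda>w. ad (?Q ! i) w \<and> w \<notin> set ?Q) ord"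
  note b = bfs_basic[OF z(1), of i]
  show ?case
  proof (cases "i < length ?Q")
    case False
    thus ?thesis using Suc by (simp add: bfs_step_def)
  next
    case True
    define u where "u = ?Q ! i"
    have Q': "bfs ad ord z (Suc i) = ?Q @ ?X" using True by (simp add: bfs_step_def)
    have uQ: "u \<in> set ?Q" using True by (simp add: u_def)
    hence uC: "u \<in> C" using b by blast
    have XC: "x \<in> C \<and> x \<notin> set ?Q \<and> ad u x" if "x \<in> set ?X" for x
      using that closed[OF uC] by (auto simp: u_def)
    have takeC: "set (take i ?Q) \<subseteq> C" using b by (meson set_take_subset order_trans)
    have below: "set (take i ?Q) \<subseteq> LN x" if x: "x \<in> C" "x \<notin> set ?Q" for x
    proof
      fix v assume v: "v \<in> set (take i ?Q)"
      then obtain j where j: "j < i" "v = ?Q ! j" by (auto simp: in_set_conv_nth)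
      hence vQ: "v \<in> set ?Q" "v \<in> C" "\<not> ad v x" using v takeC b x True
        by (auto dest: in_set_takeD)
      hence "before v x" using Suc x by blast
      from before_nonadj[OF this vQ(2) x(1) vQ(3)] show "v \<in> LN x" using vQ by (simp add: LN_def)
    qed
    \<comment> \<open>A vertex expanded earlier is not adjacent to \<open>x\<close>, or
      \<open>x\<close> would be in the queue already. Any other vertex does not precede
      \<open>u\<close> strictly, and \<open>u\<close> is adjacent to \<open>x\<close>.\<close>
    have LNx: "LN x = set (take i ?Q)" if x: "x \<in> set ?X" for x
    proof
      show "LN x \<subseteq> set (take i ?Q)"
      proof
        fix w assume w: "w \<in> LN x"
        hence wC: "w \<in> C" by (simp add: LN_def)
        show "w \<in> set (take i ?Q)"
        proof (rule ccontr)
          assume wn: "w \<notin> set (take i ?Q)"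
          have "before u w"
          proof (cases "w \<in> set ?Q")
            case True
            then obtain j where j: "j < length ?Q" "w = ?Q ! j" by (metis in_set_conv_nth)
            have "\<not> j < i" using wn j by (auto simp: in_set_conv_nth)
            thus ?thesis using Suc before_refl j
              by (cases "j = i") (auto simp: u_def sorted_wrt_iff_nth_less)
          next
            case False
            thus ?thesis using Suc uQ wC by blast
          qed
          moreover have "x \<in> RN w" using w XC[OF x] by (auto simp: LN_def RN_def)
          ultimately have "x \<in> RN u" by (auto simp: before_def)
          thus False using XC[OF x] ad_iff[OF uC, of x] by (auto simp: RN_def)
        qed
      qed
      show "set (take i ?Q) \<subseteq> LN x" using below XC[OF x] by blast
    qed
    have new_old: "before x y" if x: "x \<in> set ?X" and y: "y \<in> C" "y \<notin> set ?Q" "y \<notin> set ?X" for x y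
    proof (rule ccontr)
      assume "\<not> before x y"
      hence "before y x" using before_total by blast
      hence sub: "LN y \<subseteq> set (take i ?Q)" using LNx[OF x] by (auto simp: before_def)
      have "\<not> ad u y" using y Cord by (auto simp: u_def)
      moreover have "before u y" using Suc uQ y by blast
      ultimately have "u \<in> LN y" using before_nonadj uC y by (simp add: LN_def)
      hence "u \<in> set (take i ?Q)" using sub by blast
      then obtain j where "j < i" "?Q ! j = ?Q ! i" using True by (auto simp: u_def in_set_conv_nth)
      thus False using b True by (simp add: nth_eq_iff_index_eq)
    qed
    \<comment> \<open>\<open>C\<close> is the disjoint union of the neighbours, left nonneighbours
      and right nonneighbours of a vertex. With equal left parts, a smaller degree means more
      vertices to the right.\<close>
    have new_new: "before x y" if x: "x \<in> set ?X" and y: "y \<in> set ?X" and d: "dg x \<le> dg y" for x y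
    proof (rule ccontr)
      assume n: "\<not> before x y"
      hence "before y x" using before_total by blast
      hence "RN x \<subseteq> RN y" by (simp add: before_def)
      moreover have "\<not> RN y \<subseteq> RN x" using n LNx x y by (simp add: before_def)
      ultimately have ps: "RN x \<subset> RN y" by blast
      have fin: "finite (LN v)" "finite (RN v)" for v using finC by (auto simp: LN_def RN_def)
      have c: "card C = dg v + card (LN v) + card (RN v)" if v: "v \<in> C" for v
      proof -
        have "C = {w \<in> C. ad v w} \<union> LN v \<union> RN v" using ad_iff[OF v] by (auto simp: LN_def RN_def)
        moreover have "{w \<in> C. ad v w} \<inter> LN v = {}" "({w \<in> C. ad v w} \<union> LN v) \<inter> RN v = {}"
          using ad_iff[OF v] M0 by (auto simp: LN_def RN_def)
        ultimately show ?thesis using dg[OF v] fin finC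
          by (metis (no_types, lifting) card_Un_disjoint finite_Un)
      qed
      have "card (RN x) < card (RN y)" by (rule psubset_card_mono[OF fin(2) ps])
      moreover have "card (LN x) = card (LN y)" unfolding LNx[OF x] LNx[OF y] ..
      moreover have "x \<in> C" "y \<in> C" using XC x y by blast+
      ultimately show False using c[OF \<open>x \<in> C\<close>] c[OF \<open>y \<in> C\<close>] d by linarith
    qed
    have "sorted_wrt (\<lambda>x y. dg x \<le> dg y) ?X"
      using sorted by (intro sorted_wrt_filter) (simp add: sorted_wrt_map)
    hence "sorted_wrt before ?X"
      by (rule sorted_wrt_mono_rel[rotated]) (use new_new in blast)
    moreover have "before v w" if "v \<in> set ?Q" "w \<in> C" "w \<notin> set ?Q" for v w using Suc that by blast
    hence "\<forall>v\<in>set ?Q. \<forall>w\<in>set ?X. before v w" using XC by blast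
    ultimately have "sorted_wrt before (?Q @ ?X)" using Suc unfolding sorted_wrt_append by blast
    moreover have "before v w" if "v \<in> set (?Q @ ?X)" "w \<in> C - set (?Q @ ?X)" for v w
    proof (cases "v \<in> set ?Q")
      case True
      thus ?thesis using Suc that(2) unfolding set_append by blast
    next
      case False
      hence "v \<in> set ?X" using that(1) unfolding set_append by blast
      thus ?thesis by (rule new_old) (use that(2) in \<open>unfold set_append, blast+\<close>)
    qed
    ultimately show ?thesis unfolding Q' by blast
  qed
qed

text \<open>A missing edge below an umbrella would put the left end among the left nonneighbours of
  the middle vertex, hence of the right end, or symmetrically on the other side; both contradict the
  spanning edge.\<close>

lemma bfs_order:
  assumes z: "z \<in> C" "s \<in> C" "\<And>v. v \<in> C \<Longrightarrow> g s \<le> g v" "{w \<in> C. ad z w} = {w \<in> C. ad s w}"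
  shows "nonadj_sorted ad M g (bfs ad ord z i)" "umbrella_free ad (bfs ad ord z i)"
proof -
  let ?q = "bfs ad ord z i"
  have C: "?q ! j \<in> C" if "j < length ?q" for j using bfs_basic[OF z(1), of i] that nth_mem by blast
  have le: "before (?q ! j) (?q ! l)" if "j < l" "l < length ?q" for j l
    using bfs_sorted[OF assms, of i] that by (simp add: sorted_wrt_iff_nth_less)
  show ns: "nonadj_sorted ad M g ?q" unfolding nonadj_sorted_def
    using before_nonadj le C by (meson less_trans)
  show "umbrella_free ad ?q" unfolding umbrella_free_def
  proof (intro allI impI)
    fix j l i assume h: "j < length ?q" "l < j" "i < l" "ad (?q ! i) (?q ! j)"
    hence c: "?q ! i \<in> C" "?q ! l \<in> C" "?q ! j \<in> C" using C by auto
    have aij: "\<bar>g (?q ! i) - g (?q ! j)\<bar> \<le> M" using ad_iff c h by blast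
    have "ad (?q ! i) (?q ! l)"
    proof (rule ccontr)
      assume "\<not> ad (?q ! i) (?q ! l)"
      hence "?q ! i \<in> LN (?q ! l)" using before_nonadj[OF le[of i l]] c h by (simp add: LN_def)
      hence "?q ! i \<in> LN (?q ! j)" using le[of l j] h by (auto simp: before_def)
      thus False using aij by (auto simp: LN_def)
    qed
    moreover have "ad (?q ! l) (?q ! j)"
    proof (rule ccontr)
      assume "\<not> ad (?q ! l) (?q ! j)"
      hence "?q ! j \<in> RN (?q ! l)" using before_nonadj[OF le[of l j]] c h by (simp add: RN_def)
      hence "?q ! j \<in> RN (?q ! i)" using le[of i l] h by (auto simp: before_def)
      thus False using aij by (auto simp: RN_def)
    qed
    ultimately show "ad (?q ! i) (?q ! l) \<and> ad (?q ! l) (?q ! j)" by blast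
  qed
qed

end

context conn_graph
begin

text \<open>The start \<open>z\<close> of the second search is found without knowledge of
  \<open>g\<close>. It is a twin of the extreme vertex on whichever side of \<open>a\<close> it
  lies, so the second search sorts by \<open>g\<close> or by its mirror image. The order itself is
  the same for all \<open>g\<close>.\<close>

lemma double_bfs_order:
  assumes rep: "rep_on C ad M g" and a: "a \<in> C" and fin: "length (bfs ad ord a i) \<le> i"
    and z: "z = bfs ad ord a i ! last_batch ad ord a i"
  shows "z \<in> C" and "umbrella_free ad (bfs ad ord z j) \<and>
    (nonadj_sorted ad M g (bfs ad ord z j) \<or> nonadj_sorted ad M g (rev (bfs ad ord z j)))"
proof -
  have "last_batch ad ord a i < length (bfs ad ord a i)"
    using bfs_batches[OF a, of i] by (simp add: Let_def)
  thus zC: "z \<in> C" using z bfs_complete[OF a fin] by (metis nth_mem)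
  have rep': "rep_on C ad M (\<lambda>v. - g v)" using rep by (rule rep_on_uminus)
  interpret p: conn_rep C ad ord dg M g by unfold_locales (fact rep)
  interpret m: conn_rep C ad ord dg M "\<lambda>v. - g v" by unfold_locales (fact rep')
  have rev: "nonadj_sorted ad M g (rev q)" if q: "nonadj_sorted ad M (\<lambda>v. - g v) q" for q
    unfolding nonadj_sorted_def
  proof (intro allI impI)
    fix j i assume h: "j < length (rev q)" "i < j" "\<not> ad (rev q ! i) (rev q ! j)"
    have "\<not> ad (q ! (length q - Suc j)) (q ! (length q - Suc i))"
      using h sym by (auto simp: rev_nth)
    hence "- g (q ! (length q - Suc j)) + M < - g (q ! (length q - Suc i))"
      using q h unfolding nonadj_sorted_def by (auto simp: Suc_diff_Suc)
    thus "g (rev q ! i) + M < g (rev q ! j)" using h by (simp add: rev_nth)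
  qed
  show "umbrella_free ad (bfs ad ord z j) \<and>
    (nonadj_sorted ad M g (bfs ad ord z j) \<or> nonadj_sorted ad M g (rev (bfs ad ord z j)))"
  proof (cases "g a \<le> g z")
    case True
    then obtain s where "s \<in> C" "\<forall>v\<in>C. g v \<le> g s" "{w \<in> C. ad z w} = {w \<in> C. ad s w}"
      using end_vertex_aux[OF rep a fin z] by blast
    thus ?thesis using m.bfs_order[of z s j] zC rev by auto
  next
    case False
    then obtain s where "s \<in> C" "\<forall>v\<in>C. g s \<le> g v" "{w \<in> C. ad z w} = {w \<in> C. ad s w}"
      using end_vertex_aux[OF rep' a fin z] by auto
    thus ?thesis using p.bfs_order[of z s j] zC by auto
  qed
qed

end

lemma umbrella_free_rev:
  assumes "umbrella_free ad q" "\<And>u v. ad u v \<Longrightarrow> ad v u"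
  shows "umbrella_free ad (rev q)"
  unfolding umbrella_free_def
proof (intro allI impI)
  fix j l i assume h: "j < length (rev q)" "l < j" "i < l" "ad (rev q ! i) (rev q ! j)"
  let ?r = "\<lambda>i. length q - Suc i"
  have "ad (q ! ?r j) (q ! ?r i)" using h assms(2) by (simp add: rev_nth)
  moreover have "?r i < length q" "?r l < ?r i" "?r j < ?r l" using h by auto
  ultimately have "ad (q ! ?r j) (q ! ?r l) \<and> ad (q ! ?r l) (q ! ?r i)"
    using assms(1) unfolding umbrella_free_def by blast
  thus "ad (rev q ! i) (rev q ! l) \<and> ad (rev q ! l) (rev q ! j)" using h assms(2) by (simp add: rev_nth)
qed

section \<open>Discretisation\<close>

locale grid =
  fixes n d :: nat and Q :: int and F :: "nat \<Rightarrow> int"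
  assumes d: "d \<ge> 1" and Q: "Q > 0" and F0: "F 0 = 0"
    and Fmono: "i < j \<Longrightarrow> j < d \<Longrightarrow> F i < F j" and FQ: "i < d \<Longrightarrow> F i < Q"
begin

definition M :: int where "M = int (n + 1) * int d"
text \<open>The grid point of the position \<open>A + F \<rho> / Q\<close>. The \<open>n\<close>
  points that follow it are reserved for positions strictly below the next grid fraction:
  \<open>n\<close> vertices have at most \<open>n\<close> distinct fractional parts there.\<close>

definition code :: "int \<Rightarrow> nat \<Rightarrow> int" where "code A \<rho> = (A * int d + int \<rho>) * int (n + 1)"

lemma M_pos: "M > 0" using d by (simp add: M_def)

lemma code_alt: "code A \<rho> = A * M + int \<rho> * int (n + 1)"
  by (simp add: code_def M_def algebra_simps)

lemma Fle: "i \<le> j \<Longrightarrow> j < d \<Longrightarrow> F i \<le> F j"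
  using Fmono by (cases "i = j") (auto simp: le_less)

lemma F_nonneg: "i < d \<Longrightarrow> 0 \<le> F i"
  using Fle[of 0 i] F0 by simp

text \<open>The index of the largest grid fraction that is at most \<open>x\<close>. Counting
  positive indices gives the index itself, because \<open>F 0 = 0\<close>.\<close>

definition level :: "real \<Rightarrow> nat" where
  "level x = card {i. 0 < i \<and> i < d \<and> F i / Q \<le> x}"

lemma level_less: "level x < d"
proof -
  have "level x \<le> card {1..<d}" unfolding level_def by (intro card_mono) auto
  thus ?thesis using d by simp
qed

lemma level_ge_iff:
  assumes "x \<ge> 0" "i < d"
  shows "i \<le> level x \<longleftrightarrow> F i / Q \<le> x"
proof
  assume "F i / Q \<le> x"
  moreover have "real_of_int (F j) / Q \<le> F i / Q" if "j \<le> i" for j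
    using Fle[OF that assms(2)] Q by (simp add: divide_right_mono)
  ultimately have "F j / Q \<le> x" if "j \<le> i" for j using that order_trans by blast
  hence "{1..<Suc i} \<subseteq> {i. 0 < i \<and> i < d \<and> F i / Q \<le> x}"
    using assms(2) by auto
  hence "card {1..<Suc i} \<le> level x" unfolding level_def by (intro card_mono) auto
  thus "i \<le> level x" by simp
next
  assume i: "i \<le> level x"
  show "F i / Q \<le> x"
  proof (rule ccontr)
    assume n: "\<not> F i / Q \<le> x"
    hence i0: "i \<noteq> 0" using F0 assms by (metis div_0 of_int_0)
    have "\<not> F j / Q \<le> x" if "i \<le> j" "j < d" for j
    proof -
      have "real_of_int (F i) / Q \<le> F j / Q" using Fle[OF that] Q by (simp add: divide_right_mono)
      thus ?thesis using n by linarith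
    qed
    hence "{i. 0 < i \<and> i < d \<and> F i / Q \<le> x} \<subseteq> {1..<i}" 
    proof safe
      fix j assume "0 < j" "j < d" "F j / Q \<le> x"
      thus "j \<in> {1..<i}" using \<open>\<And>j. i \<le> j \<Longrightarrow> j < d \<Longrightarrow> \<not> F j / Q \<le> x\<close>[of j] by (cases "i \<le> j") auto
    qed
    hence "level x \<le> card {1..<i}" unfolding level_def by (intro card_mono) auto
    thus False using i i0 by simp
  qed
qed

text \<open>A real position is sent to its integer part, the largest grid fraction below it and the rank
  of its fractional part above that grid fraction. This map is strictly monotone on the positions
  in question and commutes with the translation by a unit.\<close>

lemma quantize:
  fixes l :: "'v \<Rightarrow> real"
  assumes V: "finite V" "card V \<le> n"
  shows "\<exists>g. (\<forall>u\<in>V. \<forall>v\<in>V. l v \<le> l u + 1 \<longleftrightarrow> g v \<le> g u + M) \<and>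
    (\<forall>v\<in>V. \<forall>A. \<forall>\<rho><d. (of_int A + F \<rho> / Q \<le> l v \<longrightarrow> code A \<rho> \<le> g v) \<and>
       (l v \<le> of_int A + F \<rho> / Q \<longrightarrow> g v \<le> code A \<rho>))"
proof -
  define fr where "fr = (\<lambda>v. frac (l v)) ` V"
  have fr: "finite fr" "card fr \<le> n" using V card_image_le[of V] by (auto simp: fr_def intro: le_trans)
  \<comment> \<open>The size of \<open>ab x\<close> is the rank of \<open>x\<close> among the
    occurring fractional parts above its grid fraction; it is 0 exactly on the grid fraction if
    \<open>x\<close> occurs.\<close>
  define ab where "ab x = {y \<in> fr. F (level x) / Q < y \<and> y \<le> x}" for x
  have ab: "finite (ab x)" "card (ab x) \<le> n" for x
    using fr card_mono[of fr "ab x"] by (auto simp: ab_def)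
  define key where "key x = int (level x) * int (n + 1) + int (card (ab x))" for x
  have key0: "0 \<le> key x" for x by (simp add: key_def)
  have key_less: "key x < int (Suc (level x)) * int (n + 1)" for x
    using ab(2)[of x] by (simp add: key_def algebra_simps)
  have keyM: "key x < M" for x
  proof -
    have "int (Suc (level x)) * int (n + 1) \<le> int d * int (n + 1)"
      using level_less[of x] by (intro mult_right_mono) auto
    also have "\<dots> = M" by (simp add: M_def mult.commute)
    finally show ?thesis using key_less[of x] by linarith
  qed
  have level_mono: "level x \<le> level y" if "x \<le> y" for x y
    unfolding level_def using that by (intro card_mono) auto
  have key_mono: "key x < key y" if xy: "x < y" "y \<in> fr" "0 \<le> x" for x y
  proof (cases "level x = level y")
    case True
    have "y \<notin> ab x" "ab x \<subseteq> ab y" using xy True by (auto simp: ab_def)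
    moreover have "y \<in> ab y"
    proof -
      have "F (level y) / Q \<le> x" using level_ge_iff[of x "level y"] xy level_less True by simp
      thus ?thesis using xy by (simp add: ab_def)
    qed
    ultimately have "card (ab x) < card (ab y)" using ab by (intro psubset_card_mono) auto
    thus ?thesis using True by (simp add: key_def)
  next
    case False
    hence "level x < level y" using level_mono[of x y] xy by simp
    hence "int (Suc (level x)) * int (n + 1) \<le> int (level y) * int (n + 1)" by (intro mult_right_mono) auto
    also have "\<dots> \<le> key y" by (simp add: key_def)
    finally show ?thesis using key_less[of x] by linarith
  qed
  have key_iff: "key x \<le> key y \<longleftrightarrow> x \<le> y" if "x \<in> fr" "y \<in> fr" for x y
  proof -
    have "0 \<le> x" "0 \<le> y" using that by (auto simp: fr_def)
    thus ?thesis using key_mono[of x y] key_mono[of y x] that by (cases x y rule: linorder_cases) auto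
  qed
  define g where "g v = \<lfloor>l v\<rfloor> * M + key (frac (l v))" for v
  \<comment> \<open>A coordinate is compared lexicographically by its integer part and its key,
    exactly as a real is by its floor and fractional part. This gives both the compatibility with
    unit shifts and the comparison with bounds.\<close>
  have lex: "a * M + k \<le> b * M + k' \<longleftrightarrow> a < b \<or> (a = b \<and> k \<le> k')"
    if "0 \<le> k" "k < M" "0 \<le> k'" "k' < M" for a b k k' :: int
  proof (cases a b rule: linorder_cases)
    case less
    hence "(a + 1) * M \<le> b * M" using M_pos by (intro mult_right_mono) auto
    thus ?thesis using that less by (simp add: algebra_simps)
  next
    case greater
    hence "(b + 1) * M \<le> a * M" using M_pos by (intro mult_right_mono) auto
    thus ?thesis using that greater by (simp add: algebra_simps)
  qed simp
  have split: "of_int a + x \<le> of_int b + y \<longleftrightarrow> a < b \<or> (a = b \<and> x \<le> y)"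
    if "0 \<le> x" "x < 1" "0 \<le> y" "y < 1" for a b :: int and x y :: real
  proof (cases a b rule: linorder_cases)
    case less
    hence "real_of_int a + 1 \<le> of_int b" by linarith
    thus ?thesis using that less by simp
  next
    case greater
    hence "real_of_int b + 1 \<le> of_int a" by linarith
    thus ?thesis using that greater by auto
  qed simp
  have lv: "l v = of_int \<lfloor>l v\<rfloor> + frac (l v)" for v by (simp add: frac_def)
  have f01: "0 \<le> frac (l v)" "frac (l v) < 1" for v by (simp_all add: frac_lt_1)
  have frV: "frac (l v) \<in> fr" if "v \<in> V" for v using that by (simp add: fr_def)
  have 1: "l v \<le> l u + 1 \<longleftrightarrow> g v \<le> g u + M" if "u \<in> V" "v \<in> V" for u v
  proof -
    have "l v \<le> l u + 1 \<longleftrightarrow> of_int \<lfloor>l v\<rfloor> + frac (l v) \<le> of_int (\<lfloor>l u\<rfloor> + 1) + frac (l u)"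
      by (simp add: frac_def add.commute)
    also have "\<dots> \<longleftrightarrow> \<lfloor>l v\<rfloor> < \<lfloor>l u\<rfloor> + 1 \<or> (\<lfloor>l v\<rfloor> = \<lfloor>l u\<rfloor> + 1 \<and> frac (l v) \<le> frac (l u))"
      by (rule split[OF f01 f01])
    also have "\<dots> \<longleftrightarrow> \<lfloor>l v\<rfloor> < \<lfloor>l u\<rfloor> + 1 \<or> (\<lfloor>l v\<rfloor> = \<lfloor>l u\<rfloor> + 1 \<and> key (frac (l v)) \<le> key (frac (l u)))"
      using key_iff frV that by simp
    also have "\<dots> \<longleftrightarrow> \<lfloor>l v\<rfloor> * M + key (frac (l v)) \<le> (\<lfloor>l u\<rfloor> + 1) * M + key (frac (l u))"
      by (rule lex[symmetric]) (rule key0 keyM)+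
    finally show ?thesis by (simp add: g_def algebra_simps)
  qed
  have 2: "code A \<rho> \<le> g v" if "v \<in> V" "\<rho> < d" "of_int A + F \<rho> / Q \<le> l v" for v A \<rho>
  proof -
    have r: "0 \<le> int \<rho> * int (n + 1)" "int \<rho> * int (n + 1) < M"
      using that(2) by (auto simp: M_def mult.commute)
    have "of_int A + F \<rho> / Q \<le> of_int \<lfloor>l v\<rfloor> + frac (l v)" using that(3) lv by metis
    hence "A < \<lfloor>l v\<rfloor> \<or> (A = \<lfloor>l v\<rfloor> \<and> F \<rho> / Q \<le> frac (l v))"
      using split[of "F \<rho> / Q" "frac (l v)" A "\<lfloor>l v\<rfloor>"] f01 F_nonneg[OF that(2)] FQ[OF that(2)] Q by simp
    moreover have "int \<rho> * int (n + 1) \<le> key (frac (l v))" if "F \<rho> / Q \<le> frac (l v)"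
    proof -
      have "\<rho> \<le> level (frac (l v))" using that level_ge_iff[of "frac (l v)" \<rho>] \<open>\<rho> < d\<close> f01 by simp
      hence "int \<rho> * int (n + 1) \<le> int (level (frac (l v))) * int (n + 1)" by (intro mult_right_mono) auto
      thus ?thesis unfolding key_def by (rule order_trans) simp
    qed
    ultimately show ?thesis unfolding code_alt g_def
      using lex[OF r key0 keyM, of A "\<lfloor>l v\<rfloor>" "frac (l v)"] by blast
  qed
  have 3: "g v \<le> code A \<rho>" if "v \<in> V" "\<rho> < d" "l v \<le> of_int A + F \<rho> / Q" for v A \<rho>
  proof -
    have r: "0 \<le> int \<rho> * int (n + 1)" "int \<rho> * int (n + 1) < M"
      using that(2) by (auto simp: M_def mult.commute)
    have "of_int \<lfloor>l v\<rfloor> + frac (l v) \<le> of_int A + F \<rho> / Q" using that(3) lv by metis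
    hence "\<lfloor>l v\<rfloor> < A \<or> (\<lfloor>l v\<rfloor> = A \<and> frac (l v) \<le> F \<rho> / Q)"
      using split[of "frac (l v)" "F \<rho> / Q" "\<lfloor>l v\<rfloor>" A] f01 F_nonneg[OF that(2)] FQ[OF that(2)] Q by simp
    moreover have "key (frac (l v)) \<le> int \<rho> * int (n + 1)" if le: "frac (l v) \<le> F \<rho> / Q"
    proof -
      let ?x = "frac (l v)"
      have lx: "F (level ?x) / Q \<le> ?x" using level_ge_iff[of ?x "level ?x"] f01 level_less by simp
      have "\<not> \<rho> < level ?x"
      proof
        assume "\<rho> < level ?x"
        hence "real_of_int (F \<rho>) / Q < F (level ?x) / Q"
          using Fmono level_less Q by (simp add: divide_strict_right_mono)
        thus False using lx le by linarith
      qed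
      moreover have ?thesis if "level ?x < \<rho>"
      proof -
        have "int (Suc (level ?x)) * int (n + 1) \<le> int \<rho> * int (n + 1)"
          using that by (intro mult_right_mono) auto
        thus ?thesis using key_less[of ?x] by linarith
      qed
      moreover have ?thesis if "level ?x = \<rho>"
      proof -
        \<comment> \<open>The position sits on the grid fraction itself, so its rank is 0 and an
          upper bound that is met with equality stays met.\<close>
        have "ab ?x = {}" using le that by (auto simp: ab_def)
        thus ?thesis using that by (simp add: key_def)
      qed
      ultimately show ?thesis by linarith
    qed
    ultimately show ?thesis unfolding code_alt g_def
      using lex[OF key0 keyM r, of "\<lfloor>l v\<rfloor>" "frac (l v)" A] by blast
  qed
  show ?thesis using 1 2 3 by blast
qed

text \<open>The numerator over the denominator \<open>Q * (n + 1)\<close> of the position that a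
  code stands for. Distinct values of \<open>F\<close> differ by at least 1, so the offset between
  grid points, at most \<open>n\<close>, can be added at scale \<open>1 / (Q * (n + 1))\<close>
  without passing the next fraction.\<close>

definition dec :: "int \<Rightarrow> int" where
  "dec w = (w div M * Q + F (nat (w mod M div int (n + 1)))) * int (n + 1) + w mod M mod int (n + 1)"

lemma rem_level: "nat (w mod M div int (n + 1)) < d" "0 \<le> w mod M div int (n + 1)"
proof -
  have "w mod M < int d * int (n + 1)" using M_pos by (simp add: M_def mult.commute)
  moreover have "w mod M div int (n + 1) * int (n + 1) \<le> w mod M"
    using div_mult_mod_eq[of "w mod M" "int (n + 1)"] pos_mod_sign[of "int (n + 1)" "w mod M"] by linarith
  ultimately have "w mod M div int (n + 1) * int (n + 1) < int d * int (n + 1)" by linarith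
  hence "w mod M div int (n + 1) < int d" using mult_less_cancel_right_pos[of "int (n + 1)"] by simp
  moreover show "0 \<le> w mod M div int (n + 1)" using M_pos by (simp add: pos_imp_zdiv_nonneg_iff)
  ultimately show "nat (w mod M div int (n + 1)) < d" by linarith
qed

text \<open>Integer part, residue rank and offset of a code are compared lexicographically, and each
  coarser part outweighs all finer ones after decoding as well.\<close>

lemma dec_mono: assumes "w < w'" shows "dec w < dec w'"
proof -
  let ?N = "int (n + 1)"
  define A \<rho> j where "A = w div M" and "\<rho> = w mod M div ?N" and "j = w mod M mod ?N"
  define A' \<rho>' j' where "A' = w' div M" and "\<rho>' = w' mod M div ?N" and "j' = w' mod M mod ?N"
  have w: "w = A * M + (\<rho> * ?N + j)" "w' = A' * M + (\<rho>' * ?N + j')"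
    by (simp_all only: A_def \<rho>_def j_def A'_def \<rho>'_def j'_def div_mult_mod_eq)
  have j: "0 \<le> j" "j < ?N" "0 \<le> j'" "j' < ?N" by (simp_all add: j_def j'_def)
  have r: "nat \<rho> < d" "0 \<le> \<rho>" "nat \<rho>' < d" "0 \<le> \<rho>'"
    using rem_level[of w] rem_level[of w'] by (simp_all add: \<rho>_def \<rho>'_def)
  have dec: "dec w = (A * Q + F (nat \<rho>)) * ?N + j" "dec w' = (A' * Q + F (nat \<rho>')) * ?N + j'"
    by (simp_all add: dec_def A_def \<rho>_def j_def A'_def \<rho>'_def j'_def)
  have le: "A \<le> A'" unfolding A_def A'_def using assms M_pos by (intro zdiv_mono1) auto
  have step: "dec w < dec w'" if "A * Q + F (nat \<rho>) < A' * Q + F (nat \<rho>')"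
  proof -
    have "(A * Q + F (nat \<rho>) + 1) * ?N \<le> (A' * Q + F (nat \<rho>')) * ?N"
      using that by (intro mult_right_mono) auto
    thus ?thesis using j by (simp add: dec algebra_simps)
  qed
  show ?thesis
  proof (cases "A = A'")
    case False
    hence "(A + 1) * Q \<le> A' * Q" using le Q by (intro mult_right_mono) auto
    moreover have "F (nat \<rho>) < Q" "0 \<le> F (nat \<rho>')" using FQ F_nonneg r by auto
    ultimately show ?thesis by (intro step) (simp add: algebra_simps)
  next
    case True
    hence lt: "\<rho> * ?N + j < \<rho>' * ?N + j'" using w assms by simp
    have "\<rho> \<le> \<rho>'"
    proof (rule ccontr)
      assume "\<not> \<rho> \<le> \<rho>'"
      hence "(\<rho>' + 1) * ?N \<le> \<rho> * ?N" by (intro mult_right_mono) auto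
      thus False using lt j by (simp add: algebra_simps)
    qed
    show ?thesis
    proof (cases "\<rho> = \<rho>'")
      case True
      thus ?thesis using lt \<open>A = A'\<close> by (simp add: dec)
    next
      case False
      hence "nat \<rho> < nat \<rho>'" using \<open>\<rho> \<le> \<rho>'\<close> r by simp
      thus ?thesis using Fmono r True by (intro step) simp
    qed
  qed
qed

lemma dec_le_iff: "dec w \<le> dec w' \<longleftrightarrow> w \<le> w'"
  using dec_mono[of w w'] dec_mono[of w' w] by (cases w w' rule: linorder_cases) auto

lemma dec_shift: "dec (w + M) = dec w + Q * int (n + 1)"
  using M_pos by (simp add: dec_def algebra_simps)

lemma dec_code: assumes "\<rho> < d" shows "dec (code A \<rho>) = (A * Q + F \<rho>) * int (n + 1)"
proof -
  have r: "0 \<le> int \<rho> * int (n + 1)" "int \<rho> * int (n + 1) < M"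
    using assms by (auto simp: M_def mult.commute)
  have "code A \<rho> div M = A" "code A \<rho> mod M = int \<rho> * int (n + 1)"
    using r M_pos unfolding code_alt by auto
  moreover have "int \<rho> * int (n + 1) div int (n + 1) = int \<rho>" "int \<rho> * int (n + 1) mod int (n + 1) = 0"
    by (simp_all only: nonzero_mult_div_cancel_right[of "int (n + 1)"] mod_mult_self2_is_0)
  ultimately show ?thesis unfolding dec_def by (simp only: nat_int)
qed

end

section \<open>The discretised problem\<close>

locale inst =
  fixes I :: boundrep_input
  assumes valid: "valid_input I"
begin

abbreviation n where "n \<equiv> nv I"
abbreviation Cs where "Cs \<equiv> comps I"

definition ad :: "nat \<Rightarrow> nat \<Rightarrow> bool" where "ad u v \<longleftrightarrow> u = v \<or> {u, v} \<in> edges I"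

lemma ad_refl: "ad u u" and ad_sym: "ad u v \<Longrightarrow> ad v u"
  by (auto simp: ad_def insert_commute)

lemma edge_vertices: "{u, v} \<in> edges I \<Longrightarrow> u < n \<and> v < n \<and> u \<noteq> v"
  using valid unfolding valid_input_def edges_def by (fastforce simp: doubleton_eq_iff)

definition R where
  "R = {(u, v). u \<in> vertices I \<and> v \<in> vertices I \<and> (u, v) \<in> {(a, b). {a, b} \<in> edges I}\<^sup>*}"

lemma equiv_R: "equiv (vertices I) R"
proof -
  have "sym {(a, b). {a, b} \<in> edges I}" by (auto simp: sym_def insert_commute)
  hence "sym ({(a, b). {a, b} \<in> edges I}\<^sup>*)" by (rule sym_rtrancl)
  thus ?thesis unfolding equiv_def R_def
    by (auto simp: refl_on_def sym_def trans_def)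
qed

lemma set_Cs: "set Cs = vertices I // R" and distinct_Cs: "distinct Cs"
  using valid by (auto simp: valid_input_def conn_components_def R_def)

lemma Cs_Union: "\<Union> (set Cs) = {..<n}"
  unfolding set_Cs using Union_quotient[OF equiv_R] by (simp add: vertices_def)

lemma comp_sub: "t < length Cs \<Longrightarrow> Cs ! t \<subseteq> {..<n}"
  using Cs_Union nth_mem by blast

lemma comp_finite: "t < length Cs \<Longrightarrow> finite (Cs ! t)"
  using comp_sub finite_subset by blast

lemma comp_nonempty: "t < length Cs \<Longrightarrow> Cs ! t \<noteq> {}"
  using in_quotient_imp_non_empty[OF equiv_R] set_Cs nth_mem by blast

lemma comp_disjoint: "s < length Cs \<Longrightarrow> t < length Cs \<Longrightarrow> s \<noteq> t \<Longrightarrow> Cs ! s \<inter> Cs ! t = {}"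
  using quotient_disj[OF equiv_R, of "Cs ! s" "Cs ! t"] set_Cs distinct_Cs
  by (metis nth_eq_iff_index_eq nth_mem)

lemma comp_closed:
  assumes "t < length Cs" "u \<in> Cs ! t" "v < n" "ad u v"
  shows "v \<in> Cs ! t"
proof (cases "u = v")
  case False
  hence "(u, v) \<in> R" using assms comp_sub[of t] edge_vertices[of u v] by (auto simp: R_def ad_def vertices_def)
  moreover have "Cs ! t \<in> vertices I // R" using assms(1) set_Cs nth_mem by blast
  ultimately show ?thesis using in_quotient_imp_closed[OF equiv_R] assms(2) by blast
qed (use assms in simp)

lemma comp_conn:
  assumes "t < length Cs"
  shows "conn_on (Cs ! t) ad"
  unfolding conn_on_def
proof (intro allI impI subsetI)
  fix S v assume ne: "S \<inter> Cs ! t \<noteq> {}" and cl: "\<forall>u\<in>S \<inter> Cs ! t. \<forall>v\<in>Cs ! t. ad u v \<longrightarrow> v \<in> S"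
    and v: "v \<in> Cs ! t"
  obtain u where u: "u \<in> S" "u \<in> Cs ! t" using ne by blast
  have "Cs ! t \<in> vertices I // R" using assms set_Cs nth_mem by blast
  hence "(u, v) \<in> R" using in_quotient_imp_in_rel[OF equiv_R] u v by blast
  hence "(u, v) \<in> {(a, b). {a, b} \<in> edges I}\<^sup>*" by (simp add: R_def)
  hence "v \<in> S \<inter> Cs ! t"
  proof (induction rule: rtrancl_induct)
    case (step y z)
    hence e: "{y, z} \<in> edges I" by simp
    hence "ad y z" "z < n" using edge_vertices by (auto simp: ad_def)
    moreover from this have "z \<in> Cs ! t" using comp_closed[OF assms, of y z] step by blast
    ultimately show ?case using cl step by blast
  qed (use u in simp)
  thus "v \<in> S" by simp
qed

lemma comp_of: "v < n \<Longrightarrow> \<exists>t<length Cs. v \<in> Cs ! t"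
  using Cs_Union by (metis UnionE in_set_conv_nth lessThan_iff)

lemma comp_index_eq: "t < length Cs \<Longrightarrow> v \<in> Cs ! t \<Longrightarrow> comp_index I v = t"
  unfolding comp_index_def using comp_disjoint by (intro the_equality) blast+

lemma comp_index: "v < n \<Longrightarrow> comp_index I v < length Cs \<and> v \<in> Cs ! comp_index I v"
  using comp_of comp_index_eq by metis

lemma sum_card: "T \<le> length Cs \<Longrightarrow> (\<Sum>t<T. card (Cs ! t)) = card (\<Union>t<T. Cs ! t)"
  by (subst card_UN_disjoint) (use comp_finite comp_disjoint in auto)

lemma sum_card_le: "(\<Sum>t<length Cs. card (Cs ! t)) \<le> n"
proof -
  have "(\<Union>t<length Cs. Cs ! t) \<subseteq> {..<n}" using comp_sub by blast
  from card_mono[OF _ this] show ?thesis using sum_card[of "length Cs"] by simp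
qed

lemma comp_card_pos: "t < length Cs \<Longrightarrow> card (Cs ! t) \<ge> 1"
  using comp_finite comp_nonempty by (metis One_nat_def Suc_leI card_gt_0_iff)

lemma length_Cs: "length Cs \<le> n"
proof -
  have "(\<Sum>t<length Cs. 1) \<le> (\<Sum>t<length Cs. card (Cs ! t))" by (intro sum_mono) (use comp_card_pos in auto)
  thus ?thesis using sum_card_le by simp
qed

lemma comp_card_le: "t < length Cs \<Longrightarrow> card (Cs ! t) \<le> n"
  using card_mono[OF _ comp_sub] by fastforce

text \<open>Lower bounds, upper bounds and one artificial bound 0 at index \<open>2 * n\<close>. The
  artificial one puts 0 among the fractional parts, as the grid requires of
  \<open>F 0\<close>.\<close>

definition bnd :: "nat \<Rightarrow> (int \<times> int) option" where
  "bnd i = (if i < n then lbounds I ! i else if i < 2 * n then ubounds I ! (i - n) else Some (0, 1))"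
definition num :: "nat \<Rightarrow> int" where "num i = bound_num (bnd i)"
definition den :: "nat \<Rightarrow> int" where "den i = (if bound_den (bnd i) = 0 then 1 else bound_den (bnd i))"
definition Q :: int where "Q = (\<Prod>i<2 * n + 1. den i)"
text \<open>The bound as a numerator over the common denominator \<open>Q\<close>; \<open>A\<close>
  is then its integer part and \<open>f\<close> its fractional part times \<open>Q\<close>.\<close>

definition scaled :: "nat \<Rightarrow> int" where "scaled i = num i * (Q div den i)"
definition A :: "nat \<Rightarrow> int" where "A i = scaled i div Q"
definition f :: "nat \<Rightarrow> int" where "f i = scaled i mod Q"

lemma bnd_den: "bnd i = Some (p, q) \<Longrightarrow> i < 2 * n + 1 \<Longrightarrow> q > 0"
proof -
  assume b: "bnd i = Some (p, q)" "i < 2 * n + 1"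
  have l: "length (lbounds I) = n" "length (ubounds I) = n"
    and s: "\<And>p q. Some (p, q) \<in> set (lbounds I) \<union> set (ubounds I) \<Longrightarrow> q > 0"
    using valid by (auto simp: valid_input_def)
  consider "i < n" | "n \<le> i" "i < 2 * n" | "i = 2 * n" using b by linarith
  thus ?thesis
  proof cases
    case 1
    thus ?thesis using b l s[of p q] nth_mem[of i "lbounds I"] by (simp add: bnd_def)
  next
    case 2
    thus ?thesis using b l s[of p q] nth_mem[of "i - n" "ubounds I"] by (simp add: bnd_def)
  qed (use b in \<open>auto simp: bnd_def\<close>)
qed

lemma den_pos: "i < 2 * n + 1 \<Longrightarrow> den i > 0"
  using bnd_den[of i] by (auto simp: den_def bound_den_def split: option.splits)

lemma Q_pos: "Q > 0"
  unfolding Q_def by (intro prod_pos) (use den_pos in auto)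

lemma den_dvd: "i < 2 * n + 1 \<Longrightarrow> den i dvd Q"
  unfolding Q_def by (intro dvd_prodI) auto

lemma value_eq:
  assumes "i < 2 * n + 1"
  shows "real_of_int (num i) / den i = real_of_int (A i) + real_of_int (f i) / Q"
proof -
  obtain e where e: "Q = den i * e" using den_dvd[OF assms] by (auto simp: dvd_def)
  have "real_of_int (num i) / den i = scaled i / Q"
    using e Q_pos den_pos[OF assms] by (cases "e = 0") (simp_all add: scaled_def)
  also have "scaled i = A i * Q + f i" by (simp add: A_def f_def)
  finally show ?thesis using Q_pos by (simp add: add_divide_distrib)
qed

lemma f_range: "0 \<le> f i" "f i < Q"
  using Q_pos by (simp_all add: f_def)

lemma f_last: "f (2 * n) = 0"
  by (simp add: f_def scaled_def num_def bnd_def bound_num_def)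

definition lfin :: "nat \<Rightarrow> bool" where "lfin v \<longleftrightarrow> lbounds I ! v \<noteq> None"
definition ufin :: "nat \<Rightarrow> bool" where "ufin v \<longleftrightarrow> ubounds I ! v \<noteq> None"

lemma den_eq: "i < 2 * n + 1 \<Longrightarrow> bnd i \<noteq> None \<Longrightarrow> bound_den (bnd i) = den i"
  using bnd_den by (fastforce simp: den_def bound_den_def split: option.splits)

lemma lbound_eq: "v < n \<Longrightarrow> lbound I v = (if lfin v then ereal (A v + f v / Q) else - \<infinity>)"
  using value_eq[of v] den_eq[of v]
  by (auto simp: lbound_def lfin_def num_def bnd_def bound_num_def bound_den_def split: option.splits)

lemma ubound_eq: "v < n \<Longrightarrow> ubound I v = (if ufin v then ereal (A (n + v) + f (n + v) / Q) else \<infinity>)"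
  using value_eq[of "n + v"] den_eq[of "n + v"]
  by (auto simp: ubound_def ufin_def num_def bnd_def bound_num_def bound_den_def split: option.splits)

end

text \<open>\<open>E0\<close> is the integer part of the substitute for infinite lower bounds. The
  distance of \<open>3 * n\<close> units from every upper bound makes room for all components in
  between, which \<open>solution_imp_grid_sol\<close> needs.\<close>

locale ranked = inst I + grid "nv I" d Q F for I d F +
  fixes rk :: "nat \<Rightarrow> nat" and E0 :: int
  assumes rk: "i < 2 * nv I + 1 \<Longrightarrow> rk i < d \<and> F (rk i) = f i"
    and E0: "v < nv I \<Longrightarrow> E0 + 3 * int (nv I) \<le> A (nv I + v)"
begin

definition LC :: "nat \<Rightarrow> int" where "LC v = (if lfin v then code (A v) (rk v) else E0 * M)"
definition UC :: "nat \<Rightarrow> int" where "UC v = code (A (n + v)) (rk (n + v))"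

definition grid_sol :: "(nat \<Rightarrow> int) \<Rightarrow> bool" where
  "grid_sol g \<longleftrightarrow> (\<forall>t<length Cs. \<forall>u\<in>Cs ! t. \<forall>v\<in>Cs ! t. ad u v \<longleftrightarrow> \<bar>g u - g v\<bar> \<le> M) \<and>
     (\<forall>t<length Cs. \<forall>s<t. \<forall>u\<in>Cs ! s. \<forall>v\<in>Cs ! t. g u + M < g v) \<and>
     (\<forall>v<n. LC v \<le> g v \<and> (ufin v \<longrightarrow> g v \<le> UC v))"

lemma unit_intervals_meet:
  "unit_interval x \<inter> unit_interval y \<noteq> {} \<longleftrightarrow> y \<le> x + 1 \<and> x \<le> y + 1"
proof
  assume "y \<le> x + 1 \<and> x \<le> y + 1"
  hence "max x y \<in> unit_interval x \<inter> unit_interval y" by auto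
  thus "unit_interval x \<inter> unit_interval y \<noteq> {}" by blast
qed auto

lemma left_of_iff: "left_of (unit_interval x) (unit_interval y) \<longleftrightarrow> x + 1 < y"
  by (force simp: left_of_def)

text \<open>\<open>dec\<close> is strictly monotone, turns a shift by \<open>M\<close> into a shift
  by one unit, and maps the code of a bound to that bound, so every condition carries over. Vertices
  of different components are nonadjacent and separated by the order condition.\<close>

lemma grid_sol_imp_solution:
  assumes g: "grid_sol g"
  shows "is_solution I (\<lambda>v. real_of_int (dec (g v)) / real_of_int (Q * int (n + 1)))"
proof -
  let ?N = "Q * int (n + 1)"
  let ?l = "\<lambda>v. real_of_int (dec (g v)) / real_of_int ?N"
  have N: "real_of_int ?N > 0" using Q_pos by simp
  have le: "?l v \<le> ?l u + 1 \<longleftrightarrow> g v \<le> g u + M" for u v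
  proof -
    have "?l u + 1 = real_of_int (dec (g u + M)) / ?N"
      using N Q_pos by (simp only: dec_shift of_int_add add_divide_distrib) simp
    thus ?thesis using N by (simp only: divide_le_cancel of_int_le_iff dec_le_iff) auto
  qed
  have cd: "real_of_int (dec (code (A i) (rk i))) / ?N = A i + f i / Q" if "i < 2 * n + 1" for i
  proof -
    have "dec (code (A i) (rk i)) = (A i * Q + f i) * int (n + 1)" using dec_code rk[OF that] by simp
    hence "real_of_int (dec (code (A i) (rk i))) / ?N =
        (real_of_int (A i * Q + f i) * real_of_int (int (n + 1))) / (real_of_int Q * real_of_int (int (n + 1)))"
      by (simp only: of_int_mult)
    also have "\<dots> = real_of_int (A i * Q + f i) / Q" by (rule mult_divide_mult_cancel_right) simp
    finally show ?thesis using Q_pos by (simp add: add_divide_distrib)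
  qed
  have adj: "ad u v \<longleftrightarrow> \<bar>g u - g v\<bar> \<le> M" if uv: "u < n" "v < n" for u v
  proof -
    obtain s t where st: "s < length Cs" "u \<in> Cs ! s" "t < length Cs" "v \<in> Cs ! t"
      using comp_of uv by metis
    show ?thesis
    proof (cases s t rule: linorder_cases)
      case equal
      thus ?thesis using g st by (auto simp: grid_sol_def)
    next
      case less
      hence "\<not> ad u v" using comp_closed[of s u v] comp_disjoint[of s t] st uv by blast
      moreover have "g u + M < g v" using g st less by (auto simp: grid_sol_def)
      ultimately show ?thesis by auto
    next
      case greater
      hence "\<not> ad u v" using comp_closed[of s u v] comp_disjoint[of s t] st uv by blast
      moreover have "g v + M < g u" using g st greater by (auto simp: grid_sol_def)
      ultimately show ?thesis by auto
    qed
  qed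
  have 1: "{u, v} \<in> edges I \<longleftrightarrow> unit_interval (?l u) \<inter> unit_interval (?l v) \<noteq> {}"
    if "u < n" "v < n" "u \<noteq> v" for u v
    using adj[OF that(1,2)] that(3) unfolding unit_intervals_meet le ad_def by auto
  have 2: "lbound I v \<le> ereal (?l v)" if "v < n" for v
  proof (cases "lfin v")
    case True
    hence "code (A v) (rk v) \<le> g v" using g that by (auto simp: grid_sol_def LC_def)
    hence "dec (code (A v) (rk v)) \<le> dec (g v)" by (simp add: dec_le_iff)
    hence "real_of_int (dec (code (A v) (rk v))) / ?N \<le> ?l v" using N by (intro divide_right_mono) auto
    thus ?thesis using cd[of v] that True by (simp add: lbound_eq)
  qed (use that in \<open>simp add: lbound_eq\<close>)
  have 3: "ereal (?l v) \<le> ubound I v" if "v < n" for v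
  proof (cases "ufin v")
    case True
    hence "g v \<le> code (A (n + v)) (rk (n + v))" using g that by (auto simp: grid_sol_def UC_def)
    hence "dec (g v) \<le> dec (code (A (n + v)) (rk (n + v)))" by (simp add: dec_le_iff)
    hence "?l v \<le> real_of_int (dec (code (A (n + v)) (rk (n + v)))) / ?N" using N by (intro divide_right_mono) auto
    thus ?thesis using cd[of "n + v"] that True by (simp add: ubound_eq)
  qed (use that in \<open>simp add: ubound_eq\<close>)
  have 4: "?l u + 1 < ?l v" if "Suc t < length Cs" "u \<in> Cs ! t" "v \<in> Cs ! Suc t" for t u v
  proof -
    have "g u + M < g v" using g that unfolding grid_sol_def by blast
    thus ?thesis using le[of v u] by linarith
  qed
  show ?thesis unfolding is_solution_def bounded_rep_def respects_order_def left_of_iff vertices_def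
    using 1 2 3 4 by auto
qed

text \<open>A quantized solution may extend arbitrarily far to the left of \<open>E0\<close>. Each
  component has a slot that starts at \<open>E0 + w t\<close>; a component that begins further left
  is moved into its slot as a whole. Moved components are ordered by their slots and lie below all
  upper bounds; unmoved ones keep their positions, which are valid already.\<close>

lemma solution_imp_grid_sol:
  assumes l: "is_solution I l"
  shows "\<exists>g. grid_sol g \<and> (\<forall>v<n. E0 * M \<le> g v)"
proof -
  obtain h where h1: "\<And>u v. u < n \<Longrightarrow> v < n \<Longrightarrow> l v \<le> l u + 1 \<longleftrightarrow> h v \<le> h u + M"
    and h2: "\<And>v B \<rho>. v < n \<Longrightarrow> \<rho> < d \<Longrightarrow> of_int B + F \<rho> / Q \<le> l v \<Longrightarrow> code B \<rho> \<le> h v"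
    and h3: "\<And>v B \<rho>. v < n \<Longrightarrow> \<rho> < d \<Longrightarrow> l v \<le> of_int B + F \<rho> / Q \<Longrightarrow> h v \<le> code B \<rho>"
    using quantize[of "{..<n}" l] by auto
  have e: "u < n \<Longrightarrow> v < n \<Longrightarrow> u \<noteq> v \<Longrightarrow> {u, v} \<in> edges I \<longleftrightarrow> l v \<le> l u + 1 \<and> l u \<le> l v + 1" for u v
    using l unfolding is_solution_def bounded_rep_def unit_intervals_meet vertices_def by blast
  have adh: "ad u v \<longleftrightarrow> \<bar>h u - h v\<bar> \<le> M" if "u < n" "v < n" for u v
    using e[OF that] h1[OF that] h1[OF that(2,1)] M_pos by (auto simp: ad_def)
  have ordh1: "h u + M < h v" if "Suc t < length Cs" "u \<in> Cs ! t" "v \<in> Cs ! Suc t" for t u v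
  proof -
    have "u < n" "v < n" using that comp_sub[of t] comp_sub[of "Suc t"] by auto
    moreover have "l u + 1 < l v"
      using l that unfolding is_solution_def respects_order_def left_of_iff by blast
    ultimately show ?thesis using h1[of u v] by linarith
  qed
  have lbh: "code (A v) (rk v) \<le> h v" if "v < n" "lfin v" for v
  proof (rule h2)
    have "lbound I v \<le> ereal (l v)" using l that by (auto simp: is_solution_def bounded_rep_def vertices_def)
    thus "of_int (A v) + F (rk v) / Q \<le> l v" using that rk[of v] by (simp add: lbound_eq)
  qed (use that rk[of v] in auto)
  have ubh: "h v \<le> UC v" if "v < n" "ufin v" for v
    unfolding UC_def
  proof (rule h3)
    have "ereal (l v) \<le> ubound I v" using l that by (auto simp: is_solution_def bounded_rep_def vertices_def)
    thus "l v \<le> of_int (A (n + v)) + F (rk (n + v)) / Q" using that rk[of "n + v"] by (simp add: ubound_eq)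
  qed (use that rk[of "n + v"] in auto)
  \<comment> \<open>A component with \<open>k\<close> vertices spans at most \<open>k\<close> units,
    and 2 more separate it from the next slot. Since \<open>k + 2 \<le> 3 * k\<close>, all slots
    together need at most \<open>3 * n\<close> units.\<close>
  define w where "w t = (\<Sum>s<t. int (card (Cs ! s)) + 2)" for t
  have w_mono: "w s + int (card (Cs ! s)) + 2 \<le> w t" if "s < t" for s t
  proof -
    have "w (Suc s) \<le> w t" unfolding w_def using that by (intro sum_mono2) auto
    thus ?thesis by (simp add: w_def)
  qed
  have w0: "0 \<le> w t" for t unfolding w_def by (intro sum_nonneg) auto
  have w_le: "w t + int (card (Cs ! t)) \<le> 3 * int n" if "t < length Cs" for t
  proof -
    have "w t + int (card (Cs ! t)) \<le> w (Suc t)" by (simp add: w_def)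
    also have "\<dots> \<le> (\<Sum>s<length Cs. int (card (Cs ! s)) + 2)" unfolding w_def using that
      by (intro sum_mono2) auto
    also have "\<dots> \<le> (\<Sum>s<length Cs. 3 * int (card (Cs ! s)))"
      using comp_card_pos by (intro sum_mono) force
    also have "\<dots> = 3 * int (\<Sum>s<length Cs. card (Cs ! s))" by (simp add: sum_distrib_left)
    also have "\<dots> \<le> 3 * int n" using sum_card_le by (intro mult_left_mono of_nat_mono) simp_all
    finally show ?thesis .
  qed
  define mn where "mn t = Min (h ` (Cs ! t))" for t
  have mn: "mn t \<le> h v" if "t < length Cs" "v \<in> Cs ! t" for t v
    unfolding mn_def using that comp_finite by simp
  have mn_span: "h v \<le> mn t + int (card (Cs ! t)) * M" if "t < length Cs" "v \<in> Cs ! t" for t v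
  proof -
    have "mn t \<in> h ` (Cs ! t)" unfolding mn_def using that comp_finite by (intro Min_in) auto
    then obtain u where u: "u \<in> Cs ! t" "mn t = h u" by auto
    have "rep_on (Cs ! t) ad M h" using adh comp_sub[OF that(1)] M_pos by (auto simp: rep_on_def)
    from rep_span[OF this comp_conn comp_finite u(1) that(2)] show ?thesis using that u by simp
  qed
  define sh where "sh t = max 0 ((E0 + w t) * M - mn t)" for t
  define g where "g v = h v + sh (comp_index I v)" for v
  have g: "g v = h v + sh t" if "t < length Cs" "v \<in> Cs ! t" for v t
    using comp_index_eq[OF that] by (simp add: g_def)
  have g_ge: "(E0 + w t) * M \<le> g v" if "t < length Cs" "v \<in> Cs ! t" for v t
    using g[OF that] mn[OF that] by (simp add: sh_def)
  have g_cases: "g v = h v \<or> g v \<le> (E0 + w t + int (card (Cs ! t))) * M"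
    if "t < length Cs" "v \<in> Cs ! t" for v t
    using g[OF that] mn_span[OF that] by (auto simp: sh_def algebra_simps max_def)
  have h_le_g: "h v \<le> g v" for v by (simp add: g_def sh_def)
  have ordh: "h u + M < h v" if "s < t" "t < length Cs" "u \<in> Cs ! s" "v \<in> Cs ! t" for s t u v
    using that
  proof (induction t arbitrary: v)
    case (Suc t)
    show ?case
    proof (cases "s = t")
      case True
      thus ?thesis using ordh1 Suc by blast
    next
      case False
      obtain x where x: "x \<in> Cs ! t" using comp_nonempty[of t] Suc by auto
      hence "h u + M < h x" using Suc False by auto
      thus ?thesis using ordh1[OF _ x] Suc M_pos by fastforce
    qed
  qed simp
  \<comment> \<open>If \<open>u\<close> did not move, \<open>v\<close> only moved away from it. If
    \<open>u\<close> moved, it lies inside its slot, while \<open>v\<close> is at least at the start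
    of a later slot.\<close>
  have "g u + M < g v" if "s < t" "t < length Cs" "u \<in> Cs ! s" "v \<in> Cs ! t" for s t u v
    using g_cases[of s u]
  proof
    assume "g u = h u"
    thus ?thesis using ordh[OF that] h_le_g[of v] by linarith
  next
    assume a: "g u \<le> (E0 + w s + int (card (Cs ! s))) * M"
    have "(E0 + w s + int (card (Cs ! s)) + 2) * M \<le> (E0 + w t) * M"
      using w_mono[OF that(1)] M_pos by (intro mult_right_mono) auto
    thus ?thesis using a g_ge[OF that(2,4)] M_pos by (simp add: algebra_simps)
  qed (use that in auto)
  moreover have "ad u v \<longleftrightarrow> \<bar>g u - g v\<bar> \<le> M" if "t < length Cs" "u \<in> Cs ! t" "v \<in> Cs ! t" for t u v
  proof -
    have "u < n" "v < n" using that comp_sub[of t] by auto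
    thus ?thesis using adh g that by simp
  qed
  moreover have E: "E0 * M \<le> g v" if v: "v < n" for v
  proof -
    obtain t where t: "t < length Cs" "v \<in> Cs ! t" using comp_of v by blast
    have "E0 * M \<le> (E0 + w t) * M" using w0 M_pos by (intro mult_right_mono) auto
    thus ?thesis using g_ge[OF t] by linarith
  qed
  moreover have "LC v \<le> g v" if "v < n" for v
    using lbh[OF that] h_le_g[of v] E[OF that] by (auto simp: LC_def)
  moreover have "g v \<le> UC v" if v: "v < n" "ufin v" for v
  proof -
    obtain t where t: "t < length Cs" "v \<in> Cs ! t" using comp_of v by blast
    show ?thesis using g_cases[OF t]
    proof
      assume "g v = h v"
      thus ?thesis using ubh[OF v] by simp
    next
      assume a: "g v \<le> (E0 + w t + int (card (Cs ! t))) * M"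
      also have "\<dots> \<le> A (n + v) * M"
        using w_le[OF t(1)] E0[OF v(1)] M_pos by (intro mult_right_mono) auto
      also have "\<dots> \<le> UC v" by (simp add: UC_def code_alt)
      finally show ?thesis .
    qed
  qed
  ultimately show ?thesis unfolding grid_sol_def by (intro exI[of _ g]) blast
qed

end

section \<open>Preprocessing\<close>

abbreviation At :: "string \<Rightarrow> string \<Rightarrow> aexp" where
  "At x y \<equiv> Plus (Times (Var x) (Var ''n'')) (Var y)"

definition p_adj :: com where
  "p_adj = Seq
    (For ''i'' ''m'' (seqs
      [Put ''u'' (Cell ''edge_u'' (Var ''i'')), Put ''v'' (Cell ''edge_v'' (Var ''i'')),
       Assign ''adj'' (At ''u'' ''v'') (Const 1), Assign ''adj'' (At ''v'' ''u'') (Const 1)]))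
    (For ''i'' ''n'' (Assign ''adj'' (At ''i'' ''i'') (Const 1)))"

definition p_deg :: com where
  "p_deg = For ''i'' ''n'' (For ''j'' ''n''
     (Assign ''deg'' (Var ''i'') (Plus (Cell ''deg'' (Var ''i'')) (Cell ''adj'' (At ''i'' ''j'')))))"

text \<open>One pass over all vertices for each possible degree; quadratic time is affordable
  here.\<close>

definition p_ord :: com where
  "p_ord = Seq (Seq (Put ''n1'' (Plus (Var ''n'') (Const 1))) (Put ''k'' (Const 0)))
     (For ''e'' ''n1'' (For ''i'' ''n''
       (If (Equal (Cell ''deg'' (Var ''i'')) (Var ''e''))
         (seqs [Assign ''ord'' (Var ''k'') (Var ''i''), Put ''k'' (Plus (Var ''k'') (Const 1))])
         Skip)))"

definition holds :: "(nat \<Rightarrow> int) \<Rightarrow> nat list \<Rightarrow> bool" where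
  "holds a L \<longleftrightarrow> (\<forall>i<length L. a i = int (L ! i))"

lemma holds_snoc: "holds a L \<Longrightarrow> k = length L \<Longrightarrow> holds (a(k := int x)) (L @ [x])"
  by (auto simp: holds_def nth_append)

lemma holds_nth: "holds a L \<Longrightarrow> i < length L \<Longrightarrow> a i = int (L ! i)"
  by (simp add: holds_def)

lemma nat_addr [simp]: "nat (int a * int b + int c) = a * b + c"
  by (simp add: nat_add_distrib nat_mult_distrib)

lemma addr_inj:
  assumes "(v::nat) < n" "v' < n"
  shows "u * n + v = u' * n + v' \<longleftrightarrow> u = u' \<and> v = v'"
proof
  assume e: "u * n + v = u' * n + v'"
  have "u = (u * n + v) div n" "u' = (u' * n + v') div n" using assms by auto
  hence "u = u'" using e by simp
  thus "u = u' \<and> v = v'" using e by simp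
qed simp

lemma upd_addr:
  "(v::nat) < n \<Longrightarrow> b < n \<Longrightarrow> (h(u * n + v := x)) (a * n + b) = (if a = u \<and> b = v then x else h (a * n + b))"
  using addr_inj[of v n b u a] by auto

lemma addr_less:
  assumes "(u::nat) < n" "v < n"
  shows "u * n + v < n * n"
proof -
  have "Suc u * n \<le> n * n" using assms by (intro mult_right_mono) auto
  thus ?thesis using assms by simp
qed

locale prun = inst I + ram D "input_size I" for I D
begin

abbreviation r where "r \<equiv> input_size I"

lemmas wp_For_W = wp_For_sl[OF _ _ _ _ _ _ md_W]
lemmas wp_For_B = wp_For_sl[OF _ _ _ _ _ _ md_B]

lemma nbits_pos: "nbits a \<ge> 1" by (simp add: nbits_def)

lemma sum_nbits_ge: "(\<Sum>a\<leftarrow>xs. nbits a) \<ge> length xs"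
proof (induction xs)
  case (Cons a xs)
  thus ?case using nbits_pos[of a] by simp
qed simp

lemma len_bounds: "length (lbounds I) = n" "length (ubounds I) = n"
  using valid by (auto simp: valid_input_def)

text \<open>Every encoded number takes at least one bit, and five arrays of length \<open>n\<close>,
  two of length \<open>m\<close> and two scalars are encoded. All estimates of indices and
  coordinates by powers of \<open>r\<close> go back to this.\<close>

lemma r_ge: "r \<ge> 5 * n + 2 * length (edge_list I) + 2"
  using sum_nbits_ge[of "map (int \<circ> fst) (edge_list I)"] sum_nbits_ge[of "map (int \<circ> snd) (edge_list I)"]
    sum_nbits_ge[of "map bound_num (lbounds I)"] sum_nbits_ge[of "map bound_den (lbounds I)"]
    sum_nbits_ge[of "map bound_num (ubounds I)"] sum_nbits_ge[of "map bound_den (ubounds I)"]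
    sum_nbits_ge[of "map (int \<circ> comp_index I) [0..<n]"] nbits_pos[of "int n"]
    nbits_pos[of "int (length (edge_list I))"] len_bounds
  unfolding input_size_def encode_def by simp

lemma r_pow: "r \<le> r ^ 5" "r ^ 2 \<le> r ^ 5"
  using r_ge power_increasing[of 1 5 r] power_increasing[of 2 5 r] by simp_all

lemma small_nat: "a \<le> r \<Longrightarrow> small (int a)"
proof -
  assume "a \<le> r"
  hence "a \<le> r ^ 5" using r_pow by simp
  hence "int a \<le> int (r ^ 5)" by (rule of_nat_mono)
  thus ?thesis by (simp add: small_def)
qed

lemma small_sq: "a \<le> r ^ 2 \<Longrightarrow> small (int a)"
proof -
  assume "a \<le> r ^ 2"
  hence "a \<le> r ^ 5" using r_pow by simp
  hence "int a \<le> int (r ^ 5)" by (rule of_nat_mono)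
  thus ?thesis by (simp add: small_def)
qed

lemma nn_le: "n * n \<le> r ^ 2"
  unfolding power2_eq_square using r_ge by (intro mult_mono) auto

lemma small_addr: "u < n \<Longrightarrow> v < n \<Longrightarrow> small (int u * int n + int v)"
  using small_sq[of "u * n + v"] addr_less[of u n v] nn_le by simp

lemma small_row: "u < n \<Longrightarrow> small (int u * int n)"
proof -
  assume "u < n"
  hence "u * n \<le> n * n" by (intro mult_le_mono1) simp
  hence "u * n \<le> r\<^sup>2" using nn_le by (rule le_trans)
  from small_sq[OF this] show ?thesis by simp
qed

lemma small01 [simp]: "small 0" "small 1"
  using small_nat[of 0] small_nat[of 1] r_ge by simp_all

lemma addr0 [simp]: "addr 0" by (simp add: addr_def)

lemma addr_int: "addr (int a) \<longleftrightarrow> small (int a)"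
  by (simp add: addr_def)

lemma addr_At: "u < n \<Longrightarrow> v < n \<Longrightarrow> addr (int u * int n + int v)"
  using small_addr by (simp add: addr_def)

lemma small_Suc: "a < r \<Longrightarrow> small (int a + 1)" "a < r \<Longrightarrow> small (1 + int a)"
  using small_nat[of "Suc a"] by (simp_all add: add.commute)

definition inputs :: "state \<Rightarrow> bool" where
  "inputs s \<longleftrightarrow> (\<forall>x\<in>set (map fst (encode I)). s x = init_state I x)"

lemma inputsD:
  assumes "inputs s"
  shows "s ''n'' 0 = int n" "s ''m'' 0 = int (length (edge_list I))"
    "i < length (edge_list I) \<Longrightarrow> s ''edge_u'' i = int (fst (edge_list I ! i))"
    "i < length (edge_list I) \<Longrightarrow> s ''edge_v'' i = int (snd (edge_list I ! i))"
    "v < n \<Longrightarrow> s ''lb_num'' v = bound_num (lbounds I ! v)"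
    "v < n \<Longrightarrow> s ''lb_den'' v = bound_den (lbounds I ! v)"
    "v < n \<Longrightarrow> s ''ub_num'' v = bound_num (ubounds I ! v)"
    "v < n \<Longrightarrow> s ''ub_den'' v = bound_den (ubounds I ! v)"
    "v < n \<Longrightarrow> s ''comp'' v = int (comp_index I v)"
  using assms len_bounds by (simp_all add: inputs_def encode_def init_state_def)

lemma inputs_cong:
  assumes "inputs s" "\<And>x. x \<in> set (map fst (encode I)) \<Longrightarrow> s' x = s x"
  shows "inputs s'"
  using assms by (auto simp: inputs_def)

lemma edge_bounds:
  assumes "i < length (edge_list I)"
  shows "fst (edge_list I ! i) < n" "snd (edge_list I ! i) < n"
  using valid nth_mem[OF assms] by (auto simp: valid_input_def case_prod_beta)

lemma edges_iff: "{u, v} \<in> edges I \<longleftrightarrow>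
  (\<exists>j<length (edge_list I). {fst (edge_list I ! j), snd (edge_list I ! j)} = {u, v})"
proof -
  have "{u, v} \<in> edges I \<longleftrightarrow> (\<exists>e\<in>set (edge_list I). {fst e, snd e} = {u, v})"
    by (auto simp: edges_def image_iff case_prod_beta)
  thus ?thesis by (metis in_set_conv_nth)
qed

lemma edges_le: "length (edge_list I) \<le> n * n"
proof -
  have "distinct (map (\<lambda>(u, v). {u, v}) (edge_list I))" using valid by (simp add: valid_input_def)
  hence "length (edge_list I) = card (set (edge_list I))"
    by (metis distinct_card distinct_map)
  also have "\<dots> \<le> card ({..<n} \<times> {..<n})"
    using valid by (intro card_mono) (auto simp: valid_input_def)
  finally show ?thesis by simp
qed

definition adj_ok :: "state \<Rightarrow> bool" where
  "adj_ok s \<longleftrightarrow> (\<forall>u<n. \<forall>v<n. s ''adj'' (u * n + v) = (if ad u v then 1 else 0))"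

lemma p_adj:
  assumes "inputs s" "s ''adj'' = (\<lambda>_. 0)"
  shows "wp p_adj s (600 * (n * n + n + 2)) adj_ok"
proof -
  define el where "el = edge_list I"
  define I1 where "I1 k s \<longleftrightarrow> (\<forall>u<n. \<forall>v<n. s ''adj'' (u * n + v) =
    (if \<exists>j<k. {fst (el ! j), snd (el ! j)} = {u, v} then 1 else (0::int)))" for k and s :: state
  define I2 where "I2 k s \<longleftrightarrow> (\<forall>u<n. \<forall>v<n. s ''adj'' (u * n + v) =
    (if {u, v} \<in> edges I \<or> (u = v \<and> u < k) then 1 else (0::int)))" for k and s :: state
  let ?b1 = "seqs [Put ''u'' (Cell ''edge_u'' (Var ''i'')), Put ''v'' (Cell ''edge_v'' (Var ''i'')),
       Assign ''adj'' (At ''u'' ''v'') (Const 1), Assign ''adj'' (At ''v'' ''u'') (Const 1)]"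
  let ?b2 = "Assign ''adj'' (At ''i'' ''i'') (Const 1)"
  have "wp (For ''i'' ''m'' ?b1) s (400 * (n * n + 1)) (I1 (length el))"
  proof (rule wp_For_W[where I = I1 and N = "length el"])
    show "s ''m'' 0 = int (length el)" using inputsD[OF assms(1)] by (simp add: el_def)
    show "small (int (length el))" using r_ge by (intro small_nat) (simp add: el_def)
    show "I1 0 (store s ''i'' 0 0)" using assms(2) by (simp add: I1_def)
    show "csize ?b1 * 7 * length el + 100 * (length el + 1) \<le> 400 * (n * n + 1)"
      using edges_le by (simp add: el_def)
  next
    fix k s' assume k: "k < length el" and I: "I1 k s'" "s' ''i'' 0 = int k"
      and fr: "\<And>z. z \<notin> insert ''i'' (wr ?b1) \<Longrightarrow> s' z = s z"
    define u v where "u = fst (el ! k)" and "v = snd (el ! k)"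
    have e: "s' ''edge_u'' k = int u" "s' ''edge_v'' k = int v" "s' ''n'' 0 = int n"
      using fr[of "''edge_u''"] fr[of "''edge_v''"] fr[of "''n''"] inputsD[OF assms(1)] k
      by (simp_all add: el_def u_def v_def)
    have uv: "u < n" "v < n" using edge_bounds k by (simp_all add: el_def u_def v_def)
    have sm: "small (int k)" "small (int u)" "small (int v)" "small (int n)"
      using k uv r_ge by (auto intro!: small_nat simp: el_def)
    note sa = small_addr[OF uv] small_addr[OF uv(2,1)] small_row[OF uv(1)] small_row[OF uv(2)]
      addr_At[OF uv] addr_At[OF uv(2,1)]
    have "I1 (Suc k) (store (store (store (store (store s' ''u'' 0 (int u)) ''v'' 0 (int v))
        ''adj'' (u * n + v) 1) ''adj'' (v * n + u) 1) ''i'' 0 (int (Suc k)))"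
      unfolding I1_def
    proof (intro allI impI)
      have adj_eq: "(store (store (store (store (store s' ''u'' 0 (int u)) ''v'' 0 (int v))
        ''adj'' (u * n + v) 1) ''adj'' (v * n + u) 1) ''i'' 0 (int (Suc k))) ''adj'' =
        (s' ''adj'')(u * n + v := 1, v * n + u := 1)" by (rule ext) simp
      fix a b assume ab: "a < n" "b < n"
      define P where "P \<longleftrightarrow> (\<exists>j<k. {fst (el ! j), snd (el ! j)} = {a, b})"
      have eq: "(\<exists>j<Suc k. {fst (el ! j), snd (el ! j)} = {a, b}) \<longleftrightarrow> P \<or> (a = u \<and> b = v) \<or> (a = v \<and> b = u)"
        unfolding P_def by (auto simp: less_Suc_eq u_def v_def doubleton_eq_iff)
      have old: "s' ''adj'' (a * n + b) = (if P then 1 else 0)" 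
        unfolding P_def by (rule I(1)[unfolded I1_def, rule_format, OF ab])
      have "((s' ''adj'')(u * n + v := 1, v * n + u := 1)) (a * n + b) =
        (if (a = u \<and> b = v) \<or> (a = v \<and> b = u) then 1 else s' ''adj'' (a * n + b))"
        unfolding upd_addr[OF uv(2) ab(2)] upd_addr[OF uv(1) ab(2)] by argo
      hence "((s' ''adj'')(u * n + v := 1, v * n + u := 1)) (a * n + b) =
        (if \<exists>j<Suc k. {fst (el ! j), snd (el ! j)} = {a, b} then 1 else 0)"
        unfolding eq old by argo
      thus "(store (store (store (store (store s' ''u'' 0 (int u)) ''v'' 0 (int v))
        ''adj'' (u * n + v) 1) ''adj'' (v * n + u) 1) ''i'' 0 (int (Suc k))) ''adj'' (a * n + b) =
        (if \<exists>j<Suc k. {fst (el ! j), snd (el ! j)} = {a, b} then 1 else 0)"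
        by (simp only: adj_eq)
    qed
    thus "sl addr small small ?b1 s' (\<lambda>s''. I1 (Suc k) (store s'' ''i'' 0 (int (Suc k))))"
      using I(2) e sm sa by (simp add: addr_int)
  qed simp_all
  moreover have "wp (For ''i'' ''n'' ?b2) s' (200 * (n + 1)) adj_ok"
    if s': "I1 (length el) s'" and fr: "\<And>z. z \<notin> wr (For ''i'' ''m'' ?b1) \<Longrightarrow> s' z = s z" for s'
  proof (rule wp_For_W[where I = I2 and N = n])
    have nn: "s' ''n'' 0 = int n" using fr[of "''n''"] inputsD[OF assms(1)] by simp
    thus "s' ''n'' 0 = int n" .
    show "small (int n)" using r_ge by (intro small_nat) simp
    show "I2 0 (store s' ''i'' 0 0)" using s' edges_iff by (simp add: I1_def I2_def el_def)
    show "csize ?b2 * 7 * n + 100 * (n + 1) \<le> 200 * (n + 1)" by simp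
  next
    fix k s'' assume k: "k < n" and I: "I2 k s''" "s'' ''i'' 0 = int k" and n: "s'' ''n'' 0 = int n"
    have sm: "small (int k)" "small (int n)" using k r_ge by (auto intro!: small_nat)
    have "I2 (Suc k) (store (store s'' ''adj'' (k * n + k) 1) ''i'' 0 (int (Suc k)))"
      using I(1) k by (auto simp: I2_def upd_addr less_Suc_eq simp del: fun_upd_apply)
    thus "sl addr small small ?b2 s'' (\<lambda>s''. I2 (Suc k) (store s'' ''i'' 0 (int (Suc k))))"
      using I(2) n sm small_addr[OF k k] small_row[OF k] addr_At[OF k k] by (simp add: addr_int)
  next
    fix s'' assume "I2 n s''"
    thus "adj_ok s''" by (auto simp: I2_def adj_ok_def ad_def)
  qed simp_all
  moreover have "400 * (x + 1) + 200 * (y + 1) \<le> 600 * (x + y + 2)" for x y :: nat by simp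
  ultimately show ?thesis unfolding p_adj_def by (rule wp_Seq)
qed

definition dgr :: "nat \<Rightarrow> nat" where "dgr u = card {v. v < n \<and> ad u v}"

lemma card_upto_Suc: "card {v. v < Suc j \<and> P v} = card {v. v < j \<and> P v} + (if P j then 1 else 0)"
proof -
  have "{v. v < Suc j \<and> P v} = (if P j then insert j {v. v < j \<and> P v} else {v. v < j \<and> P v})"
    by (auto simp: less_Suc_eq)
  thus ?thesis by simp
qed

lemma card_upto_le: "card {v. v < j \<and> P v} \<le> j"
  using card_mono[of "{..<j}" "{v. v < j \<and> P v}"] by auto

lemma p_deg:
  assumes "inputs s" "s ''deg'' = (\<lambda>_. 0)" "adj_ok s"
  shows "wp p_deg s (400 * ((n + 1) * (n + 1))) (\<lambda>s. \<forall>u<n. s ''deg'' u = int (dgr u))"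
proof -
  define I1 where "I1 k s \<longleftrightarrow> (\<forall>u<n. s ''deg'' u = (if u < k then int (dgr u) else 0))"
    for k and s :: state
  define I2 where "I2 i k s \<longleftrightarrow> (\<forall>u<n. s ''deg'' u =
    (if u < i then int (dgr u) else if u = i then int (card {v. v < k \<and> ad i v}) else 0)) \<and> s ''i'' 0 = int i"
    for i k and s :: state
  let ?b = "Assign ''deg'' (Var ''i'') (Plus (Cell ''deg'' (Var ''i'')) (Cell ''adj'' (At ''i'' ''j'')))"
  show ?thesis unfolding p_deg_def
  proof (rule wp_For[where I = I1 and N = n and Tb = "\<lambda>_. 250 * (n + 1)"])
    show "s ''n'' 0 = int n" using inputsD[OF assms(1)] by simp
    show "small (int n)" using r_ge by (intro small_nat) simp
    show "I1 0 (store s ''i'' 0 0)" using assms(2) by (simp add: I1_def)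
    show "(\<Sum>k<n. 250 * (n + 1)) + 100 * (n + 1) \<le> 400 * ((n + 1) * (n + 1))"
      by (simp add: algebra_simps)
  next
    fix i s1 assume i: "i < n" and I: "I1 i s1" "s1 ''i'' 0 = int i" and n: "s1 ''n'' 0 = int n"
      and fr: "\<And>z. z \<notin> insert ''i'' (wr (For ''j'' ''n'' ?b)) \<Longrightarrow> s1 z = s z"
    show "wp (For ''j'' ''n'' ?b) s1 (250 * (n + 1)) (\<lambda>s'. I1 (Suc i) (store s' ''i'' 0 (int (Suc i))))"
    proof (rule wp_For_W[where I = "I2 i" and N = n])
      show "s1 ''n'' 0 = int n" by (rule n)
      show "small (int n)" using r_ge by (intro small_nat) simp
      show "I2 i 0 (store s1 ''j'' 0 0)" using I by (auto simp: I1_def I2_def)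
      show "csize ?b * 7 * n + 100 * (n + 1) \<le> 250 * (n + 1)" by simp
    next
      fix k s2 assume k: "k < n" and I2: "I2 i k s2" "s2 ''j'' 0 = int k" and n2: "s2 ''n'' 0 = int n"
        and fr2: "\<And>z. z \<notin> insert ''j'' (wr ?b) \<Longrightarrow> s2 z = s1 z"
      have a: "s2 ''adj'' (i * n + k) = (if ad i k then 1 else 0)"
        using fr2[of "''adj''"] fr[of "''adj''"] assms(3) i k by (simp add: adj_ok_def)
      have dg: "s2 ''deg'' i = int (card {v. v < k \<and> ad i v})" "s2 ''i'' 0 = int i"
        using I2(1) i by (auto simp: I2_def)
      have ck: "card {v. v < k \<and> ad i v} < n" using card_upto_le[of k "ad i"] k by simp
      have sm: "small (int k)" "small (int i)" "small (int n)" "small (int (card {v. v < k \<and> ad i v}))"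
        "small (int (card {v. v < k \<and> ad i v}) + 1)"
        using k i r_ge ck by (auto intro!: small_nat small_Suc)
      have "I2 i (Suc k) (store (store s2 ''deg'' i (int (card {v. v < k \<and> ad i v}) + (if ad i k then 1 else 0)))
          ''j'' 0 (int (Suc k)))"
        using I2(1) by (auto simp: I2_def card_upto_Suc)
      thus "sl addr small small ?b s2 (\<lambda>s'. I2 i (Suc k) (store s' ''j'' 0 (int (Suc k))))"
        using I2(2) n2 a dg sm small_addr[OF i k] small_row[OF i] addr_At[OF i k]
        by (simp add: addr_int)
    next
      fix s2 assume "I2 i n s2"
      thus "I1 (Suc i) (store s2 ''i'' 0 (int (Suc i)))"
        by (auto simp: I1_def I2_def dgr_def less_Suc_eq)
    qed simp_all
  next
    fix s1 assume "I1 n s1"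
    thus "\<forall>u<n. s1 ''deg'' u = int (dgr u)" by (simp add: I1_def)
  qed simp_all
qed

definition ordl :: "nat \<Rightarrow> nat list" where
  "ordl e = concat (map (\<lambda>d. filter (\<lambda>i. dgr i = d) [0..<n]) [0..<e])"

definition ord :: "nat list" where "ord = ordl (n + 1)"

lemma set_ordl: "set (ordl e) = {i. i < n \<and> dgr i < e}"
  by (auto simp: ordl_def)

lemma sorted_map_const: "(\<And>x. x \<in> set xs \<Longrightarrow> h x = (e::nat)) \<Longrightarrow> sorted (map h xs)"
  by (induction xs) auto

lemma distinct_ordl: "distinct (ordl e) \<and> sorted (map dgr (ordl e))"
proof (induction e)
  case (Suc e)
  have "ordl (Suc e) = ordl e @ filter (\<lambda>i. dgr i = e) [0..<n]" by (simp add: ordl_def)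
  moreover have "set (ordl e) \<inter> set (filter (\<lambda>i. dgr i = e) [0..<n]) = {}" by (auto simp: set_ordl)
  moreover have "sorted (map dgr (filter (\<lambda>i. dgr i = e) [0..<n]))"
    by (rule sorted_map_const) simp
  ultimately show ?case using Suc by (auto simp: sorted_append set_ordl)
qed (simp add: ordl_def)

lemma set_ord: "set ord = {..<n}"
  using card_upto_le[of n] by (auto simp: ord_def set_ordl dgr_def less_Suc_eq_le)

lemma length_ordl: "length (ordl e) \<le> n"
  using distinct_ordl[of e] card_mono[of "{..<n}" "set (ordl e)"] distinct_card[of "ordl e"]
  by (auto simp: set_ordl)

lemma length_ord: "length ord = n"
  using distinct_ordl[of "n + 1"] distinct_card[of ord] set_ord by (simp add: ord_def)

lemma distinct_ord: "distinct ord" and sorted_ord: "sorted (map dgr ord)"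
  using distinct_ordl by (simp_all only: ord_def)

lemma ord_nth: "i < n \<Longrightarrow> ord ! i < n"
proof -
  assume "i < n"
  hence "i < length ord" by (simp only: length_ord)
  hence "ord ! i \<in> set ord" by (rule nth_mem)
  thus "ord ! i < n" by (simp only: set_ord lessThan_iff)
qed

lemma p_ord:
  assumes "inputs s" "\<forall>u<n. s ''deg'' u = int (dgr u)"
  shows "wp p_ord s (500 * ((n + 2) * (n + 2))) (\<lambda>s. holds (s ''ord'') ord)"
proof -
  \<comment> \<open>The list written after the passes for the degrees below \<open>e\<close> and the
    first \<open>i\<close> vertices of pass \<open>e\<close>.\<close>
  define L where "L e i = ordl e @ filter (\<lambda>i. dgr i = e) [0..<i]" for e i
  have L0: "L e 0 = ordl e" "L e n = ordl (Suc e)" for e by (simp_all add: L_def ordl_def)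
  have LS: "L e (Suc i) = (if dgr i = e then L e i @ [i] else L e i)" for e i by (simp add: L_def)
  have len: "length (L e i) \<le> n" if "i \<le> n" for e i
  proof -
    have "filter (\<lambda>i. dgr i = e) [0..<n] = filter (\<lambda>i. dgr i = e) [0..<i] @ filter (\<lambda>i. dgr i = e) [i..<n]"
      using that upt_add_eq_append[of 0 i "n - i"] by (simp flip: filter_append)
    hence "length (L e i) \<le> length (L e n)" by (simp add: L_def)
    thus ?thesis using length_ordl[of "Suc e"] L0 by simp
  qed
  define I1 where "I1 e s \<longleftrightarrow> holds (s ''ord'') (ordl e) \<and> s ''k'' 0 = int (length (ordl e))"
    for e and s :: state
  define I2 where "I2 e i s \<longleftrightarrow> holds (s ''ord'') (L e i) \<and> s ''k'' 0 = int (length (L e i)) \<and> s ''e'' 0 = int e"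
    for e i and s :: state
  let ?b = "If (Equal (Cell ''deg'' (Var ''i'')) (Var ''e''))
         (seqs [Assign ''ord'' (Var ''k'') (Var ''i''), Put ''k'' (Plus (Var ''k'') (Const 1))]) Skip"
  have sn: "small (int n)" "small (int n + 1)" using r_ge by (auto intro!: small_nat small_Suc)
  have "wp (For ''e'' ''n1'' (For ''i'' ''n'' ?b)) s1 (450 * ((n + 2) * (n + 2))) (\<lambda>s. holds (s ''ord'') ord)"
    if s1: "s1 ''n1'' 0 = int n + 1" "s1 ''k'' 0 = 0" and
      fr: "\<And>z. z \<notin> {''n1'', ''k''} \<Longrightarrow> s1 z = s z" for s1
  proof (rule wp_For[where I = I1 and N = "n + 1" and Tb = "\<lambda>_. 300 * (n + 1)"])
    show "s1 ''n1'' 0 = int (n + 1)" using s1 by simp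
    show "small (int (n + 1))" using sn by (simp add: add.commute)
    show "I1 0 (store s1 ''e'' 0 0)" using s1 by (simp add: I1_def ordl_def holds_def)
    show "(\<Sum>k<n + 1. 300 * (n + 1)) + 100 * (n + 1 + 1) \<le> 450 * ((n + 2) * (n + 2))"
      by (simp add: algebra_simps)
  next
    fix e s2 assume e: "e < n + 1" and I: "I1 e s2" "s2 ''e'' 0 = int e"
      and fr2: "\<And>z. z \<notin> insert ''e'' (wr (For ''i'' ''n'' ?b)) \<Longrightarrow> s2 z = s1 z"
    have n: "s2 ''n'' 0 = int n" using fr2[of "''n''"] fr[of "''n''"] inputsD[OF assms(1)] by simp
    show "wp (For ''i'' ''n'' ?b) s2 (300 * (n + 1)) (\<lambda>s'. I1 (Suc e) (store s' ''e'' 0 (int (Suc e))))"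
    proof (rule wp_For_W[where I = "I2 e" and N = n])
      show "s2 ''n'' 0 = int n" by (rule n)
      show "small (int n)" by (rule sn)
      show "I2 e 0 (store s2 ''i'' 0 0)" using I by (auto simp: I1_def I2_def L0)
      show "csize ?b * 7 * n + 100 * (n + 1) \<le> 300 * (n + 1)" by simp
    next
      fix i s3 assume i: "i < n" and I3: "I2 e i s3" "s3 ''i'' 0 = int i"
        and fr3: "\<And>z. z \<notin> insert ''i'' (wr ?b) \<Longrightarrow> s3 z = s2 z"
      have dg: "s3 ''deg'' i = int (dgr i)"
        using fr3[of "''deg''"] fr2[of "''deg''"] fr[of "''deg''"] assms(2) i by simp
      have k: "s3 ''k'' 0 = int (length (L e i))" "s3 ''e'' 0 = int e" using I3 by (simp_all add: I2_def)
      have "dgr i \<le> n" using card_upto_le by (simp add: dgr_def)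
      hence sm: "small (int i)" "small (int e)" "small (int (dgr i))" "small (int (length (L e i)))"
        "small (int (length (L e i)) + 1)"
        using i e r_ge len[of i e] by (auto intro!: small_nat small_Suc)
      show "sl addr small small ?b s3 (\<lambda>s'. I2 e (Suc i) (store s' ''i'' 0 (int (Suc i))))"
        using I3 dg k sm by (auto simp: addr_int I2_def LS intro!: holds_snoc)
    next
      fix s3 assume "I2 e n s3"
      thus "I1 (Suc e) (store s3 ''e'' 0 (int (Suc e)))" by (simp add: I1_def I2_def L0)
    qed simp_all
  next
    fix s2 assume "I1 (n + 1) s2"
    thus "holds (s2 ''ord'') ord" by (simp add: I1_def ord_def)
  qed simp_all
  note loop = this
  show ?thesis unfolding p_ord_def
  proof (rule wp_Seq_sl[OF md_W, where R = "\<lambda>s'. s' ''n1'' 0 = int n + 1 \<and> s' ''k'' 0 = 0"])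
    show "sl addr small small (Seq (Put ''n1'' (Plus (Var ''n'') (Const 1))) (Put ''k'' (Const 0))) s
      (\<lambda>s'. s' ''n1'' 0 = int n + 1 \<and> s' ''k'' 0 = 0)"
      using inputsD[OF assms(1)] sn by simp
  next
    fix s' assume R: "s' ''n1'' 0 = int n + 1 \<and> s' ''k'' 0 = 0"
      and fr: "\<And>z. z \<notin> wr (Seq (Put ''n1'' (Plus (Var ''n'') (Const 1))) (Put ''k'' (Const 0))) \<Longrightarrow> s' z = s z"
    show "wp (For ''e'' ''n1'' (For ''i'' ''n'' ?b)) s' (450 * ((n + 2) * (n + 2))) (\<lambda>s. holds (s ''ord'') ord)"
      by (rule loop) (use R fr in auto)
  qed simp
qed

end

section \<open>Common denominator, residues and integer codes of the bounds\<close>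

definition p_bnd :: com where
  "p_bnd = Seq
    (For ''i'' ''n'' (seqs
      [Assign ''num'' (Var ''i'') (Cell ''lb_num'' (Var ''i'')),
       Assign ''den'' (Var ''i'') (Cell ''lb_den'' (Var ''i'')),
       Put ''j'' (Plus (Var ''n'') (Var ''i'')),
       Assign ''num'' (Var ''j'') (Cell ''ub_num'' (Var ''i'')),
       Assign ''den'' (Var ''j'') (Cell ''ub_den'' (Var ''i''))]))
    (Seq (seqs
      [Put ''j'' (Plus (Var ''n'') (Var ''n'')),
       Assign ''num'' (Var ''j'') (Const 0),
       Assign ''den'' (Var ''j'') (Const 1),
       Put ''N'' (Plus (Var ''j'') (Const 1)),
       Put ''Q'' (Const 1)])
    (For ''i'' ''N'' (If (Equal (Cell ''den'' (Var ''i'')) (Const 0)) (Assign ''den'' (Var ''i'') (Const 1)) Skip)))"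

definition p_Q :: com where
  "p_Q = For ''i'' ''N'' (Put ''Q'' (Times (Var ''Q'') (Cell ''den'' (Var ''i''))))"

definition p_res :: com where
  "p_res = For ''i'' ''N'' (seqs
    [Put ''t'' (Times (Cell ''num'' (Var ''i'')) (Div (Var ''Q'') (Cell ''den'' (Var ''i'')))),
     Assign ''A'' (Var ''i'') (Div (Var ''t'') (Var ''Q'')),
     Assign ''f'' (Var ''i'') (Mod (Var ''t'') (Var ''Q''))])"

text \<open>The array \<open>S\<close> holds indices sorted by their residues, so long numbers are
  only compared and never moved.\<close>

definition b_search :: com where
  "b_search = Seq (Put ''mid'' (Div (Plus (Var ''lo'') (Var ''hi'')) (Const 2)))
      (If (Less (Cell ''f'' (Cell ''S'' (Var ''mid''))) (Cell ''f'' (Var ''i'')))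
         (Put ''lo'' (Plus (Var ''mid'') (Const 1)))
         (Put ''hi'' (Var ''mid'')))"

definition p_search :: com where
  "p_search = Seq (Seq (Put ''lo'' (Const 0)) (Put ''hi'' (Var ''d'')))
    (While (Less (Var ''lo'') (Var ''hi'')) b_search)"

text \<open>The tail is shifted from its end downwards, so that no entry is overwritten before it
  has been copied.\<close>

definition p_insert :: com where
  "p_insert = Seq (Put ''len'' (Minus (Var ''d'') (Var ''lo'')))
    (Seq (For ''j'' ''len'' (Assign ''S'' (Minus (Var ''d'') (Var ''j''))
        (Cell ''S'' (Minus (Minus (Var ''d'') (Var ''j'')) (Const 1)))))
    (Seq (Assign ''S'' (Var ''lo'') (Var ''i'')) (Put ''d'' (Plus (Var ''d'') (Const 1)))))"

text \<open>Insertion sort that skips a residue already present: the search returns the first entry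
  that is not smaller, so one equality test decides.\<close>

definition p_sort :: com where
  "p_sort = Seq (Put ''d'' (Const 0)) (For ''i'' ''N'' (Seq p_search
    (Seq (seqs [Put ''found'' (Const 0),
      If (Less (Var ''lo'') (Var ''d''))
        (If (Equal (Cell ''f'' (Cell ''S'' (Var ''lo''))) (Cell ''f'' (Var ''i'')))
          (Put ''found'' (Const 1)) Skip) Skip])
     (If (Equal (Var ''found'') (Const 0)) p_insert Skip))))"

definition p_rank :: com where
  "p_rank = For ''i'' ''N'' (Seq p_search (Assign ''rk'' (Var ''i'') (Var ''lo'')))"

text \<open>\<open>E\<close> starts \<open>M + 1\<close> to the left of the substitute lower bound
  \<open>L0\<close>, as if a component placed there had just ended; the first component then needs
  no special treatment.\<close>

definition p_code :: com where
  "p_code = Seq (seqs [Put ''E0'' (Const 0), Put ''n1'' (Plus (Var ''n'') (Const 1)), Put ''M'' (Times (Var ''n1'') (Var ''d''))])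
    (Seq (For ''i'' ''n'' (If (Less (Cell ''A'' (Plus (Var ''n'') (Var ''i''))) (Var ''E0''))
        (Put ''E0'' (Cell ''A'' (Plus (Var ''n'') (Var ''i'')))) Skip))
    (Seq (seqs [Put ''E0'' (Minus (Var ''E0'') (Plus (Var ''n'') (Plus (Var ''n'') (Var ''n'')))),
        Put ''L0'' (Times (Var ''E0'') (Var ''M'')),
        Put ''E'' (Minus (Minus (Var ''L0'') (Var ''M'')) (Const 1))])
    (For ''i'' ''n'' (seqs
      [If (Equal (Cell ''lb_den'' (Var ''i'')) (Const 0))
         (Assign ''LC'' (Var ''i'') (Var ''L0''))
         (Assign ''LC'' (Var ''i'')
           (Times (Plus (Times (Cell ''A'' (Var ''i'')) (Var ''d'')) (Cell ''rk'' (Var ''i''))) (Var ''n1''))),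
       Put ''j'' (Plus (Var ''n'') (Var ''i'')),
       Assign ''UC'' (Var ''i'')
         (Times (Plus (Times (Cell ''A'' (Var ''j'')) (Var ''d'')) (Cell ''rk'' (Var ''j''))) (Var ''n1''))]))))"

context prun
begin

definition rden :: "nat \<Rightarrow> int" where "rden i = bound_den (bnd i)"

lemma num_l: "v < n \<Longrightarrow> num v = bound_num (lbounds I ! v)"
  and num_u: "v < n \<Longrightarrow> num (n + v) = bound_num (ubounds I ! v)"
  and rden_l: "v < n \<Longrightarrow> rden v = bound_den (lbounds I ! v)"
  and rden_u: "v < n \<Longrightarrow> rden (n + v) = bound_den (ubounds I ! v)"
  and num_last: "num (n + n) = 0" and rden_last: "rden (n + n) = 1"
  by (simp_all add: num_def rden_def bnd_def bound_num_def bound_den_def)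

lemma den_rden: "den i = (if rden i = 0 then 1 else rden i)"
  by (simp add: den_def rden_def)

lemma den_last: "den (n + n) = 1"
  by (simp add: den_rden rden_last)

definition input_names :: "string set" where
  "input_names = {''n'', ''m'', ''edge_u'', ''edge_v'', ''lb_num'', ''lb_den'', ''ub_num'', ''ub_den'', ''comp''}"

lemma set_encode: "set (map fst (encode I)) = input_names"
  by (simp add: encode_def input_names_def)

lemma inputs_frame:
  "inputs s \<Longrightarrow> (\<And>z. z \<notin> X \<Longrightarrow> s' z = s z) \<Longrightarrow> X \<inter> input_names = {} \<Longrightarrow> inputs s'"
  by (erule inputs_cong, subst (asm) set_encode) blast

text \<open>Numerators and denominators are counted separately because a scaled numerator multiplies
  one of the former with denominators; only the sum of both counts is bounded by
  \<open>r\<close>.\<close>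

definition bits_num where "bits_num = (\<Sum>i<2 * n. nbits (bound_num (bnd i)))"
definition bits_den where "bits_den = (\<Sum>i<2 * n. nbits (bound_den (bnd i)))"

lemma sum_bnd: "(\<Sum>i<2 * n. (h (bnd i) :: nat)) = (\<Sum>b\<leftarrow>lbounds I. h b) + (\<Sum>b\<leftarrow>ubounds I. h b)"
proof -
  have "(\<Sum>i<2 * n. h (bnd i)) = (\<Sum>i<n. h (bnd i)) + (\<Sum>i<n. h (bnd (n + i)))"
    using sum.atLeastLessThan_concat[of 0 n "2 * n" "\<lambda>i. h (bnd i)"] sum.shift_bounds_nat_ivl[of "\<lambda>i. h (bnd i)" 0 n n]
    by (simp add: lessThan_atLeast0 mult_2 add.commute)
  moreover have "(\<Sum>i<n. h (bnd i)) = (\<Sum>b\<leftarrow>lbounds I. h b)"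
    using len_bounds by (simp add: sum_list_sum_nth lessThan_atLeast0 bnd_def)
  moreover have "(\<Sum>i<n. h (bnd (n + i))) = (\<Sum>b\<leftarrow>ubounds I. h b)"
    using len_bounds by (simp add: sum_list_sum_nth lessThan_atLeast0 bnd_def)
  ultimately show ?thesis by simp
qed

lemma bits_le: "bits_num + bits_den \<le> r"
  using sum_bnd[of "\<lambda>b. nbits (bound_num b)"] sum_bnd[of "\<lambda>b. nbits (bound_den b)"]
  unfolding bits_num_def bits_den_def input_size_def encode_def by (simp add: comp_def)

lemma bits_num_le: "bits_num \<le> r" and bits_den_le: "bits_den \<le> r"
  using bits_le by simp_all

lemma for_time: "c + 100 \<le> K \<Longrightarrow> 1 \<le> u \<Longrightarrow> c * u * N + 100 * (N + 1) \<le> K * u * (N + (1::nat))"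
proof -
  assume c: "c + 100 \<le> K" and u: "1 \<le> u"
  have "c * u * N \<le> c * u * (N + 1)" by simp
  moreover have "100 * (N + 1) \<le> 100 * u * (N + 1)" using u by (intro mult_le_mono1) simp
  moreover have "(c + 100) * u * (N + 1) \<le> K * u * (N + 1)" using c by (intro mult_le_mono) auto
  moreover have "(c + 100) * u * (N + 1) = c * u * (N + 1) + 100 * u * (N + 1)" by (simp only: add_mult_distrib)
  ultimately show ?thesis by linarith
qed

lemma abs_nbits: "\<bar>a\<bar> < 2 ^ nbits a"
proof -
  have "nat \<bar>a\<bar> < 2 ^ floorlog 2 (nat \<bar>a\<bar>)" by (rule floorlog_leD) simp_all
  also have "\<dots> \<le> 2 ^ nbits a" by (intro power_increasing) (simp_all add: nbits_def)
  finally show ?thesis by (simp add: nat_less_iff)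
qed

lemma den_bits: "i < 2 * n \<Longrightarrow> den i \<le> 2 ^ nbits (bound_den (bnd i))"
  using abs_nbits[of "bound_den (bnd i)"] abs_ge_self[of "bound_den (bnd i)"] unfolding den_def
  by (auto intro: less_imp_le order_le_less_trans)

text \<open>Bit lengths add under multiplication, so the product of all denominators is no longer
  than their joint encoding. This is why a plain product serves as common denominator.\<close>

lemma Q_bits: "Q \<le> 2 ^ bits_den"
proof -
  have "Q = (\<Prod>i<2 * n. den i)" using den_last by (simp add: Q_def mult_2)
  also have "\<dots> \<le> (\<Prod>i<2 * n. 2 ^ nbits (bound_den (bnd i)))"
    by (intro prod_mono) (use den_bits den_pos in \<open>force intro: less_imp_le\<close>)
  also have "\<dots> = 2 ^ bits_den" by (simp add: bits_den_def power_sum)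
  finally show ?thesis .
qed

lemma pow_mono: "a \<le> b \<Longrightarrow> (2::int) ^ a \<le> 2 ^ b"
  by (intro power_increasing) auto

lemma Q_le: "Q \<le> 2 ^ r"
  using Q_bits pow_mono[OF bits_den_le] by linarith

lemma num_le: assumes "i < 2 * n + 1" shows "\<bar>num i\<bar> \<le> 2 ^ bits_num"
proof (cases "i < 2 * n")
  case True
  have "nbits (num i) \<le> bits_num" unfolding bits_num_def num_def
    using True by (intro member_le_sum) auto
  thus ?thesis using abs_nbits[of "num i"] pow_mono[of "nbits (num i)" bits_num] by linarith
next
  case False
  hence "i = n + n" using assms by simp
  thus ?thesis by (simp add: num_last)
qed

lemma abs_mult_le: "\<bar>a\<bar> \<le> x \<Longrightarrow> \<bar>b\<bar> \<le> y \<Longrightarrow> \<bar>a * b\<bar> \<le> x * (y::int)"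
  unfolding abs_mult by (intro mult_mono) auto

lemma Qdiv_range: assumes "i < 2 * n + 1" shows "0 \<le> Q div den i" "Q div den i \<le> Q"
  using den_pos[OF assms] Q_pos zdiv_mono2[of Q 1 "den i"] by (simp_all add: pos_imp_zdiv_nonneg_iff)

lemma scaled_le: assumes "i < 2 * n + 1" shows "\<bar>scaled i\<bar> \<le> 2 ^ r"
proof -
  have "\<bar>Q div den i\<bar> \<le> 2 ^ bits_den" using Qdiv_range[OF assms] Q_bits by simp
  hence "\<bar>scaled i\<bar> \<le> 2 ^ bits_num * 2 ^ bits_den" unfolding scaled_def
    by (intro abs_mult_le num_le assms)
  also have "\<dots> = 2 ^ (bits_num + bits_den)" by (simp add: power_add)
  also have "\<dots> \<le> 2 ^ r" by (intro pow_mono bits_le)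
  finally show ?thesis .
qed

lemma abs_div_le: "(q::int) > 0 \<Longrightarrow> \<bar>a div q\<bar> \<le> \<bar>a\<bar>"
proof (cases "a \<ge> 0")
  case True
  assume "q > 0"
  thus ?thesis using True zdiv_mono2[of a 1 q] by (simp add: pos_imp_zdiv_nonneg_iff)
next
  case False
  assume q: "q > 0"
  have "a * q \<le> a * 1" using False q by (intro mult_left_mono_neg) auto
  hence "a * q div q \<le> a div q" using q by (intro zdiv_mono1) auto
  hence "a \<le> a div q" using q by simp
  moreover have "a div q < 0" using False q pos_imp_zdiv_neg_iff[of q a] by linarith
  ultimately show ?thesis using False by linarith
qed

lemma A_le: assumes "i < 2 * n + 1" shows "\<bar>A i\<bar> \<le> 2 ^ r"
  unfolding A_def using abs_div_le[OF Q_pos, of "scaled i"] scaled_le[OF assms] by linarith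

lemma bigI: "\<bar>a\<bar> \<le> 2 ^ k \<Longrightarrow> k < 10 * r \<Longrightarrow> big a"
  unfolding big_def using power_strict_increasing[of k "10 * r" "2::int"] by linarith

lemma r_pos: "0 < r" using r2 by simp

lemma big_r: "\<bar>a\<bar> \<le> 2 ^ r \<Longrightarrow> big a"
  by (rule bigI) (use r_pos in auto)

lemma big01 [simp]: "big 0" "big 1"
  by (rule small_big, simp)+

lemma num_big: "i < 2 * n + 1 \<Longrightarrow> big (num i)"
  using num_le[of i] pow_mono[OF bits_num_le] by (intro big_r) linarith

lemma den_le: "i < 2 * n + 1 \<Longrightarrow> den i \<le> Q"
  using den_dvd Q_pos by (simp add: zdvd_imp_le)

lemma den_big: "i < 2 * n + 1 \<Longrightarrow> big (den i)"
  using den_le[of i] den_pos[of i] Q_le by (intro big_r) auto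

lemma rden_big: "i < 2 * n + 1 \<Longrightarrow> big (rden i)"
  using den_big[of i] by (auto simp: den_rden split: if_splits)

lemma index_cases: "i < 2 * n + 1 \<Longrightarrow> i < n \<or> (\<exists>v<n. i = n + v) \<or> i = n + n"
  by (cases "i < n"; cases "i = n + n") (auto intro!: exI[of _ "i - n"])

definition bounds_ok :: "state \<Rightarrow> bool" where
  "bounds_ok s \<longleftrightarrow> (\<forall>i<2 * n + 1. s ''num'' i = num i \<and> s ''den'' i = den i) \<and> s ''N'' 0 = int (2 * n + 1)"

lemma p_bnd:
  assumes "inputs s"
  shows "wp p_bnd s (800 * G * (2 * n + 1 + 1)) (\<lambda>s. bounds_ok s \<and> s ''Q'' 0 = 1)"
proof -
  define J where "J k s \<longleftrightarrow> (\<forall>i<k. s ''num'' i = num i \<and> s ''den'' i = rden i \<and>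
    s ''num'' (n + i) = num (n + i) \<and> s ''den'' (n + i) = rden (n + i))" for k and s :: state
  define K where "K k s \<longleftrightarrow> (\<forall>i<2 * n + 1. s ''num'' i = num i \<and>
    s ''den'' i = (if i < k then den i else rden i)) \<and> s ''N'' 0 = int (2 * n + 1) \<and> s ''Q'' 0 = 1" for k and s :: state
  have G: "G \<ge> 1" by (simp add: G_def)
  have sn: "small (int n)" "small (int n + int n)" "small (int n + int n + 1)"
    using small_nat[of "n"] small_nat[of "n + n"] small_nat[of "n + n + 1"] r_ge by (simp_all add: add.commute)
  let ?b = "seqs
      [Assign ''num'' (Var ''i'') (Cell ''lb_num'' (Var ''i'')),
       Assign ''den'' (Var ''i'') (Cell ''lb_den'' (Var ''i'')),
       Put ''j'' (Plus (Var ''n'') (Var ''i'')),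
       Assign ''num'' (Var ''j'') (Cell ''ub_num'' (Var ''i'')),
       Assign ''den'' (Var ''j'') (Cell ''ub_den'' (Var ''i''))]"
  let ?c = "seqs
      [Put ''j'' (Plus (Var ''n'') (Var ''n'')),
       Assign ''num'' (Var ''j'') (Const 0),
       Assign ''den'' (Var ''j'') (Const 1),
       Put ''N'' (Plus (Var ''j'') (Const 1)),
       Put ''Q'' (Const 1)]"
  let ?e = "If (Equal (Cell ''den'' (Var ''i'')) (Const 0)) (Assign ''den'' (Var ''i'') (Const 1)) Skip"
  have loop: "wp (For ''i'' ''n'' ?b) s (300 * G * (n + 1)) (J n)"
  proof (rule wp_For_B[where I = J and N = n])
    show "s ''n'' 0 = int n" using inputsD[OF assms] by simp
    show "small (int n)" by (rule sn)
    show "J 0 (store s ''i'' 0 0)" by (simp add: J_def)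
    show "csize ?b * G * n + 100 * (n + 1) \<le> 300 * G * (n + 1)" by (rule for_time) (use G in simp_all)
  next
    fix k s1 assume k: "k < n" and J: "J k s1" and i: "s1 ''i'' 0 = int k" and nn: "s1 ''n'' 0 = int n"
      and fr: "\<And>z. z \<notin> insert ''i'' (wr ?b) \<Longrightarrow> s1 z = s z"
    have inp: "inputs s1" by (rule inputs_frame[OF assms], erule fr) (simp add: input_names_def)
    note e = inputsD(5-8)[OF inp k]
    have sm: "small (int k)" "small (int n + int k)" "nat (int n + int k) = n + k"
      using small_nat[of k] small_nat[of "n + k"] r_ge k by simp_all
    have bg: "big (bound_num (lbounds I ! k))" "big (bound_num (ubounds I ! k))"
      "big (bound_den (lbounds I ! k))" "big (bound_den (ubounds I ! k))"
      using num_big[of k] num_big[of "n + k"] num_l[OF k] num_u[OF k] k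
        rden_big[of k] rden_big[of "n + k"] rden_l[OF k] rden_u[OF k] by simp_all
    have step: "J (Suc k) s'" if "\<And>i. i \<noteq> k \<Longrightarrow> i \<noteq> n + k \<Longrightarrow> s' ''num'' i = s1 ''num'' i \<and> s' ''den'' i = s1 ''den'' i"
       "s' ''num'' k = num k" "s' ''den'' k = rden k" "s' ''num'' (n + k) = num (n + k)" "s' ''den'' (n + k) = rden (n + k)" for s'
      unfolding J_def
    proof (intro allI impI)
      fix i assume "i < Suc k"
      hence "i = k \<or> (i < k \<and> i \<noteq> k \<and> i \<noteq> n + k \<and> n + i \<noteq> k \<and> n + i \<noteq> n + k)" using k by linarith
      thus "s' ''num'' i = num i \<and> s' ''den'' i = rden i \<and> s' ''num'' (n + i) = num (n + i) \<and> s' ''den'' (n + i) = rden (n + i)"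
        using that(2-5) that(1)[of i] that(1)[of "n + i"] J unfolding J_def by metis
    qed
    have "n \<noteq> 0" using k by simp
    thus "sl addr big big ?b s1 (\<lambda>s'. J (Suc k) (store s' ''i'' 0 (int (Suc k))))"
      using i nn e sm bg small_big[OF sm(1)] small_big[OF sm(2)] small_big[OF sn(1)]
        num_l[OF k] num_u[OF k] rden_l[OF k] rden_u[OF k] by (simp add: addr_def step)
  qed simp_all
  show ?thesis unfolding p_bnd_def
  proof (rule wp_Seq[OF loop wp_Seq_sl[OF md_B, where R = "K 0"]])
    fix s1 assume J: "J n s1" and fr: "\<And>z. z \<notin> wr (For ''i'' ''n'' ?b) \<Longrightarrow> s1 z = s z"
    have nn: "s1 ''n'' 0 = int n" using fr[of "''n''"] inputsD[OF assms] by simp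
    have e: "nat (int n + int n) = n + n" by simp
    have "K 0 s'" if s': "s' ''num'' = (s1 ''num'')(n + n := 0)" "s' ''den'' = (s1 ''den'')(n + n := 1)"
      "s' ''N'' 0 = int n + int n + 1" "s' ''Q'' 0 = 1" for s'
    proof -
      have "s' ''num'' i = num i \<and> s' ''den'' i = rden i" if i: "i < 2 * n + 1" for i
      proof -
        consider "i < n" | v where "v < n" "i = n + v" | "i = n + n" using index_cases[OF i] by blast
        thus ?thesis
        proof cases
          case 1
          thus ?thesis using J s' unfolding J_def by simp
        next
          case 2
          thus ?thesis using J s' unfolding J_def by simp
        next
          case 3
          thus ?thesis using s' num_last rden_last by simp
        qed
      qed
      thus ?thesis using s' by (simp add: K_def)
    qed
    thus "sl addr big big ?c s1 (K 0)"
      using nn sn small_big[OF sn(1)] small_big[OF sn(2)] small_big[OF sn(3)] e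
      by (simp add: addr_def fun_eq_iff)
  next
    fix s2 assume K: "K 0 s2"
    show "wp (For ''i'' ''N'' ?e) s2 (200 * G * (2 * n + 1 + 1)) (\<lambda>s. bounds_ok s \<and> s ''Q'' 0 = 1)"
    proof (rule wp_For_B[where I = K and N = "2 * n + 1"])
      show "s2 ''N'' 0 = int (2 * n + 1)" using K by (simp add: K_def)
      show "small (int (2 * n + 1))" using r_ge by (intro small_nat) simp
      show "K 0 (store s2 ''i'' 0 0)" using K by (simp add: K_def)
      show "csize ?e * G * (2 * n + 1) + 100 * (2 * n + 1 + 1) \<le> 200 * G * (2 * n + 1 + 1)"
        by (rule for_time) (use G in simp_all)
    next
      fix k s3 assume k: "k < 2 * n + 1" and K: "K k s3" and i: "s3 ''i'' 0 = int k"
      have sm: "small (int k)" using small_nat[of k] r_ge k by simp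
      have dk: "s3 ''den'' k = rden k" using K k by (simp add: K_def)
      have step: "K (Suc k) s'" if "s' ''num'' = s3 ''num''" "s' ''N'' = s3 ''N''" "s' ''Q'' = s3 ''Q''"
        "s' ''den'' k = den k" "\<And>i. i \<noteq> k \<Longrightarrow> s' ''den'' i = s3 ''den'' i" for s'
        using that K unfolding K_def by (metis less_Suc_eq)
      show "sl addr big big ?e s3 (\<lambda>s'. K (Suc k) (store s' ''i'' 0 (int (Suc k))))"
        using i dk sm small_big[OF sm] rden_big[OF k] by (auto simp: addr_def den_rden intro!: step)
    qed (auto simp: K_def bounds_ok_def)
  next
    have "300 * G * (n + 1) \<le> 300 * G * (2 * n + 1 + 1)" "300 * G * 1 \<le> 300 * G * (2 * n + 1 + 1)"
      by (intro mult_le_mono2, simp)+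
    moreover have "csize ?c * G + 200 * G * (2 * n + 1 + 1) \<le> 300 * G * 1 + 200 * G * (2 * n + 1 + 1)" by simp
    ultimately show "300 * G * (n + 1) + (300 * G * 1 + 200 * G * (2 * n + 1 + 1)) \<le> 800 * G * (2 * n + 1 + 1)"
      by linarith
  qed simp_all
qed

lemma p_Q:
  assumes "bounds_ok s" "s ''Q'' 0 = 1"
  shows "wp p_Q s (150 * G * (2 * n + 1 + 1)) (\<lambda>s. s ''Q'' 0 = Q)"
proof -
  define J where "J k s \<longleftrightarrow> s ''Q'' 0 = (\<Prod>i<k. den i)" for k and s :: state
  have G: "G \<ge> 1" by (simp add: G_def)
  let ?b = "Put ''Q'' (Times (Var ''Q'') (Cell ''den'' (Var ''i'')))"
  \<comment> \<open>A partial product divides \<open>Q\<close>, so no intermediate value is longer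
    than the result.\<close>
  have part: "0 < (\<Prod>i<k. den i) \<and> (\<Prod>i<k. den i) \<le> Q" if "k \<le> 2 * n + 1" for k
  proof
    show pos: "0 < (\<Prod>i<k. den i)" using den_pos that by (intro prod_pos) auto
    have "(\<Prod>i<k. den i) dvd Q" unfolding Q_def using that by (intro prod_dvd_prod_subset) auto
    thus "(\<Prod>i<k. den i) \<le> Q" using Q_pos by (intro zdvd_imp_le)
  qed
  show ?thesis unfolding p_Q_def
  proof (rule wp_For_B[where I = J and N = "2 * n + 1"])
    show "s ''N'' 0 = int (2 * n + 1)" using assms by (simp add: bounds_ok_def)
    show "small (int (2 * n + 1))" using r_ge by (intro small_nat) simp
    show "J 0 (store s ''i'' 0 0)" using assms by (simp add: J_def)
    show "csize ?b * G * (2 * n + 1) + 100 * (2 * n + 1 + 1) \<le> 150 * G * (2 * n + 1 + 1)"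
      by (rule for_time) (use G in simp_all)
  next
    fix k s1 assume k: "k < 2 * n + 1" and J: "J k s1" and i: "s1 ''i'' 0 = int k"
      and fr: "\<And>z. z \<notin> insert ''i'' (wr ?b) \<Longrightarrow> s1 z = s z"
    have d: "s1 ''den'' k = den k" using fr[of "''den''"] assms k by (simp add: bounds_ok_def)
    have sm: "small (int k)" using small_nat[of k] r_ge k by simp
    have "big (\<Prod>i<k. den i)" "big (\<Prod>i<Suc k. den i)"
      using part[of k] part[of "Suc k"] k Q_le by (auto intro!: big_r simp del: prod.lessThan_Suc)
    thus "sl addr big big ?b s1 (\<lambda>s'. J (Suc k) (store s' ''i'' 0 (int (Suc k))))"
      using J i d sm small_big[OF sm] den_big[OF k] by (simp add: J_def addr_def)
  qed (auto simp: J_def Q_def)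
qed

lemma p_res:
  assumes "bounds_ok s" "s ''Q'' 0 = Q"
  shows "wp p_res s (200 * G * (2 * n + 1 + 1)) (\<lambda>s. \<forall>i<2 * n + 1. s ''A'' i = A i \<and> s ''f'' i = f i)"
proof -
  define J where "J k s \<longleftrightarrow> (\<forall>i<k. s ''A'' i = A i \<and> s ''f'' i = f i)" for k and s :: state
  have G: "G \<ge> 1" by (simp add: G_def)
  let ?b = "seqs
    [Put ''t'' (Times (Cell ''num'' (Var ''i'')) (Div (Var ''Q'') (Cell ''den'' (Var ''i'')))),
     Assign ''A'' (Var ''i'') (Div (Var ''t'') (Var ''Q'')),
     Assign ''f'' (Var ''i'') (Mod (Var ''t'') (Var ''Q''))]"
  show ?thesis unfolding p_res_def
  proof (rule wp_For_B[where I = J and N = "2 * n + 1"])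
    show "s ''N'' 0 = int (2 * n + 1)" using assms by (simp add: bounds_ok_def)
    show "small (int (2 * n + 1))" using r_ge by (intro small_nat) simp
    show "J 0 (store s ''i'' 0 0)" by (simp add: J_def)
    show "csize ?b * G * (2 * n + 1) + 100 * (2 * n + 1 + 1) \<le> 200 * G * (2 * n + 1 + 1)"
      by (rule for_time) (use G in simp_all)
  next
    fix k s1 assume k: "k < 2 * n + 1" and J: "J k s1" and i: "s1 ''i'' 0 = int k"
      and fr: "\<And>z. z \<notin> insert ''i'' (wr ?b) \<Longrightarrow> s1 z = s z"
    have d: "s1 ''den'' k = den k" "s1 ''num'' k = num k" "s1 ''Q'' 0 = Q"
      using fr[of "''den''"] fr[of "''num''"] fr[of "''Q''"] assms k by (simp_all add: bounds_ok_def)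
    have sm: "small (int k)" using small_nat[of k] r_ge k by simp
    have bg: "big (num k * (Q div den k))" "big (Q div den k)" "big (scaled k div Q)" "big (scaled k mod Q)" "big Q"
      using scaled_le[OF k] Qdiv_range[OF k] Q_le A_le[OF k] Q_pos
        pos_mod_bound[OF Q_pos, of "scaled k"] pos_mod_sign[OF Q_pos, of "scaled k"]
      by (auto intro!: big_r simp: scaled_def A_def f_def)
    show "sl addr big big ?b s1 (\<lambda>s'. J (Suc k) (store s' ''i'' 0 (int (Suc k))))"
      using J i d sm small_big[OF sm] den_big[OF k] num_big[OF k] bg den_pos[OF k] Q_pos
      by (auto simp: J_def addr_def less_Suc_eq A_def f_def scaled_def)
  qed (auto simp: J_def)
qed

definition search_post :: "nat list \<Rightarrow> nat \<Rightarrow> state \<Rightarrow> bool" where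
  "search_post L i s \<longleftrightarrow> (\<exists>p\<le>length L. s ''lo'' 0 = int p \<and> (\<forall>a<p. f (L ! a) < f i) \<and>
     (\<forall>a<length L. p \<le> a \<longrightarrow> f i \<le> f (L ! a)))"

lemma big_f: "big (f i)"
  using f_range[of i] Q_le by (intro big_r) auto

text \<open>The logarithm in the number of comparisons cancels against the block length in the price
  of one comparison.\<close>

lemma search_time: "(floorlog 2 r + 1) * H \<le> 24 * r"
proof -
  let ?l = "floorlog 2 r"
  have "?l * (11 * r div ?l) \<le> 11 * r" by simp
  moreover have "?l * H = ?l * (11 * r div ?l) + ?l" by (simp add: H_def)
  ultimately have "?l * H \<le> 12 * r" using floorlog_le by linarith
  moreover have "1 * H \<le> ?l * H" by (intro mult_le_mono1 floorlog_pos)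
  ultimately show ?thesis unfolding add_mult_distrib by linarith
qed

text \<open>The loop is charged at the price \<open>H\<close> through \<open>md_C\<close>: the only
  division is that of a word by 2. With price \<open>G\<close> every search would cost a factor log
  r too much.\<close>

lemma p_search:
  assumes L: "holds (s ''S'') L" "s ''d'' 0 = int (length L)" "sorted_wrt (\<lambda>a b. f a < f b) L"
      "\<forall>a\<in>set L. a < 2 * n + 1" "length L \<le> 2 * n + 1"
    and i: "s ''i'' 0 = int i" "i < 2 * n + 1"
    and f: "\<forall>j<2 * n + 1. s ''f'' j = f j"
  shows "wp p_search s (1000 * r) (search_post L i)"
proof -
  define J where "J j s \<longleftrightarrow> (\<exists>lo hi. lo \<le> hi \<and> hi \<le> length L \<and> s ''lo'' 0 = int lo \<and> s ''hi'' 0 = int hi \<and>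
    hi - lo < 2 ^ j \<and> (\<forall>a<lo. f (L ! a) < f i) \<and> (\<forall>a<length L. hi \<le> a \<longrightarrow> f i \<le> f (L ! a)))"
    for j and s :: state
  have sm: "small (int a)" if "a \<le> 5 * n + 2" for a using that r_ge by (intro small_nat) simp
  have bg: "big (int a)" if "a \<le> 5 * n + 2" for a using sm[OF that] by (rule small_big)
  have H1: "H \<ge> 1" by (simp add: H_def)
  have "wp (While (Less (Var ''lo'') (Var ''hi'')) b_search) s1 (40 * 24 * r) (search_post L i)"
    if s1: "s1 ''lo'' 0 = 0" "s1 ''hi'' 0 = int (length L)" and fr: "\<And>z. z \<notin> {''lo'', ''hi''} \<Longrightarrow> s1 z = s z" for s1
  proof (rule wp_While[where I = J and j = "floorlog 2 r" and P = big and M = small and u = H and Tb = "\<lambda>_. 34 * H"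
        and st = s1])
    show "md big small H" by (rule md_C)
    have "length L < 2 ^ floorlog 2 r" using assms(5) r_ge r_less_floorlog by linarith
    thus "J (floorlog 2 r) s1" using s1 by (auto simp: J_def)
    \<comment> \<open>The body is allowed 34 charges and the guard takes 6, which makes 40 per
      iteration.\<close>
    show "(\<Sum>i<floorlog 2 r. 34 * H) + bsize (Less (Var ''lo'') (Var ''hi'')) * H * (floorlog 2 r + 1) \<le> 40 * 24 * r"
      using search_time by (simp add: algebra_simps)
  next
    fix j s2 assume "J j s2"
    then obtain lo hi where "lo \<le> hi" "hi \<le> length L" "s2 ''lo'' 0 = int lo" "s2 ''hi'' 0 = int hi"
      by (auto simp: J_def)
    thus "badm addr big small (Less (Var ''lo'') (Var ''hi'')) s2"
      using assms(5) by (auto intro!: bg)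
  next
    fix j s2 assume "J j s2" and b: "bval (Less (Var ''lo'') (Var ''hi'')) s2"
      and fr2: "\<And>z. z \<notin> wr b_search \<Longrightarrow> s2 z = s1 z"
    then obtain lo hi where h: "lo < hi" "hi \<le> length L" "s2 ''lo'' 0 = int lo" "s2 ''hi'' 0 = int hi"
      "hi - lo < 2 ^ j" "\<forall>a<lo. f (L ! a) < f i" "\<forall>a<length L. hi \<le> a \<longrightarrow> f i \<le> f (L ! a)"
      by (auto simp: J_def)
    obtain j' where j: "j = Suc j'" using h(1,5) by (cases j) auto
    define mid where "mid = (lo + hi) div 2"
    have m: "lo \<le> mid" "mid < hi" using h(1) by (auto simp: mid_def)
    have mid: "(int lo + int hi) div 2 = int mid" by (simp add: mid_def)
    have w: "''f'' \<notin> wr b_search" "''S'' \<notin> wr b_search" "''i'' \<notin> wr b_search" by (simp_all add: b_search_def)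
    have S: "s2 ''S'' mid = int (L ! mid)" "L ! mid < 2 * n + 1"
      using fr2[OF w(2)] fr[of "''S''"] holds_nth[OF L(1)] m h L(4) nth_mem[of mid L] by auto
    have ff: "s2 ''f'' (L ! mid) = f (L ! mid)" "s2 ''f'' i = f i" "s2 ''i'' 0 = int i"
      using fr2[OF w(1)] fr2[OF w(3)] fr[of "''f''"] fr[of "''i''"] f i S by auto
    have small_m: "small (int mid)" "small (int mid + 1)" "small (int i)" "small (int (L ! mid))" "small (int lo + int hi)" "small 2"
      using sm[of mid] sm[of "Suc mid"] sm[of i] sm[of "L ! mid"] sm[of "lo + hi"] m h assms(5) i S sm[of 2] 
      by (simp_all add: add.commute)
    have low: "f (L ! a) < f i" if "f (L ! mid) < f i" "a < Suc mid" for a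
    proof (cases "a = mid")
      case False
      hence "f (L ! a) < f (L ! mid)" using L(3) that m h by (auto simp: sorted_wrt_iff_nth_less)
      thus ?thesis using that by simp
    qed (use that in simp)
    have high: "f i \<le> f (L ! a)" if "\<not> f (L ! mid) < f i" "mid \<le> a" "a < length L" for a
    proof (cases "a = mid")
      case False
      hence "f (L ! mid) < f (L ! a)" using L(3) that by (auto simp: sorted_wrt_iff_nth_less)
      thus ?thesis using that by simp
    qed (use that in simp)
    \<comment> \<open>Strictness in \<open>hi - lo < 2 ^ j\<close> makes both halves fall below the
      next smaller power.\<close>
    have sz: "hi - Suc mid < 2 ^ j'" "mid - lo < 2 ^ j'" using h(1,5) unfolding j mid_def by auto
    have J1: "J j' (store (store s2 ''mid'' 0 (int mid)) ''lo'' 0 (int mid + 1))" if "f (L ! mid) < f i"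
      unfolding J_def using h m sz low[OF that]
      by (intro exI[of _ "Suc mid"] exI[of _ hi]) auto
    have J2: "J j' (store (store s2 ''mid'' 0 (int mid)) ''hi'' 0 (int mid))" if "\<not> f (L ! mid) < f i"
      unfolding J_def using h m sz high[OF that]
      by (intro exI[of _ lo] exI[of _ mid]) auto
    have "sl addr big small b_search s2 (J j')" unfolding b_search_def
      using h(3,4) mid S ff small_m J1 J2 bg[of lo] bg[of hi] h(1,2) assms(5)
        small_big[OF small_m(1)] small_big[OF small_m(2)] small_big[OF small_m(3)] small_big[OF small_m(4)]
        small_big[OF small_m(5)] small_big[OF small_m(6)] big_f
      by (simp add: addr_def)
    from wp_sl[OF md_C this] have "wp b_search s2 (34 * H) (J j')"
      by (rule wp_mono) (simp_all add: b_search_def)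
    thus "\<exists>i. j = Suc i \<and> wp b_search s2 (34 * H) (J i)" using j by blast
  next
    fix j s2 assume "J j s2" "\<not> bval (Less (Var ''lo'') (Var ''hi'')) s2"
    then obtain lo where "lo \<le> length L" "s2 ''lo'' 0 = int lo" "\<forall>a<lo. f (L ! a) < f i"
      "\<forall>a<length L. lo \<le> a \<longrightarrow> f i \<le> f (L ! a)" unfolding J_def by auto
    thus "search_post L i s2" unfolding search_post_def by blast
  qed simp_all
  note loop = this
  show ?thesis unfolding p_search_def
  proof (rule wp_Seq_sl[OF md_W, where R = "\<lambda>s1. s1 ''lo'' 0 = 0 \<and> s1 ''hi'' 0 = int (length L)"])
    show "sl addr small small (Seq (Put ''lo'' (Const 0)) (Put ''hi'' (Var ''d''))) s
      (\<lambda>s1. s1 ''lo'' 0 = 0 \<and> s1 ''hi'' 0 = int (length L))"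
      using L(2,5) sm[of "length L"] by simp
    fix s' assume R: "s' ''lo'' 0 = 0 \<and> s' ''hi'' 0 = int (length L)"
      and fr: "\<And>z. z \<notin> wr (Seq (Put ''lo'' (Const 0)) (Put ''hi'' (Var ''d''))) \<Longrightarrow> s' z = s z"
    show "wp (While (Less (Var ''lo'') (Var ''hi'')) b_search) s' (40 * 24 * r) (search_post L i)"
      by (rule loop) (use R fr in auto)
  next
    show "csize (Seq (Put ''lo'' (Const 0)) (Put ''hi'' (Var ''d''))) * 7 + 40 * 24 * r \<le> 1000 * r"
      using r2 by simp
  qed
qed

lemma small_le: "a \<le> 5 * n + 2 \<Longrightarrow> small (int a)"
  using r_ge by (intro small_nat) simp

lemma p_insert:
  assumes L: "holds (s ''S'') L" "s ''d'' 0 = int (length L)" "\<forall>a\<in>set L. a < 2 * n + 1" "length L \<le> 2 * n"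
    and p: "s ''lo'' 0 = int p" "p \<le> length L" and i: "s ''i'' 0 = int i" "i < 2 * n + 1"
  shows "wp p_insert s (1000 * r) (\<lambda>s'. holds (s' ''S'') (take p L @ i # drop p L) \<and> s' ''d'' 0 = int (length L) + 1)"
proof -
  let ?n = "length L - p"
  \<comment> \<open>After \<open>j\<close> moves, the positions above \<open>length L - j\<close>
    hold their former left neighbours and the position at that border holds a stale copy.\<close>
  define J where "J j s' \<longleftrightarrow> (\<forall>a\<le>length L. s' ''S'' a = (if length L - j < a then s ''S'' (a - 1) else s ''S'' a))"
    for j and s' :: state
  let ?b = "Assign ''S'' (Minus (Var ''d'') (Var ''j'')) (Cell ''S'' (Minus (Minus (Var ''d'') (Var ''j'')) (Const 1)))"
  have Ssm: "small (s ''S'' a)" if "a < length L" for a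
  proof -
    have "L ! a < 2 * n + 1" using L(3) nth_mem[OF that] by blast
    thus ?thesis using holds_nth[OF L(1) that] small_le[of "L ! a"] by simp
  qed
  have dp: "int (length L) - int p = int ?n" using p by simp
  have smd: "small (int (length L))" "small (int p)" "small (int ?n)" "small (int i)" "small (int (length L) + 1)"
    using small_le[of "length L"] small_le[of p] small_le[of ?n] small_le[of i] small_le[of "length L + 1"] L(4) p(2) i(2)
    by (simp_all add: add.commute)
  have loop: "wp (For ''j'' ''len'' ?b) s1 (700 * r) (J ?n)"
    if len: "s1 ''len'' 0 = int ?n" and fr: "\<And>z. z \<notin> {''len''} \<Longrightarrow> s1 z = s z" for s1
  proof (rule wp_For_W[where I = J and N = ?n])
    show "s1 ''len'' 0 = int ?n" by (rule len)
    show "small (int ?n)" by (rule smd)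
    show "J 0 (store s1 ''j'' 0 0)" using fr[of "''S''"] by (simp add: J_def)
    have "csize ?b * 7 * ?n + 100 * (?n + 1) \<le> 300 * (?n + 1)" by simp
    also have "\<dots> \<le> 300 * r" using L(4) r_ge by simp
    finally show "csize ?b * 7 * ?n + 100 * (?n + 1) \<le> 700 * r" by linarith
  next
    fix j s2 assume j: "j < ?n" and J: "J j s2" and jj: "s2 ''j'' 0 = int j"
      and fr2: "\<And>z. z \<notin> insert ''j'' (wr ?b) \<Longrightarrow> s2 z = s1 z"
    define q where "q = length L - j"
    have q: "int (length L) - int j = int q" "int q - 1 = int (q - 1)" "q - 1 < length L" "q \<le> length L" "q \<noteq> 0"
      using j p by (auto simp: q_def)
    have d: "s2 ''d'' 0 = int (length L)" using fr2[of "''d''"] fr[of "''d''"] L(2) by simp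
    have Sq: "s2 ''S'' (q - 1) = s ''S'' (q - 1)" using J q unfolding J_def q_def by auto
    have sm: "small (int j)" "small (int q)" "small (int (q - 1))"
      using small_le[of j] small_le[of q] small_le[of "q - 1"] q(3,4) j L(4) by auto
    have step: "J (Suc j) s'" if that: "s' ''S'' q = s ''S'' (q - 1)" "\<And>a. a \<noteq> q \<Longrightarrow> s' ''S'' a = s2 ''S'' a" for s'
      unfolding J_def
    proof (intro allI impI)
      fix a assume a: "a \<le> length L"
      consider "a = q" | "a < q" | "q < a" by linarith
      thus "s' ''S'' a = (if length L - Suc j < a then s ''S'' (a - 1) else s ''S'' a)"
      proof cases
        case 1
        moreover have "length L - Suc j < q" using j unfolding q_def by linarith
        ultimately show ?thesis using that(1) by simp
      next
        case 2
        hence "\<not> length L - Suc j < a" "\<not> length L - j < a" "a \<noteq> q" using j unfolding q_def by auto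
        thus ?thesis using that(2)[of a] J a unfolding J_def by simp
      next
        case 3
        hence "length L - Suc j < a" "length L - j < a" "a \<noteq> q" using j unfolding q_def by auto
        thus ?thesis using that(2)[of a] J a unfolding J_def by simp
      qed
    qed
    define z where "z = int (length L) - int j"
    have z: "nat z = q" "nat (z - 1) = q - 1" "0 \<le> z" "1 \<le> z" "small z" "small (z - 1)"
    proof -
      have e: "z = int q" "z - 1 = int (q - 1)" using q(1,2) by (simp_all only: z_def)
      show "nat z = q" "0 \<le> z" "small z" using e(1) sm by simp_all
      show "nat (z - 1) = q - 1" "small (z - 1)" unfolding e(2) using sm by simp_all
      show "1 \<le> z" using e(1) q(5) by simp
    qed
    have "J (Suc j) (store (store s2 ''S'' q (s2 ''S'' (q - 1))) ''j'' 0 (int (Suc j)))"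
      using Sq by (intro step) auto
    moreover have "aval (Minus (Var ''d'') (Var ''j'')) s2 = z" using d jj by (simp add: z_def)
    ultimately show "sl addr small small ?b s2 (\<lambda>s'. J (Suc j) (store s' ''j'' 0 (int (Suc j))))"
      using d jj z Sq sm smd Ssm[OF q(3)] by (simp add: addr_def z_def[symmetric])
  qed simp_all
  show ?thesis unfolding p_insert_def
  proof (rule wp_Seq_sl[OF md_W, where R = "\<lambda>s1. s1 ''len'' 0 = int ?n"])
    show "sl addr small small (Put ''len'' (Minus (Var ''d'') (Var ''lo''))) s (\<lambda>s1. s1 ''len'' 0 = int ?n)"
    proof -
      have "small (int (length L) - int p)" unfolding dp by (rule smd)
      thus ?thesis using L(2) p smd(1,2) by (simp add: of_nat_diff)
    qed
    fix s1 assume len: "s1 ''len'' 0 = int ?n"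
      and fr1: "\<And>z. z \<notin> wr (Put ''len'' (Minus (Var ''d'') (Var ''lo''))) \<Longrightarrow> s1 z = s z"
    have fr: "s1 z = s z" if "z \<notin> {''len''}" for z using fr1[of z] that by simp
    show "wp (Seq (For ''j'' ''len'' ?b) (Seq (Assign ''S'' (Var ''lo'') (Var ''i'')) (Put ''d'' (Plus (Var ''d'') (Const 1)))))
      s1 (800 * r) (\<lambda>s'. holds (s' ''S'') (take p L @ i # drop p L) \<and> s' ''d'' 0 = int (length L) + 1)"
    proof (rule wp_Seq[OF loop[OF len fr] wp_sl[OF md_W]])
      fix s2 assume J: "J ?n s2" and fr2: "\<And>z. z \<notin> wr (For ''j'' ''len'' ?b) \<Longrightarrow> s2 z = s1 z"
      have e: "s2 ''d'' 0 = int (length L)" "s2 ''lo'' 0 = int p" "s2 ''i'' 0 = int i"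
        using fr2[of "''d''"] fr2[of "''lo''"] fr2[of "''i''"] fr[of "''d''"] fr[of "''lo''"] fr[of "''i''"] L p i by simp_all
      have fin: "holds ((s2 ''S'')(p := int i)) (take p L @ i # drop p L)"
        unfolding holds_def
      proof (intro allI impI)
        fix a assume "a < length (take p L @ i # drop p L)"
        hence a: "a \<le> length L" using p by simp
        have pn: "length L - ?n = p" using p by simp
        consider "a = p" | "a < p" | "p < a" by linarith
        thus "((s2 ''S'')(p := int i)) a = int ((take p L @ i # drop p L) ! a)"
        proof cases
          case 1
          thus ?thesis using p by (simp add: nth_append)
        next
          case 2
          thus ?thesis using p J a pn holds_nth[OF L(1), of a] unfolding J_def by (simp add: nth_append)
        next
          case 3
          hence "((s2 ''S'')(p := int i)) a = int (L ! (a - 1))"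
            using p J a pn holds_nth[OF L(1), of "a - 1"] unfolding J_def by simp
          moreover have "(take p L @ i # drop p L) ! a = L ! (a - 1)"
          proof -
            obtain b where b: "a = p + Suc b" using 3 less_imp_Suc_add by auto
            thus ?thesis using p a by (simp add: nth_append)
          qed
          ultimately show ?thesis by simp
        qed
      qed
      show "sl addr small small (Seq (Assign ''S'' (Var ''lo'') (Var ''i'')) (Put ''d'' (Plus (Var ''d'') (Const 1)))) s2
        (\<lambda>s'. holds (s' ''S'') (take p L @ i # drop p L) \<and> s' ''d'' 0 = int (length L) + 1)"
        using e smd by (simp add: addr_def fin)
    next
      show "700 * r + csize (Seq (Assign ''S'' (Var ''lo'') (Var ''i'')) (Put ''d'' (Plus (Var ''d'') (Const 1)))) * 7 \<le> 800 * r"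
        using r2 by simp
    qed simp
  next
    show "csize (Put ''len'' (Minus (Var ''d'') (Var ''lo''))) * 7 + 800 * r \<le> 1000 * r" using r2 by simp
  qed
qed

text \<open>Strict sortedness and equality of the images say that \<open>L\<close> contains exactly
  one index for each distinct residue seen so far.\<close>

definition sorted_idx :: "nat list \<Rightarrow> nat \<Rightarrow> bool" where
  "sorted_idx L i \<longleftrightarrow> sorted_wrt (\<lambda>a b. f a < f b) L \<and> set L \<subseteq> {..<i} \<and> f ` set L = f ` {..<i} \<and> length L \<le> i"

definition residues_ok :: "state \<Rightarrow> bool" where
  "residues_ok s \<longleftrightarrow> (\<forall>i<2 * n + 1. s ''A'' i = A i \<and> s ''f'' i = f i)"

lemma H_r: "H \<le> 12 * r"
  using H_le r2 by simp

text \<open>Each of the \<open>2 * n + 1\<close> residues costs O(r) for the search and O(n) word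
  moves for the insertion, so the sort takes O(n * r).\<close>

lemma p_sort:
  assumes f: "residues_ok s" and N: "s ''N'' 0 = int (2 * n + 1)"
  shows "wp p_sort s (4000 * r * (2 * n + 2))
    (\<lambda>s. \<exists>L. holds (s ''S'') L \<and> s ''d'' 0 = int (length L) \<and> sorted_idx L (2 * n + 1))"
proof -
  define K where "K i s \<longleftrightarrow> (\<exists>L. holds (s ''S'') L \<and> s ''d'' 0 = int (length L) \<and> sorted_idx L i)"
    for i and s :: state
  let ?flag = "seqs [Put ''found'' (Const 0),
      If (Less (Var ''lo'') (Var ''d''))
        (If (Equal (Cell ''f'' (Cell ''S'' (Var ''lo''))) (Cell ''f'' (Var ''i'')))
          (Put ''found'' (Const 1)) Skip) Skip]"
  let ?ins = "If (Equal (Var ''found'') (Const 0)) p_insert Skip"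
  let ?body = "Seq p_search (Seq ?flag ?ins)"
  have wrs: "wr p_search = {''lo'', ''hi'', ''mid''}" "wr p_insert = {''len'', ''j'', ''S'', ''d''}"
    by (auto simp: p_search_def b_search_def p_insert_def)
  have loop: "wp (For ''i'' ''N'' ?body) s1 (3500 * r * (2 * n + 2)) (K (2 * n + 1))"
    if d0: "s1 ''d'' 0 = 0" and fr: "\<And>z. z \<notin> {''d''} \<Longrightarrow> s1 z = s z" for s1
  proof (rule wp_For[where I = K and N = "2 * n + 1" and Tb = "\<lambda>_. 3000 * r"])
    show "''i'' \<notin> wr ?body" "''N'' \<notin> wr ?body" by (simp_all add: wrs)
    show "s1 ''N'' 0 = int (2 * n + 1)" using fr[of "''N''"] N by simp
    show "small (int (2 * n + 1))" by (rule small_le) simp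
    show "K 0 (store s1 ''i'' 0 0)" using d0 unfolding K_def
      by (intro exI[of _ "[]"]) (simp add: holds_def sorted_idx_def)
    have "100 * (2 * n + 1 + 1) \<le> 100 * r * (2 * n + 2)"
      by (rule mult_le_mono) (use r2 in simp_all)
    moreover have "3000 * r * (2 * n + 1) \<le> 3000 * r * (2 * n + 2)" by simp
    moreover have "3500 * r * (2 * n + 2) = 3000 * r * (2 * n + 2) + 500 * r * (2 * n + 2)" by simp
    moreover have "100 * r * (2 * n + 2) \<le> 500 * r * (2 * n + 2)" by simp
    ultimately have "3000 * r * (2 * n + 1) + 100 * (2 * n + 1 + 1) \<le> 3500 * r * (2 * n + 2)" by linarith
    thus "(\<Sum>k<2 * n + 1. 3000 * r) + 100 * (2 * n + 1 + 1) \<le> 3500 * r * (2 * n + 2)"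
      by (simp add: mult.commute)
  next
    fix i s2 assume i: "i < 2 * n + 1" and K: "K i s2" and ii: "s2 ''i'' 0 = int i"
      and fr2: "\<And>z. z \<notin> insert ''i'' (wr ?body) \<Longrightarrow> s2 z = s1 z"
    obtain L where L: "holds (s2 ''S'') L" "s2 ''d'' 0 = int (length L)" "sorted_idx L i" using K by (auto simp: K_def)
    have L': "sorted_wrt (\<lambda>a b. f a < f b) L" "\<forall>a\<in>set L. a < 2 * n + 1" "length L \<le> 2 * n"
      "f ` set L = f ` {..<i}" "set L \<subseteq> {..<i}" "length L \<le> i"
      using L(3) i by (auto simp: sorted_idx_def)
    have f2: "s2 ''f'' j = f j" if "j < 2 * n + 1" for j
      using fr2[of "''f''"] fr[of "''f''"] f that by (simp add: wrs residues_ok_def)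
    have search: "wp p_search s2 (1000 * r) (search_post L i)"
      using L L' i ii f2 by (intro p_search) auto
    show "wp ?body s2 (3000 * r) (\<lambda>s'. K (Suc i) (store s' ''i'' 0 (int (Suc i))))"
    proof (rule wp_Seq[OF search])
      fix s3 assume "search_post L i s3" and fr3: "\<And>z. z \<notin> wr p_search \<Longrightarrow> s3 z = s2 z"
      then obtain p where p: "p \<le> length L" "s3 ''lo'' 0 = int p" "\<And>a. a < p \<Longrightarrow> f (L ! a) < f i"
        "\<And>a. a < length L \<Longrightarrow> p \<le> a \<Longrightarrow> f i \<le> f (L ! a)"
        by (auto simp: search_post_def)
      define hit where "hit \<longleftrightarrow> p < length L \<and> f (L ! p) = f i"
      have e3: "s3 ''S'' = s2 ''S''" "s3 ''d'' 0 = int (length L)" "s3 ''i'' 0 = int i" "s3 ''f'' = s2 ''f''"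
        using fr3[of "''S''"] fr3[of "''d''"] fr3[of "''i''"] fr3[of "''f''"] L ii by (simp_all add: wrs)
      have sm: "small (int p)" "small (int (length L))" "small (int i)"
        using p i L' by (auto intro!: small_le)
      have Sp: "s2 ''S'' p = int (L ! p) \<and> small (int (L ! p)) \<and> s2 ''f'' (L ! p) = f (L ! p)" if "p < length L"
      proof -
        have "L ! p < 2 * n + 1" using L'(2) nth_mem[OF that] by blast
        thus ?thesis using holds_nth[OF L(1) that] f2[of "L ! p"] small_le[of "L ! p"] by simp
      qed
      have flag: "sl addr big small ?flag s3 (\<lambda>s'. s' ''found'' 0 = (if hit then 1 else 0))"
        using p(1,2) e3 sm Sp f2[OF i] big_f small_big[OF sm(1)] small_big[OF sm(2)] small_big[OF sm(3)]
        by (auto simp: addr_def hit_def small_big)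
      show "wp (Seq ?flag ?ins) s3 (2000 * r) (\<lambda>s'. K (Suc i) (store s' ''i'' 0 (int (Suc i))))"
      proof (rule wp_Seq_sl[OF md_C flag])
        fix s4 assume fd: "s4 ''found'' 0 = (if hit then 1 else 0)" and fr4: "\<And>z. z \<notin> wr ?flag \<Longrightarrow> s4 z = s3 z"
        have e4: "s4 ''S'' = s2 ''S''" "s4 ''d'' 0 = int (length L)" "s4 ''i'' 0 = int i" "s4 ''lo'' 0 = int p"
          using fr4[of "''S''"] fr4[of "''d''"] fr4[of "''i''"] fr4[of "''lo''"] e3 p by simp_all
        show "wp ?ins s4 (1100 * r) (\<lambda>s'. K (Suc i) (store s' ''i'' 0 (int (Suc i))))"
        proof (rule wp_If[OF md_W, where Tp = "1000 * r"])
          show "badm addr small small (Equal (Var ''found'') (Const 0)) s4" using fd by simp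
          show "bsize (Equal (Var ''found'') (Const 0)) * 7 + 1000 * r \<le> 1100 * r" using r2 by simp
        next
          assume "bval (Equal (Var ''found'') (Const 0)) s4"
          hence nh: "\<not> hit" using fd by (simp split: if_splits)
          have gt: "f i < f (L ! a)" if "a < length L" "p \<le> a" for a
          proof (cases "a = p")
            case True
            thus ?thesis using nh that p(4)[of a] by (simp add: hit_def)
          next
            case False
            hence "f (L ! p) < f (L ! a)" using L'(1) that by (auto simp: sorted_wrt_iff_nth_less)
            thus ?thesis using p(4)[of p] that by simp
          qed
          let ?L = "take p L @ i # drop p L"
          have "sorted_wrt (\<lambda>a b. f a < f b) (take p L)" "sorted_wrt (\<lambda>a b. f a < f b) (drop p L)"
            "\<forall>x\<in>set (take p L). \<forall>y\<in>set (drop p L). f x < f y"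
            using L'(1) sorted_wrt_append[of "\<lambda>a b. f a < f b" "take p L" "drop p L"] by simp_all
          moreover have "f x < f i" if "x \<in> set (take p L)" for x
            using that p by (auto simp: in_set_conv_nth)
          moreover have "f i < f x" if x: "x \<in> set (drop p L)" for x
          proof -
            obtain b where "b < length L - p" "x = L ! (p + b)" using x by (auto simp: in_set_conv_nth)
            thus ?thesis using gt[of "p + b"] by simp
          qed
          ultimately have so: "sorted_wrt (\<lambda>a b. f a < f b) ?L" by (auto simp: sorted_wrt_append)
          have st: "set ?L = insert i (set L)" 
            by (simp) (metis append_take_drop_id set_append)
          have "sorted_idx ?L (Suc i)" unfolding sorted_idx_def
          proof (intro conjI)
            show "set ?L \<subseteq> {..<Suc i}" using st L'(5) by auto
            have "f ` set ?L = insert (f i) (f ` {..<i})" unfolding st using L'(4) by simp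
            thus "f ` set ?L = f ` {..<Suc i}" by (simp add: lessThan_Suc)
            show "length ?L \<le> Suc i" using L'(6) by simp
          qed (rule so)
          moreover have "length ?L = length L + 1" using p(1) by simp
          ultimately have "K (Suc i) (store s' ''i'' 0 (int (Suc i)))"
            if "holds (s' ''S'') ?L \<and> s' ''d'' 0 = int (length L) + 1" for s'
            unfolding K_def using that by (intro exI[of _ ?L]) simp
          thus "wp p_insert s4 (1000 * r) (\<lambda>s'. K (Suc i) (store s' ''i'' 0 (int (Suc i))))"
            by (intro wp_mono[OF p_insert[of s4 L p i]]) (use e4 L L' p i in auto)
        next
          assume "\<not> bval (Equal (Var ''found'') (Const 0)) s4"
          hence hit: "p < length L" "f (L ! p) = f i" using fd by (simp_all add: hit_def split: if_splits)
          have "f i \<in> f ` {..<i}" using hit nth_mem[OF hit(1)] L'(4) by (metis image_eqI)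
          hence "f ` {..<Suc i} = f ` {..<i}" by (simp add: lessThan_Suc insert_absorb)
          hence "sorted_idx L (Suc i)" using L(3) by (auto simp: sorted_idx_def)
          hence "K (Suc i) (store s4 ''i'' 0 (int (Suc i)))" unfolding K_def
            using L e4 by (intro exI[of _ L]) simp
          thus "wp Skip s4 (1000 * r) (\<lambda>s'. K (Suc i) (store s' ''i'' 0 (int (Suc i))))"
            using r2 by (intro wp_Skip) simp_all
        qed
      next
        have "csize ?flag * H \<le> 70 * H" by simp
        also have "\<dots> \<le> 70 * (12 * r)" using H_r by (intro mult_le_mono2)
        finally show "csize ?flag * H + 1100 * r \<le> 2000 * r" by simp
      qed
    qed simp
  qed simp_all
  show ?thesis unfolding p_sort_def
  proof (rule wp_Seq_sl[OF md_W, where R = "\<lambda>s1. s1 ''d'' 0 = 0"])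
    show "sl addr small small (Put ''d'' (Const 0)) s (\<lambda>s1. s1 ''d'' 0 = 0)" by simp
    fix s1 assume d0: "s1 ''d'' 0 = 0" and fr1: "\<And>z. z \<notin> wr (Put ''d'' (Const 0)) \<Longrightarrow> s1 z = s z"
    have "wp (For ''i'' ''N'' ?body) s1 (3500 * r * (2 * n + 2)) (K (2 * n + 1))"
      by (rule loop) (use d0 fr1 in simp_all)
    thus "wp (For ''i'' ''N'' ?body) s1 (3500 * r * (2 * n + 2))
      (\<lambda>s. \<exists>L. holds (s ''S'') L \<and> s ''d'' 0 = int (length L) \<and> sorted_idx L (2 * n + 1))"
      by (simp add: K_def[abs_def])
  next
    have "21 \<le> 500 * r * (2 * n + 2)" using r2 by simp
    moreover have "4000 * r * (2 * n + 2) = 3500 * r * (2 * n + 2) + 500 * r * (2 * n + 2)" by simp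
    moreover have "csize (Put ''d'' (Const 0)) * 7 = 21" by simp
    ultimately show "csize (Put ''d'' (Const 0)) * 7 + 3500 * r * (2 * n + 2) \<le> 4000 * r * (2 * n + 2)" by linarith
  qed
qed

lemma p_rank:
  assumes f: "residues_ok s" and N: "s ''N'' 0 = int (2 * n + 1)"
    and L: "holds (s ''S'') L" "s ''d'' 0 = int (length L)" "sorted_idx L (2 * n + 1)"
  shows "wp p_rank s (4000 * r * (2 * n + 2)) (\<lambda>s. \<forall>i<2 * n + 1. \<exists>p<length L. s ''rk'' i = int p \<and> f (L ! p) = f i)"
proof -
  define K where "K i s \<longleftrightarrow> (\<forall>j<i. \<exists>p<length L. s ''rk'' j = int p \<and> f (L ! p) = f j)" for i and s :: state
  let ?asg = "Assign ''rk'' (Var ''i'') (Var ''lo'')"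
  let ?body = "Seq p_search ?asg"
  have wrs: "wr p_search = {''lo'', ''hi'', ''mid''}" by (auto simp: p_search_def b_search_def)
  have L': "sorted_wrt (\<lambda>a b. f a < f b) L" "\<forall>a\<in>set L. a < 2 * n + 1" "length L \<le> 2 * n + 1"
      "f ` set L = f ` {..<2 * n + 1}" using L(3) by (auto simp: sorted_idx_def)
  show ?thesis unfolding p_rank_def
  proof (rule wp_For[where I = K and N = "2 * n + 1" and Tb = "\<lambda>_. 2000 * r"])
    show "''i'' \<notin> wr ?body" "''N'' \<notin> wr ?body" by (simp_all add: wrs)
    show "s ''N'' 0 = int (2 * n + 1)" by (rule N)
    show "small (int (2 * n + 1))" by (rule small_le) simp
    show "K 0 (store s ''i'' 0 0)" by (simp add: K_def)
    have "100 * (2 * n + 1 + 1) \<le> 100 * r * (2 * n + 2)"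
      by (rule mult_le_mono) (use r2 in simp_all)
    moreover have "2000 * r * (2 * n + 1) \<le> 2000 * r * (2 * n + 2)" by simp
    moreover have "4000 * r * (2 * n + 2) = 2000 * r * (2 * n + 2) + 2000 * r * (2 * n + 2)" by simp
    moreover have "100 * r * (2 * n + 2) \<le> 2000 * r * (2 * n + 2)" by simp
    ultimately have "2000 * r * (2 * n + 1) + 100 * (2 * n + 1 + 1) \<le> 4000 * r * (2 * n + 2)" by linarith
    thus "(\<Sum>k<2 * n + 1. 2000 * r) + 100 * (2 * n + 1 + 1) \<le> 4000 * r * (2 * n + 2)"
      by (simp add: mult.commute)
  next
    fix i s2 assume i: "i < 2 * n + 1" and K: "K i s2" and ii: "s2 ''i'' 0 = int i"
      and fr2: "\<And>z. z \<notin> insert ''i'' (wr ?body) \<Longrightarrow> s2 z = s z"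
    have f2: "s2 ''f'' j = f j" if "j < 2 * n + 1" for j
      using fr2[of "''f''"] f that by (simp add: wrs residues_ok_def)
    have L2: "holds (s2 ''S'') L" "s2 ''d'' 0 = int (length L)" using fr2[of "''S''"] fr2[of "''d''"] L by (simp_all add: wrs)
    have search: "wp p_search s2 (1000 * r) (search_post L i)"
      using L2 L' i ii f2 by (intro p_search) auto
    show "wp ?body s2 (2000 * r) (\<lambda>s'. K (Suc i) (store s' ''i'' 0 (int (Suc i))))"
    proof (rule wp_Seq[OF search wp_sl[OF md_W]])
      fix s3 assume "search_post L i s3" and fr3: "\<And>z. z \<notin> wr p_search \<Longrightarrow> s3 z = s2 z"
      then obtain p where p: "p \<le> length L" "s3 ''lo'' 0 = int p" "\<And>a. a < p \<Longrightarrow> f (L ! a) < f i"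
        "\<And>a. a < length L \<Longrightarrow> p \<le> a \<Longrightarrow> f i \<le> f (L ! a)"
        by (auto simp: search_post_def)
      have "f i \<in> f ` set L" unfolding L'(4) using i by blast
      then obtain b where "b \<in> set L" "f b = f i" by auto
      then obtain a where a: "a < length L" "f (L ! a) = f i" by (metis in_set_conv_nth)
      have "\<not> a < p" using p(3)[of a] a by auto
      hence "p \<le> a" by simp
      \<comment> \<open>The residue occurs in \<open>L\<close>, and strict sortedness makes its
        position the one at which the search stops.\<close>
      have pa: "p = a"
      proof (rule ccontr)
        assume "p \<noteq> a"
        hence "p < a" using \<open>p \<le> a\<close> by simp
        hence "f (L ! p) < f (L ! a)" using L'(1) a(1) unfolding sorted_wrt_iff_nth_less by blast
        moreover have "f i \<le> f (L ! p)" using p(4)[of p] \<open>p < a\<close> a by simp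
        ultimately show False using a by simp
      qed
      have e3: "s3 ''rk'' = s2 ''rk''" "s3 ''i'' 0 = int i" using fr3[of "''rk''"] fr3[of "''i''"] ii by (simp_all add: wrs)
      have sm: "small (int p)" "small (int i)" using p(1) i L'(3) by (auto intro!: small_le)
      have "K (Suc i) (store (store s3 ''rk'' i (int p)) ''i'' 0 (int (Suc i)))"
        unfolding K_def
      proof (intro allI impI)
        fix j assume "j < Suc i"
        hence "j = i \<or> (j < i \<and> j \<noteq> i)" by linarith
        thus "\<exists>q<length L. (store (store s3 ''rk'' i (int p)) ''i'' 0 (int (Suc i))) ''rk'' j = int q \<and> f (L ! q) = f j"
          using K e3 a pa unfolding K_def by auto
      qed
      thus "sl addr small small ?asg s3 (\<lambda>s'. K (Suc i) (store s' ''i'' 0 (int (Suc i))))"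
        using e3 p(2) sm by (simp add: addr_def)
    next
      show "1000 * r + csize ?asg * 7 \<le> 2000 * r" using r2 by simp
    qed
  next
    fix s2 assume "K (2 * n + 1) s2"
    thus "\<forall>i<2 * n + 1. \<exists>p<length L. s2 ''rk'' i = int p \<and> f (L ! p) = f i" by (simp add: K_def)
  qed simp_all
qed

text \<open>Residue 0 occurs by the artificial bound and no residue is negative, so the first entry
  of \<open>L\<close> has residue 0.\<close>

lemma ranked_intro:
  assumes L: "sorted_idx L (2 * n + 1)"
    and rk: "\<And>i. i < 2 * n + 1 \<Longrightarrow> rk i < length L \<and> f (L ! rk i) = f i"
    and E0: "\<And>v. v < n \<Longrightarrow> E0 + 3 * int n \<le> A (n + v)"
  shows "ranked I (length L) (\<lambda>\<rho>. f (L ! \<rho>)) rk E0"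
proof -
  have L': "sorted_wrt (\<lambda>a b. f a < f b) L" "f ` set L = f ` {..<2 * n + 1}" using L by (auto simp: sorted_idx_def)
  have "f (2 * n) \<in> f ` set L" unfolding L'(2) by (rule imageI) simp
  hence "0 \<in> f ` set L" by (simp only: f_last)
  then obtain b where "b \<in> set L" "f b = 0" by auto
  then obtain a where a: "a < length L" "f (L ! a) = 0" by (metis in_set_conv_nth)
  have "f (L ! 0) \<le> f (L ! a)"
  proof (cases "a = 0")
    case False
    hence "f (L ! 0) < f (L ! a)" using L'(1) a(1) unfolding sorted_wrt_iff_nth_less by blast
    thus ?thesis by simp
  qed simp
  hence 0: "f (L ! 0) = 0" using a f_range(1)[of "L ! 0"] by simp
  show ?thesis
    by unfold_locales (use a 0 Q_pos L'(1) f_range rk E0 in \<open>auto simp: sorted_wrt_iff_nth_less\<close>)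
qed

end

context inst
begin

primrec upper_min :: "nat \<Rightarrow> int" where
  "upper_min 0 = 0"
| "upper_min (Suc k) = min (upper_min k) (A (n + k))"

definition low :: int where "low = upper_min n - 3 * int n"

lemma upper_min_le: "v < k \<Longrightarrow> upper_min k \<le> A (n + v)"
  by (induction k) (auto simp: less_Suc_eq min.coboundedI1)

lemma low_le: "v < n \<Longrightarrow> low + 3 * int n \<le> A (n + v)"
  using upper_min_le[of v n] by (simp add: low_def)

end

locale pmain = prun I D + ranked I "length L" "\<lambda>\<rho>. inst.f I (L ! \<rho>)" rk "inst.low I" for I D L rk +
  assumes L_idx: "sorted_idx L (2 * nv I + 1)"
begin

lemma length_L: "1 \<le> length L" "length L \<le> 2 * n + 1"
  using L_idx d by (auto simp: sorted_idx_def)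

lemma L_bound: "\<rho> < length L \<Longrightarrow> L ! \<rho> < 2 * n + 1"
  using L_idx nth_mem[of \<rho> L] unfolding sorted_idx_def by blast

lemma M_nat: "M = int ((n + 1) * length L)"
  by (simp only: M_def of_nat_mult)

lemma M_le: "M \<le> int (r ^ 2)"
proof -
  have "(n + 1) * length L \<le> r * r" using length_L r_ge by (intro mult_mono) auto
  hence "int ((n + 1) * length L) \<le> int (r * r)" by (rule of_nat_mono)
  thus ?thesis unfolding M_nat by (simp add: power2_eq_square)
qed

lemma small_M: "small M"
  unfolding M_nat using length_L r_ge mult_mono[of "n + 1" r "length L" r] by (intro small_sq) (simp add: power2_eq_square)

lemma r_le_pow: "int r \<le> 2 ^ r"
proof -
  have "int r \<le> int (2 ^ r)" by (intro of_nat_mono less_imp_le less_exp)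
  thus ?thesis by simp
qed

lemma upper_min_abs: "k \<le> n \<Longrightarrow> \<bar>upper_min k\<bar> \<le> 2 ^ r"
proof (induction k)
  case (Suc k)
  thus ?case using A_le[of "n + k"] by (auto simp: min_def)
qed simp

lemma low_abs: "\<bar>low\<bar> \<le> 2 ^ (r + 1)"
proof -
  have "3 * n \<le> r" using r_ge by simp
  hence "3 * int n \<le> int r" by linarith
  moreover have "(2::int) ^ (r + 1) = 2 * 2 ^ r" by simp
  ultimately show ?thesis using upper_min_abs[OF order_refl] r_le_pow unfolding low_def by linarith
qed

lemma lowM_abs: "\<bar>low * M\<bar> \<le> 2 ^ (3 * r + 1)"
proof -
  have "\<bar>M\<bar> \<le> 2 ^ r * 2 ^ r"
    using M_le M_pos mult_mono[OF r_le_pow r_le_pow] by (simp add: power2_eq_square)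
  from abs_mult_le[OF low_abs this] show ?thesis by (simp add: power_add power_mult_distrib mult.commute numeral_3_eq_3)
qed

lemma code_parts:
  assumes "i < 2 * n + 1"
  shows "\<bar>A i * int (length L)\<bar> \<le> 2 ^ (2 * r)" "\<bar>A i * int (length L) + int (rk i)\<bar> \<le> 2 ^ (2 * r + 1)"
    "\<bar>code (A i) (rk i)\<bar> \<le> 2 ^ (3 * r + 1)" "rk i < length L"
proof -
  have d: "\<bar>int (length L)\<bar> \<le> 2 ^ r" "\<bar>int (n + 1)\<bar> \<le> 2 ^ r" using length_L r_ge r_le_pow by linarith+
  show rk: "rk i < length L" using rk[OF assms] by simp
  show 1: "\<bar>A i * int (length L)\<bar> \<le> 2 ^ (2 * r)"
    using abs_mult_le[OF A_le[OF assms] d(1)] by (simp add: power_add mult_2)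
  have "(2::int) ^ r \<le> 2 ^ (2 * r)" by (intro pow_mono) simp
  hence "\<bar>int (rk i)\<bar> \<le> 2 ^ (2 * r)" using rk d(1) by linarith
  moreover have "(2::int) ^ (2 * r + 1) = 2 * 2 ^ (2 * r)" by simp
  ultimately show 2: "\<bar>A i * int (length L) + int (rk i)\<bar> \<le> 2 ^ (2 * r + 1)" using 1 by linarith
  show "\<bar>code (A i) (rk i)\<bar> \<le> 2 ^ (3 * r + 1)"
  proof -
    have "(2::int) ^ (2 * r + 1) * 2 ^ r = 2 ^ (2 * r + 1 + r)" by (rule power_add[symmetric])
    also have "2 * r + 1 + r = 3 * r + 1" by simp
    finally show ?thesis unfolding code_def using abs_mult_le[OF 2 d(2)] by simp
  qed
qed

lemma LC_abs: "v < n \<Longrightarrow> \<bar>LC v\<bar> \<le> 2 ^ (3 * r + 1)"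
  using lowM_abs code_parts(3)[of v] by (simp add: LC_def)

lemma UC_abs: "v < n \<Longrightarrow> \<bar>UC v\<bar> \<le> 2 ^ (3 * r + 1)"
  using code_parts(3)[of "n + v"] by (simp add: UC_def)

lemma big4: "\<bar>a\<bar> \<le> 2 ^ (3 * r + 1) \<Longrightarrow> big a"
  by (rule bigI[where k = "3 * r + 1"]) (use r2 in auto)

lemma rden_lfin: "v < n \<Longrightarrow> bound_den (lbounds I ! v) = 0 \<longleftrightarrow> \<not> lfin v"
proof -
  assume v: "v < n"
  show ?thesis
  proof (cases "lbounds I ! v")
    case None
    thus ?thesis by (simp add: lfin_def bound_den_def)
  next
    case (Some pq)
    obtain p q where pq: "lbounds I ! v = Some (p, q)" using Some by (cases pq) auto
    hence "bnd v = Some (p, q)" using v by (simp add: bnd_def)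
    hence "q > 0" using bnd_den[of v p q] v by simp
    thus ?thesis using pq by (simp add: lfin_def bound_den_def)
  qed
qed

lemma rden_ufin: "v < n \<Longrightarrow> bound_den (ubounds I ! v) = 0 \<longleftrightarrow> \<not> ufin v"
proof -
  assume v: "v < n"
  show ?thesis
  proof (cases "ubounds I ! v")
    case None
    thus ?thesis by (simp add: ufin_def bound_den_def)
  next
    case (Some pq)
    obtain p q where pq: "ubounds I ! v = Some (p, q)" using Some by (cases pq) auto
    hence "bnd (n + v) = Some (p, q)" using v by (simp add: bnd_def)
    hence "q > 0" using bnd_den[of "n + v" p q] v by simp
    thus ?thesis using pq by (simp add: ufin_def bound_den_def)
  qed
qed

definition codes_ok :: "state \<Rightarrow> bool" where
  "codes_ok s \<longleftrightarrow> s ''n1'' 0 = int (n + 1) \<and> s ''M'' 0 = M \<and> (\<forall>v<n. s ''LC'' v = LC v \<and> s ''UC'' v = UC v)"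

lemma p_code:
  assumes inp: "inputs s" and res: "residues_ok s" and dd: "s ''d'' 0 = int (length L)"
    and rks: "\<forall>i<2 * n + 1. s ''rk'' i = int (rk i)"
  shows "wp p_code s (1500 * G * (n + 1)) (\<lambda>s. codes_ok s \<and> s ''E'' 0 = low * M - M - 1)"
proof -
  let ?a = "seqs [Put ''E0'' (Const 0), Put ''n1'' (Plus (Var ''n'') (Const 1)), Put ''M'' (Times (Var ''n1'') (Var ''d''))]"
  let ?min = "If (Less (Cell ''A'' (Plus (Var ''n'') (Var ''i''))) (Var ''E0''))
        (Put ''E0'' (Cell ''A'' (Plus (Var ''n'') (Var ''i'')))) Skip"
  let ?b = "seqs [Put ''E0'' (Minus (Var ''E0'') (Plus (Var ''n'') (Plus (Var ''n'') (Var ''n'')))),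
        Put ''L0'' (Times (Var ''E0'') (Var ''M'')),
        Put ''E'' (Minus (Minus (Var ''L0'') (Var ''M'')) (Const 1))]"
  let ?c = "seqs
      [If (Equal (Cell ''lb_den'' (Var ''i'')) (Const 0))
         (Assign ''LC'' (Var ''i'') (Var ''L0''))
         (Assign ''LC'' (Var ''i'')
           (Times (Plus (Times (Cell ''A'' (Var ''i'')) (Var ''d'')) (Cell ''rk'' (Var ''i''))) (Var ''n1''))),
       Put ''j'' (Plus (Var ''n'') (Var ''i'')),
       Assign ''UC'' (Var ''i'')
         (Times (Plus (Times (Cell ''A'' (Var ''j'')) (Var ''d'')) (Cell ''rk'' (Var ''j''))) (Var ''n1''))]"
  let ?R1 = "\<lambda>s. s ''E0'' 0 = 0 \<and> s ''n1'' 0 = int n + 1 \<and> s ''M'' 0 = M"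
  let ?R2 = "\<lambda>s. s ''E0'' 0 = upper_min n"
  let ?R3 = "\<lambda>s. s ''L0'' 0 = low * M \<and> s ''E'' 0 = low * M - M - 1"
  have G: "G \<ge> 1" by (simp add: G_def)
  have sn: "small (int n)" "small (int n + 1)" "small (int (length L))" "small (int n + int n)" "small (int n + (int n + int n))"
    using small_le[of n] small_le[of "n + 1"] small_le[of "length L"] small_le[of "n + n"] small_le[of "n + (n + n)"] length_L
    by (simp_all add: add.commute)
  have Meq: "(int n + 1) * int (length L) = M" by (simp add: M_def add.commute)
  have bM: "big M" by (rule small_big[OF small_M])
  have b1: "sl addr big big ?a s ?R1"
    using inputsD(1)[OF inp] dd sn small_big[OF sn(1)] small_big[OF sn(2)] small_big[OF sn(3)] bM Meq by simp
  have step1: "wp (For ''i'' ''n'' ?min) s1 (400 * G * (n + 1)) ?R2"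
    if R1: "?R1 s1" and fr: "\<And>z. z \<notin> wr ?a \<Longrightarrow> s1 z = s z" for s1
  proof (rule wp_For_B[where I = "\<lambda>k s. s ''E0'' 0 = upper_min k" and N = n])
    show "s1 ''n'' 0 = int n" using fr[of "''n''"] inputsD(1)[OF inp] by simp
    show "store s1 ''i'' 0 0 ''E0'' 0 = upper_min 0" using R1 by simp
    show "csize ?min * G * n + 100 * (n + 1) \<le> 400 * G * (n + 1)" by (rule for_time) (use G in simp_all)
  next
    fix k s2 assume k: "k < n" and E: "s2 ''E0'' 0 = upper_min k" and i: "s2 ''i'' 0 = int k" and nn: "s2 ''n'' 0 = int n"
      and fr2: "\<And>z. z \<notin> insert ''i'' (wr ?min) \<Longrightarrow> s2 z = s1 z"
    have a: "s2 ''A'' (n + k) = A (n + k)" using fr2[of "''A''"] fr[of "''A''"] res k by (simp add: residues_ok_def)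
    have sm: "small (int n + int k)" "small (int k)" "nat (int n + int k) = n + k" using small_le[of "n + k"] small_le[of k] k by simp_all
    have bg: "big (upper_min k)" "big (A (n + k))" using upper_min_abs[of k] A_le[of "n + k"] k by (auto intro: big_r)
    show "sl addr big big ?min s2 (\<lambda>s'. store s' ''i'' 0 (int (Suc k)) ''E0'' 0 = upper_min (Suc k))"
      using E i nn a sm bg small_big[OF sm(1)] small_big[OF sm(2)] small_big[OF sn(1)]
      by (simp add: addr_def min_def)
  qed (use sn in simp_all)
  have b3: "sl addr big big ?b s2 ?R3"
    if E: "s2 ''E0'' 0 = upper_min n" and nn: "s2 ''n'' 0 = int n" and M: "s2 ''M'' 0 = M" for s2
  proof -
    have e: "upper_min n - (int n + (int n + int n)) = low" by (simp add: low_def)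
    have p: "\<bar>low\<bar> \<le> 2 ^ (3 * r + 1)" "(2::int) ^ (3 * r + 1) + 2 * 2 ^ (3 * r + 1) \<le> 2 ^ (3 * r + 3)"
      "\<bar>M\<bar> + 1 \<le> 2 ^ (3 * r + 1)"
    proof -
      have "(2::int) ^ (r + 1) \<le> 2 ^ (3 * r + 1)" by (intro pow_mono) simp
      thus "\<bar>low\<bar> \<le> 2 ^ (3 * r + 1)" using low_abs by linarith
      show "(2::int) ^ (3 * r + 1) + 2 * 2 ^ (3 * r + 1) \<le> 2 ^ (3 * r + 3)" by (simp add: power_add)
      have "int (r\<^sup>2) \<le> 2 ^ r * 2 ^ r" using mult_mono[OF r_le_pow r_le_pow] by (simp add: power2_eq_square)
      also have "\<dots> = 2 ^ (2 * r)" by (simp add: power_add mult_2)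
      also have "\<dots> \<le> 2 ^ (3 * r)" by (intro pow_mono) simp
      finally have "M \<le> 2 ^ (3 * r)" using M_le by linarith
      moreover have "1 \<le> (2::int) ^ (3 * r)" by simp
      ultimately show "\<bar>M\<bar> + 1 \<le> 2 ^ (3 * r + 1)" using M_pos by simp
    qed
    have b: "big low" "big (low * M)" "big (low * M - M)" "big (low * M - M - 1)"
    proof -
      have "big a" if "\<bar>a\<bar> \<le> 2 ^ (3 * r + 3)" for a by (rule bigI[OF that]) (use r2 in simp)
      have z: "0 \<le> (2::int) ^ (3 * r + 1)" by simp
      show "big low" using p(1) by (rule big4)
      show "big (low * M)" using lowM_abs by (rule big4)
      show "big (low * M - M)" by (rule \<open>\<And>a. \<bar>a\<bar> \<le> 2 ^ (3 * r + 3) \<Longrightarrow> big a\<close>) (use p lowM_abs z in linarith)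
      show "big (low * M - M - 1)" by (rule \<open>\<And>a. \<bar>a\<bar> \<le> 2 ^ (3 * r + 3) \<Longrightarrow> big a\<close>) (use p lowM_abs z in linarith)
    qed
    have bE: "big (upper_min n)" using upper_min_abs[of n] by (auto intro: big_r)
    show ?thesis using E nn M e b bE bM small_big[OF sn(1)] small_big[OF sn(4)] small_big[OF sn(5)] by simp
  qed
  have step4: "wp (For ''i'' ''n'' ?c) s3 (500 * G * (n + 1)) (\<lambda>s. codes_ok s \<and> s ''E'' 0 = low * M - M - 1)"
    if R3: "?R3 s3" and e3: "s3 ''n'' 0 = int n" "s3 ''M'' 0 = M" "s3 ''n1'' 0 = int n + 1" "s3 ''A'' = s ''A''" "s3 ''rk'' = s ''rk''"
      "s3 ''d'' 0 = int (length L)" "s3 ''lb_den'' = s ''lb_den''" for s3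
  proof (rule wp_For_B[where I = "\<lambda>k s. \<forall>v<k. s ''LC'' v = LC v \<and> s ''UC'' v = UC v" and N = n])
    show "s3 ''n'' 0 = int n" by (rule e3)
    show "csize ?c * G * n + 100 * (n + 1) \<le> 500 * G * (n + 1)" by (rule for_time) (use G in simp_all)
  next
    fix k s4 assume k: "k < n" and J: "\<forall>v<k. s4 ''LC'' v = LC v \<and> s4 ''UC'' v = UC v"
      and i: "s4 ''i'' 0 = int k" and nn: "s4 ''n'' 0 = int n"
      and fr: "\<And>z. z \<notin> insert ''i'' (wr ?c) \<Longrightarrow> s4 z = s3 z"
    have e4: "s4 ''A'' k = A k" "s4 ''A'' (n + k) = A (n + k)" "s4 ''rk'' k = int (rk k)" "s4 ''rk'' (n + k) = int (rk (n + k))"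
      "s4 ''d'' 0 = int (length L)" "s4 ''n1'' 0 = int n + 1" "s4 ''L0'' 0 = low * M" "s4 ''lb_den'' k = bound_den (lbounds I ! k)"
      using fr[of "''A''"] fr[of "''rk''"] fr[of "''d''"] fr[of "''n1''"] fr[of "''L0''"] fr[of "''lb_den''"] e3 R3 res rks k inputsD(6)[OF inp k]
      by (simp_all add: residues_ok_def)
    have sm: "small (int n + int k)" "small (int k)" "nat (int n + int k) = n + k" "small (int (rk k))" "small (int (rk (n + k)))"
      using small_le[of "n + k"] small_le[of k] small_le[of "rk k"] small_le[of "rk (n + k)"] code_parts(4)[of k] code_parts(4)[of "n + k"] length_L k
      by simp_all
    have bp: "big a" if "\<bar>a\<bar> \<le> 2 ^ (2 * r + 1)" for a by (rule bigI[OF that]) (use r2 in simp)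
    have p2: "(2::int) ^ (2 * r) \<le> 2 ^ (2 * r + 1)" by (rule pow_mono) simp
    have bg: "big (A k)" "big (A (n + k))" "big (A k * int (length L))" "big (A (n + k) * int (length L))"
      "big (A k * int (length L) + int (rk k))" "big (A (n + k) * int (length L) + int (rk (n + k)))"
      "big (low * M)" "big (code (A k) (rk k))" "big (code (A (n + k)) (rk (n + k)))"
    proof -
      have kk: "k < 2 * n + 1" "n + k < 2 * n + 1" using k by simp_all
      show "big (A k)" by (rule big_r[OF A_le[OF kk(1)]])
      show "big (A (n + k))" by (rule big_r[OF A_le[OF kk(2)]])
      show "big (A k * int (length L))" by (rule bp[OF order_trans[OF code_parts(1)[OF kk(1)] p2]])
      show "big (A (n + k) * int (length L))" by (rule bp[OF order_trans[OF code_parts(1)[OF kk(2)] p2]])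
      show "big (A k * int (length L) + int (rk k))" by (rule bp[OF code_parts(2)[OF kk(1)]])
      show "big (A (n + k) * int (length L) + int (rk (n + k)))" by (rule bp[OF code_parts(2)[OF kk(2)]])
      show "big (low * M)" by (rule big4[OF lowM_abs])
      show "big (code (A k) (rk k))" by (rule big4[OF code_parts(3)[OF kk(1)]])
      show "big (code (A (n + k)) (rk (n + k)))" by (rule big4[OF code_parts(3)[OF kk(2)]])
    qed
    have ce: "(A i * int (length L) + int (rk i)) * (int n + 1) = code (A i) (rk i)" for i
      by (simp add: code_def add.commute)
    have fin: "\<forall>v<Suc k. s' ''LC'' v = LC v \<and> s' ''UC'' v = UC v"
      if "s' ''LC'' = (s4 ''LC'')(k := LC k)" "s' ''UC'' = (s4 ''UC'')(k := UC k)" for s'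
      using that J by (auto simp: less_Suc_eq)
    have bd: "big (bound_den (lbounds I ! k))" using rden_big[of k] rden_l[OF k] k by simp
    show "sl addr big big ?c s4 (\<lambda>s'. \<forall>v<Suc k. store s' ''i'' 0 (int (Suc k)) ''LC'' v = LC v \<and>
        store s' ''i'' 0 (int (Suc k)) ''UC'' v = UC v)"
      using i nn e4 sm bg bd J small_big[OF sm(1)] small_big[OF sm(2)] small_big[OF sm(4)] small_big[OF sm(5)]
        small_big[OF sn(1)] small_big[OF sn(2)] small_big[OF sn(3)] rden_lfin[OF k]
      by (auto simp: addr_def ce less_Suc_eq LC_def UC_def)
  next
    fix s4 assume J: "\<forall>v<n. s4 ''LC'' v = LC v \<and> s4 ''UC'' v = UC v"
      and fr: "\<And>z. z \<notin> insert ''i'' (wr ?c) \<Longrightarrow> s4 z = s3 z"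
    thus "codes_ok s4 \<and> s4 ''E'' 0 = low * M - M - 1"
      using fr[of "''n1''"] fr[of "''M''"] fr[of "''E''"] e3 R3 by (simp add: codes_ok_def)
  qed (use sn in simp_all)
  show ?thesis unfolding p_code_def
  proof (rule wp_Seq_sl[OF md_B b1])
    fix s1 assume R1: "?R1 s1" and fr: "\<And>z. z \<notin> wr ?a \<Longrightarrow> s1 z = s z"
    show "wp (Seq (For ''i'' ''n'' ?min) (Seq ?b (For ''i'' ''n'' ?c))) s1 (400 * G * (n + 1) + (100 * G * (n + 1) + 500 * G * (n + 1)))
      (\<lambda>s. codes_ok s \<and> s ''E'' 0 = low * M - M - 1)"
    proof (rule wp_Seq[OF step1[OF R1 fr]])
      fix s2 assume E: "?R2 s2" and fr2: "\<And>z. z \<notin> wr (For ''i'' ''n'' ?min) \<Longrightarrow> s2 z = s1 z"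
      have e2: "s2 ''n'' 0 = int n" "s2 ''M'' 0 = M" "s2 ''n1'' 0 = int n + 1" "s2 ''A'' = s ''A''" "s2 ''rk'' = s ''rk''"
        "s2 ''d'' 0 = int (length L)" "s2 ''lb_den'' = s ''lb_den''"
        using fr2[of "''n''"] fr2[of "''M''"] fr2[of "''n1''"] fr2[of "''A''"] fr2[of "''rk''"] fr2[of "''d''"] fr2[of "''lb_den''"]
          fr[of "''n''"] fr[of "''A''"] fr[of "''rk''"] fr[of "''d''"] fr[of "''lb_den''"] R1 inputsD(1)[OF inp] dd by simp_all
      have b3': "sl addr big big ?b s2 ?R3" by (rule b3) (use E e2 in simp_all)
      show "wp (Seq ?b (For ''i'' ''n'' ?c)) s2 (100 * G * (n + 1) + 500 * G * (n + 1)) (\<lambda>s. codes_ok s \<and> s ''E'' 0 = low * M - M - 1)"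
      proof (rule wp_Seq_sl[OF md_B b3'])
        fix s3 assume R3: "?R3 s3" and fr3: "\<And>z. z \<notin> wr ?b \<Longrightarrow> s3 z = s2 z"
        show "wp (For ''i'' ''n'' ?c) s3 (500 * G * (n + 1)) (\<lambda>s. codes_ok s \<and> s ''E'' 0 = low * M - M - 1)"
          by (rule step4) (use R3 e2 fr3[of "''n''"] fr3[of "''M''"] fr3[of "''n1''"] fr3[of "''A''"] fr3[of "''rk''"] fr3[of "''d''"] fr3[of "''lb_den''"] in simp_all)
      next
        have "csize ?b * G \<le> 100 * G * (n + 1)" by simp
        thus "csize ?b * G + 500 * G * (n + 1) \<le> 100 * G * (n + 1) + 500 * G * (n + 1)" by (rule add_right_mono)
      qed
    qed (assumption, rule order_refl)
  next
    have "csize ?a * G \<le> 100 * G * (n + 1)" by simp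
    moreover have "y \<le> 100 * x \<Longrightarrow> y + (400 * x + (100 * x + 500 * x)) \<le> 1500 * x" for x y :: nat by simp
    ultimately show "csize ?a * G + (400 * G * (n + 1) + (100 * G * (n + 1) + 500 * G * (n + 1))) \<le> 1500 * G * (n + 1)"
      unfolding mult.assoc by blast
  qed
qed

end

section \<open>The leftmost placement of one component\<close>

primrec last_adj :: "(nat \<Rightarrow> bool) \<Rightarrow> nat \<Rightarrow> nat" where
  "last_adj P 0 = 0"
| "last_adj P (Suc j) = (if P j then Suc j else last_adj P j)"

text \<open>Written as a scan from left to right, as the program performs it: the value equals the
  number of tested positions as long as there has been no hit, and stays at the first hit
  afterwards.\<close>

primrec first_adj :: "(nat \<Rightarrow> bool) \<Rightarrow> nat \<Rightarrow> nat" where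
  "first_adj P 0 = 0"
| "first_adj P (Suc j) = (if \<not> P j \<and> first_adj P j = j then Suc j else first_adj P j)"

lemma last_adj: "last_adj P k \<le> k" "j < k \<Longrightarrow> P j \<Longrightarrow> j < last_adj P k"
  "0 < last_adj P k \<Longrightarrow> P (last_adj P k - 1)"
  by (induction k) (auto simp: less_Suc_eq)

lemma first_adj: "first_adj P k \<le> k" "j < first_adj P k \<Longrightarrow> \<not> P j" "first_adj P k < k \<Longrightarrow> P (first_adj P k)"
  by (induction k) (auto simp: less_Suc_eq split: if_splits)

lemma first_adj_greater: "j < k \<Longrightarrow> (\<And>l. l \<le> j \<Longrightarrow> \<not> P l) \<Longrightarrow> j < first_adj P k"
  using first_adj(1,3)[of P k] by (metis le_less_linear less_le_trans)

context pmain
begin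

lemma conn_graph_comp:
  assumes "t < length Cs"
  shows "conn_graph (Cs ! t) ad ord dgr"
proof
  show "finite (Cs ! t)" using comp_finite assms .
  show "ad u u" for u by (rule ad_refl)
  show "ad u v \<Longrightarrow> ad v u" for u v by (rule ad_sym)
  show "conn_on (Cs ! t) ad" using comp_conn assms .
  show "distinct ord" by (rule distinct_ord)
  show "Cs ! t \<subseteq> set ord" using comp_sub[OF assms] set_ord by simp
  show "u \<in> Cs ! t \<Longrightarrow> v \<in> set ord \<Longrightarrow> ad u v \<Longrightarrow> v \<in> Cs ! t" for u v
    using comp_closed[OF assms, of u v] set_ord by simp
  show "dgr v = card {w \<in> Cs ! t. ad v w}" if v: "v \<in> Cs ! t" for v
  proof -
    have "{w. w < n \<and> ad v w} = {w \<in> Cs ! t. ad v w}"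
      using comp_closed[OF assms v] comp_sub[OF assms] by blast
    thus ?thesis by (simp add: dgr_def)
  qed
  show "sorted (map dgr ord)" by (rule sorted_ord)
qed

text \<open>Coordinates are taken relative to \<open>base\<close>, the largest lower bound in the
  component. Some vertex of any representation lies at \<open>base\<close> or to its right, and the
  component spans at most \<open>n * M\<close>, so no relative coordinate is below
  \<open>- n * M\<close>. Raising smaller lower bounds to \<open>c_init\<close> therefore loses
  nothing and bounds all coordinates; \<open>c_pre\<close> lies far enough below to start the prefix
  maxima.\<close>

definition c_init :: int where "c_init = - (int n + 2) * M"
definition c_pre :: int where "c_pre = - (int n + 4) * M"

definition first_nb :: "nat list \<Rightarrow> nat \<Rightarrow> nat" where
  "first_nb q i = first_adj (\<lambda>j. ad (q ! i) (q ! j)) (length q)"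
definition last_nb :: "nat list \<Rightarrow> nat \<Rightarrow> nat" where
  "last_nb q i = last_adj (\<lambda>j. ad (q ! i) (q ! j)) (length q)"

text \<open>\<open>E\<close> is the rightmost left endpoint placed so far. Being more than
  \<open>M\<close> to its right is the integer bound \<open>E + M + 1\<close>.\<close>

definition lb :: "int \<Rightarrow> nat \<Rightarrow> int" where "lb E v = max (LC v) (E + M + 1)"
definition base :: "int \<Rightarrow> nat list \<Rightarrow> int" where "base E q = prefix_max (E + M + 1) (\<lambda>i. lb E (q ! i)) (length q)"

definition x_init :: "int \<Rightarrow> int \<Rightarrow> nat list \<Rightarrow> nat \<Rightarrow> int" where
  "x_init E b q i = max (lb E (q ! i) - b) c_init"
definition x_rounds :: "int \<Rightarrow> int \<Rightarrow> nat list \<Rightarrow> nat \<Rightarrow> nat \<Rightarrow> int" where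
  "x_rounds E b q k = (relax c_pre M (first_nb q) (last_nb q) ^^ k) (x_init E b q)"
definition x_fin :: "int \<Rightarrow> int \<Rightarrow> nat list \<Rightarrow> nat \<Rightarrow> int" where
  "x_fin E b q = x_rounds E b q (length q)"

definition pairs_ok :: "nat list \<Rightarrow> (nat \<Rightarrow> int) \<Rightarrow> bool" where
  "pairs_ok q x \<longleftrightarrow> (\<forall>i<length q. \<forall>j<length q. ad (q ! i) (q ! j) \<longleftrightarrow> \<bar>x i - x j\<bar> \<le> M)"
definition upper_ok :: "int \<Rightarrow> nat list \<Rightarrow> (nat \<Rightarrow> int) \<Rightarrow> bool" where
  "upper_ok b q x \<longleftrightarrow> (\<forall>i<length q. ufin (q ! i) \<longrightarrow> b + x i \<le> UC (q ! i))"
definition x_max :: "nat list \<Rightarrow> (nat \<Rightarrow> int) \<Rightarrow> int" where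
  "x_max q x = prefix_max c_pre x (length q)"

text \<open>\<open>fits E C g\<close>: \<open>g\<close> represents the component \<open>C\<close> strictly to the right of position \<open>E\<close>.\<close>

definition fits :: "int \<Rightarrow> nat set \<Rightarrow> (nat \<Rightarrow> int) \<Rightarrow> bool" where
  "fits E C g \<longleftrightarrow> (\<forall>u\<in>C. \<forall>v\<in>C. ad u v \<longleftrightarrow> \<bar>g u - g v\<bar> \<le> M) \<and>
     (\<forall>v\<in>C. lb E v \<le> g v \<and> (ufin v \<longrightarrow> g v \<le> UC v))"

lemma M1: "M \<ge> 1" using M_pos by simp

lemma nM: "0 \<le> int n * M" using M1 by simp

lemma c_eq: "c_init = - (int n * M) - 2 * M" "c_pre = - (int n * M) - 4 * M"
  by (simp_all add: c_init_def c_pre_def algebra_simps)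

lemma nb_bounds: "first_nb q i \<le> length q" "last_nb q i \<le> length q"
  using first_adj(1) last_adj(1) by (simp_all add: first_nb_def last_nb_def)

lemma lb_le_base: "i < length q \<Longrightarrow> lb E (q ! i) \<le> base E q"
  unfolding base_def by (rule prefix_max_ge)

lemma x_init_le: "i < length q \<Longrightarrow> x_init E (base E q) q i \<le> 0"
proof -
  assume "i < length q"
  from lb_le_base[OF this, of E] have "lb E (q ! i) - base E q \<le> 0" by simp
  moreover have "c_init \<le> 0" using nM M1 c_eq by linarith
  ultimately show ?thesis by (simp add: x_init_def)
qed

lemma c_pre_le: "c_pre + M + 1 \<le> c_init" "c_pre \<le> 0"
  using M1 nM c_eq by linarith+

text \<open>Both orientations use the same \<open>base\<close>, so their results can be compared and
  it is computed only once.\<close>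

lemma base_perm: "set q = set q' \<Longrightarrow> base E q = base E q'"
proof -
  have le: "base E q \<le> base E q'" if qq: "set q \<subseteq> set q'" for q q'
    unfolding base_def prefix_max_le_iff
  proof (intro conjI allI impI)
    show "E + M + 1 \<le> prefix_max (E + M + 1) (\<lambda>i. lb E (q' ! i)) (length q')" by (rule prefix_max_ge_init)
    fix j assume "j < length q"
    hence "q ! j \<in> set q'" using nth_mem[of j q] qq by blast
    then obtain l where l: "l < length q'" "q' ! l = q ! j" by (metis in_set_conv_nth)
    show "lb E (q ! j) \<le> prefix_max (E + M + 1) (\<lambda>i. lb E (q' ! i)) (length q')"
      using prefix_max_ge[OF l(1), of "\<lambda>i. lb E (q' ! i)"] unfolding l(2) .
  qed
  assume "set q = set q'"
  thus "base E q = base E q'" using le[of q q'] le[of q' q] by simp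
qed

lemma x_rounds_bound:
  assumes "i < length q"
  shows "c_pre \<le> x_rounds E (base E q) q k i" "x_rounds E (base E q) q k i \<le> int k * (M + 1)"
proof -
  have "c_pre \<le> x_init E (base E q) q i \<and> x_init E (base E q) q i \<le> 0" if "i < length q" for i
    using x_init_le[OF that] c_pre_le M1 by (simp add: x_init_def)
  from relax_bound[of "length q" "last_nb q" "first_nb q" M c_pre 0 "x_init E (base E q) q" i k, OF _ _ c_pre_le(2) this assms]
  show "c_pre \<le> x_rounds E (base E q) q k i" "x_rounds E (base E q) q k i \<le> int k * (M + 1)"
    using nb_bounds M1 by (simp_all add: x_rounds_def)
qed

lemma x_fin_lb:
  assumes "i < length q"
  shows "lb E (q ! i) \<le> base E q + x_fin E (base E q) q i"
proof -
  have "x_init E (base E q) q i \<le> x_rounds E (base E q) q k i" for k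
    by (induction k) (auto simp: x_rounds_def relax_def le_max_iff_disj)
  from this[of "length q"] show ?thesis by (simp add: x_fin_def x_init_def)
qed

text \<open>The given representation, taken relative to \<open>base\<close>, satisfies all window
  constraints, so the least solution exists and lies below it in every coordinate. Hence it respects
  the upper bounds and ends no further right. It represents the component, since by the umbrella
  property the windows express all adjacencies and nonadjacencies.\<close>

lemma attempt_complete:
  assumes t: "t < length Cs" and q: "set q = Cs ! t" "distinct q"
    and so: "nonadj_sorted ad M g q" and um: "umbrella_free ad q" and g: "fits E (Cs ! t) g"
  defines "x \<equiv> x_fin E (base E q) q"
  shows "pairs_ok q x \<and> upper_ok (base E q) q x \<and> (\<exists>v\<in>Cs ! t. base E q + x_max q x \<le> g v)"
proof -
  let ?k = "length q" and ?b = "base E q"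
  define y where "y i = g (q ! i) - ?b" for i
  have mem: "q ! i \<in> Cs ! t" if "i < ?k" for i using that q(1) nth_mem by blast
  have k: "0 < ?k" using q(1) comp_nonempty[OF t] by auto
  have rep: "rep_on (Cs ! t) ad M g" using g M_pos by (simp add: fits_def rep_on_def)
  have glb: "lb E v \<le> g v" if "v \<in> Cs ! t" for v using g that by (simp add: fits_def)
  have b_le: "?b \<le> g v + int n * M" if v: "v \<in> Cs ! t" for v
  proof -
    have "\<exists>u\<in>Cs ! t. ?b \<le> g u"
      using prefix_max_attained[of "E + M + 1" "\<lambda>i. lb E (q ! i)" ?k]
    proof
      assume e: "prefix_max (E + M + 1) (\<lambda>i. lb E (q ! i)) ?k = E + M + 1"
      have "E + M + 1 \<le> lb E v" by (simp add: lb_def)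
      hence "E + M + 1 \<le> g v" using glb[OF v] by linarith
      thus ?thesis unfolding base_def e using v by blast
    next
      assume "\<exists>j<?k. prefix_max (E + M + 1) (\<lambda>i. lb E (q ! i)) ?k = lb E (q ! j)"
      then obtain j where j: "j < ?k" "prefix_max (E + M + 1) (\<lambda>i. lb E (q ! i)) ?k = lb E (q ! j)" by blast
      show ?thesis unfolding base_def j(2) using glb[OF mem[OF j(1)]] mem[OF j(1)] by blast
    qed
    then obtain u where u: "u \<in> Cs ! t" "?b \<le> g u" by blast
    have "g u \<le> g v + int (card (Cs ! t)) * M"
      by (rule rep_span[OF rep comp_conn[OF t] comp_finite[OF t] v u(1)])
    moreover have "int (card (Cs ! t)) * M \<le> int n * M"
      using comp_card_le[OF t] M1 by (intro mult_right_mono) auto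
    ultimately show ?thesis using u(2) by linarith
  qed
  have x0y: "x_init E ?b q i \<le> y i" if "i < ?k" for i
  proof -
    have "c_init \<le> y i" using b_le[OF mem[OF that]] M1 c_eq(1) unfolding y_def by linarith
    thus ?thesis using glb[OF mem[OF that]] by (simp add: x_init_def y_def)
  qed
  have lt: "y i + M < y j" if "i < j" "j < ?k" "\<not> ad (q ! i) (q ! j)" for i j
    using so that unfolding nonadj_sorted_def y_def by simp
  have near: "\<bar>y i - y j\<bar> \<le> M" if "i < ?k" "j < ?k" "ad (q ! i) (q ! j)" for i j
    using g mem[OF that(1)] mem[OF that(2)] that(3) by (simp add: fits_def y_def)
  \<comment> \<open>The window up to the last neighbour may contain nonneighbours of
    \<open>i\<close>. By the umbrella property these precede \<open>i\<close>, and then the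
    constraint holds because they lie even further left.\<close>
  have hi: "y j - M \<le> y i" if i: "i < ?k" and j: "j < last_nb q i" for i j
  proof -
    define h where "h = last_nb q i - 1"
    have h: "ad (q ! i) (q ! h)" "j \<le> h" "h < ?k"
      using last_adj(3)[of "\<lambda>j. ad (q ! i) (q ! j)" ?k] j nb_bounds(2)[of q i]
      by (auto simp: h_def last_nb_def)
    show ?thesis
    proof (cases "ad (q ! i) (q ! j)")
      case True
      thus ?thesis using near[of i j] i h by linarith
    next
      case False
      hence "j \<noteq> i" "j \<noteq> h" using ad_refl h by auto
      have "\<not> i < j"
      proof
        assume "i < j"
        hence "ad (q ! i) (q ! j)" using um h \<open>j \<noteq> h\<close> unfolding umbrella_free_def
          by (meson le_neq_implies_less)
        thus False using False by simp
      qed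
      hence "j < i" using \<open>j \<noteq> i\<close> by simp
      moreover have "\<not> ad (q ! j) (q ! i)" using False ad_sym by blast
      ultimately show ?thesis using lt[of j i] i M1 by simp
    qed
  qed
  have lo: "y j + M + 1 \<le> y i" if i: "i < ?k" and j: "j < first_nb q i" for i j
  proof -
    have nj: "\<not> ad (q ! i) (q ! j')" if "j' < first_nb q i" for j'
      using first_adj(2)[of j' "\<lambda>j. ad (q ! i) (q ! j)" ?k] that by (simp add: first_nb_def)
    have "\<not> i < first_nb q i" using nj[of i] ad_refl by blast
    hence "j < i" using j by simp
    moreover have "\<not> ad (q ! j) (q ! i)" using nj[OF j] ad_sym by blast
    ultimately show ?thesis using lt[of j i] i by simp
  qed
  have ws: "window_sol M ?k (first_nb q) (last_nb q) (x_init E ?b q) y"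
    unfolding window_sol_def using x0y hi lo by blast
  have cp: "c_pre + M + 1 \<le> x_init E ?b q i" for i
    using c_pre_le(1) by (simp add: x_init_def)
  have conv: "window_sol M ?k (first_nb q) (last_nb q) (x_init E ?b q) x \<and> (\<forall>i<?k. x i \<le> y i)"
    unfolding x_def x_fin_def x_rounds_def
    by (rule relax_converges[OF ws _ _ cp]) (use M1 nb_bounds in auto)
  have xy: "x i \<le> y i" if "i < ?k" for i using conv that by blast
  have xh: "x j - M \<le> x i" if "i < ?k" "j < last_nb q i" for i j
    using conv that unfolding window_sol_def by blast
  have xl: "x j + M + 1 \<le> x i" if "i < ?k" "j < first_nb q i" for i j
    using conv that unfolding window_sol_def by blast
  have near_x: "x j - M \<le> x i" if "i < ?k" "j < ?k" "ad (q ! i) (q ! j)" for i j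
    using xh[OF that(1)] last_adj(2)[of j ?k "\<lambda>j. ad (q ! i) (q ! j)"] that by (simp add: last_nb_def)
  \<comment> \<open>If \<open>i\<close> precedes \<open>j\<close> and is not adjacent to it, nothing
    before \<open>i\<close> is adjacent to \<open>j\<close> either, by the umbrella property; so
    \<open>i\<close> comes before the first neighbour of \<open>j\<close>.\<close>
  have far_x: "x i + M + 1 \<le> x j" if ij: "i < j" "j < ?k" "\<not> ad (q ! i) (q ! j)" for i j
  proof -
    have "\<not> ad (q ! j) (q ! l)" if "l \<le> i" for l
    proof
      assume "ad (q ! j) (q ! l)"
      hence a: "ad (q ! l) (q ! j)" by (rule ad_sym)
      hence "l \<noteq> i" using ij by auto
      hence "l < i" using that by simp
      hence "ad (q ! i) (q ! j)" using um a ij unfolding umbrella_free_def by blast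
      thus False using ij by simp
    qed
    hence "i < first_nb q j" unfolding first_nb_def using ij by (intro first_adj_greater) auto
    thus ?thesis using xl[OF ij(2)] by blast
  qed
  have "pairs_ok q x" unfolding pairs_ok_def
  proof (intro allI impI)
    fix i j assume ij: "i < ?k" "j < ?k"
    show "ad (q ! i) (q ! j) \<longleftrightarrow> \<bar>x i - x j\<bar> \<le> M"
    proof
      assume a: "ad (q ! i) (q ! j)"
      show "\<bar>x i - x j\<bar> \<le> M" using near_x[OF ij a] near_x[OF ij(2,1) ad_sym[OF a]] by linarith
    next
      assume le: "\<bar>x i - x j\<bar> \<le> M"
      show "ad (q ! i) (q ! j)"
      proof (rule ccontr)
        assume n: "\<not> ad (q ! i) (q ! j)"
        hence n': "\<not> ad (q ! j) (q ! i)" using ad_sym by blast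
        have "i \<noteq> j" using n ad_refl by auto
        hence "i < j \<or> j < i" by linarith
        thus False using far_x[of i j] far_x[of j i] ij n n' le by linarith
      qed
    qed
  qed
  moreover have "upper_ok ?b q x" unfolding upper_ok_def
  proof (intro allI impI)
    fix i assume i: "i < ?k" "ufin (q ! i)"
    have "g (q ! i) \<le> UC (q ! i)" using g mem[OF i(1)] i(2) by (simp add: fits_def)
    thus "?b + x i \<le> UC (q ! i)" using xy[OF i(1)] by (simp add: y_def)
  qed
  moreover have "\<exists>v\<in>Cs ! t. ?b + x_max q x \<le> g v"
    using prefix_max_attained[of c_pre x ?k]
  proof
    assume "prefix_max c_pre x ?k = c_pre"
    moreover have "c_pre \<le> x_init E ?b q 0" using c_pre_le M1 by (simp add: x_init_def)
    ultimately show ?thesis using x0y[OF k] mem[OF k] by (intro bexI[of _ "q ! 0"]) (simp_all add: x_max_def y_def)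
  next
    assume "\<exists>j<?k. prefix_max c_pre x ?k = x j"
    then obtain j where j: "j < ?k" "prefix_max c_pre x ?k = x j" by blast
    thus ?thesis using xy[OF j(1)] mem[OF j(1)] by (intro bexI[of _ "q ! j"]) (simp_all add: x_max_def y_def)
  qed
  ultimately show ?thesis by blast
qed

text \<open>No property of the order is assumed: adjacencies and upper bounds were checked, and the
  lower bounds hold because the relaxation starts above them and never decreases.\<close>

lemma attempt_sound:
  assumes q: "set q = C" "distinct q"
    and ok: "pairs_ok q (x_fin E (base E q) q)" "upper_ok (base E q) q (x_fin E (base E q) q)"
    and h: "\<And>i. i < length q \<Longrightarrow> h (q ! i) = x_fin E (base E q) q i"
  shows "fits E C (\<lambda>v. base E q + h v)" "v \<in> C \<Longrightarrow> h v \<le> x_max q (x_fin E (base E q) q)"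
proof -
  let ?x = "x_fin E (base E q) q"
  have ex: "\<exists>i<length q. v = q ! i" if "v \<in> C" for v using that q by (metis in_set_conv_nth)
  show "fits E C (\<lambda>v. base E q + h v)" unfolding fits_def
  proof (intro conjI ballI impI)
    fix u v assume "u \<in> C" "v \<in> C"
    then obtain i j where ij: "i < length q" "u = q ! i" "j < length q" "v = q ! j" using ex by metis
    show "ad u v \<longleftrightarrow> \<bar>base E q + h u - (base E q + h v)\<bar> \<le> M"
      using ok(1) ij h[OF ij(1)] h[OF ij(3)] by (simp add: pairs_ok_def)
  next
    fix v assume "v \<in> C"
    then obtain i where i: "i < length q" "v = q ! i" using ex by metis
    show "lb E v \<le> base E q + h v" using x_fin_lb[OF i(1)] h[OF i(1)] i by simp
    show "ufin v \<Longrightarrow> base E q + h v \<le> UC v" using ok(2) i h[OF i(1)] by (simp add: upper_ok_def)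
  qed
  show "h v \<le> x_max q ?x" if "v \<in> C"
  proof -
    obtain i where i: "i < length q" "v = q ! i" using ex \<open>v \<in> C\<close> by metis
    thus ?thesis using h[OF i(1)] prefix_max_ge[OF i(1), of ?x c_pre] by (simp add: x_max_def)
  qed
qed

text \<open>From \<open>n + 5 \<le> r\<close> and \<open>M + 1 \<le> 2 * r^2\<close> the bound is at
  most \<open>6 * r^3\<close>, and \<open>6 \<le> r^2\<close>.\<close>

lemma small_wide:
  assumes "n \<ge> 1" "\<bar>a\<bar> \<le> 3 * ((int n + 5) * (M + 1))"
  shows "small a"
proof -
  have r7: "7 \<le> r" "n + 5 \<le> r" using r_ge assms(1) by simp_all
  have r7i: "7 \<le> int r" "int n + 5 \<le> int r" using r7 by linarith+
  have s: "7 * 7 \<le> int r * int r" using r7i by (intro mult_mono) auto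
  have "M + 1 \<le> 2 * (int r * int r)" using M_le s by (simp add: power2_eq_square)
  hence "(int n + 5) * (M + 1) \<le> int r * (2 * (int r * int r))" using r7i M1 by (intro mult_mono) auto
  hence "\<bar>a\<bar> \<le> 6 * (int r * (int r * int r))" using assms(2) by linarith
  also have "\<dots> \<le> (int r * int r) * (int r * (int r * int r))" using s by (intro mult_right_mono) auto
  also have "\<dots> = int r ^ 5" by (simp add: numeral_eq_Suc mult.assoc)
  finally show ?thesis by (simp add: small_def)
qed

end

section \<open>The two searches of a component as programs\<close>

definition b_scan :: com where
  "b_scan = Seq (Put ''w'' (Cell ''ord'' (Var ''i'')))
    (If (And (Equal (Cell ''adj'' (At ''u'' ''w'')) (Const 1)) (Not (Equal (Cell ''vis'' (Var ''w'')) (Var ''st''))))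
      (Seq (Assign ''vis'' (Var ''w'') (Var ''st''))
        (Seq (Assign ''q'' (Var ''tail'') (Var ''w'')) (Put ''tail'' (Plus (Var ''tail'') (Const 1)))))
      Skip)"

definition b_bfs :: com where
  "b_bfs = Seq (Seq (Put ''u'' (Cell ''q'' (Var ''head''))) (Put ''old'' (Var ''tail'')))
    (Seq (For ''i'' ''n'' b_scan)
      (Seq (If (Less (Var ''old'') (Var ''tail'')) (Put ''zi'' (Var ''old'')) Skip)
        (Put ''head'' (Plus (Var ''head'') (Const 1)))))"

text \<open>Visited vertices carry the stamp of the current search. Stamps only grow from search to
  search, so old marks never need to be cleared.\<close>

definition i_bfs :: com where
  "i_bfs = seqs [Assign ''q'' (Const 0) (Var ''a''), Assign ''vis'' (Var ''a'') (Var ''st''),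
     Put ''tail'' (Const 1), Put ''head'' (Const 0), Put ''zi'' (Const 0)]"

definition p_bfs :: com where
  "p_bfs = Seq i_bfs (While (Less (Var ''head'') (Var ''tail'')) b_bfs)"

text \<open>The second search uses the next stamp. Its queue is followed by its mirror image in the
  same array, so an orientation is chosen by an offset alone.\<close>

definition p_order :: com where
  "p_order = Seq (seqs [Put ''a'' (Cell ''first'' (Var ''t'')), Put ''st'' (Plus (Plus (Var ''t'') (Var ''t'')) (Const 1))])
    (Seq p_bfs (Seq (seqs [Put ''a'' (Cell ''q'' (Var ''zi'')), Put ''st'' (Plus (Var ''st'') (Const 1))])
    (Seq p_bfs (For ''i'' ''tail'' (Assign ''q'' (Plus (Var ''tail'') (Var ''i''))
      (Cell ''q'' (Minus (Minus (Var ''tail'') (Var ''i'')) (Const 1))))))))"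

lemma seq_time: "z \<le> a * y * x \<Longrightarrow> a + b \<le> c \<Longrightarrow> z + b * y * x \<le> c * y * (x::nat)"
proof -
  assume z: "z \<le> a * y * x" and c: "a + b \<le> c"
  have "(a + b) * (y * x) \<le> c * (y * x)" using c by (rule mult_le_mono1)
  thus ?thesis using z by (simp add: add_mult_distrib mult.assoc)
qed

lemma loop_time: "z \<le> a * y * x \<Longrightarrow> a + b \<le> c \<Longrightarrow> x * (b * y) + z \<le> c * y * (x::nat)"
  using seq_time[of z a y x b c] by (simp add: ac_simps)

lemma wr_bfs [simp]: "wr b_scan = {''w'', ''vis'', ''q'', ''tail''}"
  "wr b_bfs = {''u'', ''old'', ''i'', ''w'', ''vis'', ''q'', ''tail'', ''zi'', ''head''}"
  "wr p_bfs = {''u'', ''old'', ''i'', ''w'', ''vis'', ''q'', ''tail'', ''zi'', ''head''}"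
  by (auto simp: b_scan_def b_bfs_def i_bfs_def p_bfs_def)

context pmain
begin

definition graph_ok :: "state \<Rightarrow> bool" where
  "graph_ok s \<longleftrightarrow> s ''n'' 0 = int n \<and> adj_ok s \<and> holds (s ''ord'') ord"

lemma graph_ok_frame:
  "graph_ok s \<Longrightarrow> s' ''n'' = s ''n'' \<Longrightarrow> s' ''adj'' = s ''adj'' \<Longrightarrow> s' ''ord'' = s ''ord'' \<Longrightarrow> graph_ok s'"
  by (simp add: graph_ok_def adj_ok_def)

text \<open>\<open>queue_ok W st qa len vi\<close>: the queue stored in \<open>qa\<close> is \<open>W\<close>, and the vertices in the queue
  are those marked with the stamp \<open>st\<close>.\<close>

definition queue_ok :: "nat list \<Rightarrow> int \<Rightarrow> (nat \<Rightarrow> int) \<Rightarrow> int \<Rightarrow> (nat \<Rightarrow> int) \<Rightarrow> bool" where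
  "queue_ok W st qa len vi \<longleftrightarrow> holds qa W \<and> len = int (length W) \<and>
     (\<forall>v<n. 0 \<le> vi v \<and> vi v \<le> st \<and> (vi v = st \<longleftrightarrow> v \<in> set W))"

lemma queue_ok_snoc:
  assumes "queue_ok W st qa len vi" "0 \<le> st" "w < n"
  shows "queue_ok (W @ [w]) st (qa(length W := int w)) (int (length W) + 1) (vi(w := st))"
  using assms by (auto simp: queue_ok_def intro!: holds_snoc)

text \<open>Each expansion scans the whole degree order in O(n), and only the vertices of the
  component are expanded; over all components this sums to O(n^2).\<close>

lemma p_bfs:
  assumes t: "t < length Cs" and a: "a \<in> Cs ! t"
    and s: "graph_ok s" "s ''a'' 0 = int a" "s ''st'' 0 = st" "0 < st" "small st"
    and vis: "\<forall>v<n. 0 \<le> s ''vis'' v \<and> s ''vis'' v < st"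
  shows "wp p_bfs s (2000 * (n + 1) * card (Cs ! t)) (\<lambda>s'. \<exists>i. length (bfs ad ord a i) \<le> i \<and>
    queue_ok (bfs ad ord a i) st (s' ''q'') (s' ''tail'' 0) (s' ''vis'') \<and>
    s' ''zi'' 0 = int (last_batch ad ord a i))"
proof -
  let ?C = "Cs ! t" and ?Q = "bfs ad ord a"
  interpret cg: conn_graph ?C ad ord dgr by (rule conn_graph_comp[OF t])
  have C1: "card ?C \<ge> 1" by (rule comp_card_pos[OF t])
  have Cn: "card ?C \<le> n" by (rule comp_card_le[OF t])
  have an: "a < n" using a comp_sub[OF t] by auto
  have lenQ: "length (?Q i) \<le> card ?C" for i by (rule cg.bfs_length[OF a])
  have Qn: "?Q i ! k < n" if "k < length (?Q i)" for i k
    using cg.bfs_basic[OF a, of i] nth_mem[OF that] comp_sub[OF t] by auto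
  define J where "J i s \<longleftrightarrow> queue_ok (?Q i) st (s ''q'') (s ''tail'' 0) (s ''vis'') \<and> s ''head'' 0 = int i \<and>
    i \<le> length (?Q i) \<and> s ''zi'' 0 = int (last_batch ad ord a i)" for i and s :: state
  have sn: "small (int n)" by (rule small_le) simp
  have snn: "small (int k)" if "k \<le> n + 1" for k using that by (intro small_le) simp
  have body: "wp b_bfs s1 (1000 * (n + 1)) (J (Suc i))"
    if J: "J i s1" and lt: "i < length (?Q i)" and g: "graph_ok s1" and st1: "s1 ''st'' 0 = st" for i s1
  proof -
    define u where "u = ?Q i ! i"
    have un: "u < n" using Qn[OF lt] by (simp add: u_def)
    \<comment> \<open>The queue after the first \<open>k\<close> vertices of \<open>ord\<close> have
      been examined for the expansion of \<open>u\<close>. The test against the original queue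
      agrees with the stamps because \<open>ord\<close> has no repetitions.\<close>
    define W where "W k = ?Q i @ filter (\<lambda>w. ad u w \<and> w \<notin> set (?Q i)) (take k ord)" for k
    have Wn: "W n = ?Q (Suc i)" using lt length_ord by (simp add: W_def bfs_step_def u_def)
    have lenW: "length (W k) \<le> n" for k
    proof -
      have "filter (\<lambda>w. ad u w \<and> w \<notin> set (?Q i)) ord =
        filter (\<lambda>w. ad u w \<and> w \<notin> set (?Q i)) (take k ord) @ filter (\<lambda>w. ad u w \<and> w \<notin> set (?Q i)) (drop k ord)"
        by (metis append_take_drop_id filter_append)
      hence "length (W k) \<le> length (W n)" using length_ord by (simp add: W_def)
      thus ?thesis using Wn lenQ[of "Suc i"] Cn by simp
    qed
    have q1: "queue_ok (?Q i) st (s1 ''q'') (s1 ''tail'' 0) (s1 ''vis'')" "s1 ''head'' 0 = int i"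
      "s1 ''zi'' 0 = int (last_batch ad ord a i)" using J by (simp_all add: J_def)
    have uq: "s1 ''q'' i = int u" "s1 ''tail'' 0 = int (length (?Q i))"
      using q1(1) lt by (simp_all add: queue_ok_def holds_def u_def)
    have lQ: "length (?Q i) \<le> n" using lenQ[of i] Cn by simp
    have scan: "wp (For ''i'' ''n'' b_scan) s2 (500 * (n + 1)) (\<lambda>s. queue_ok (W n) st (s ''q'') (s ''tail'' 0) (s ''vis''))"
      if s2: "graph_ok s2" "s2 ''u'' 0 = int u" "s2 ''st'' 0 = st"
        "queue_ok (W 0) st (s2 ''q'') (s2 ''tail'' 0) (s2 ''vis'')" for s2
    proof (rule wp_For_W[where I = "\<lambda>k s. queue_ok (W k) st (s ''q'') (s ''tail'' 0) (s ''vis'')" and N = n])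
      show "s2 ''n'' 0 = int n" using s2(1) by (simp add: graph_ok_def)
      show "queue_ok (W 0) st (store s2 ''i'' 0 0 ''q'') (store s2 ''i'' 0 0 ''tail'' 0) (store s2 ''i'' 0 0 ''vis'')"
        using s2(4) by simp
      have "csize b_scan * 7 * n + 100 * (n + 1) \<le> 400 * n + 100 * (n + 1)" by (simp add: b_scan_def)
      also have "\<dots> \<le> 500 * (n + 1)" by simp
      finally show "csize b_scan * 7 * n + 100 * (n + 1) \<le> 500 * (n + 1)" .
    next
      fix k s3 assume k: "k < n" and q3: "queue_ok (W k) st (s3 ''q'') (s3 ''tail'' 0) (s3 ''vis'')"
        and i3: "s3 ''i'' 0 = int k" and n3: "s3 ''n'' 0 = int n"
        and fr: "\<And>z. z \<notin> insert ''i'' (wr b_scan) \<Longrightarrow> s3 z = s2 z"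
      define w where "w = ord ! k"
      have wn: "w < n" using ord_nth[OF k] by (simp add: w_def)
      have e3: "s3 ''ord'' k = int w" "s3 ''u'' 0 = int u" "s3 ''st'' 0 = st"
        "s3 ''adj'' (u * n + w) = (if ad u w then 1 else 0)"
        using fr[of "''ord''"] fr[of "''u''"] fr[of "''st''"] fr[of "''adj''"] s2 k un wn length_ord
        by (simp_all add: graph_ok_def holds_def w_def adj_ok_def)
      have tl: "s3 ''tail'' 0 = int (length (W k))" using q3 by (simp add: queue_ok_def)
      have viw: "0 \<le> s3 ''vis'' w" "s3 ''vis'' w \<le> st" "s3 ''vis'' w = st \<longleftrightarrow> w \<in> set (W k)"
        using q3 wn by (simp_all add: queue_ok_def)
      have tk: "take (Suc k) ord = take k ord @ [w]" using k length_ord by (simp add: take_Suc_conv_app_nth w_def)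
      have wt: "w \<notin> set (take k ord)"
      proof
        assume "w \<in> set (take k ord)"
        then obtain j where j: "j < k" "ord ! j = ord ! k" using k length_ord by (auto simp: in_set_conv_nth w_def)
        thus False using j k length_ord distinct_ord by (simp add: nth_eq_iff_index_eq)
      qed
      have inW: "w \<in> set (W k) \<longleftrightarrow> w \<in> set (?Q i)" using wt by (simp add: W_def)
      have W1: "W (Suc k) = W k @ [w]" if "ad u w" "w \<notin> set (W k)"
        using that inW tk by (simp add: W_def)
      have W2: "W (Suc k) = W k" if "\<not> (ad u w \<and> w \<notin> set (W k))"
        using that inW tk by (auto simp: W_def)
      have A: "queue_ok (W (Suc k)) st ((s3 ''q'')(length (W k) := int w)) (int (length (W k)) + 1) ((s3 ''vis'')(w := st))"
        if "ad u w" "w \<notin> set (W k)"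
        unfolding W1[OF that] using queue_ok_snoc[OF q3 _ wn] s(4) by simp
      have B: "queue_ok (W (Suc k)) st (s3 ''q'') (int (length (W k))) (s3 ''vis'')"
        if "\<not> (ad u w \<and> w \<notin> set (W k))"
        unfolding W2[OF that] using q3 tl by simp
      have sv: "small (s3 ''vis'' w)" using viw(1,2) s(5) by (simp add: small_def)
      have sm: "small (int k)" "small (int w)" "small (int (length (W k)))" "small (int (length (W k)) + 1)"
        using snn[of k] snn[of w] snn[of "length (W k)"] snn[of "length (W k) + 1"] k wn lenW[of k]
        by (simp_all add: add.commute)
      note sa = small_addr[OF un wn] small_row[OF un] addr_At[OF un wn] snn[of u]
      have small_u: "small (int u)" using snn[of u] un by simp
      show "sl addr small small b_scan s3 (\<lambda>s'. queue_ok (W (Suc k)) st (store s' ''i'' 0 (int (Suc k)) ''q'')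
          (store s' ''i'' 0 (int (Suc k)) ''tail'' 0) (store s' ''i'' 0 (int (Suc k)) ''vis''))"
      proof (cases "ad u w \<and> w \<notin> set (W k)")
        case True
        thus ?thesis unfolding b_scan_def using i3 n3 e3 tl viw(3) sv sm sn sa(1-3) small_u s(5) A
          by (simp add: addr_int)
      next
        case False
        show ?thesis
        proof (cases "ad u w")
          case True
          hence "s3 ''vis'' w = st" using False viw(3) by simp
          thus ?thesis unfolding b_scan_def using i3 n3 e3 tl sv sm sn sa(1-3) small_u s(5) B[OF False] True
            by (simp add: addr_int)
        next
          case nad: False
          thus ?thesis unfolding b_scan_def using i3 n3 e3 tl sv sm sn sa(1-3) small_u s(5) B[OF False]
            by (simp add: addr_int)
        qed
      qed
    qed (use sn in simp_all)
    let ?p1 = "Seq (Put ''u'' (Cell ''q'' (Var ''head''))) (Put ''old'' (Var ''tail''))"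
    let ?p2 = "Seq (If (Less (Var ''old'') (Var ''tail'')) (Put ''zi'' (Var ''old'')) Skip)
        (Put ''head'' (Plus (Var ''head'') (Const 1)))"
    have li: "i \<le> n" using lt lQ by simp
    show ?thesis unfolding b_bfs_def
    proof (rule wp_Seq_sl[OF md_W, where R = "\<lambda>s. s ''u'' 0 = int u \<and> s ''old'' 0 = int (length (?Q i))"])
      show "sl addr small small ?p1 s1 (\<lambda>s. s ''u'' 0 = int u \<and> s ''old'' 0 = int (length (?Q i)))"
        using q1(2) uq snn[of i] snn[of u] snn[of "length (?Q i)"] un lQ li by (simp add: addr_int)
    next
      fix s2 assume R: "s2 ''u'' 0 = int u \<and> s2 ''old'' 0 = int (length (?Q i))"
        and fr: "\<And>z. z \<notin> wr ?p1 \<Longrightarrow> s2 z = s1 z"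
      have e2: "s2 ''q'' = s1 ''q''" "s2 ''tail'' = s1 ''tail''" "s2 ''vis'' = s1 ''vis''" "s2 ''st'' = s1 ''st''"
        "s2 ''n'' = s1 ''n''" "s2 ''adj'' = s1 ''adj''" "s2 ''ord'' = s1 ''ord''" "s2 ''head'' = s1 ''head''" "s2 ''zi'' = s1 ''zi''"
        by (rule fr, simp)+
      show "wp (Seq (For ''i'' ''n'' b_scan) ?p2) s2 (900 * (n + 1)) (J (Suc i))"
      proof (rule wp_Seq[OF scan wp_sl[OF md_W]])
        show "graph_ok s2" by (rule graph_ok_frame[OF g]) (use e2 in simp_all)
        show "s2 ''u'' 0 = int u" using R by simp
        show "s2 ''st'' 0 = st" using e2 st1 by simp
        show "queue_ok (W 0) st (s2 ''q'') (s2 ''tail'' 0) (s2 ''vis'')" using q1(1) e2 by (simp add: W_def)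
      next
        fix s3 assume q3: "queue_ok (W n) st (s3 ''q'') (s3 ''tail'' 0) (s3 ''vis'')"
          and fr3: "\<And>z. z \<notin> wr (For ''i'' ''n'' b_scan) \<Longrightarrow> s3 z = s2 z"
        have e3: "s3 ''old'' 0 = int (length (?Q i))" "s3 ''head'' 0 = int i" "s3 ''zi'' 0 = int (last_batch ad ord a i)"
          using fr3[of "''old''"] fr3[of "''head''"] fr3[of "''zi''"] R e2 q1 by simp_all
        have tl: "s3 ''tail'' 0 = int (length (?Q (Suc i)))" using q3 Wn by (simp add: queue_ok_def)
        have q3': "queue_ok (?Q (Suc i)) st (s3 ''q'') (int (length (?Q (Suc i)))) (s3 ''vis'')" using q3 Wn tl by simp
        have le: "length (?Q i) \<le> length (?Q (Suc i))" using Wn by (metis W_def le_add1 length_append)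
        have lb: "last_batch ad ord a (Suc i) = (if length (?Q i) < length (?Q (Suc i)) then length (?Q i) else last_batch ad ord a i)"
          using le by (simp del: bfs.simps)
        have sc: "Suc i \<le> length (?Q (Suc i))" using lt le by linarith
        have lS: "length (?Q (Suc i)) \<le> n" using lenQ[of "Suc i"] Cn by linarith
        have sm: "small (int (length (?Q i)))" "small (int (length (?Q (Suc i))))" "small (int i)" "small (int i + 1)"
          using snn[of "length (?Q i)"] snn[of "length (?Q (Suc i))"] snn[of i] snn[of "Suc i"] lQ lS li by (simp_all add: add.commute del: bfs.simps)
        have fin: "J (Suc i) s'" if "s' ''q'' = s3 ''q''" "s' ''tail'' = s3 ''tail''" "s' ''vis'' = s3 ''vis''"
            "s' ''head'' 0 = int i + 1" "s' ''zi'' 0 = int (last_batch ad ord a (Suc i))" for s'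
          using that q3' tl sc unfolding J_def by (simp del: bfs.simps last_batch.simps)
        show "sl addr small small ?p2 s3 (J (Suc i))"
          using e3 tl sm lb by (simp add: fin del: bfs.simps last_batch.simps)
      next
        show "500 * (n + 1) + csize ?p2 * 7 \<le> 900 * (n + 1)" by simp
      qed
    next
      show "csize ?p1 * 7 + 900 * (n + 1) \<le> 1000 * (n + 1)" by simp
    qed
  qed
  have loop: "wp (While (Less (Var ''head'') (Var ''tail'')) b_bfs) s1 (1100 * (n + 1) * card ?C) (\<lambda>s'. \<exists>i. length (?Q i) \<le> i \<and> J i s')"
    if J0: "J 0 s1" and g1: "graph_ok s1" and st1: "s1 ''st'' 0 = st" for s1
  proof (rule wp_While[where I = "\<lambda>j s. \<exists>i. i + j = card ?C \<and> J i s" and j = "card ?C" and P = small and M = small and u = 7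
        and Tb = "\<lambda>_. 1000 * (n + 1)" and st = s1])
    show "md small small 7" by (rule md_W)
    show "\<exists>i. i + card ?C = card ?C \<and> J i s1" using J0 by simp
    have "42 * (card ?C + 1) \<le> 100 * (n + 1) * card ?C"
    proof -
      have "42 * (card ?C + 1) \<le> 100 * card ?C" using C1 by simp
      also have "\<dots> \<le> 100 * (n + 1) * card ?C" by simp
      finally show ?thesis .
    qed
    moreover have "x + y = z \<Longrightarrow> w \<le> y \<Longrightarrow> x + w \<le> z" for x y z w :: nat by simp
    moreover have "1000 * (n + 1) * card ?C + 100 * (n + 1) * card ?C = 1100 * (n + 1) * card ?C"
      by (simp only: add_mult_distrib[symmetric]) simp
    ultimately have "1000 * (n + 1) * card ?C + 42 * (card ?C + 1) \<le> 1100 * (n + 1) * card ?C" by blast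
    thus "(\<Sum>i<card ?C. 1000 * (n + 1)) + bsize (Less (Var ''head'') (Var ''tail'')) * 7 * (card ?C + 1) \<le> 1100 * (n + 1) * card ?C"
      by (simp add: mult.commute)
  next
    fix j s2 assume "\<exists>i. i + j = card ?C \<and> J i s2"
    then obtain i where i: "i + j = card ?C" "J i s2" by blast
    hence "s2 ''head'' 0 = int i" "s2 ''tail'' 0 = int (length (?Q i))" by (simp_all add: J_def queue_ok_def)
    thus "badm addr small small (Less (Var ''head'') (Var ''tail'')) s2"
      using snn[of i] snn[of "length (?Q i)"] lenQ[of i] Cn i(1) by simp
  next
    fix j s2 assume "\<exists>i. i + j = card ?C \<and> J i s2" and b: "bval (Less (Var ''head'') (Var ''tail'')) s2"
      and fr: "\<And>z. z \<notin> wr b_bfs \<Longrightarrow> s2 z = s1 z"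
    then obtain i where i: "i + j = card ?C" "J i s2" by blast
    hence lt: "i < length (?Q i)" using b by (simp add: J_def queue_ok_def)
    hence "j \<noteq> 0" using lenQ[of i] i(1) by auto
    then obtain j' where j': "j = Suc j'" by (cases j) auto
    have g: "graph_ok s2" by (rule graph_ok_frame[OF g1]) (use fr[of "''n''"] fr[of "''adj''"] fr[of "''ord''"] in simp_all)
    have "s2 ''st'' 0 = st" using fr[of "''st''"] st1 by simp
    from body[OF i(2) lt g this] have "wp b_bfs s2 (1000 * (n + 1)) (\<lambda>s. \<exists>i. i + j' = card ?C \<and> J i s)"
    proof (rule wp_mono)
      fix s' assume "J (Suc i) s'"
      thus "\<exists>i. i + j' = card ?C \<and> J i s'" using i(1) j' by (intro exI[of _ "Suc i"]) simp
    qed simp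
    thus "\<exists>j'. j = Suc j' \<and> wp b_bfs s2 (1000 * (n + 1)) (\<lambda>s. \<exists>i. i + j' = card ?C \<and> J i s)" using j' by blast
  next
    fix j s2 assume "\<exists>i. i + j = card ?C \<and> J i s2" and b: "\<not> bval (Less (Var ''head'') (Var ''tail'')) s2"
    then obtain i where i: "J i s2" by blast
    hence "length (?Q i) \<le> i" using b by (simp add: J_def queue_ok_def)
    thus "\<exists>i. length (?Q i) \<le> i \<and> J i s2" using i by blast
  qed simp
  show ?thesis unfolding p_bfs_def
  proof (rule wp_Seq_sl[OF md_W, where R = "J 0"])
    have q0: "queue_ok [a] st ((s ''q'')(0 := int a)) 1 ((s ''vis'')(a := st))"
      using vis s(4) an by (auto simp: queue_ok_def holds_def)
    show "sl addr small small i_bfs s (J 0)" unfolding i_bfs_def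
      using s(2,3,5) snn[of a] an q0 by (simp add: addr_int J_def)
  next
    fix s1 assume J0: "J 0 s1" and fr: "\<And>z. z \<notin> wr i_bfs \<Longrightarrow> s1 z = s z"
    have g1: "graph_ok s1" by (rule graph_ok_frame[OF s(1)]) (use fr[of "''n''"] fr[of "''adj''"] fr[of "''ord''"] in \<open>simp_all add: i_bfs_def\<close>)
    have st1: "s1 ''st'' 0 = st" using fr[of "''st''"] s(3) by (simp add: i_bfs_def)
    show "wp (While (Less (Var ''head'') (Var ''tail'')) b_bfs) s1 (1100 * (n + 1) * card ?C)
      (\<lambda>s'. \<exists>i. length (?Q i) \<le> i \<and> queue_ok (?Q i) st (s' ''q'') (s' ''tail'' 0) (s' ''vis'') \<and>
        s' ''zi'' 0 = int (last_batch ad ord a i))"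
      by (rule wp_mono[OF loop[OF J0 g1 st1] order_refl]) (auto simp: J_def)
  next
    have "csize i_bfs * 7 \<le> 900 * (n + 1) * card ?C"
    proof -
      have "csize i_bfs * 7 \<le> 900 * 1 * 1" by (simp add: i_bfs_def)
      also have "\<dots> \<le> 900 * (n + 1) * card ?C" using C1 by (intro mult_le_mono) auto
      finally show ?thesis .
    qed
    moreover have "x \<le> 900 * y * z \<Longrightarrow> x + 1100 * y * z \<le> 2000 * y * z" for x y z :: nat by simp
    ultimately show "csize i_bfs * 7 + 1100 * (n + 1) * card ?C \<le> 2000 * (n + 1) * card ?C" by blast
  qed
qed

text \<open>One list serves all representations \<open>g\<close> simultaneously, as the later
  argument needs: it is fixed before any \<open>g\<close> is considered. The two stamps of component
  \<open>t\<close> are \<open>2 * t + 1\<close> and \<open>2 * t + 2\<close>.\<close>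

lemma p_order:
  assumes t: "t < length Cs" and a: "a \<in> Cs ! t" "s ''first'' t = int a"
    and s: "graph_ok s" "s ''t'' 0 = int t" and vis: "\<forall>v<n. 0 \<le> s ''vis'' v \<and> s ''vis'' v \<le> 2 * int t"
  shows "wp p_order s (6000 * (n + 1) * card (Cs ! t)) (\<lambda>s'. \<exists>q. set q = Cs ! t \<and> distinct q \<and>
    holds (s' ''q'') (q @ rev q) \<and> s' ''tail'' 0 = int (length q) \<and>
    (\<forall>v<n. 0 \<le> s' ''vis'' v \<and> s' ''vis'' v \<le> 2 * int t + 2) \<and>
    (\<forall>g. rep_on (Cs ! t) ad M g \<longrightarrow> umbrella_free ad q \<and> (nonadj_sorted ad M g q \<or> nonadj_sorted ad M g (rev q))))"
    (is "wp _ _ _ ?post")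
proof -
  let ?C = "Cs ! t"
  interpret cg: conn_graph ?C ad ord dgr by (rule conn_graph_comp[OF t])
  have C1: "card ?C \<ge> 1" by (rule comp_card_pos[OF t])
  have Cn: "card ?C \<le> n" by (rule comp_card_le[OF t])
  have an: "a < n" using a(1) comp_sub[OF t] by auto
  have tn: "t < n" using t length_Cs by simp
  have sm: "small (int k)" if "k \<le> 5 * n + 2" for k by (rule small_le[OF that])
  let ?p1 = "seqs [Put ''a'' (Cell ''first'' (Var ''t'')), Put ''st'' (Plus (Plus (Var ''t'') (Var ''t'')) (Const 1))]"
  let ?p2 = "seqs [Put ''a'' (Cell ''q'' (Var ''zi'')), Put ''st'' (Plus (Var ''st'') (Const 1))]"
  let ?b = "Assign ''q'' (Plus (Var ''tail'') (Var ''i'')) (Cell ''q'' (Minus (Minus (Var ''tail'') (Var ''i'')) (Const 1)))"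
  let ?r1 = "\<lambda>s'. \<exists>i. length (bfs ad ord a i) \<le> i \<and>
    queue_ok (bfs ad ord a i) (2 * int t + 1) (s' ''q'') (s' ''tail'' 0) (s' ''vis'') \<and>
    s' ''zi'' 0 = int (last_batch ad ord a i)"
  have sms: "small (int t + int t)" "small (2 * int t + 1)" "small (2 * int t + 2)"
    using sm[of "t + t"] sm[of "2 * t + 1"] sm[of "2 * t + 2"] tn by (simp_all add: add.commute)
  have mirror: "wp (For ''i'' ''tail'' ?b) s4 (300 * (n + 1)) (\<lambda>s'. holds (s' ''q'') (q @ rev q))"
    if q: "holds (s4 ''q'') q" "s4 ''tail'' 0 = int (length q)" "length q \<le> n" "set q \<subseteq> {..<n}" for q s4
  proof (rule wp_For_W[where I = "\<lambda>j s. holds (s ''q'') (q @ take j (rev q))" and N = "length q"])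
    show "s4 ''tail'' 0 = int (length q)" by (rule q)
    show "small (int (length q))" using q(3) by (intro sm) simp
    show "holds (store s4 ''i'' 0 0 ''q'') (q @ take 0 (rev q))" using q(1) by simp
    have "csize ?b * 7 * length q + 100 * (length q + 1) \<le> 200 * n + 100 * (n + 1)" using q(3) by simp
    also have "\<dots> \<le> 300 * (n + 1)" by simp
    finally show "csize ?b * 7 * length q + 100 * (length q + 1) \<le> 300 * (n + 1)" .
  next
    fix j s5 assume j: "j < length q" and h: "holds (s5 ''q'') (q @ take j (rev q))" and i: "s5 ''i'' 0 = int j"
      and tl: "s5 ''tail'' 0 = int (length q)"
    define m where "m = length q - Suc j"
    have m: "int (length q) - int j - 1 = int m" "m < length q" using j by (auto simp: m_def)
    define v where "v = q ! m"
    have vn: "v < n" using q(4) nth_mem[OF m(2)] by (auto simp: v_def)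
    have rv: "rev q ! j = v" using j by (simp add: rev_nth v_def m_def)
    have sq: "s5 ''q'' m = int v" using holds_nth[OF h, of m] m(2) by (simp add: nth_append v_def)
    have tk: "q @ take (Suc j) (rev q) = (q @ take j (rev q)) @ [v]"
      using j rv by (simp add: take_Suc_conv_app_nth)
    have new: "holds ((s5 ''q'')(length q + j := int v)) (q @ take (Suc j) (rev q))"
      unfolding tk by (rule holds_snoc[OF h]) (use j in simp)
    have d: "small (int (length q) - int j)" "small (int (length q) + int j)" "small (int m)" "small (int v)" "small (int (length q))" "small (int j)"
      using sm[of "length q - j"] sm[of "length q + j"] sm[of m] sm[of v] sm[of "length q"] sm[of j] j m(2) vn q(3) by (simp_all add: of_nat_diff)
    have na: "nat (int (length q) + int j) = length q + j" by simp
    show "sl addr small small ?b s5 (\<lambda>s'. holds (store s' ''i'' 0 (int (Suc j)) ''q'') (q @ take (Suc j) (rev q)))"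
      using i tl m(1) sq new d na by (simp add: addr_def del: take_Suc)
  qed simp_all
  show ?thesis unfolding p_order_def
  proof (rule wp_Seq_sl[OF md_W, where R = "\<lambda>s'. s' ''a'' 0 = int a \<and> s' ''st'' 0 = 2 * int t + 1"])
    show "sl addr small small ?p1 s (\<lambda>s'. s' ''a'' 0 = int a \<and> s' ''st'' 0 = 2 * int t + 1)"
      using a(2) s(2) sms sm[of t] sm[of a] tn an by (simp add: addr_int)
  next
    fix s1 assume R1: "s1 ''a'' 0 = int a \<and> s1 ''st'' 0 = 2 * int t + 1" and fr1: "\<And>z. z \<notin> wr ?p1 \<Longrightarrow> s1 z = s z"
    have e1: "s1 ''n'' = s ''n''" "s1 ''adj'' = s ''adj''" "s1 ''ord'' = s ''ord''" "s1 ''vis'' = s ''vis''"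
      by (rule fr1, simp)+
    have g1: "graph_ok s1" by (rule graph_ok_frame[OF s(1)]) (use e1 in simp_all)
    have v1: "\<forall>v<n. 0 \<le> s1 ''vis'' v \<and> s1 ''vis'' v < 2 * int t + 1" using vis e1 by force
    have bfs1: "wp p_bfs s1 (2000 * (n + 1) * card ?C) ?r1"
      by (rule p_bfs[OF t a(1) g1]) (use R1 sms v1 in auto)
    show "wp (Seq p_bfs (Seq ?p2 (Seq p_bfs (For ''i'' ''tail'' ?b)))) s1 (5000 * (n + 1) * card ?C) ?post"
    proof (rule wp_Seq[OF bfs1])
      fix s2 assume r1: "?r1 s2" and fr2: "\<And>z. z \<notin> wr p_bfs \<Longrightarrow> s2 z = s1 z"
      obtain i where i: "length (bfs ad ord a i) \<le> i"
        "queue_ok (bfs ad ord a i) (2 * int t + 1) (s2 ''q'') (s2 ''tail'' 0) (s2 ''vis'')"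
        "s2 ''zi'' 0 = int (last_batch ad ord a i)" using r1 by blast
      let ?zi = "last_batch ad ord a i"
      define z where "z = bfs ad ord a i ! ?zi"
      have zl: "?zi < length (bfs ad ord a i)" using cg.bfs_batches[OF a(1), of i] unfolding Let_def by blast
      have ln: "length (bfs ad ord a i) \<le> n" using cg.bfs_length[OF a(1), of i] Cn by linarith
      have zC: "z \<in> ?C" using cg.bfs_basic[OF a(1), of i] nth_mem[OF zl] unfolding z_def by blast
      have zn: "z < n" using zC comp_sub[OF t] by auto
      have e2: "s2 ''n'' = s1 ''n''" "s2 ''adj'' = s1 ''adj''" "s2 ''ord'' = s1 ''ord''" "s2 ''st'' = s1 ''st''"
        by (rule fr2, simp)+
      have qz: "s2 ''q'' ?zi = int z" using i(2) zl by (simp add: queue_ok_def holds_def z_def)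
      have v2: "\<forall>v<n. 0 \<le> s2 ''vis'' v \<and> s2 ''vis'' v < 2 * int t + 2" using i(2) unfolding queue_ok_def by force
      show "wp (Seq ?p2 (Seq p_bfs (For ''i'' ''tail'' ?b))) s2 (2900 * (n + 1) * card ?C) ?post"
      proof (rule wp_Seq_sl[OF md_W, where R = "\<lambda>s'. s' ''a'' 0 = int z \<and> s' ''st'' 0 = 2 * int t + 2"])
        have "s2 ''st'' 0 = 2 * int t + 1" using e2 R1 by simp
        moreover have "small (2 + 2 * int t)" using sms(3) by (simp only: add.commute)
        ultimately show "sl addr small small ?p2 s2 (\<lambda>s'. s' ''a'' 0 = int z \<and> s' ''st'' 0 = 2 * int t + 2)"
          using qz i(3) sms sm[of ?zi] sm[of z] zl ln zn by (simp add: addr_int)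
      next
        fix s3 assume R3: "s3 ''a'' 0 = int z \<and> s3 ''st'' 0 = 2 * int t + 2" and fr3: "\<And>z. z \<notin> wr ?p2 \<Longrightarrow> s3 z = s2 z"
        have e3: "s3 ''n'' = s2 ''n''" "s3 ''adj'' = s2 ''adj''" "s3 ''ord'' = s2 ''ord''" "s3 ''vis'' = s2 ''vis''"
          by (rule fr3, simp)+
        have g3: "graph_ok s3" by (rule graph_ok_frame[OF g1]) (use e2 e3 in simp_all)
        have bfs2: "wp p_bfs s3 (2000 * (n + 1) * card ?C) (\<lambda>s'. \<exists>i. length (bfs ad ord z i) \<le> i \<and>
            queue_ok (bfs ad ord z i) (2 * int t + 2) (s' ''q'') (s' ''tail'' 0) (s' ''vis'') \<and>
            s' ''zi'' 0 = int (last_batch ad ord z i))"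
          by (rule p_bfs[OF t zC g3]) (use R3 sms v2 e3 in auto)
        show "wp (Seq p_bfs (For ''i'' ''tail'' ?b)) s3 (2500 * (n + 1) * card ?C) ?post"
        proof (rule wp_Seq[OF bfs2])
          fix s4 assume "\<exists>i. length (bfs ad ord z i) \<le> i \<and>
            queue_ok (bfs ad ord z i) (2 * int t + 2) (s4 ''q'') (s4 ''tail'' 0) (s4 ''vis'') \<and>
            s4 ''zi'' 0 = int (last_batch ad ord z i)"
          then obtain j where j: "length (bfs ad ord z j) \<le> j"
            "queue_ok (bfs ad ord z j) (2 * int t + 2) (s4 ''q'') (s4 ''tail'' 0) (s4 ''vis'')" by blast
          let ?q = "bfs ad ord z j"
          have qC: "set ?q = ?C" "distinct ?q" using cg.bfs_complete[OF zC j(1)] cg.bfs_basic[OF zC, of j] by blast+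
          have lq: "length ?q \<le> n" using cg.bfs_length[OF zC, of j] Cn by linarith
          have orders: "\<forall>g. rep_on ?C ad M g \<longrightarrow> umbrella_free ad ?q \<and> (nonadj_sorted ad M g ?q \<or> nonadj_sorted ad M g (rev ?q))"
            using cg.double_bfs_order(2)[OF _ a(1) i(1) z_def] by blast
          have v4: "\<forall>v<n. 0 \<le> s4 ''vis'' v \<and> s4 ''vis'' v \<le> 2 * int t + 2" using j(2) unfolding queue_ok_def by blast
          have h4: "holds (s4 ''q'') ?q" "s4 ''tail'' 0 = int (length ?q)" using j(2) by (simp_all add: queue_ok_def)
          show "wp (For ''i'' ''tail'' ?b) s4 (300 * (n + 1)) ?post"
          proof (rule wp_mono[OF mirror[OF h4 lq]])
            show "set ?q \<subseteq> {..<n}" using qC comp_sub[OF t] by simp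
            fix s5 assume h5: "holds (s5 ''q'') (?q @ rev ?q)" and fr5: "\<And>z. z \<notin> wr (For ''i'' ''tail'' ?b) \<Longrightarrow> s5 z = s4 z"
            have "s5 ''tail'' = s4 ''tail''" "s5 ''vis'' = s4 ''vis''" by (rule fr5, simp)+
            thus "?post s5" using h5 qC orders v4 h4(2) by (intro exI[of _ ?q]) simp
          qed simp
        next
          have "300 * (n + 1) * 1 \<le> 300 * (n + 1) * card ?C" using C1 by (intro mult_le_mono2)
          hence "300 * (n + 1) \<le> 300 * (n + 1) * card ?C" by simp
          from seq_time[OF this, of 2000 2500] show "2000 * (n + 1) * card ?C + 300 * (n + 1) \<le> 2500 * (n + 1) * card ?C"
            by (simp add: add.commute)
        qed
      next
        have "csize ?p2 * 7 \<le> 400 * 1 * 1" by simp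
        also have "\<dots> \<le> 400 * (n + 1) * card ?C" using C1 by (intro mult_le_mono) auto
        finally show "csize ?p2 * 7 + 2500 * (n + 1) * card ?C \<le> 2900 * (n + 1) * card ?C"
          by (rule seq_time) simp
      qed
    next
      have "2000 * (n + 1) * card ?C \<le> 2000 * (n + 1) * card ?C" ..
      thus "2000 * (n + 1) * card ?C + 2900 * (n + 1) * card ?C \<le> 5000 * (n + 1) * card ?C"
        by (rule seq_time) simp
    qed
  next
    have "csize ?p1 * 7 \<le> 400 * 1 * 1" by simp
    also have "\<dots> \<le> 400 * (n + 1) * card ?C" using C1 by (intro mult_le_mono) auto
    finally show "csize ?p1 * 7 + 5000 * (n + 1) * card ?C \<le> 6000 * (n + 1) * card ?C"
      by (rule seq_time) simp
  qed
qed

end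

text \<open>\<open>P\<close> stands for the product \<open>n * M\<close>; abstracting it makes the
  estimates linear.\<close>

lemma range_arith:
  fixes a M P N :: int
  assumes "- P - 4 * M \<le> a" "a \<le> P + N" "0 \<le> P" "1 \<le> M" "0 \<le> N"
  shows "\<bar>a\<bar> \<le> 3 * (P + N + 5 * M + 5)" "\<bar>a - M\<bar> \<le> 3 * (P + N + 5 * M + 5)"
    "\<bar>a + M\<bar> \<le> 3 * (P + N + 5 * M + 5)" "\<bar>a + M + 1\<bar> \<le> 3 * (P + N + 5 * M + 5)"
    "- P - 4 * M \<le> b \<Longrightarrow> b \<le> P + N \<Longrightarrow> \<bar>a - b\<bar> \<le> 3 * (P + N + 5 * M + 5)"
  using assms unfolding abs_le_iff distrib_left by - (simp; linarith)+

section \<open>Windows and relaxation for one orientation\<close>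

abbreviation Q_at :: "string \<Rightarrow> aexp" where "Q_at x \<equiv> Cell ''q'' (Plus (Var ''off'') (Var x))"

definition b_window :: com where
  "b_window = Seq (Put ''w'' (Q_at ''j''))
     (If (Equal (Cell ''adj'' (At ''u'' ''w'')) (Const 1))
       (Assign ''ln'' (Var ''i'') (Plus (Var ''j'') (Const 1)))
       (If (Equal (Cell ''fn'' (Var ''i'')) (Var ''j''))
         (Assign ''fn'' (Var ''i'') (Plus (Var ''j'') (Const 1))) Skip))"

definition p_window :: com where
  "p_window = For ''i'' ''tail'' (Seq
     (seqs [Put ''u'' (Q_at ''i''), Assign ''fn'' (Var ''i'') (Const 0), Assign ''ln'' (Var ''i'') (Const 0)])
     (For ''j'' ''tail'' b_window))"

definition p_xinit :: com where
  "p_xinit = For ''i'' ''tail'' (Seq (Put ''y'' (Minus (Cell ''LB'' (Q_at ''i'')) (Var ''base'')))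
     (If (Less (Var ''y'') (Var ''c1'')) (Assign ''x'' (Var ''i'') (Var ''c1'')) (Assign ''x'' (Var ''i'') (Var ''y''))))"

definition b_prefix :: com where
  "b_prefix = If (Less (Cell ''p'' (Var ''i'')) (Cell ''x'' (Var ''i'')))
     (Assign ''p'' (Plus (Var ''i'') (Const 1)) (Cell ''x'' (Var ''i'')))
     (Assign ''p'' (Plus (Var ''i'') (Const 1)) (Cell ''p'' (Var ''i'')))"

text \<open>The other vertices are read only through the prefix maxima \<open>p\<close>, taken
  before the first update. So updating \<open>x\<close> in place still performs a simultaneous
  round.\<close>

definition b_relax :: com where
  "b_relax = seqs [Put ''y'' (Minus (Cell ''p'' (Cell ''ln'' (Var ''i''))) (Var ''M'')),
     Put ''z'' (Plus (Plus (Cell ''p'' (Cell ''fn'' (Var ''i''))) (Var ''M'')) (Const 1)),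
     If (Less (Cell ''x'' (Var ''i'')) (Var ''y'')) (Assign ''x'' (Var ''i'') (Var ''y'')) Skip,
     If (Less (Cell ''x'' (Var ''i'')) (Var ''z'')) (Assign ''x'' (Var ''i'') (Var ''z'')) Skip]"

definition p_round :: com where
  "p_round = Seq (Assign ''p'' (Const 0) (Var ''c2''))
     (Seq (For ''i'' ''tail'' b_prefix) (For ''i'' ''tail'' b_relax))"

definition p_rounds :: com where "p_rounds = For ''rd'' ''tail'' p_round"

lemma wr_attempt [simp]: "wr b_window = {''w'', ''ln'', ''fn''}" "wr b_prefix = {''p''}" "wr b_relax = {''y'', ''z'', ''x''}"
  "wr p_window = {''i'', ''u'', ''fn'', ''ln'', ''j'', ''w''}" "wr p_xinit = {''i'', ''y'', ''x''}"
  "wr p_round = {''p'', ''i'', ''y'', ''z'', ''x''}" "wr p_rounds = {''rd'', ''p'', ''i'', ''y'', ''z'', ''x''}"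
  by (auto simp: b_window_def b_prefix_def b_relax_def p_window_def p_xinit_def p_round_def p_rounds_def)

context pmain
begin

definition env_names :: "string set" where
  "env_names = {''n'', ''adj'', ''ord'', ''M'', ''tail'', ''off'', ''q'', ''c1'', ''c2'', ''base'', ''LB'', ''UC'', ''ub_den''}"

text \<open>What an attempt reads but never writes. Keeping the names of these arrays in one set
  lets the frame rule transport all of it at once.\<close>

definition env :: "int \<Rightarrow> nat list \<Rightarrow> nat \<Rightarrow> state \<Rightarrow> bool" where
  "env E q off s \<longleftrightarrow> graph_ok s \<and> s ''M'' 0 = M \<and> s ''tail'' 0 = int (length q) \<and> s ''off'' 0 = int off \<and>
     (\<forall>i<length q. s ''q'' (off + i) = int (q ! i)) \<and> s ''c1'' 0 = c_init \<and> s ''c2'' 0 = c_pre \<and>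
     s ''base'' 0 = base E q \<and> (\<forall>v\<in>set q. s ''LB'' v = lb E v) \<and> (\<forall>v<n. s ''UC'' v = UC v) \<and>
     (\<forall>v<n. s ''ub_den'' v = bound_den (ubounds I ! v))"

lemma env_frame:
  assumes "env E q off s" "\<And>z. z \<notin> X \<Longrightarrow> s' z = s z" "X \<inter> env_names = {}"
  shows "env E q off s'"
proof -
  have "s' z = s z" if "z \<in> env_names" for z using assms(2)[of z] assms(3) that by blast
  hence "s' ''n'' = s ''n''" "s' ''adj'' = s ''adj''" "s' ''ord'' = s ''ord''" "s' ''M'' = s ''M''" "s' ''tail'' = s ''tail''"
    "s' ''off'' = s ''off''" "s' ''q'' = s ''q''" "s' ''c1'' = s ''c1''" "s' ''c2'' = s ''c2''" "s' ''base'' = s ''base''"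
    "s' ''LB'' = s ''LB''" "s' ''UC'' = s ''UC''" "s' ''ub_den'' = s ''ub_den''" by (simp_all add: env_names_def)
  thus ?thesis using assms(1) unfolding env_def graph_ok_def adj_ok_def by simp
qed

end

text \<open>One run of the relaxation. The offset \<open>off\<close> is 0 for the searched order and
  \<open>length q\<close> for its mirror image; the bound on \<open>E\<close> comes from
  \<open>EB_le\<close>.\<close>

locale attempt = pmain I D L rk for I D L rk +
  fixes t :: nat and E :: int and q :: "nat list" and off :: nat
  assumes t: "t < length Cs" and setq: "set q = Cs ! t" and distq: "distinct q" and off: "off \<le> n"
    and E_abs: "\<bar>E\<bar> \<le> 2 ^ (7 * input_size I)"
begin

abbreviation k where "k \<equiv> length q"

lemma k_bounds: "1 \<le> k" "k \<le> n" "k = card (Cs ! t)"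
proof -
  show kc: "k = card (Cs ! t)" using setq distq distinct_card by metis
  show "1 \<le> k" "k \<le> n" unfolding kc using comp_card_pos[OF t] comp_card_le[OF t] by simp_all
qed

lemma q_less: "i < k \<Longrightarrow> q ! i < n"
  using nth_mem[of i q] setq comp_sub[OF t] by auto

lemma sm: "a \<le> 5 * n + 2 \<Longrightarrow> small (int a)" by (rule small_le)

lemma sm_idx: "i < k \<Longrightarrow> small (int i)" "i < k \<Longrightarrow> small (int i + 1)" "i < k \<Longrightarrow> small (int off + int i)"
   "i < k \<Longrightarrow> small (int (q ! i))" "small (int k)" "small (int off)" "small (int n)"
proof -
  assume i: "i < k"
  show "small (int i)" using i k_bounds by (intro sm) simp
  have "small (int (i + 1))" using i k_bounds by (intro sm) simp
  thus "small (int i + 1)" by (simp add: add.commute)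
  have "small (int (off + i))" using i k_bounds off by (intro sm) simp
  thus "small (int off + int i)" by simp
  show "small (int (q ! i))" using q_less[OF i] by (intro sm) simp
next
  show "small (int k)" using k_bounds by (intro sm) simp
  show "small (int off)" using off by (intro sm) simp
  show "small (int n)" by (intro sm) simp
qed

lemma nat_off [simp]: "nat (int off + int i) = off + i"
  by simp

lemma wide: "\<bar>a\<bar> \<le> 3 * ((int n + 5) * (M + 1)) \<Longrightarrow> small a"
  using small_wide k_bounds by simp

lemma wide_expand: "(int n + 5) * (M + 1) = int n * M + int n + 5 * M + 5"
  by (simp add: algebra_simps)

text \<open>The range of the coordinates during the relaxation.\<close>

definition inr :: "int \<Rightarrow> bool" where "inr a \<longleftrightarrow> c_pre \<le> a \<and> a \<le> int n * (M + 1)"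

lemma inr_small: "inr a \<Longrightarrow> small a" "inr a \<Longrightarrow> small (a - M)" "inr a \<Longrightarrow> small (a + M)" "inr a \<Longrightarrow> small (a + M + 1)"
    "inr a \<Longrightarrow> inr b \<Longrightarrow> small (a - b)"
proof -
  have e: "int n * (M + 1) = int n * M + int n" by (simp add: algebra_simps)
  have inr: "- (int n * M) - 4 * M \<le> a \<and> a \<le> int n * M + int n" if "inr a" for a
    using that unfolding inr_def c_eq e .
  have n0: "0 \<le> int n" by simp
  note w = wide[unfolded wide_expand]
  note ra = range_arith[OF conjunct1[OF inr] conjunct2[OF inr] nM M1 n0]
  show "inr a \<Longrightarrow> small a" by (rule w, rule ra)
  show "inr a \<Longrightarrow> small (a - M)" by (rule w, rule ra)
  show "inr a \<Longrightarrow> small (a + M)" by (rule w, rule ra)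
  show "inr a \<Longrightarrow> small (a + M + 1)" by (rule w, rule ra)
  show "inr a \<Longrightarrow> inr b \<Longrightarrow> small (a - b)"
    using w[OF ra(5)[OF _ _ conjunct1[OF inr] conjunct2[OF inr]]] by blast
qed

lemma small_c: "small c_init" "small c_pre" "small M" "small (0 - M)"
proof -
  have "1 * M \<le> int n * M" using k_bounds M1 by (intro mult_right_mono) linarith+
  hence m: "M \<le> int n * M" by simp
  have e: "int n * (M + 1) = int n * M + int n" by (simp add: algebra_simps)
  have "inr c_init" "inr c_pre" "inr M" "inr (0 - M)"
    unfolding inr_def e c_eq using m M1 by - (intro conjI; linarith)+
  thus "small c_init" "small c_pre" "small M" "small (0 - M)" by (simp_all only: inr_small(1))
qed

text \<open>There are at most \<open>n\<close> rounds, each of which raises the coordinates by at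
  most \<open>M + 1\<close>, and they start at 0 or below.\<close>

lemma inr_rounds: "i < k \<Longrightarrow> m \<le> k \<Longrightarrow> inr (x_rounds E (base E q) q m i)"
proof -
  assume i: "i < k" and m: "m \<le> k"
  have "int m * (M + 1) \<le> int n * (M + 1)" using m k_bounds M1 by (intro mult_right_mono) auto
  thus ?thesis using x_rounds_bound[OF i, of E m] by (simp add: inr_def)
qed

lemma inr_prefix: "(\<And>i. i < j \<Longrightarrow> inr (x i)) \<Longrightarrow> inr (prefix_max c_pre x j)"
proof -
  assume x: "\<And>i. i < j \<Longrightarrow> inr (x i)"
  have "0 \<le> int n * (M + 1)" using M1 by simp
  hence "inr c_pre" using c_pre_le(2) by (simp add: inr_def)
  thus ?thesis using prefix_max_attained[of c_pre x j] x by metis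
qed

lemma time_k: "c + 100 \<le> K \<Longrightarrow> c * 7 * k + 100 * (k + 1) \<le> 7 * K * (n + (1::nat))"
proof -
  assume c: "c + 100 \<le> K"
  have "c * 7 * k + 100 * (k + 1) \<le> K * 7 * (k + 1)" by (rule for_time[OF c]) simp
  also have "\<dots> = 7 * K * (k + 1)" by (rule arg_cong[of _ _ "\<lambda>x. x * (k + 1)"], rule mult.commute)
  also have "\<dots> \<le> 7 * K * (n + 1)" using k_bounds(2) by (intro mult_le_mono2 add_right_mono)
  finally show ?thesis .
qed

lemma p_window:
  assumes env: "env E q off s"
  shows "wp p_window s (1500 * (n + 1) * k) (\<lambda>s. \<forall>i<k. s ''fn'' i = int (first_nb q i) \<and> s ''ln'' i = int (last_nb q i))"
proof -
  define T where "T i fa la \<longleftrightarrow> (\<forall>j<i. fa j = int (first_nb q j) \<and> la j = int (last_nb q j))"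
    for i and fa la :: "nat \<Rightarrow> int"
  define P where "P i j \<longleftrightarrow> ad (q ! i) (q ! j)" for i j
  \<comment> \<open>The invariant of the inner loop: all rows before \<open>i\<close> are complete
    and row \<open>i\<close> has been scanned up to column \<open>j\<close>.\<close>
  define W where "W i j fa la \<longleftrightarrow> T i fa la \<and> fa i = int (first_adj (P i) j) \<and> la i = int (last_adj (P i) j)"
    for i j and fa la :: "nat \<Rightarrow> int"
  have T_upd: "T i (fa(i := a)) la = T i fa la" "T i fa (la(i := a)) = T i fa la" for i a fa la
    by (auto simp: T_def)
  have W0: "W i 0 (fa(i := 0)) (la(i := 0))" if "T i fa la" for i fa la
    using that by (auto simp: W_def T_def)
  have W1: "W i (Suc j) fa (la(i := int j + 1))" if "W i j fa la" "P i j" for i j fa la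
    using that by (auto simp: W_def T_def)
  have W2: "W i (Suc j) (fa(i := int j + 1)) la" if "W i j fa la" "\<not> P i j" "first_adj (P i) j = j" for i j fa la
    using that by (auto simp: W_def T_def)
  have W3: "W i (Suc j) fa la" if "W i j fa la" "\<not> P i j" "first_adj (P i) j \<noteq> j" for i j fa la
    using that by (auto simp: W_def T_def)
  have WT: "T (Suc i) fa la" if "W i k fa la" for i fa la
    using that by (auto simp: W_def T_def first_nb_def last_nb_def P_def[abs_def] less_Suc_eq)
  let ?p = "seqs [Put ''u'' (Q_at ''i''), Assign ''fn'' (Var ''i'') (Const 0), Assign ''ln'' (Var ''i'') (Const 0)]"
  show ?thesis unfolding p_window_def
  proof (rule wp_For[where I = "\<lambda>i s. T i (s ''fn'') (s ''ln'')" and N = k and Tb = "\<lambda>_. 1300 * (n + 1)"])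
    show "s ''tail'' 0 = int k" using env by (simp add: env_def)
    show "small (int k)" by (rule sm_idx)
    show "T 0 (store s ''i'' 0 0 ''fn'') (store s ''i'' 0 0 ''ln'')" by (simp add: T_def)
    have "100 * (k + 1) \<le> 200 * 1 * k" using k_bounds by simp
    also have "\<dots> \<le> 200 * (n + 1) * k" by (intro mult_le_mono) auto
    finally have "k * (1300 * (n + 1)) + 100 * (k + 1) \<le> 1500 * (n + 1) * k" by (rule loop_time) simp
    thus "(\<Sum>i<k. 1300 * (n + 1)) + 100 * (k + 1) \<le> 1500 * (n + 1) * k"
      by (simp only: sum_constant card_lessThan of_nat_id)
  next
    fix i s1 assume i: "i < k" and T: "T i (s1 ''fn'') (s1 ''ln'')" and ii: "s1 ''i'' 0 = int i"
      and fr: "\<And>z. z \<notin> insert ''i'' (wr (Seq ?p (For ''j'' ''tail'' b_window))) \<Longrightarrow> s1 z = s z"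
    have env1: "env E q off s1" by (rule env_frame[OF env], erule fr) (simp add: env_names_def)
    show "wp (Seq ?p (For ''j'' ''tail'' b_window)) s1 (1300 * (n + 1))
      (\<lambda>s'. T (Suc i) (store s' ''i'' 0 (int (Suc i)) ''fn'') (store s' ''i'' 0 (int (Suc i)) ''ln''))"
    proof (rule wp_Seq_sl[OF md_W, where R = "\<lambda>s. W i 0 (s ''fn'') (s ''ln'') \<and> s ''u'' 0 = int (q ! i)"])
      have "s1 ''off'' 0 = int off" "s1 ''q'' (off + i) = int (q ! i)" using env1 i by (simp_all add: env_def)
      thus "sl addr small small ?p s1 (\<lambda>s. W i 0 (s ''fn'') (s ''ln'') \<and> s ''u'' 0 = int (q ! i))"
        using ii sm_idx(1,3,4)[OF i] sm_idx(6) W0[OF T] by (simp add: addr_def)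
    next
      fix s2 assume R: "W i 0 (s2 ''fn'') (s2 ''ln'') \<and> s2 ''u'' 0 = int (q ! i)" and fr2: "\<And>z. z \<notin> wr ?p \<Longrightarrow> s2 z = s1 z"
      have env2: "env E q off s2" by (rule env_frame[OF env1], erule fr2) (simp add: env_names_def)
      have i2: "s2 ''i'' 0 = int i" using fr2[of "''i''"] ii by simp
      show "wp (For ''j'' ''tail'' b_window) s2 (1100 * (n + 1))
        (\<lambda>s'. T (Suc i) (store s' ''i'' 0 (int (Suc i)) ''fn'') (store s' ''i'' 0 (int (Suc i)) ''ln''))"
      proof (rule wp_For_W[where I = "\<lambda>j s. W i j (s ''fn'') (s ''ln'')" and N = k])
        show "s2 ''tail'' 0 = int k" using env2 by (simp add: env_def)
        show "small (int k)" by (rule sm_idx)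
        show "W i 0 (store s2 ''j'' 0 0 ''fn'') (store s2 ''j'' 0 0 ''ln'')" using R by simp
        have "csize b_window * 7 * k + 100 * (k + 1) \<le> 7 * 150 * (n + 1)" by (rule time_k) (simp add: b_window_def)
        also have "\<dots> \<le> 1100 * (n + 1)" by simp
        finally show "csize b_window * 7 * k + 100 * (k + 1) \<le> 1100 * (n + 1)" .
      next
        fix j s3 assume j: "j < k" and W: "W i j (s3 ''fn'') (s3 ''ln'')" and jj: "s3 ''j'' 0 = int j"
          and fr3: "\<And>z. z \<notin> insert ''j'' (wr b_window) \<Longrightarrow> s3 z = s2 z"
        have env3: "env E q off s3" by (rule env_frame[OF env2], erule fr3) (simp add: env_names_def)
        have e: "s3 ''off'' 0 = int off" "s3 ''q'' (off + j) = int (q ! j)" "s3 ''n'' 0 = int n"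
            "s3 ''adj'' (q ! i * n + q ! j) = (if P i j then 1 else 0)"
          using env3 i j q_less[OF i] q_less[OF j] by (simp_all add: env_def graph_ok_def adj_ok_def P_def)
        have e': "s3 ''u'' 0 = int (q ! i)" "s3 ''i'' 0 = int i" using fr3[of "''u''"] fr3[of "''i''"] R i2 by simp_all
        have fi: "s3 ''fn'' i = int (first_adj (P i) j)" using W by (simp add: W_def)
        have sf: "small (int (first_adj (P i) j))" using first_adj(1)[of "P i" j] j k_bounds by (intro sm) simp
        note sa = small_addr[OF q_less[OF i] q_less[OF j]] small_row[OF q_less[OF i]] addr_At[OF q_less[OF i] q_less[OF j]]
        note ss = sm_idx(1)[OF i] sm_idx(4)[OF i] sm_idx(1)[OF j] sm_idx(2)[OF j] sm_idx(3)[OF j] sm_idx(4)[OF j] sm_idx(6) sm_idx(7)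
        note w1 = W1[OF W] note w2 = W2[OF W] note w3 = W3[OF W]
        show "sl addr small small b_window s3 (\<lambda>s'. W i (Suc j) (store s' ''j'' 0 (int (Suc j)) ''fn'') (store s' ''j'' 0 (int (Suc j)) ''ln''))"
        proof (cases "P i j")
          case True
          thus ?thesis unfolding b_window_def using e e' jj sa ss w1 by (simp add: addr_def)
        next
          case False
          thus ?thesis unfolding b_window_def using e e' jj sa ss w2 w3 fi sf by (simp add: addr_def)
        qed
      next
        fix s3 assume "W i k (s3 ''fn'') (s3 ''ln'')"
        from WT[OF this] show "T (Suc i) (store s3 ''i'' 0 (int (Suc i)) ''fn'') (store s3 ''i'' 0 (int (Suc i)) ''ln'')" by simp
      qed simp_all
    next
      show "csize ?p * 7 + 1100 * (n + 1) \<le> 1300 * (n + 1)" by simp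
    qed
  next
    fix s1 assume "T k (s1 ''fn'') (s1 ''ln'')"
    thus "\<forall>i<k. s1 ''fn'' i = int (first_nb q i) \<and> s1 ''ln'' i = int (last_nb q i)" by (simp add: T_def)
  qed simp_all
qed

text \<open>The position \<open>E\<close> dominates with \<open>7 * r\<close> bits; codes of bounds
  have \<open>3 * r + 1\<close> bits and \<open>M\<close> fewer still.\<close>

lemma big_bounds: "v \<in> set q \<Longrightarrow> \<bar>lb E v\<bar> \<le> 2 ^ (7 * r + 1)" "\<bar>base E q\<bar> \<le> 2 ^ (7 * r + 1)"
proof -
  have m: "\<bar>M + 1\<bar> \<le> 2 ^ (7 * r)"
  proof -
    have "int (r\<^sup>2) \<le> 2 ^ r * 2 ^ r" using mult_mono[OF r_le_pow r_le_pow] by (simp add: power2_eq_square)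
    also have "\<dots> = 2 ^ (2 * r)" by (simp add: power_add mult_2)
    finally have a: "M \<le> 2 ^ (2 * r)" using M_le by linarith
    have "(2::int) ^ (2 * r + 1) = 2 * 2 ^ (2 * r)" by simp
    moreover have "1 \<le> (2::int) ^ (2 * r)" by simp
    ultimately have "\<bar>M + 1\<bar> \<le> 2 ^ (2 * r + 1)" using a M1 by linarith
    also have "\<dots> \<le> 2 ^ (7 * r)" using r2 by (intro pow_mono) simp
    finally show ?thesis .
  qed
  have p: "(2::int) ^ (7 * r + 1) = 2 * 2 ^ (7 * r)" by simp
  have p2: "(2::int) ^ (3 * r + 1) \<le> 2 ^ (7 * r)" using r2 by (intro pow_mono) simp
  have e: "\<bar>E + M + 1\<bar> \<le> 2 ^ (7 * r + 1)" using E_abs m p by linarith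
  have l: "\<bar>lb E v\<bar> \<le> 2 ^ (7 * r + 1)" if "v \<in> set q" for v
  proof -
    have "v < n" using that setq comp_sub[OF t] by auto
    hence "\<bar>LC v\<bar> \<le> 2 ^ (7 * r + 1)" using LC_abs[of v] p p2 by linarith
    thus ?thesis using e by (auto simp: lb_def max_def)
  qed
  thus "v \<in> set q \<Longrightarrow> \<bar>lb E v\<bar> \<le> 2 ^ (7 * r + 1)" .
  show "\<bar>base E q\<bar> \<le> 2 ^ (7 * r + 1)"
    using prefix_max_attained[of "E + M + 1" "\<lambda>i. lb E (q ! i)" k] unfolding base_def
  proof
    assume "prefix_max (E + M + 1) (\<lambda>i. lb E (q ! i)) k = E + M + 1"
    thus "\<bar>prefix_max (E + M + 1) (\<lambda>i. lb E (q ! i)) k\<bar> \<le> 2 ^ (7 * r + 1)" using e by simp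
  next
    assume "\<exists>j<k. prefix_max (E + M + 1) (\<lambda>i. lb E (q ! i)) k = lb E (q ! j)"
    then obtain j where j: "j < k" "prefix_max (E + M + 1) (\<lambda>i. lb E (q ! i)) k = lb E (q ! j)" by blast
    show "\<bar>prefix_max (E + M + 1) (\<lambda>i. lb E (q ! i)) k\<bar> \<le> 2 ^ (7 * r + 1)" unfolding j(2) by (rule l) (use j in simp)
  qed
qed

lemma big7: "\<bar>a\<bar> \<le> 2 ^ (7 * r + 2) \<Longrightarrow> big a"
  by (rule bigI[where k = "7 * r + 2"]) (use r2 in auto)

lemma small_abs: "small a \<Longrightarrow> \<bar>a\<bar> \<le> 2 ^ (7 * r + 1)"
proof -
  assume "small a"
  hence "\<bar>a\<bar> \<le> int r ^ 5" by (simp add: small_def)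
  also have "\<dots> \<le> (2 ^ r) ^ 5" using r_le_pow by (intro power_mono) auto
  also have "\<dots> = 2 ^ (5 * r)" by (simp add: power_mult[symmetric] mult.commute)
  also have "\<dots> \<le> 2 ^ (7 * r + 1)" by (intro pow_mono) simp
  finally show ?thesis .
qed

lemma big_facts: "v \<in> set q \<Longrightarrow> big (lb E v)" "big (base E q)" "v \<in> set q \<Longrightarrow> big (lb E v - base E q)"
    "small a \<Longrightarrow> big (base E q + a)"
proof -
  have p: "(2::int) ^ (7 * r + 2) = 2 * 2 ^ (7 * r + 1)" by simp
  have z: "0 \<le> (2::int) ^ (7 * r + 1)" by simp
  show "v \<in> set q \<Longrightarrow> big (lb E v)" by (rule big7) (use big_bounds(1)[of v] p z in linarith)
  show "big (base E q)" by (rule big7) (use big_bounds(2) p z in linarith)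
  show "v \<in> set q \<Longrightarrow> big (lb E v - base E q)" by (rule big7) (use big_bounds(1)[of v] big_bounds(2) p z in linarith)
  show "small a \<Longrightarrow> big (base E q + a)" by (rule big7) (use small_abs[of a] big_bounds(2) p z in linarith)
qed

lemma G1: "G \<ge> 1" by (simp add: G_def)

lemma time_G: "c + 100 \<le> K \<Longrightarrow> c * G * k + 100 * (k + 1) \<le> 2 * K * G * k"
proof -
  assume c: "c + 100 \<le> K"
  have "c * G * k + 100 * (k + 1) \<le> K * G * (k + 1)" by (rule for_time[OF c G1])
  also have "\<dots> \<le> K * G * (2 * k)" using k_bounds by (intro mult_le_mono2) simp
  finally show ?thesis by (simp add: ac_simps)
qed

lemma p_xinit:
  assumes env: "env E q off s"
  shows "wp p_xinit s (300 * G * k) (\<lambda>s. \<forall>i<k. s ''x'' i = x_rounds E (base E q) q 0 i)"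
proof -
  define T where "T i xa \<longleftrightarrow> (\<forall>j<i. xa j = x_init E (base E q) q j)" for i and xa :: "nat \<Rightarrow> int"
  have TS: "T (Suc i) (xa(i := x_init E (base E q) q i))" if "T i xa" for i xa
    using that by (auto simp: T_def less_Suc_eq)
  let ?b = "Seq (Put ''y'' (Minus (Cell ''LB'' (Q_at ''i'')) (Var ''base'')))
     (If (Less (Var ''y'') (Var ''c1'')) (Assign ''x'' (Var ''i'') (Var ''c1'')) (Assign ''x'' (Var ''i'') (Var ''y'')))"
  show ?thesis unfolding p_xinit_def
  proof (rule wp_For_B[where I = "\<lambda>i s. T i (s ''x'')" and N = k])
    show "s ''tail'' 0 = int k" using env by (simp add: env_def)
    show "small (int k)" by (rule sm_idx)
    show "T 0 (store s ''i'' 0 0 ''x'')" by (simp add: T_def)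
    have "csize ?b * G * k + 100 * (k + 1) \<le> 2 * 150 * G * k" by (rule time_G) simp
    thus "csize ?b * G * k + 100 * (k + 1) \<le> 300 * G * k" by simp
  next
    fix i s1 assume i: "i < k" and T: "T i (s1 ''x'')" and ii: "s1 ''i'' 0 = int i"
      and fr: "\<And>z. z \<notin> insert ''i'' (wr ?b) \<Longrightarrow> s1 z = s z"
    have env1: "env E q off s1" by (rule env_frame[OF env], erule fr) (simp add: env_names_def)
    have qi: "q ! i \<in> set q" using i by simp
    have e: "s1 ''off'' 0 = int off" "s1 ''q'' (off + i) = int (q ! i)" "s1 ''base'' 0 = base E q" "s1 ''c1'' 0 = c_init"
      "s1 ''LB'' (q ! i) = lb E (q ! i)" using env1 i qi by (simp_all add: env_def)
    have xi: "x_init E (base E q) q i = (if lb E (q ! i) - base E q < c_init then c_init else lb E (q ! i) - base E q)"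
      by (simp add: x_init_def)
    note ss = sm_idx(1)[OF i] sm_idx(3)[OF i] sm_idx(4)[OF i] sm_idx(6)
    note bs = ss[THEN small_big] small_c(1)[THEN small_big] big_facts(1)[OF qi] big_facts(2) big_facts(3)[OF qi]
    show "sl addr big big ?b s1 (\<lambda>s'. T (Suc i) (store s' ''i'' 0 (int (Suc i)) ''x''))"
    proof (cases "lb E (q ! i) - base E q < c_init")
      case True
      thus ?thesis using ii e ss bs TS[OF T] xi by (simp add: addr_def)
    next
      case False
      thus ?thesis using ii e ss bs TS[OF T] xi by (simp add: addr_def)
    qed
  next
    fix s1 assume "T k (s1 ''x'')"
    thus "\<forall>i<k. s1 ''x'' i = x_rounds E (base E q) q 0 i" by (simp add: T_def x_rounds_def)
  qed simp_all
qed

lemma p_round: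
  assumes env: "env E q off s" and nb: "\<forall>i<k. s ''fn'' i = int (first_nb q i) \<and> s ''ln'' i = int (last_nb q i)"
    and x: "\<forall>i<k. s ''x'' i = x i" "\<forall>i<k. inr (x i)" and y: "\<forall>i<k. inr (relax c_pre M (first_nb q) (last_nb q) x i)"
  shows "wp p_round s (2700 * (n + 1)) (\<lambda>s. \<forall>i<k. s ''x'' i = relax c_pre M (first_nb q) (last_nb q) x i)"
proof -
  let ?p = "prefix_max c_pre x"
  let ?y = "relax c_pre M (first_nb q) (last_nb q) x"
  define P where "P j pa \<longleftrightarrow> (\<forall>i\<le>j. pa i = ?p i)" for j and pa :: "nat \<Rightarrow> int"
  \<comment> \<open>Positions below \<open>j\<close> hold the values of the new round and the others
    still those of the old one.\<close>
  define X where "X j xa \<longleftrightarrow> (\<forall>i<k. xa i = (if i < j then ?y i else x i))" for j and xa :: "nat \<Rightarrow> int"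
  have PS: "P (Suc j) (pa(Suc j := ?p (Suc j)))" if "P j pa" for j pa
    using that by (auto simp: P_def le_Suc_eq)
  have XS: "X (Suc j) xa'" if "X j xa" "xa' j = ?y j" "\<And>i. i \<noteq> j \<Longrightarrow> xa' i = xa i" for j xa xa'
    using that unfolding X_def by (metis less_Suc_eq)
  have ip: "inr (?p j)" if "j \<le> k" for j using that x(2) by (intro inr_prefix) auto
  have prefix: "wp (For ''i'' ''tail'' b_prefix) s1 (1000 * (n + 1)) (\<lambda>s. P k (s ''p''))"
    if env1: "env E q off s1" and P0: "P 0 (s1 ''p'')" and x1: "\<forall>i<k. s1 ''x'' i = x i" for s1
  proof (rule wp_For_W[where I = "\<lambda>j s. P j (s ''p'')" and N = k])
    show "s1 ''tail'' 0 = int k" using env1 by (simp add: env_def)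
    show "small (int k)" by (rule sm_idx)
    show "P 0 (store s1 ''i'' 0 0 ''p'')" using P0 by simp
    have "csize b_prefix * 7 * k + 100 * (k + 1) \<le> 7 * 140 * (n + 1)" by (rule time_k) (simp add: b_prefix_def)
    also have "\<dots> \<le> 1000 * (n + 1)" by simp
    finally show "csize b_prefix * 7 * k + 100 * (k + 1) \<le> 1000 * (n + 1)" .
  next
    fix j s2 assume j: "j < k" and P: "P j (s2 ''p'')" and jj: "s2 ''i'' 0 = int j"
      and fr: "\<And>z. z \<notin> insert ''i'' (wr b_prefix) \<Longrightarrow> s2 z = s1 z"
    have e: "s2 ''p'' j = ?p j" "s2 ''x'' j = x j" using P fr[of "''x''"] x1 j by (simp_all add: P_def)
    have s: "small (?p j)" "small (x j)" using inr_small(1) ip[of j] x(2) j by auto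
    have na: "nat (int j + 1) = Suc j" by simp
    have pS: "?p (Suc j) = (if ?p j < x j then x j else ?p j)" by simp
    show "sl addr small small b_prefix s2 (\<lambda>s'. P (Suc j) (store s' ''i'' 0 (int (Suc j)) ''p''))"
    proof (cases "?p j < x j")
      case True
      hence "P (Suc j) ((s2 ''p'')(Suc j := x j))" using PS[OF P] pS by simp
      thus ?thesis unfolding b_prefix_def using jj e s na True sm_idx(1,2)[OF j] by (simp add: addr_def)
    next
      case False
      hence "P (Suc j) ((s2 ''p'')(Suc j := ?p j))" using PS[OF P] pS by simp
      thus ?thesis unfolding b_prefix_def using jj e s na False sm_idx(1,2)[OF j] by (simp add: addr_def)
    qed
  qed simp_all
  have relax: "wp (For ''i'' ''tail'' b_relax) s1 (1500 * (n + 1)) (\<lambda>s. X k (s ''x''))"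
    if env1: "env E q off s1" and P1: "P k (s1 ''p'')" and x1: "\<forall>i<k. s1 ''x'' i = x i"
      and nb1: "\<forall>i<k. s1 ''fn'' i = int (first_nb q i) \<and> s1 ''ln'' i = int (last_nb q i)" for s1
  proof (rule wp_For_W[where I = "\<lambda>j s. X j (s ''x'')" and N = k])
    show "s1 ''tail'' 0 = int k" using env1 by (simp add: env_def)
    show "small (int k)" by (rule sm_idx)
    show "X 0 (store s1 ''i'' 0 0 ''x'')" using x1 by (simp add: X_def)
    have "csize b_relax * 7 * k + 100 * (k + 1) \<le> 7 * 200 * (n + 1)" by (rule time_k) (simp add: b_relax_def)
    also have "\<dots> \<le> 1500 * (n + 1)" by simp
    finally show "csize b_relax * 7 * k + 100 * (k + 1) \<le> 1500 * (n + 1)" .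
  next
    fix j s2 assume j: "j < k" and X: "X j (s2 ''x'')" and jj: "s2 ''i'' 0 = int j"
      and fr: "\<And>z. z \<notin> insert ''i'' (wr b_relax) \<Longrightarrow> s2 z = s1 z"
    have env2: "env E q off s2" by (rule env_frame[OF env1], erule fr) (simp add: env_names_def)
    define h where "h = last_nb q j"
    define l where "l = first_nb q j"
    have hl: "h \<le> k" "l \<le> k" using nb_bounds[of q j] by (simp_all add: h_def l_def)
    have e: "s2 ''ln'' j = int h" "s2 ''fn'' j = int l" "s2 ''p'' h = ?p h" "s2 ''p'' l = ?p l" "s2 ''x'' j = x j" "s2 ''M'' 0 = M"
      using fr[of "''ln''"] fr[of "''fn''"] fr[of "''p''"] nb1 j P1 hl X env2 by (simp_all add: P_def h_def l_def X_def env_def)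
    have ss: "small (int h)" "small (int l)" using hl k_bounds by (auto intro!: sm)
    have sp: "small (?p h)" "small (?p h - M)" "small (?p l)" "small (?p l + M)" "small (?p l + M + 1)" "small (x j)" "small (?y j)"
      using inr_small(1,2)[OF ip[OF hl(1)]] inr_small(1,3,4)[OF ip[OF hl(2)]] inr_small(1) x(2) y j by auto
    have yj: "?y j = max (max (x j) (?p h - M)) (?p l + M + 1)" by (simp add: relax_def h_def l_def)
    have fin: "X (Suc j) ((s2 ''x'')(j := ?y j))" by (rule XS[OF X]) auto
    have fin2: "X (Suc j) (s2 ''x'')" if "?y j = x j" by (rule XS[OF X]) (use e(5) that in auto)
    define y1 where "y1 = ?p h - M"
    define z1 where "z1 = ?p l + M + 1"
    have yz: "?y j = max (max (x j) y1) z1" using yj by (simp add: y1_def z1_def)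
    have sy: "small y1" "small z1" using sp by (simp_all add: y1_def z1_def)
    consider "x j < y1" "y1 < z1" | "x j < y1" "\<not> y1 < z1" | "\<not> x j < y1" "x j < z1" | "\<not> x j < y1" "\<not> x j < z1" by blast
    thus "sl addr small small b_relax s2 (\<lambda>s'. X (Suc j) (store s' ''i'' 0 (int (Suc j)) ''x''))"
    proof cases
      case 1
      hence "X (Suc j) ((s2 ''x'')(j := z1))" using fin yz by simp
      thus ?thesis unfolding b_relax_def using 1 jj e ss sp sy sm_idx(1)[OF j] small_c(3)
        unfolding y1_def z1_def by (simp add: addr_def)
    next
      case 2
      hence "X (Suc j) ((s2 ''x'')(j := y1))" using fin yz by simp
      thus ?thesis unfolding b_relax_def using 2 jj e ss sp sy sm_idx(1)[OF j] small_c(3)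
        unfolding y1_def z1_def by (simp add: addr_def)
    next
      case 3
      hence "X (Suc j) ((s2 ''x'')(j := z1))" using fin yz by simp
      thus ?thesis unfolding b_relax_def using 3 jj e ss sp sy sm_idx(1)[OF j] small_c(3)
        unfolding y1_def z1_def by (simp add: addr_def)
    next
      case 4
      hence "X (Suc j) (s2 ''x'')" using fin2 yz by simp
      thus ?thesis unfolding b_relax_def using 4 jj e ss sp sy sm_idx(1)[OF j] small_c(3)
        unfolding y1_def z1_def by (simp add: addr_def)
    qed
  qed simp_all
  let ?a = "Assign ''p'' (Const 0) (Var ''c2'')"
  show ?thesis unfolding p_round_def
  proof (rule wp_Seq_sl[OF md_W, where R = "\<lambda>s. P 0 (s ''p'')"])
    have "s ''c2'' 0 = c_pre" using env by (simp add: env_def)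
    thus "sl addr small small ?a s (\<lambda>s. P 0 (s ''p''))" using small_c by (simp add: P_def)
  next
    fix s1 assume P0: "P 0 (s1 ''p'')" and fr1: "\<And>z. z \<notin> wr ?a \<Longrightarrow> s1 z = s z"
    have env1: "env E q off s1" by (rule env_frame[OF env], erule fr1) (simp add: env_names_def)
    have e1: "s1 ''x'' = s ''x''" "s1 ''fn'' = s ''fn''" "s1 ''ln'' = s ''ln''" by (rule fr1, simp)+
    have x1: "\<forall>i<k. s1 ''x'' i = x i" using x e1 by simp
    show "wp (Seq (For ''i'' ''tail'' b_prefix) (For ''i'' ''tail'' b_relax)) s1 (2600 * (n + 1)) (\<lambda>s. \<forall>i<k. s ''x'' i = ?y i)"
    proof (rule wp_Seq[OF prefix[OF env1 P0 x1]])
      fix s2 assume P2: "P k (s2 ''p'')" and fr2: "\<And>z. z \<notin> wr (For ''i'' ''tail'' b_prefix) \<Longrightarrow> s2 z = s1 z"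
      have env2: "env E q off s2" by (rule env_frame[OF env1], erule fr2) (simp add: env_names_def)
      have e2: "s2 ''x'' = s1 ''x''" "s2 ''fn'' = s1 ''fn''" "s2 ''ln'' = s1 ''ln''" by (rule fr2, simp)+
      show "wp (For ''i'' ''tail'' b_relax) s2 (1500 * (n + 1)) (\<lambda>s. \<forall>i<k. s ''x'' i = ?y i)"
        by (rule wp_mono[OF relax[OF env2 P2] order_refl]) (use x1 nb e1 e2 in \<open>auto simp: X_def\<close>)
    qed simp
  next
    show "csize ?a * 7 + 2600 * (n + 1) \<le> 2700 * (n + 1)" by simp
  qed
qed

lemma p_rounds:
  assumes env: "env E q off s" and nb: "\<forall>i<k. s ''fn'' i = int (first_nb q i) \<and> s ''ln'' i = int (last_nb q i)"
    and x: "\<forall>i<k. s ''x'' i = x_rounds E (base E q) q 0 i"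
  shows "wp p_rounds s (3000 * (n + 1) * k) (\<lambda>s. \<forall>i<k. s ''x'' i = x_fin E (base E q) q i)"
  unfolding p_rounds_def
proof (rule wp_For[where I = "\<lambda>m s. \<forall>i<k. s ''x'' i = x_rounds E (base E q) q m i" and N = k and Tb = "\<lambda>_. 2700 * (n + 1)"])
  show "s ''tail'' 0 = int k" using env by (simp add: env_def)
  show "small (int k)" by (rule sm_idx)
  show "\<forall>i<k. store s ''rd'' 0 0 ''x'' i = x_rounds E (base E q) q 0 i" using x by simp
  have "100 * (k + 1) \<le> 200 * 1 * k" using k_bounds by simp
  also have "\<dots> \<le> 200 * (n + 1) * k" by (intro mult_le_mono) auto
  finally have "k * (2700 * (n + 1)) + 100 * (k + 1) \<le> 3000 * (n + 1) * k" by (rule loop_time) simp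
  thus "(\<Sum>i<k. 2700 * (n + 1)) + 100 * (k + 1) \<le> 3000 * (n + 1) * k"
    by (simp only: sum_constant card_lessThan of_nat_id)
next
  fix m s1 assume m: "m < k" and x1: "\<forall>i<k. s1 ''x'' i = x_rounds E (base E q) q m i"
    and fr: "\<And>z. z \<notin> insert ''rd'' (wr p_round) \<Longrightarrow> s1 z = s z"
  have env1: "env E q off s1" by (rule env_frame[OF env], erule fr) (simp add: env_names_def)
  have e1: "s1 ''fn'' = s ''fn''" "s1 ''ln'' = s ''ln''" by (rule fr, simp)+
  have xS: "x_rounds E (base E q) q (Suc m) = relax c_pre M (first_nb q) (last_nb q) (x_rounds E (base E q) q m)"
    by (simp add: x_rounds_def)
  show "wp p_round s1 (2700 * (n + 1)) (\<lambda>s'. \<forall>i<k. store s' ''rd'' 0 (int (Suc m)) ''x'' i = x_rounds E (base E q) q (Suc m) i)"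
  proof (rule wp_mono[OF p_round[OF env1 _ x1] order_refl])
    show "\<forall>i<k. s1 ''fn'' i = int (first_nb q i) \<and> s1 ''ln'' i = int (last_nb q i)" using nb e1 by simp
    show "\<forall>i<k. inr (x_rounds E (base E q) q m i)" using inr_rounds[of _ m] m by simp
    show "\<forall>i<k. inr (relax c_pre M (first_nb q) (last_nb q) (x_rounds E (base E q) q m) i)"
      unfolding xS[symmetric] using inr_rounds[of _ "Suc m"] m by simp
  qed (simp add: xS)
next
  fix s1 assume "\<forall>i<k. s1 ''x'' i = x_rounds E (base E q) q k i"
  thus "\<forall>i<k. s1 ''x'' i = x_fin E (base E q) q i" by (simp add: x_fin_def)
qed simp_all

end

section \<open>Checking an orientation and keeping the better result\<close>

definition b_pair :: com where
  "b_pair = seqs [Put ''w'' (Q_at ''j''),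
     Put ''y'' (Minus (Cell ''x'' (Var ''i'')) (Cell ''x'' (Var ''j''))), Put ''z'' (Const 0),
     If (And (Not (Less (Var ''M'') (Var ''y''))) (Not (Less (Var ''y'') (Minus (Const 0) (Var ''M''))))) (Put ''z'' (Const 1)) Skip,
     If (Equal (Cell ''adj'' (At ''u'' ''w'')) (Var ''z'')) Skip (Put ''ok'' (Const 0))]"

definition p_pairs :: com where
  "p_pairs = For ''i'' ''tail'' (Seq (Put ''u'' (Q_at ''i'')) (For ''j'' ''tail'' b_pair))"

definition p_upper :: com where
  "p_upper = For ''i'' ''tail'' (Seq (Put ''u'' (Q_at ''i''))
     (If (And (Not (Equal (Cell ''ub_den'' (Var ''u'')) (Const 0)))
         (Less (Cell ''UC'' (Var ''u'')) (Plus (Var ''base'') (Cell ''x'' (Var ''i'')))))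
       (Put ''ok'' (Const 0)) Skip))"

definition p_max :: com where
  "p_max = Seq (Put ''mx'' (Var ''c2'')) (For ''i'' ''tail''
     (If (Less (Var ''mx'') (Cell ''x'' (Var ''i''))) (Put ''mx'' (Cell ''x'' (Var ''i''))) Skip))"

text \<open>The new result replaces the stored one if it is accepted and either none is stored or it
  ends strictly further left.\<close>

definition p_best :: com where
  "p_best = If (And (Equal (Var ''ok'') (Const 1)) (Not (And (Equal (Var ''bok'') (Const 1)) (Not (Less (Var ''mx'') (Var ''bmx''))))))
     (Seq (Seq (Put ''bok'' (Const 1)) (Put ''bmx'' (Var ''mx'')))
       (For ''i'' ''tail'' (Assign ''res'' (Q_at ''i'') (Cell ''x'' (Var ''i''))))) Skip"

definition p_attempt :: com where
  "p_attempt = Seq p_window (Seq p_xinit (Seq p_rounds (Seq (Put ''ok'' (Const 1))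
     (Seq p_pairs (Seq p_upper (Seq p_max p_best))))))"

lemma wr_check [simp]: "wr b_pair = {''w'', ''y'', ''z'', ''ok''}" "wr p_pairs = {''i'', ''u'', ''j'', ''w'', ''y'', ''z'', ''ok''}"
  "wr p_upper = {''i'', ''u'', ''ok''}" "wr p_max = {''mx'', ''i''}" "wr p_best = {''bok'', ''bmx'', ''i'', ''res''}"
  by (auto simp: b_pair_def p_pairs_def p_upper_def p_max_def p_best_def)

context attempt
begin

text \<open>For a component of \<open>k\<close> vertices: O(n * k) operations on words, from
  \<open>k\<close> rounds of linear length and the check of all pairs, and O(k) operations on long
  numbers. Linear in \<open>k\<close>, so it sums over the components to the desired bound.\<close>

definition unit_cost :: nat where "unit_cost = (n + 1 + G) * k"

lemma cost1: "c * (n + 1) * k \<le> c * unit_cost" and cost2: "c * G * k \<le> c * unit_cost"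
  and cost3: "c * (n + 1) \<le> c * unit_cost" and cost4: "c \<le> c * unit_cost"
proof -
  have "(n + 1) * k \<le> unit_cost" "G * k \<le> unit_cost" unfolding unit_cost_def by (intro mult_le_mono1; simp)+
  thus "c * (n + 1) * k \<le> c * unit_cost" "c * G * k \<le> c * unit_cost" unfolding mult.assoc by - (erule mult_le_mono2)+
  have "(n + 1) * 1 \<le> (n + 1 + G) * k" using k_bounds(1) by (intro mult_le_mono) auto
  hence "n + 1 \<le> unit_cost" by (simp add: unit_cost_def)
  thus "c * (n + 1) \<le> c * unit_cost" by (rule mult_le_mono2)
  have "1 \<le> unit_cost" using \<open>n + 1 \<le> unit_cost\<close> by simp
  from mult_le_mono2[OF this, of c] show "c \<le> c * unit_cost" by simp
qed

abbreviation x where "x \<equiv> x_fin E (base E q) q"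

lemma x_inr: "i < k \<Longrightarrow> inr (x i)"
  unfolding x_fin_def by (rule inr_rounds) simp_all

lemma p_pairs:
  assumes env: "env E q off s" and xs: "\<forall>i<k. s ''x'' i = x i" and ok: "s ''ok'' 0 = 1"
  shows "wp p_pairs s (3000 * unit_cost) (\<lambda>s. s ''ok'' 0 = (if pairs_ok q x then 1 else 0))"
proof -
  define R where "R i j \<longleftrightarrow> (ad (q ! i) (q ! j) \<longleftrightarrow> \<bar>x i - x j\<bar> \<le> M)" for i j
  \<comment> \<open>The flag after checking all rows before \<open>i\<close> and the first
    \<open>j\<close> entries of row \<open>i\<close>; once 0 it stays 0.\<close>
  define P where "P i j v \<longleftrightarrow> v = (if (\<forall>a<i. \<forall>b<k. R a b) \<and> (\<forall>b<j. R i b) then 1 else (0::int))" for i j v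
  have P01: "v = 0 \<or> v = 1" if "P i j v" for i j v using that by (auto simp: P_def)
  have PT: "P i (Suc j) v" if "P i j v" "R i j" for i j v using that by (auto simp: P_def less_Suc_eq)
  have PF: "P i (Suc j) 0" if "\<not> R i j" for i j using that by (auto simp: P_def)
  have Pn: "P (Suc i) 0 v" if "P i k v" for i v using that by (auto simp: P_def less_Suc_eq)
  have "wp p_pairs s (1500 * (n + 1) * k) (\<lambda>s. s ''ok'' 0 = (if pairs_ok q x then 1 else 0))"
    unfolding p_pairs_def
  proof (rule wp_For[where I = "\<lambda>i s. P i 0 (s ''ok'' 0)" and N = k and Tb = "\<lambda>_. 1300 * (n + 1)"])
    show "s ''tail'' 0 = int k" using env by (simp add: env_def)
    show "small (int k)" by (rule sm_idx)
    show "P 0 0 (store s ''i'' 0 0 ''ok'' 0)" using ok by (simp add: P_def)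
    have "100 * (k + 1) \<le> 200 * 1 * k" using k_bounds by simp
    also have "\<dots> \<le> 200 * (n + 1) * k" by (intro mult_le_mono) auto
    finally have "k * (1300 * (n + 1)) + 100 * (k + 1) \<le> 1500 * (n + 1) * k" by (rule loop_time) simp
    thus "(\<Sum>i<k. 1300 * (n + 1)) + 100 * (k + 1) \<le> 1500 * (n + 1) * k"
      by (simp only: sum_constant card_lessThan of_nat_id)
  next
    fix i s1 assume i: "i < k" and P1: "P i 0 (s1 ''ok'' 0)" and ii: "s1 ''i'' 0 = int i"
      and fr: "\<And>z. z \<notin> insert ''i'' (wr (Seq (Put ''u'' (Q_at ''i'')) (For ''j'' ''tail'' b_pair))) \<Longrightarrow> s1 z = s z"
    have env1: "env E q off s1" by (rule env_frame[OF env], erule fr) (simp add: env_names_def)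
    have x1: "s1 ''x'' = s ''x''" by (rule fr) simp
    show "wp (Seq (Put ''u'' (Q_at ''i'')) (For ''j'' ''tail'' b_pair)) s1 (1300 * (n + 1))
      (\<lambda>s'. P (Suc i) 0 (store s' ''i'' 0 (int (Suc i)) ''ok'' 0))"
    proof (rule wp_Seq_sl[OF md_W, where R = "\<lambda>s. s ''u'' 0 = int (q ! i)"])
      have "s1 ''off'' 0 = int off" "s1 ''q'' (off + i) = int (q ! i)" using env1 i by (simp_all add: env_def)
      thus "sl addr small small (Put ''u'' (Q_at ''i'')) s1 (\<lambda>s. s ''u'' 0 = int (q ! i))"
        using ii sm_idx(1,3,4)[OF i] sm_idx(6) by (simp add: addr_def)
    next
      fix s2 assume u: "s2 ''u'' 0 = int (q ! i)" and fr2: "\<And>z. z \<notin> wr (Put ''u'' (Q_at ''i'')) \<Longrightarrow> s2 z = s1 z"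
      have env2: "env E q off s2" by (rule env_frame[OF env1], erule fr2) (simp add: env_names_def)
      have e2: "s2 ''i'' 0 = int i" "s2 ''x'' = s ''x''" "s2 ''ok'' = s1 ''ok''"
        using fr2[of "''i''"] fr2[of "''x''"] fr2[of "''ok''"] ii x1 by simp_all
      show "wp (For ''j'' ''tail'' b_pair) s2 (1200 * (n + 1)) (\<lambda>s'. P (Suc i) 0 (store s' ''i'' 0 (int (Suc i)) ''ok'' 0))"
      proof (rule wp_For_W[where I = "\<lambda>j s. P i j (s ''ok'' 0)" and N = k])
        show "s2 ''tail'' 0 = int k" using env2 by (simp add: env_def)
        show "small (int k)" by (rule sm_idx)
        show "P i 0 (store s2 ''j'' 0 0 ''ok'' 0)" using P1 e2 by simp
        have "csize b_pair * 7 * k + 100 * (k + 1) \<le> 7 * 170 * (n + 1)" by (rule time_k) (simp add: b_pair_def)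
        also have "\<dots> \<le> 1200 * (n + 1)" by simp
        finally show "csize b_pair * 7 * k + 100 * (k + 1) \<le> 1200 * (n + 1)" .
      next
        fix j s3 assume j: "j < k" and P3: "P i j (s3 ''ok'' 0)" and jj: "s3 ''j'' 0 = int j"
          and fr3: "\<And>z. z \<notin> insert ''j'' (wr b_pair) \<Longrightarrow> s3 z = s2 z"
        have env3: "env E q off s3" by (rule env_frame[OF env2], erule fr3) (simp add: env_names_def)
        have e: "s3 ''off'' 0 = int off" "s3 ''q'' (off + j) = int (q ! j)" "s3 ''n'' 0 = int n" "s3 ''M'' 0 = M"
            "s3 ''adj'' (q ! i * n + q ! j) = (if ad (q ! i) (q ! j) then 1 else 0)"
          using env3 i j q_less[OF i] q_less[OF j] by (simp_all add: env_def graph_ok_def adj_ok_def)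
        have e': "s3 ''u'' 0 = int (q ! i)" "s3 ''i'' 0 = int i" "s3 ''x'' i = x i" "s3 ''x'' j = x j"
          using fr3[of "''u''"] fr3[of "''i''"] fr3[of "''x''"] u e2 xs i j by simp_all
        have sx: "small (x i)" "small (x j)" "small (x i - x j)" using inr_small(1,5) x_inr i j by auto
        note sa = small_addr[OF q_less[OF i] q_less[OF j]] small_row[OF q_less[OF i]] addr_At[OF q_less[OF i] q_less[OF j]]
        note ss = sm_idx(1)[OF i] sm_idx(4)[OF i] sm_idx(1)[OF j] sm_idx(3)[OF j] sm_idx(4)[OF j] sm_idx(6) sm_idx(7) small_c(3,4)
        have sM: "small (- M)" using small_c(4) by simp
        define y where "y = x i - x j"
        have ey: "x i - x j = y" by (simp add: y_def)
        have near: "\<bar>x i - x j\<bar> \<le> M \<longleftrightarrow> \<not> M < y \<and> \<not> y < - M" unfolding ey by linarith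
        note pt = PT[OF P3] note pf = PF[of i j]
        consider "ad (q ! i) (q ! j)" "\<not> M < y" "\<not> y < - M" | "ad (q ! i) (q ! j)" "M < y" | "ad (q ! i) (q ! j)" "\<not> M < y" "y < - M"
          | "\<not> ad (q ! i) (q ! j)" "\<not> M < y" "\<not> y < - M" | "\<not> ad (q ! i) (q ! j)" "M < y" | "\<not> ad (q ! i) (q ! j)" "\<not> M < y" "y < - M"
          by blast
        thus "sl addr small small b_pair s3 (\<lambda>s'. P i (Suc j) (store s' ''j'' 0 (int (Suc j)) ''ok'' 0))"
        proof cases
          case 1
          hence "P i (Suc j) (s3 ''ok'' 0)" using pt near by (simp add: R_def)
          thus ?thesis unfolding b_pair_def using 1 e e' jj sa ss sx[unfolded ey] sM by (simp add: addr_def ey)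
        next
          case 2
          hence "P i (Suc j) 0" using pf near by (simp add: R_def)
          thus ?thesis unfolding b_pair_def using 2 e e' jj sa ss sx[unfolded ey] sM by (simp add: addr_def ey)
        next
          case 3
          hence "P i (Suc j) 0" using pf near by (simp add: R_def)
          thus ?thesis unfolding b_pair_def using 3 e e' jj sa ss sx[unfolded ey] sM by (simp add: addr_def ey)
        next
          case 4
          hence "P i (Suc j) 0" using pf near by (simp add: R_def)
          thus ?thesis unfolding b_pair_def using 4 e e' jj sa ss sx[unfolded ey] sM by (simp add: addr_def ey)
        next
          case 5
          hence "P i (Suc j) (s3 ''ok'' 0)" using pt near by (simp add: R_def)
          thus ?thesis unfolding b_pair_def using 5 e e' jj sa ss sx[unfolded ey] sM by (simp add: addr_def ey)
        next
          case 6
          hence "P i (Suc j) (s3 ''ok'' 0)" using pt near by (simp add: R_def)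
          thus ?thesis unfolding b_pair_def using 6 e e' jj sa ss sx[unfolded ey] sM by (simp add: addr_def ey)
        qed
      next
        fix s3 :: state assume "P i k (s3 ''ok'' 0)"
        thus "P (Suc i) 0 (store s3 ''i'' 0 (int (Suc i)) ''ok'' 0)" using Pn by simp
      qed simp_all
    next
      show "csize (Put ''u'' (Q_at ''i'')) * 7 + 1200 * (n + 1) \<le> 1300 * (n + 1)" by simp
    qed
  next
    fix s1 :: state assume "P k 0 (s1 ''ok'' 0)"
    thus "s1 ''ok'' 0 = (if pairs_ok q x then 1 else 0)" by (simp add: P_def pairs_ok_def R_def)
  qed simp_all
  thus ?thesis by (rule wp_mono) (use cost1[of 1500] in simp_all)
qed

lemma p_upper:
  assumes env: "env E q off s" and xs: "\<forall>i<k. s ''x'' i = x i" and ok: "s ''ok'' 0 = (if b then 1 else 0)"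
  shows "wp p_upper s (400 * unit_cost) (\<lambda>s. s ''ok'' 0 = (if b \<and> upper_ok (base E q) q x then 1 else 0))"
proof -
  define R where "R i \<longleftrightarrow> (ufin (q ! i) \<longrightarrow> base E q + x i \<le> UC (q ! i))" for i
  define P where "P i v \<longleftrightarrow> v = (if b \<and> (\<forall>a<i. R a) then 1 else (0::int))" for i v
  have PT: "P (Suc i) v" if "P i v" "R i" for i v using that by (auto simp: P_def less_Suc_eq)
  have PF: "P (Suc i) 0" if "\<not> R i" for i using that by (auto simp: P_def)
  let ?b = "Seq (Put ''u'' (Q_at ''i''))
     (If (And (Not (Equal (Cell ''ub_den'' (Var ''u'')) (Const 0)))
         (Less (Cell ''UC'' (Var ''u'')) (Plus (Var ''base'') (Cell ''x'' (Var ''i'')))))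
       (Put ''ok'' (Const 0)) Skip)"
  have "wp p_upper s (400 * G * k) (\<lambda>s. s ''ok'' 0 = (if b \<and> upper_ok (base E q) q x then 1 else 0))"
    unfolding p_upper_def
  proof (rule wp_For_B[where I = "\<lambda>i s. P i (s ''ok'' 0)" and N = k])
    show "s ''tail'' 0 = int k" using env by (simp add: env_def)
    show "small (int k)" by (rule sm_idx)
    show "P 0 (store s ''i'' 0 0 ''ok'' 0)" using ok by (simp add: P_def)
    have "csize ?b * G * k + 100 * (k + 1) \<le> 2 * 200 * G * k" by (rule time_G) simp
    thus "csize ?b * G * k + 100 * (k + 1) \<le> 400 * G * k" by simp
  next
    fix i s1 assume i: "i < k" and P1: "P i (s1 ''ok'' 0)" and ii: "s1 ''i'' 0 = int i"
      and fr: "\<And>z. z \<notin> insert ''i'' (wr ?b) \<Longrightarrow> s1 z = s z"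
    have env1: "env E q off s1" by (rule env_frame[OF env], erule fr) (simp add: env_names_def)
    have qn: "q ! i < n" by (rule q_less[OF i])
    have e: "s1 ''off'' 0 = int off" "s1 ''q'' (off + i) = int (q ! i)" "s1 ''base'' 0 = base E q"
      "s1 ''UC'' (q ! i) = UC (q ! i)" "s1 ''ub_den'' (q ! i) = bound_den (ubounds I ! (q ! i))" "s1 ''x'' i = x i"
      using env1 i qn fr[of "''x''"] xs by (simp_all add: env_def)
    have uf: "bound_den (ubounds I ! (q ! i)) = 0 \<longleftrightarrow> \<not> ufin (q ! i)" by (rule rden_ufin[OF qn])
    note ss = sm_idx(1)[OF i] sm_idx(3)[OF i] sm_idx(4)[OF i] sm_idx(6)
    have bU: "big (UC (q ! i))" by (rule big4[OF UC_abs[OF qn]])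
    have bd: "big (bound_den (ubounds I ! (q ! i)))" using rden_big[of "n + q ! i"] rden_u[OF qn] qn by simp
    note sx = inr_small(1)[OF x_inr[OF i]]
    note bs = ss[THEN small_big] big_facts(2) big_facts(4)[OF sx] small_big[OF sx] bU bd
    note pt = PT[OF P1] note pf = PF[of i]
    show "sl addr big big ?b s1 (\<lambda>s'. P (Suc i) (store s' ''i'' 0 (int (Suc i)) ''ok'' 0))"
    proof (cases "ufin (q ! i) \<and> UC (q ! i) < base E q + x i")
      case True
      hence "P (Suc i) 0" using pf by (simp add: R_def)
      thus ?thesis using True uf ii e ss bs by (simp add: addr_def)
    next
      case False
      hence "P (Suc i) (s1 ''ok'' 0)" using pt by (auto simp: R_def)
      thus ?thesis using False uf ii e ss bs by (auto simp: addr_def)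
    qed
  next
    fix s1 :: state assume "P k (s1 ''ok'' 0)"
    thus "s1 ''ok'' 0 = (if b \<and> upper_ok (base E q) q x then 1 else 0)" by (simp add: P_def upper_ok_def R_def)
  qed simp_all
  thus ?thesis by (rule wp_mono) (use cost2[of 400] in simp_all)
qed

lemma p_max:
  assumes env: "env E q off s" and xs: "\<forall>i<k. s ''x'' i = x i"
  shows "wp p_max s (1000 * unit_cost) (\<lambda>s. s ''mx'' 0 = x_max q x)"
proof -
  let ?b = "If (Less (Var ''mx'') (Cell ''x'' (Var ''i''))) (Put ''mx'' (Cell ''x'' (Var ''i''))) Skip"
  have loop: "wp (For ''i'' ''tail'' ?b) s1 (900 * (n + 1)) (\<lambda>s. s ''mx'' 0 = x_max q x)"
    if env1: "env E q off s1" and x1: "\<forall>i<k. s1 ''x'' i = x i" and m: "s1 ''mx'' 0 = c_pre" for s1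
  proof (rule wp_For_W[where I = "\<lambda>i s. s ''mx'' 0 = prefix_max c_pre x i" and N = k])
    show "s1 ''tail'' 0 = int k" using env1 by (simp add: env_def)
    show "small (int k)" by (rule sm_idx)
    show "store s1 ''i'' 0 0 ''mx'' 0 = prefix_max c_pre x 0" using m by simp
    have "csize ?b * 7 * k + 100 * (k + 1) \<le> 7 * 125 * (n + 1)" by (rule time_k) simp
    also have "\<dots> \<le> 900 * (n + 1)" by simp
    finally show "csize ?b * 7 * k + 100 * (k + 1) \<le> 900 * (n + 1)" .
  next
    fix i s2 assume i: "i < k" and m: "s2 ''mx'' 0 = prefix_max c_pre x i" and ii: "s2 ''i'' 0 = int i"
      and fr: "\<And>z. z \<notin> insert ''i'' (wr ?b) \<Longrightarrow> s2 z = s1 z"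
    have e: "s2 ''x'' i = x i" using fr[of "''x''"] x1 i by simp
    have "inr (prefix_max c_pre x i)" using x_inr i by (intro inr_prefix) auto
    note sp = inr_small(1)[OF this] inr_small(1)[OF x_inr[OF i]]
    show "sl addr small small ?b s2 (\<lambda>s'. store s' ''i'' 0 (int (Suc i)) ''mx'' 0 = prefix_max c_pre x (Suc i))"
      using m ii e sp sm_idx(1)[OF i] by (simp add: addr_def max_def)
  qed (simp_all add: x_max_def)
  have "wp p_max s (1000 * (n + 1)) (\<lambda>s. s ''mx'' 0 = x_max q x)" unfolding p_max_def
  proof (rule wp_Seq_sl[OF md_W, where R = "\<lambda>s. s ''mx'' 0 = c_pre"])
    have "s ''c2'' 0 = c_pre" using env by (simp add: env_def)
    thus "sl addr small small (Put ''mx'' (Var ''c2'')) s (\<lambda>s. s ''mx'' 0 = c_pre)" using small_c by simp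
    fix s1 assume m: "s1 ''mx'' 0 = c_pre" and fr: "\<And>z. z \<notin> wr (Put ''mx'' (Var ''c2'')) \<Longrightarrow> s1 z = s z"
    have env1: "env E q off s1" by (rule env_frame[OF env], erule fr) (simp add: env_names_def)
    have x1: "\<forall>i<k. s1 ''x'' i = x i" using fr[of "''x''"] xs by simp
    show "wp (For ''i'' ''tail'' ?b) s1 (900 * (n + 1)) (\<lambda>s. s ''mx'' 0 = x_max q x)" by (rule loop[OF env1 x1 m])
  next
    show "csize (Put ''mx'' (Var ''c2'')) * 7 + 900 * (n + 1) \<le> 1000 * (n + 1)" by simp
  qed
  thus ?thesis by (rule wp_mono) (use cost3[of 1000] in simp_all)
qed

definition accepted :: bool where "accepted \<longleftrightarrow> pairs_ok q x \<and> upper_ok (base E q) q x"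

definition best_step :: "state \<Rightarrow> state \<Rightarrow> bool" where
  "best_step s s' \<longleftrightarrow> (if accepted \<and> \<not> (s ''bok'' 0 = 1 \<and> \<not> x_max q x < s ''bmx'' 0)
     then s' ''bok'' 0 = 1 \<and> s' ''bmx'' 0 = x_max q x \<and> (\<forall>i<k. s' ''res'' (q ! i) = x i)
     else s' ''bok'' = s ''bok'' \<and> s' ''bmx'' = s ''bmx'' \<and> s' ''res'' = s ''res'')"

lemma x_max_inr: "inr (x_max q x)"
  unfolding x_max_def using x_inr by (intro inr_prefix)

lemma p_best:
  assumes env: "env E q off s" and xs: "\<forall>i<k. s ''x'' i = x i"
    and ok: "s ''ok'' 0 = (if accepted then 1 else 0)" and mx: "s ''mx'' 0 = x_max q x"
    and b: "small (s ''bok'' 0)" "inr (s ''bmx'' 0)"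
  shows "wp p_best s (1500 * unit_cost) (best_step s)"
proof -
  let ?c = "And (Equal (Var ''ok'') (Const 1)) (Not (And (Equal (Var ''bok'') (Const 1)) (Not (Less (Var ''mx'') (Var ''bmx'')))))"
  let ?b = "Assign ''res'' (Q_at ''i'') (Cell ''x'' (Var ''i''))"
  let ?p = "Seq (Put ''bok'' (Const 1)) (Put ''bmx'' (Var ''mx''))"
  note smx = inr_small(1)[OF x_max_inr] inr_small(1)[OF b(2)]
  have loop: "wp (For ''i'' ''tail'' ?b) s1 (900 * (n + 1)) (\<lambda>s. \<forall>i<k. s ''res'' (q ! i) = x i)"
    if env1: "env E q off s1" and x1: "\<forall>i<k. s1 ''x'' i = x i" for s1
  proof (rule wp_For_W[where I = "\<lambda>i s. \<forall>j<i. s ''res'' (q ! j) = x j" and N = k])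
    show "s1 ''tail'' 0 = int k" using env1 by (simp add: env_def)
    show "small (int k)" by (rule sm_idx)
    have "csize ?b * 7 * k + 100 * (k + 1) \<le> 7 * 125 * (n + 1)" by (rule time_k) simp
    also have "\<dots> \<le> 900 * (n + 1)" by simp
    finally show "csize ?b * 7 * k + 100 * (k + 1) \<le> 900 * (n + 1)" .
  next
    fix i s2 assume i: "i < k" and J: "\<forall>j<i. s2 ''res'' (q ! j) = x j" and ii: "s2 ''i'' 0 = int i"
      and fr: "\<And>z. z \<notin> insert ''i'' (wr ?b) \<Longrightarrow> s2 z = s1 z"
    have env2: "env E q off s2" by (rule env_frame[OF env1], erule fr) (simp add: env_names_def)
    have e: "s2 ''off'' 0 = int off" "s2 ''q'' (off + i) = int (q ! i)" "s2 ''x'' i = x i"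
      using env2 i fr[of "''x''"] x1 by (simp_all add: env_def)
    have ne: "q ! j \<noteq> q ! i" if "j < i" for j using distq i that by (simp add: nth_eq_iff_index_eq)
    have "\<forall>j<Suc i. ((s2 ''res'')(q ! i := x i)) (q ! j) = x j"
      using J ne by (auto simp: less_Suc_eq)
    thus "sl addr small small ?b s2 (\<lambda>s'. \<forall>j<Suc i. store s' ''i'' 0 (int (Suc i)) ''res'' (q ! j) = x j)"
      using ii e sm_idx(1,3,4)[OF i] sm_idx(6) inr_small(1)[OF x_inr[OF i]] by (simp add: addr_def)
  qed simp_all
  have adm: "badm addr small small ?c s" using ok mx b(1) smx by simp
  have bv: "bval ?c s \<longleftrightarrow> accepted \<and> \<not> (s ''bok'' 0 = 1 \<and> \<not> x_max q x < s ''bmx'' 0)"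
    using ok mx by simp
  have "wp p_best s (1300 * (n + 1)) (best_step s)" unfolding p_best_def
  proof (rule wp_If[OF md_W adm, where Tp = "1000 * (n + 1)"])
    assume "bval ?c s"
    hence c: "accepted \<and> \<not> (s ''bok'' 0 = 1 \<and> \<not> x_max q x < s ''bmx'' 0)" using bv by blast
    show "wp (Seq ?p (For ''i'' ''tail'' ?b)) s (1000 * (n + 1)) (best_step s)"
    proof (rule wp_Seq_sl[OF md_W, where R = "\<lambda>s'. s' ''bok'' 0 = 1 \<and> s' ''bmx'' 0 = x_max q x"])
      show "sl addr small small ?p s (\<lambda>s'. s' ''bok'' 0 = 1 \<and> s' ''bmx'' 0 = x_max q x)" using mx smx by simp
      fix s1 assume R: "s1 ''bok'' 0 = 1 \<and> s1 ''bmx'' 0 = x_max q x" and fr: "\<And>z. z \<notin> wr ?p \<Longrightarrow> s1 z = s z"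
      have env1: "env E q off s1" by (rule env_frame[OF env], erule fr) (simp add: env_names_def)
      have x1: "\<forall>i<k. s1 ''x'' i = x i" using fr[of "''x''"] xs by simp
      show "wp (For ''i'' ''tail'' ?b) s1 (900 * (n + 1)) (best_step s)"
      proof (rule wp_mono[OF loop[OF env1 x1] order_refl])
        fix s2 assume r: "\<forall>i<k. s2 ''res'' (q ! i) = x i" and fr2: "\<And>z. z \<notin> wr (For ''i'' ''tail'' ?b) \<Longrightarrow> s2 z = s1 z"
        have "s2 ''bok'' = s1 ''bok''" "s2 ''bmx'' = s1 ''bmx''" by (rule fr2, simp)+
        thus "best_step s s2" unfolding best_step_def using c r R by simp
      qed
    next
      show "csize ?p * 7 + 900 * (n + 1) \<le> 1000 * (n + 1)" by simp
    qed
  next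
    assume "\<not> bval ?c s"
    hence "best_step s s" using bv unfolding best_step_def by auto
    thus "wp Skip s (1000 * (n + 1)) (best_step s)" by (rule wp_Skip) simp
  qed simp
  thus ?thesis by (rule wp_mono) (use cost3[of 1300] in simp_all)
qed

lemma p_attempt:
  assumes env: "env E q off s" and b: "small (s ''bok'' 0)" "inr (s ''bmx'' 0)"
  shows "wp p_attempt s (12000 * unit_cost) (best_step s)"
  unfolding p_attempt_def
proof (rule wp_Seq[OF p_window[OF env]])
  fix s1 assume w: "\<forall>i<k. s1 ''fn'' i = int (first_nb q i) \<and> s1 ''ln'' i = int (last_nb q i)"
    and fr1: "\<And>z. z \<notin> wr p_window \<Longrightarrow> s1 z = s z"
  have env1: "env E q off s1" by (rule env_frame[OF env], erule fr1) (simp add: env_names_def)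
  have k1: "s1 ''bok'' = s ''bok''" "s1 ''bmx'' = s ''bmx''" "s1 ''res'' = s ''res''" by (rule fr1, simp)+
  show "wp (Seq p_xinit (Seq p_rounds (Seq (Put ''ok'' (Const 1)) (Seq p_pairs (Seq p_upper (Seq p_max p_best))))))
    s1 (10400 * unit_cost) (best_step s)"
  proof (rule wp_Seq[OF p_xinit[OF env1]])
    fix s2 assume x0: "\<forall>i<k. s2 ''x'' i = x_rounds E (base E q) q 0 i" and fr2: "\<And>z. z \<notin> wr p_xinit \<Longrightarrow> s2 z = s1 z"
    have env2: "env E q off s2" by (rule env_frame[OF env1], erule fr2) (simp add: env_names_def)
    have k2: "s2 ''bok'' = s ''bok''" "s2 ''bmx'' = s ''bmx''" "s2 ''res'' = s ''res''" "s2 ''fn'' = s1 ''fn''" "s2 ''ln'' = s1 ''ln''"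
      using fr2[of "''bok''"] fr2[of "''bmx''"] fr2[of "''res''"] fr2[of "''fn''"] fr2[of "''ln''"] k1 by simp_all
    have w2: "\<forall>i<k. s2 ''fn'' i = int (first_nb q i) \<and> s2 ''ln'' i = int (last_nb q i)" using w k2 by simp
    show "wp (Seq p_rounds (Seq (Put ''ok'' (Const 1)) (Seq p_pairs (Seq p_upper (Seq p_max p_best)))))
      s2 (10000 * unit_cost) (best_step s)"
    proof (rule wp_Seq[OF p_rounds[OF env2 w2 x0]])
      fix s3 assume x3: "\<forall>i<k. s3 ''x'' i = x i" and fr3: "\<And>z. z \<notin> wr p_rounds \<Longrightarrow> s3 z = s2 z"
      have env3: "env E q off s3" by (rule env_frame[OF env2], erule fr3) (simp add: env_names_def)
      have k3: "s3 ''bok'' = s ''bok''" "s3 ''bmx'' = s ''bmx''" "s3 ''res'' = s ''res''"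
        using fr3[of "''bok''"] fr3[of "''bmx''"] fr3[of "''res''"] k2 by simp_all
      show "wp (Seq (Put ''ok'' (Const 1)) (Seq p_pairs (Seq p_upper (Seq p_max p_best)))) s3 (6500 * unit_cost) (best_step s)"
      proof (rule wp_Seq_sl[OF md_W, where R = "\<lambda>s. s ''ok'' 0 = 1"])
        show "sl addr small small (Put ''ok'' (Const 1)) s3 (\<lambda>s. s ''ok'' 0 = 1)" by simp
        fix s4 assume ok4: "s4 ''ok'' 0 = 1" and fr4: "\<And>z. z \<notin> wr (Put ''ok'' (Const 1)) \<Longrightarrow> s4 z = s3 z"
        have env4: "env E q off s4" by (rule env_frame[OF env3], erule fr4) (simp add: env_names_def)
        have k4: "s4 ''bok'' = s ''bok''" "s4 ''bmx'' = s ''bmx''" "s4 ''res'' = s ''res''" "s4 ''x'' = s3 ''x''"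
          using fr4[of "''bok''"] fr4[of "''bmx''"] fr4[of "''res''"] fr4[of "''x''"] k3 by simp_all
        have x4: "\<forall>i<k. s4 ''x'' i = x i" using x3 k4 by simp
        show "wp (Seq p_pairs (Seq p_upper (Seq p_max p_best))) s4 (6400 * unit_cost) (best_step s)"
        proof (rule wp_Seq[OF p_pairs[OF env4 x4 ok4]])
          fix s5 assume ok5: "s5 ''ok'' 0 = (if pairs_ok q x then 1 else 0)" and fr5: "\<And>z. z \<notin> wr p_pairs \<Longrightarrow> s5 z = s4 z"
          have env5: "env E q off s5" by (rule env_frame[OF env4], erule fr5) (simp add: env_names_def)
          have k5: "s5 ''bok'' = s ''bok''" "s5 ''bmx'' = s ''bmx''" "s5 ''res'' = s ''res''" "s5 ''x'' = s4 ''x''"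
            using fr5[of "''bok''"] fr5[of "''bmx''"] fr5[of "''res''"] fr5[of "''x''"] k4 by simp_all
          have x5: "\<forall>i<k. s5 ''x'' i = x i" using x4 k5 by simp
          show "wp (Seq p_upper (Seq p_max p_best)) s5 (3000 * unit_cost) (best_step s)"
          proof (rule wp_Seq[OF p_upper[OF env5 x5 ok5]])
            fix s6 assume ok6: "s6 ''ok'' 0 = (if pairs_ok q x \<and> upper_ok (base E q) q x then 1 else 0)"
              and fr6: "\<And>z. z \<notin> wr p_upper \<Longrightarrow> s6 z = s5 z"
            have env6: "env E q off s6" by (rule env_frame[OF env5], erule fr6) (simp add: env_names_def)
            have k6: "s6 ''bok'' = s ''bok''" "s6 ''bmx'' = s ''bmx''" "s6 ''res'' = s ''res''" "s6 ''x'' = s5 ''x''"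
              using fr6[of "''bok''"] fr6[of "''bmx''"] fr6[of "''res''"] fr6[of "''x''"] k5 by simp_all
            have x6: "\<forall>i<k. s6 ''x'' i = x i" using x5 k6 by simp
            show "wp (Seq p_max p_best) s6 (2500 * unit_cost) (best_step s)"
            proof (rule wp_Seq[OF p_max[OF env6 x6]])
              fix s7 assume mx: "s7 ''mx'' 0 = x_max q x" and fr7: "\<And>z. z \<notin> wr p_max \<Longrightarrow> s7 z = s6 z"
              have env7: "env E q off s7" by (rule env_frame[OF env6], erule fr7) (simp add: env_names_def)
              have k7: "s7 ''bok'' = s ''bok''" "s7 ''bmx'' = s ''bmx''" "s7 ''res'' = s ''res''" "s7 ''x'' = s6 ''x''" "s7 ''ok'' = s6 ''ok''"
                using fr7[of "''bok''"] fr7[of "''bmx''"] fr7[of "''res''"] fr7[of "''x''"] fr7[of "''ok''"] k6 by simp_all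
              have x7: "\<forall>i<k. s7 ''x'' i = x i" using x6 k7 by simp
              have ok7: "s7 ''ok'' 0 = (if accepted then 1 else 0)" using ok6 k7 by (simp add: accepted_def)
              have "best_step s7 = best_step s" unfolding best_step_def[abs_def] using k7 by simp
              moreover have "wp p_best s7 (1500 * unit_cost) (best_step s7)"
                by (rule p_best[OF env7 x7 ok7 mx]) (use b k7 in simp_all)
              ultimately show "wp p_best s7 (1500 * unit_cost) (best_step s)" by simp
            qed simp
          qed simp
        qed simp
      next
        show "csize (Put ''ok'' (Const 1)) * 7 + 6400 * unit_cost \<le> 6500 * unit_cost" using cost4[of 100] by simp
      qed
    next
      show "3000 * (n + 1) * k + 6500 * unit_cost \<le> 10000 * unit_cost" using cost1[of 3000] by linarith
    qed
  next
    show "300 * G * k + 10000 * unit_cost \<le> 10400 * unit_cost" using cost2[of 300] by linarith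
  qed
next
  show "1500 * (n + 1) * k + 10400 * unit_cost \<le> 12000 * unit_cost" using cost1[of 1500] by linarith
qed

end

section \<open>Placing one component: setup, both orientations, commitment\<close>

definition i_base :: com where
  "i_base = seqs [Put ''e1'' (Plus (Plus (Var ''E'') (Var ''M'')) (Const 1)), Put ''base'' (Var ''e1''),
     Put ''c1'' (Minus (Const 0) (Times (Plus (Var ''n'') (Const 2)) (Var ''M''))),
     Put ''c2'' (Minus (Const 0) (Times (Plus (Var ''n'') (Const 4)) (Var ''M''))),
     Put ''bok'' (Const 0), Put ''bmx'' (Const 0), Put ''off'' (Const 0)]"

definition b_base :: com where
  "b_base = seqs [Put ''u'' (Cell ''q'' (Var ''i'')), Put ''y'' (Cell ''LC'' (Var ''u'')),
     If (Less (Var ''y'') (Var ''e1'')) (Put ''y'' (Var ''e1'')) Skip,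
     Assign ''LB'' (Var ''u'') (Var ''y''),
     If (Less (Var ''base'') (Var ''y'')) (Put ''base'' (Var ''y'')) Skip]"

definition p_base :: com where "p_base = Seq i_base (For ''i'' ''tail'' b_base)"

text \<open>Only here do the relative coordinates become long numbers again, one addition per
  vertex. The new \<open>E\<close> is the rightmost left endpoint of the chosen placement.\<close>

definition p_commit :: com where
  "p_commit = If (Equal (Var ''bok'') (Const 0)) (Put ''fail'' (Const 1))
     (Seq (For ''i'' ''tail'' (Assign ''X'' (Q_at ''i'') (Plus (Var ''base'') (Cell ''res'' (Q_at ''i'')))))
       (Put ''E'' (Plus (Var ''base'') (Var ''bmx''))))"

text \<open>Between the two runs only the offset changes, since \<open>base\<close> and the lower
  bounds depend on the vertex set alone.\<close>

definition p_comp :: com where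
  "p_comp = Seq p_order (Seq p_base (Seq p_attempt (Seq (Put ''off'' (Var ''tail'')) (Seq p_attempt p_commit))))"

lemma wr_base [simp]: "wr i_base = {''e1'', ''base'', ''c1'', ''c2'', ''bok'', ''bmx'', ''off''}"
  "wr b_base = {''u'', ''y'', ''LB'', ''base''}"
  "wr p_base = {''e1'', ''base'', ''c1'', ''c2'', ''bok'', ''bmx'', ''off'', ''i'', ''u'', ''y'', ''LB''}"
  "wr p_commit = {''fail'', ''i'', ''X'', ''E''}"
  "wr p_order = {''a'', ''st'', ''u'', ''old'', ''i'', ''w'', ''vis'', ''q'', ''tail'', ''zi'', ''head''}"
  "wr p_attempt = {''i'', ''u'', ''fn'', ''ln'', ''j'', ''w'', ''y'', ''x'', ''rd'', ''p'', ''z'', ''ok'', ''mx'', ''bok'', ''bmx'', ''res''}"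
  by (auto simp: i_base_def b_base_def p_base_def p_commit_def p_order_def p_attempt_def)

context pmain
begin

definition static_names :: "string set" where
  "static_names = input_names \<union> {''adj'', ''ord'', ''n1'', ''M'', ''LC'', ''UC''}"

definition static :: "state \<Rightarrow> bool" where
  "static s \<longleftrightarrow> inputs s \<and> graph_ok s \<and> codes_ok s"

lemma static_frame:
  assumes "static s" "\<And>z. z \<notin> X \<Longrightarrow> s' z = s z" "X \<inter> static_names = {}"
  shows "static s'"
proof -
  have X: "X \<inter> input_names = {}" using assms(3) unfolding static_names_def by blast
  have "inputs s'" by (rule inputs_frame[OF _ assms(2) X]) (use assms(1) in \<open>simp_all add: static_def\<close>)
  have "s' z = s z" if "z \<in> static_names" for z using assms(2)[of z] assms(3) that by blast
  hence "s' ''n'' = s ''n''" "s' ''adj'' = s ''adj''" "s' ''ord'' = s ''ord''" "s' ''M'' = s ''M''" "s' ''n1'' = s ''n1''"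
    "s' ''LC'' = s ''LC''" "s' ''UC'' = s ''UC''" by (simp_all add: static_names_def input_names_def)
  thus ?thesis using assms(1) \<open>inputs s'\<close> unfolding static_def graph_ok_def adj_ok_def codes_ok_def by simp
qed

lemma fits_cong: "(\<And>v. v \<in> C \<Longrightarrow> g v = h v) \<Longrightarrow> fits E C g \<Longrightarrow> fits E C h"
  by (simp add: fits_def)

end

context attempt
begin

lemma p_base:
  assumes st: "static s" and E: "s ''E'' 0 = E" and q: "\<forall>i<k. s ''q'' i = int (q ! i)" and tl: "s ''tail'' 0 = int k"
  shows "wp p_base s (900 * G * k) (\<lambda>s. env E q 0 s \<and> s ''bok'' 0 = 0 \<and> s ''bmx'' 0 = 0)"
proof -
  let ?m = "\<lambda>i. prefix_max (E + M + 1) (\<lambda>i. lb E (q ! i)) i"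
  define R where "R s \<longleftrightarrow> s ''e1'' 0 = E + M + 1 \<and> s ''base'' 0 = ?m 0 \<and> s ''c1'' 0 = c_init \<and> s ''c2'' 0 = c_pre \<and>
    s ''bok'' 0 = 0 \<and> s ''bmx'' 0 = 0 \<and> s ''off'' 0 = 0" for s :: state
  have sn: "small (int n + 2)" "small (int n + 4)"
  proof -
    have n1: "1 \<le> n" using k_bounds by linarith
    have "n + 2 \<le> 5 * n + 2" "n + 4 \<le> 5 * n + 2" using n1 by simp_all
    from this[THEN sm] show "small (int n + 2)" "small (int n + 4)" by (simp_all add: add.commute)
  qed
  have ce: "- ((int n + 2) * M) = c_init" "- ((int n + 4) * M) = c_pre"
    by (simp_all add: c_init_def c_pre_def algebra_simps)
  have sc: "small ((int n + 2) * M)" "small ((int n + 4) * M)"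
    using small_c(1,2) unfolding ce[symmetric] by (simp_all add: small_def)
  have bl: "\<bar>M\<bar> \<le> 2 ^ (7 * r + 1)" by (rule small_abs[OF small_M])
  have p: "(2::int) ^ (7 * r + 2) = 2 * 2 ^ (7 * r + 1)" "(2::int) ^ (7 * r + 1) = 2 * 2 ^ (7 * r)" by simp_all
  have bE: "\<bar>E + M + 1\<bar> \<le> 2 ^ (7 * r + 1)" using prefix_max_ge_init[of "E + M + 1" "\<lambda>i. lb E (q ! i)" 0]
  proof -
    have q0: "q ! 0 \<in> set q" using k_bounds by (intro nth_mem) simp
    have "E + M + 1 \<le> lb E (q ! 0)" by (simp add: lb_def)
    moreover have "0 \<le> M" using M1 by simp
    ultimately show ?thesis using big_bounds(1)[OF q0] E_abs p by linarith
  qed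
  have bs: "big E" "big (E + M)" "big (E + M + 1)" 
    using E_abs bE bl M1 p by - (rule big7, linarith)+
  note sm0 = sn sc small_c(1-3) sm_idx(7)
  note bg = sm0[THEN small_big] bs
  have n2: "big 2" "big 4" using sm[of 2] sm[of 4] k_bounds by (auto intro!: small_big)
  have g: "s ''M'' 0 = M" "s ''n'' 0 = int n" using st by (simp_all add: static_def codes_ok_def graph_ok_def)
  have init: "sl addr big big i_base s R"
    unfolding i_base_def R_def using E g bg ce n2 by simp
  show ?thesis unfolding p_base_def
  proof (rule wp_Seq_sl[OF md_B init])
    fix s1 assume R1: "R s1" and fr1: "\<And>z. z \<notin> wr i_base \<Longrightarrow> s1 z = s z"
    have st1: "static s1" by (rule static_frame[OF st], erule fr1) (simp add: static_names_def input_names_def)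
    have q1: "\<forall>i<k. s1 ''q'' i = int (q ! i)" "s1 ''tail'' 0 = int k" using fr1[of "''q''"] fr1[of "''tail''"] q tl by simp_all
    define L where "L i la \<longleftrightarrow> (\<forall>j<i. la (q ! j) = lb E (q ! j))" for i and la :: "nat \<Rightarrow> int"
    have LS: "L (Suc i) (la(q ! i := lb E (q ! i)))" if "L i la" for i la
      using that unfolding L_def by (auto simp: less_Suc_eq)
    show "wp (For ''i'' ''tail'' b_base) s1 (600 * G * k) (\<lambda>s. env E q 0 s \<and> s ''bok'' 0 = 0 \<and> s ''bmx'' 0 = 0)"
    proof (rule wp_For_B[where I = "\<lambda>i s. s ''base'' 0 = ?m i \<and> L i (s ''LB'')" and N = k])
      show "s1 ''tail'' 0 = int k" by (rule q1)
      show "small (int k)" by (rule sm_idx)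
      show "store s1 ''i'' 0 0 ''base'' 0 = ?m 0 \<and> L 0 (store s1 ''i'' 0 0 ''LB'')" using R1 by (simp add: L_def R_def)
      have "csize b_base * G * k + 100 * (k + 1) \<le> 2 * 300 * G * k" by (rule time_G) (simp add: b_base_def)
      thus "csize b_base * G * k + 100 * (k + 1) \<le> 600 * G * k" by simp
    next
      fix i s2 assume i: "i < k" and J: "s2 ''base'' 0 = ?m i \<and> L i (s2 ''LB'')" and ii: "s2 ''i'' 0 = int i"
        and fr2: "\<And>z. z \<notin> insert ''i'' (wr b_base) \<Longrightarrow> s2 z = s1 z"
      have st2: "static s2" by (rule static_frame[OF st1], erule fr2) (simp add: static_names_def input_names_def)
      have e: "s2 ''LC'' (q ! i) = LC (q ! i)" using st2 q_less[OF i] by (simp add: static_def codes_ok_def)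
      have e': "s2 ''q'' i = int (q ! i)" "s2 ''e1'' 0 = E + M + 1"
        using fr2[of "''q''"] fr2[of "''e1''"] q1 i R1 by (simp_all add: R_def)
      have m: "?m (Suc i) = (if ?m i < lb E (q ! i) then lb E (q ! i) else ?m i)" by simp
      have lbe: "lb E (q ! i) = (if LC (q ! i) < E + M + 1 then E + M + 1 else LC (q ! i))" by (simp add: lb_def)
      have bm: "big (?m i)"
      proof -
        have "?m i = E + M + 1 \<or> (\<exists>j<i. ?m i = lb E (q ! j))" by (rule prefix_max_attained)
        thus ?thesis using bs(3) big_facts(1) i by (auto simp del: prefix_max.simps)
      qed
      have bLC: "big (LC (q ! i))" by (rule big4[OF LC_abs[OF q_less[OF i]]])
      have blb: "big (lb E (q ! i))" by (rule big_facts(1)) (use i in simp)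
      note ls = LS[OF conjunct2[OF J]]
      note ss = sm_idx(1)[OF i] sm_idx(4)[OF i]
      define mi where "mi = ?m i"
      define li where "li = lb E (q ! i)"
      show "sl addr big big b_base s2 (\<lambda>s'. store s' ''i'' 0 (int (Suc i)) ''base'' 0 = ?m (Suc i) \<and> L (Suc i) (store s' ''i'' 0 (int (Suc i)) ''LB''))"
        unfolding b_base_def m
        using conjunct1[OF J, folded mi_def] ii e e' bs(3) ss ss[THEN small_big] bLC bm[folded mi_def] blb[folded li_def] ls[folded li_def] lbe[folded li_def]
        unfolding mi_def[symmetric] li_def[symmetric]
        by (cases "LC (q ! i) < E + M + 1"; cases "mi < li") (simp_all add: addr_def)
    next
      fix s2 assume J: "s2 ''base'' 0 = ?m k \<and> L k (s2 ''LB'')"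
        and fr2: "\<And>z. z \<notin> insert ''i'' (wr b_base) \<Longrightarrow> s2 z = s1 z"
      have st2: "static s2" by (rule static_frame[OF st1], erule fr2) (simp add: static_names_def input_names_def)
      have e: "s2 ''q'' = s1 ''q''" "s2 ''tail'' = s1 ''tail''" "s2 ''c1'' = s1 ''c1''" "s2 ''c2'' = s1 ''c2''"
        "s2 ''bok'' = s1 ''bok''" "s2 ''bmx'' = s1 ''bmx''" "s2 ''off'' = s1 ''off''"
        by (rule fr2, simp)+
      have "\<forall>v\<in>set q. s2 ''LB'' v = lb E v" using J unfolding L_def by (metis in_set_conv_nth)
      thus "env E q 0 s2 \<and> s2 ''bok'' 0 = 0 \<and> s2 ''bmx'' 0 = 0"
        using st2 e q1 J R1 inputsD(8) unfolding env_def R_def base_def static_def codes_ok_def by simp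
    qed simp_all
  next
    have "csize i_base * G * 1 \<le> 300 * G * k" using k_bounds(1) by (intro mult_le_mono) (auto simp: i_base_def)
    hence h: "csize i_base * G \<le> 300 * G * k" by (simp only: mult_1_right)
    show "csize i_base * G + 600 * G * k \<le> 900 * G * k" by (rule seq_time[OF h]) simp
  qed
qed

text \<open>\<open>best s\<close>: the better of the attempts made so far, if any was successful.\<close>

definition best :: "state \<Rightarrow> bool" where
  "best s \<longleftrightarrow> (s ''bok'' 0 = 0 \<and> (\<forall>g. \<not> fits E (set q) g)) \<or>
     (s ''bok'' 0 = 1 \<and> fits E (set q) (\<lambda>v. base E q + s ''res'' v) \<and> inr (s ''bmx'' 0) \<and>
      (\<forall>v\<in>set q. small (s ''res'' v) \<and> s ''res'' v \<le> s ''bmx'' 0) \<and>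
      (\<forall>g. fits E (set q) g \<longrightarrow> (\<exists>v\<in>set q. base E q + s ''bmx'' 0 \<le> g v)))"

lemma accepted_result:
  assumes acc: accepted and h: "\<forall>i<k. h (q ! i) = x i"
  shows "fits E (set q) (\<lambda>v. base E q + h v) \<and> (\<forall>v\<in>set q. small (h v) \<and> h v \<le> x_max q x)"
proof -
  note ok = acc[unfolded accepted_def]
  have h': "\<And>i. i < k \<Longrightarrow> h (q ! i) = x_fin E (base E q) q i" using h by blast
  note s = attempt_sound[OF refl distq conjunct1[OF ok] conjunct2[OF ok] h']
  have "small (h v)" if "v \<in> set q" for v
  proof -
    obtain i where "i < k" "v = q ! i" using \<open>v \<in> set q\<close> by (metis in_set_conv_nth)
    thus ?thesis using h inr_small(1)[OF x_inr] by simp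
  qed
  thus ?thesis using s by blast
qed

lemma accepted_complete:
  assumes "nonadj_sorted ad M g q" "umbrella_free ad q" "fits E (set q) g"
  shows "accepted \<and> (\<exists>v\<in>set q. base E q + x_max q x \<le> g v)"
  using attempt_complete[OF t setq distq assms(1,2), of E] assms(3) unfolding setq accepted_def by blast

lemma p_commit:
  assumes env: "env E q off s" and b: "best s"
  shows "wp p_commit s (400 * G * k) (\<lambda>s'. if s ''bok'' 0 = 0 then s' ''fail'' 0 = 1 else
    s' ''fail'' = s ''fail'' \<and> (\<forall>v. s' ''X'' v = (if v \<in> set q then base E q + s ''res'' v else s ''X'' v)) \<and>
    s' ''E'' 0 = base E q + s ''bmx'' 0)" (is "wp _ _ _ ?post")
proof -
  let ?b = "Assign ''X'' (Q_at ''i'') (Plus (Var ''base'') (Cell ''res'' (Q_at ''i'')))"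
  have kG: "1 \<le> G * k" using mult_le_mono[OF G1 k_bounds(1)] by simp
  have bok: "big (s ''bok'' 0)" using b by (auto simp: best_def)
  show ?thesis unfolding p_commit_def
  proof (rule wp_If[OF md_B, where Tp = "380 * G * k"])
    show "badm addr big big (Equal (Var ''bok'') (Const 0)) s" using bok by simp
  next
    assume z: "bval (Equal (Var ''bok'') (Const 0)) s"
    have "sl addr big big (Put ''fail'' (Const 1)) s ?post" using z by simp
    thus "wp (Put ''fail'' (Const 1)) s (380 * G * k) ?post"
    proof (rule wp_mono[OF wp_sl[OF md_B]])
      have "csize (Put ''fail'' (Const 1)) * G * 1 \<le> 380 * G * k" using k_bounds(1) by (intro mult_le_mono) auto
      thus "csize (Put ''fail'' (Const 1)) * G \<le> 380 * G * k" by (simp only: mult_1_right)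
    qed assumption
  next
    assume z: "\<not> bval (Equal (Var ''bok'') (Const 0)) s"
    hence z': "s ''bok'' 0 \<noteq> 0" by simp
    hence b': "inr (s ''bmx'' 0)" "\<forall>v\<in>set q. small (s ''res'' v)" using b unfolding best_def by auto
    define X where "X i xa \<longleftrightarrow> (\<forall>v. xa v = (if v \<in> (\<lambda>j. q ! j) ` {..<i} then base E q + s ''res'' v else s ''X'' v))"
      for i and xa :: "nat \<Rightarrow> int"
    have XS: "X (Suc i) (xa(q ! i := base E q + s ''res'' (q ! i)))" if "X i xa" for i xa
      using that unfolding X_def by (auto simp: less_Suc_eq)
    have Xk: "\<forall>v. xa v = (if v \<in> set q then base E q + s ''res'' v else s ''X'' v)" if "X k xa" for xa
    proof -
      have "(\<lambda>j. q ! j) ` {..<k} = set q" by (auto simp: set_conv_nth)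
      thus ?thesis using that unfolding X_def by simp
    qed
    let ?R = "\<lambda>s'. \<forall>v. s' ''X'' v = (if v \<in> set q then base E q + s ''res'' v else s ''X'' v)"
    have loop: "wp (For ''i'' ''tail'' ?b) s (300 * G * k) ?R"
    proof (rule wp_For_B[where I = "\<lambda>i s. X i (s ''X'')" and N = k])
      show "s ''tail'' 0 = int k" using env by (simp add: env_def)
      show "small (int k)" by (rule sm_idx)
      show "X 0 (store s ''i'' 0 0 ''X'')" by (simp add: X_def)
      have "csize ?b * G * k + 100 * (k + 1) \<le> 2 * 150 * G * k" by (rule time_G) simp
      thus "csize ?b * G * k + 100 * (k + 1) \<le> 300 * G * k" by simp
    next
      fix i s1 assume i: "i < k" and T: "X i (s1 ''X'')" and ii: "s1 ''i'' 0 = int i"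
        and fr: "\<And>z. z \<notin> insert ''i'' (wr ?b) \<Longrightarrow> s1 z = s z"
      have env1: "env E q off s1" by (rule env_frame[OF env], erule fr) (simp add: env_names_def)
      have sr: "small (s ''res'' (q ! i))" using b'(2) i by simp
      have e: "s1 ''off'' 0 = int off" "s1 ''q'' (off + i) = int (q ! i)" "s1 ''base'' 0 = base E q" "s1 ''res'' = s ''res''"
        using env1 i fr[of "''res''"] by (simp_all add: env_def)
      note ss = sm_idx(1)[OF i] sm_idx(3)[OF i] sm_idx(4)[OF i] sm_idx(6)
      show "sl addr big big ?b s1 (\<lambda>s'. X (Suc i) (store s' ''i'' 0 (int (Suc i)) ''X''))"
        using ii e ss ss[THEN small_big] big_facts(2) big_facts(4)[OF sr] small_big[OF sr] XS[OF T] by (simp add: addr_def)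
    next
      fix s1 :: state assume "X k (s1 ''X'')"
      thus "?R s1" by (rule Xk)
    qed simp_all
    show "wp (Seq (For ''i'' ''tail'' ?b) (Put ''E'' (Plus (Var ''base'') (Var ''bmx'')))) s (380 * G * k) ?post"
    proof (rule wp_Seq[OF loop])
      fix s1 assume R: "?R s1" and fr: "\<And>z. z \<notin> wr (For ''i'' ''tail'' ?b) \<Longrightarrow> s1 z = s z"
      have e: "s1 ''base'' 0 = base E q" "s1 ''bmx'' = s ''bmx''" "s1 ''fail'' = s ''fail''"
        using env fr[of "''base''"] fr[of "''bmx''"] fr[of "''fail''"] by (simp_all add: env_def)
      have "sl addr big big (Put ''E'' (Plus (Var ''base'') (Var ''bmx''))) s1 ?post"
        using e R z' big_facts(2) big_facts(4)[OF inr_small(1)[OF b'(1)]] small_big[OF inr_small(1)[OF b'(1)]] by simp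
      from wp_sl[OF md_B this] show "wp (Put ''E'' (Plus (Var ''base'') (Var ''bmx''))) s1 (8 * G) ?post"
        by (rule wp_mono) simp_all
    next
      have "8 * G * 1 \<le> 80 * G * k" using k_bounds(1) by (intro mult_le_mono) auto
      thus "300 * G * k + 8 * G \<le> 380 * G * k" by simp
    qed
  next
    have "bsize (Equal (Var ''bok'') (Const 0)) * G * 1 \<le> 20 * G * k" using k_bounds(1) by (intro mult_le_mono) auto
    hence h: "bsize (Equal (Var ''bok'') (Const 0)) * G \<le> 20 * G * k" by (simp only: mult_1_right)
    show "bsize (Equal (Var ''bok'') (Const 0)) * G + 380 * G * k \<le> 400 * G * k" by (rule seq_time[OF h]) simp
  qed
qed

end

context pmain
begin

text \<open>Every fitting \<open>g\<close> is sorted by \<open>q\<close> or by its mirror image. The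
  corresponding attempt is accepted and ends no further right than \<open>g\<close>; the better of
  the two attempts therefore ends no further right than any \<open>g\<close>. If both are rejected,
  no \<open>g\<close> fits.\<close>

lemma best_two:
  assumes A: "attempt I L rk t E q 0" and B: "attempt I L rk t E (rev q) (length q)"
    and order: "\<And>g. rep_on (Cs ! t) ad M g \<Longrightarrow> umbrella_free ad q \<and> (nonadj_sorted ad M g q \<or> nonadj_sorted ad M g (rev q))"
    and s: "s ''bok'' 0 = 0" "attempt.best_step I L rk E q s s1"
    and s1: "s1' ''bok'' = s1 ''bok''" "s1' ''bmx'' = s1 ''bmx''" "s1' ''res'' = s1 ''res''"
    and s2: "attempt.best_step I L rk E (rev q) s1' s2"
  shows "attempt.best I L rk E (rev q) s2"
proof -
  interpret A: attempt I D L rk t E q 0 by (rule A)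
  interpret B: attempt I D L rk t E "rev q" "length q" by (rule B)
  have bp: "base E (rev q) = base E q" by (rule base_perm) simp
  define ma where "ma = x_max q (x_fin E (base E q) q)"
  define mb where "mb = x_max (rev q) (x_fin E (base E (rev q)) (rev q))"
  \<comment> \<open>Which of the two attempts dominates may depend on \<open>g\<close>; the
    comparison of \<open>ma\<close> and \<open>mb\<close> below removes this dependence.\<close>
  have comp: "(A.accepted \<and> (\<exists>v\<in>set q. base E q + ma \<le> g v)) \<or> (B.accepted \<and> (\<exists>v\<in>set q. base E q + mb \<le> g v))"
    if g: "fits E (set q) g" for g
  proof -
    have "rep_on (Cs ! t) ad M g" using g M_pos unfolding A.setq by (simp add: fits_def rep_on_def)
    from order[OF this] have o: "umbrella_free ad q" "nonadj_sorted ad M g q \<or> nonadj_sorted ad M g (rev q)" by blast+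
    have u: "umbrella_free ad (rev q)" by (rule umbrella_free_rev[OF o(1)]) (rule ad_sym)
    from o(2) show ?thesis
    proof
      assume "nonadj_sorted ad M g q"
      from A.accepted_complete[OF this o(1) g] show ?thesis unfolding ma_def by blast
    next
      assume "nonadj_sorted ad M g (rev q)"
      from B.accepted_complete[OF this u] g show ?thesis unfolding mb_def set_rev bp by blast
    qed
  qed
  have st1: "if A.accepted then s1' ''bok'' 0 = 1 \<and> s1' ''bmx'' 0 = ma \<and> (\<forall>i<length q. s1' ''res'' (q ! i) = A.x i)
      else s1' ''bok'' 0 = 0" using s s1 unfolding A.best_step_def ma_def by (auto split: if_splits)
  show ?thesis
  proof (cases "B.accepted \<and> \<not> (s1' ''bok'' 0 = 1 \<and> \<not> mb < s1' ''bmx'' 0)")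
    case True
    hence r: "s2 ''bok'' 0 = 1" "s2 ''bmx'' 0 = mb" "\<forall>i<length (rev q). s2 ''res'' (rev q ! i) = B.x i"
      using s2 unfolding B.best_step_def mb_def by simp_all
    have "\<exists>v\<in>set q. base E q + mb \<le> g v" if "fits E (set q) g" for g
      using comp[OF that]
    proof
      assume a: "A.accepted \<and> (\<exists>v\<in>set q. base E q + ma \<le> g v)"
      hence "mb < ma" using st1 True by auto
      thus ?thesis using a by force
    qed blast
    moreover note B.accepted_result[OF conjunct1[OF True] r(3), folded mb_def]
    moreover have "B.inr mb" unfolding mb_def by (rule B.x_max_inr)
    ultimately show ?thesis unfolding B.best_def r(1,2) mb_def[symmetric] bp set_rev by simp
  next
    case False
    hence r: "s2 ''bok'' = s1' ''bok''" "s2 ''bmx'' = s1' ''bmx''" "s2 ''res'' = s1' ''res''"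
      using s2 unfolding B.best_step_def mb_def by auto
    show ?thesis
    proof (cases "A.accepted")
      case True
      with st1 have a: "s1' ''bok'' 0 = 1" "s1' ''bmx'' 0 = ma" "\<forall>i<length q. s1' ''res'' (q ! i) = A.x i" by simp_all
      have "\<exists>v\<in>set q. base E q + ma \<le> g v" if "fits E (set q) g" for g
        using comp[OF that]
      proof
        assume b: "B.accepted \<and> (\<exists>v\<in>set q. base E q + mb \<le> g v)"
        hence "ma \<le> mb" using False a by auto
        thus ?thesis using b by force
      qed blast
      moreover note A.accepted_result[OF True a(3), folded ma_def]
      moreover have "A.inr ma" unfolding ma_def by (rule A.x_max_inr)
      ultimately show ?thesis unfolding B.best_def r a(1,2) ma_def[symmetric] bp set_rev by simp
    next
      case nA: False
      hence z: "s1' ''bok'' 0 = 0" using st1 by simp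
      hence "\<not> B.accepted" using False by simp
      hence "\<not> fits E (set q) g" for g using comp[of g] nA by blast
      thus ?thesis unfolding B.best_def r z set_rev by simp
    qed
  qed
qed

text \<open>A bound on the position reached after placing \<open>t\<close> components.\<close>

definition EB :: "nat \<Rightarrow> int" where
  "EB t = 2 ^ (3 * r + 1) + (int t + 1) * (2 * ((int n + 5) * (M + 1)))"

text \<open>The growth per component is a word of size at most \<open>r^5\<close>, and at most
  \<open>r\<close> such terms are added: together below \<open>2 ^ (6 * r)\<close>, which leaves
  room for the starting value.\<close>

lemma EB_le: "1 \<le> n \<Longrightarrow> t \<le> n \<Longrightarrow> EB t \<le> 2 ^ (7 * r)"
proof -
  assume n: "1 \<le> n" "t \<le> n"
  define w where "w = (int n + 5) * (M + 1)"
  have w0: "0 \<le> w" using M1 by (simp add: w_def)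
  have "small (3 * w)" by (rule small_wide[OF n(1)]) (use w0 in \<open>simp add: w_def\<close>)
  hence w: "2 * w \<le> int r ^ 5" using w0 by (simp add: small_def)
  have "int t + 1 \<le> int r" using n(2) r_ge by linarith
  hence "(int t + 1) * (2 * w) \<le> int r * int r ^ 5" using w w0 by (intro mult_mono) auto
  also have "\<dots> = int r ^ 6" by (simp add: numeral_eq_Suc)
  also have "\<dots> \<le> (2 ^ r) ^ 6" using r_le_pow by (intro power_mono) auto
  also have "\<dots> = 2 ^ (6 * r)" by (simp add: power_mult[symmetric] mult.commute)
  finally have "EB t \<le> 2 ^ (3 * r + 1) + 2 ^ (6 * r)" by (simp add: EB_def w_def)
  moreover have "(2::int) ^ (3 * r + 1) \<le> 2 ^ (6 * r)" using r2 by (intro pow_mono) simp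
  moreover have "(2::int) * 2 ^ (6 * r) = 2 ^ (6 * r + 1)" by simp
  moreover have "(2::int) ^ (6 * r + 1) \<le> 2 ^ (7 * r)" using r2 by (intro pow_mono) simp
  ultimately show ?thesis by linarith
qed

text \<open>The last clause for success is the optimality on which the greedy argument rests: every
  representation to the right of \<open>E\<close> reaches at least the new \<open>E\<close>.\<close>

definition comp_step :: "int \<Rightarrow> nat \<Rightarrow> state \<Rightarrow> state \<Rightarrow> bool" where
  "comp_step E t s s' \<longleftrightarrow> (if s' ''fail'' 0 = 0 then fits E (Cs ! t) (s' ''X'') \<and> (\<forall>v. v \<notin> Cs ! t \<longrightarrow> s' ''X'' v = s ''X'' v) \<and>
      (\<forall>v\<in>Cs ! t. s' ''X'' v \<le> s' ''E'' 0 \<and> \<bar>s' ''X'' v\<bar> \<le> 2 ^ (7 * r + 2)) \<and> \<bar>s' ''E'' 0\<bar> \<le> EB (Suc t) \<and>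
      (\<forall>g. fits E (Cs ! t) g \<longrightarrow> (\<exists>v\<in>Cs ! t. s' ''E'' 0 \<le> g v))
    else s' ''fail'' 0 = 1 \<and> (\<forall>g. \<not> fits E (Cs ! t) g))"

lemma p_comp:
  assumes t: "t < length Cs" and a: "a \<in> Cs ! t" "s ''first'' t = int a" and st: "static s" and st0: "s ''t'' 0 = int t"
    and vis: "\<forall>v<n. 0 \<le> s ''vis'' v \<and> s ''vis'' v \<le> 2 * int t"
    and E: "s ''E'' 0 = E" "\<bar>E\<bar> \<le> EB t" and fl: "s ''fail'' 0 = 0"
  shows "wp p_comp s (34000 * ((n + 1 + G) * card (Cs ! t)))
    (\<lambda>s'. (\<forall>v<n. 0 \<le> s' ''vis'' v \<and> s' ''vis'' v \<le> 2 * int t + 2) \<and> comp_step E t s s')" (is "wp _ _ _ ?post")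
proof -
  have tn: "t < n" using t length_Cs by simp
  have E7: "\<bar>E\<bar> \<le> 2 ^ (7 * r)" using E(2) EB_le[of t] tn by simp
  define U where "U = (n + 1 + G) * card (Cs ! t)"
  have C1: "1 \<le> card (Cs ! t)" by (rule comp_card_pos[OF t])
  have U1: "1 \<le> U" using mult_le_mono[OF _ C1, of 1 "n + 1 + G"] by (simp add: U_def)
  have Un: "c * (n + 1) * card (Cs ! t) \<le> c * U" and UG: "c * G * card (Cs ! t) \<le> c * U" for c
    unfolding U_def mult.assoc by (intro mult_le_mono; simp)+
  have gr: "graph_ok s" using st by (simp add: static_def)
  show ?thesis unfolding p_comp_def U_def[symmetric]
  proof (rule wp_Seq[OF p_order[OF t a gr st0 vis]])
    fix s1 assume "\<exists>q. set q = Cs ! t \<and> distinct q \<and> holds (s1 ''q'') (q @ rev q) \<and> s1 ''tail'' 0 = int (length q) \<and>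
        (\<forall>v<n. 0 \<le> s1 ''vis'' v \<and> s1 ''vis'' v \<le> 2 * int t + 2) \<and>
        (\<forall>g. rep_on (Cs ! t) ad M g \<longrightarrow> umbrella_free ad q \<and> (nonadj_sorted ad M g q \<or> nonadj_sorted ad M g (rev q)))"
      and fr1: "\<And>z. z \<notin> wr p_order \<Longrightarrow> s1 z = s z"
    then obtain q where q: "set q = Cs ! t" "distinct q" and hq: "holds (s1 ''q'') (q @ rev q)" and tl1: "s1 ''tail'' 0 = int (length q)"
      and vis1: "\<forall>v<n. 0 \<le> s1 ''vis'' v \<and> s1 ''vis'' v \<le> 2 * int t + 2"
      and order: "\<forall>g. rep_on (Cs ! t) ad M g \<longrightarrow> umbrella_free ad q \<and> (nonadj_sorted ad M g q \<or> nonadj_sorted ad M g (rev q))"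
      by blast
    have lq: "length q = card (Cs ! t)" using q distinct_card by metis
    have ln: "length q \<le> n" using comp_card_le[OF t] lq by simp
    have atA: "attempt I L rk t E q 0" by unfold_locales (use t q E7 in simp_all)
    have atB: "attempt I L rk t E (rev q) (length q)" by unfold_locales (use t q E7 ln in simp_all)
    interpret A: attempt I D L rk t E q 0 by (rule atA)
    interpret B: attempt I D L rk t E "rev q" "length q" by (rule atB)
    have bp: "base E (rev q) = base E q" by (rule base_perm) simp
    have ua: "A.unit_cost = U" "B.unit_cost = U" by (simp_all add: A.unit_cost_def B.unit_cost_def U_def lq)
    have q1: "\<forall>i<length q. s1 ''q'' i = int (q ! i)" "\<forall>i<length q. s1 ''q'' (length q + i) = int (rev q ! i)"
      using hq by (auto simp: holds_def nth_append)
    have st1: "static s1" by (rule static_frame[OF st], erule fr1) (simp add: static_names_def input_names_def)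
    have E1: "s1 ''E'' 0 = E" using fr1[of "''E''"] E(1) by simp
    show "wp (Seq p_base (Seq p_attempt (Seq (Put ''off'' (Var ''tail'')) (Seq p_attempt p_commit)))) s1 (28000 * U) ?post"
    proof (rule wp_Seq[OF A.p_base[OF st1 E1 q1(1) tl1]])
      fix s2 assume r2: "env E q 0 s2 \<and> s2 ''bok'' 0 = 0 \<and> s2 ''bmx'' 0 = 0" and fr2: "\<And>z. z \<notin> wr p_base \<Longrightarrow> s2 z = s1 z"
      hence env2: "env E q 0 s2" and bok2: "s2 ''bok'' 0 = 0" and bmx2: "s2 ''bmx'' 0 = 0" by simp_all
      have i0: "A.inr (s2 ''bmx'' 0)" unfolding bmx2 A.inr_def using c_pre_le(2) M1 by simp
      show "wp (Seq p_attempt (Seq (Put ''off'' (Var ''tail'')) (Seq p_attempt p_commit))) s2 (27000 * U) ?post"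
      proof (rule wp_Seq[OF A.p_attempt[OF env2 _ i0]])
        show "small (s2 ''bok'' 0)" using bok2 by simp
        fix s3 assume bs3: "A.best_step s2 s3" and fr3: "\<And>z. z \<notin> wr p_attempt \<Longrightarrow> s3 z = s2 z"
        have env3: "env E q 0 s3" by (rule env_frame[OF env2], erule fr3) (simp add: env_names_def)
        have b3: "small (s3 ''bok'' 0)" "A.inr (s3 ''bmx'' 0)"
          using bs3 bok2 i0 A.x_max_inr unfolding A.best_step_def by (auto split: if_splits)
        show "wp (Seq (Put ''off'' (Var ''tail'')) (Seq p_attempt p_commit)) s3 (14000 * U) ?post"
        proof (rule wp_Seq_sl[OF md_W, where R = "\<lambda>s. s ''off'' 0 = int (length q)"])
          show "sl addr small small (Put ''off'' (Var ''tail'')) s3 (\<lambda>s. s ''off'' 0 = int (length q))"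
            using env3 A.sm_idx(5) by (simp add: env_def)
        next
          fix s4 assume off: "s4 ''off'' 0 = int (length q)" and fr4: "\<And>z. z \<notin> wr (Put ''off'' (Var ''tail'')) \<Longrightarrow> s4 z = s3 z"
          have "s4 ''q'' = s1 ''q''" using fr4[of "''q''"] fr3[of "''q''"] fr2[of "''q''"] by simp
          hence q4: "\<forall>i<length q. s4 ''q'' (length q + i) = int (rev q ! i)" using q1(2) by simp
          have k4: "s4 ''n'' = s3 ''n''" "s4 ''adj'' = s3 ''adj''" "s4 ''ord'' = s3 ''ord''" "s4 ''M'' = s3 ''M''"
            "s4 ''tail'' = s3 ''tail''" "s4 ''c1'' = s3 ''c1''" "s4 ''c2'' = s3 ''c2''" "s4 ''base'' = s3 ''base''"
            "s4 ''LB'' = s3 ''LB''" "s4 ''UC'' = s3 ''UC''" "s4 ''ub_den'' = s3 ''ub_den''"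
            "s4 ''bok'' = s3 ''bok''" "s4 ''bmx'' = s3 ''bmx''" "s4 ''res'' = s3 ''res''"
            by (rule fr4, simp)+
          have g4: "graph_ok s4" by (rule graph_ok_frame[of s3]) (use env3 k4 in \<open>simp_all add: env_def\<close>)
          have env4: "env E (rev q) (length q) s4"
            using env3 g4 q4 off k4 bp unfolding env_def by simp
          show "wp (Seq p_attempt p_commit) s4 (13000 * U) ?post"
          proof (rule wp_Seq[OF B.p_attempt[OF env4]])
            show "small (s4 ''bok'' 0)" "B.inr (s4 ''bmx'' 0)" using b3 k4 by simp_all
            fix s5 assume bs5: "B.best_step s4 s5" and fr5: "\<And>z. z \<notin> wr p_attempt \<Longrightarrow> s5 z = s4 z"
            have env5: "env E (rev q) (length q) s5" by (rule env_frame[OF env4], erule fr5) (simp add: env_names_def)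
            have best: "B.best s5"
              by (rule best_two[OF atA atB _ bok2 bs3 k4(12-14) bs5]) (use order in blast)
            have k5: "s5 ''vis'' = s1 ''vis''" "s5 ''fail'' = s ''fail''" "s5 ''X'' = s ''X''"
              using fr5[of "''vis''"] fr4[of "''vis''"] fr3[of "''vis''"] fr2[of "''vis''"]
                fr5[of "''fail''"] fr4[of "''fail''"] fr3[of "''fail''"] fr2[of "''fail''"] fr1[of "''fail''"]
                fr5[of "''X''"] fr4[of "''X''"] fr3[of "''X''"] fr2[of "''X''"] fr1[of "''X''"] by simp_all
            show "wp p_commit s5 (500 * U) ?post"
            proof (rule wp_mono[OF B.p_commit[OF env5 best]])
              show "400 * G * length (rev q) \<le> 500 * U" using UG[of 400] lq by simp
              fix s6 assume c: "if s5 ''bok'' 0 = 0 then s6 ''fail'' 0 = 1 else s6 ''fail'' = s5 ''fail'' \<and>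
                  (\<forall>v. s6 ''X'' v = (if v \<in> set (rev q) then base E (rev q) + s5 ''res'' v else s5 ''X'' v)) \<and>
                  s6 ''E'' 0 = base E (rev q) + s5 ''bmx'' 0"
                and fr6: "\<And>z. z \<notin> wr p_commit \<Longrightarrow> s6 z = s5 z"
              have "s6 ''vis'' = s1 ''vis''" using fr6[of "''vis''"] k5(1) by simp
              moreover have "comp_step E t s s6"
              proof (cases "s5 ''bok'' 0 = 0")
                case True
                hence "s6 ''fail'' 0 = 1" using c by simp
                moreover have "\<not> fits E (Cs ! t) g" for g using best True unfolding B.best_def set_rev q(1) by auto
                ultimately show ?thesis by (simp add: comp_step_def)
              next
                case False
                define b where "b = base E q"
                define m where "m = s5 ''bmx'' 0"
                have bst: "fits E (Cs ! t) (\<lambda>v. b + s5 ''res'' v)" "B.inr m"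
                    "\<forall>v\<in>Cs ! t. small (s5 ''res'' v) \<and> s5 ''res'' v \<le> m"
                    "\<forall>g. fits E (Cs ! t) g \<longrightarrow> (\<exists>v\<in>Cs ! t. b + m \<le> g v)"
                  using best False unfolding B.best_def bp set_rev q(1) b_def m_def by simp_all
                have X6: "s6 ''X'' v = (if v \<in> Cs ! t then b + s5 ''res'' v else s ''X'' v)" for v
                  using c False k5 unfolding bp set_rev q(1) b_def by simp
                have E6: "s6 ''E'' 0 = b + m" and f6: "s6 ''fail'' 0 = 0" using c False k5(2) fl unfolding bp b_def m_def by simp_all
                have b7: "\<bar>b\<bar> \<le> 2 ^ (7 * r + 1)" unfolding b_def by (rule A.big_bounds)
                have p7: "(2::int) ^ (7 * r + 2) = 2 * 2 ^ (7 * r + 1)" by simp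
                have 1: "s6 ''X'' v \<le> s6 ''E'' 0 \<and> \<bar>s6 ''X'' v\<bar> \<le> 2 ^ (7 * r + 2)" if v: "v \<in> Cs ! t" for v
                proof -
                  have "\<bar>s5 ''res'' v\<bar> \<le> 2 ^ (7 * r + 1)" using bst(3) v B.small_abs by blast
                  thus ?thesis using X6[of v] v E6 bst(3) b7 p7 by auto
                qed
                have 2: "fits E (Cs ! t) (s6 ''X'')" by (rule fits_cong[OF _ bst(1)]) (simp add: X6)
                define w where "w = int n * M"
                have we: "(int n + 5) * (M + 1) = w + int n + 5 * M + 5" "int n * (M + 1) = w + int n"
                  unfolding w_def by (simp_all add: algebra_simps)
                have w0: "0 \<le> w" unfolding w_def by (rule nM)
                have EB3: "2 ^ (3 * r + 1) \<le> EB t" using w0 M1 by (simp add: EB_def we)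
                \<comment> \<open>The new position is \<open>b + m\<close>, where \<open>b\<close>
                  is a lower bound of the component or \<open>E + M + 1\<close>, and
                  \<open>m\<close> lies in the range of relative coordinates. The increment of
                  \<open>EB\<close> covers both contributions.\<close>
                have EBS: "EB (Suc t) = EB t + 2 * w + 2 * int n + 10 * M + 10" unfolding EB_def w_def by (simp add: algebra_simps)
                have lbE: "\<bar>lb E v\<bar> \<le> EB t + M + 1" if "v < n" for v
                  using LC_abs[OF that] EB3 E(2) M1 unfolding lb_def max_def by auto
                have "b = E + M + 1 \<or> (\<exists>j<length q. b = lb E (q ! j))" unfolding b_def base_def by (rule prefix_max_attained)
                hence "\<bar>b\<bar> \<le> EB t + M + 1" using lbE A.q_less E(2) M1 by auto
                moreover have "\<bar>m\<bar> \<le> w + int n + 4 * M" using bst(2) w0 M1 unfolding B.inr_def c_eq w_def[symmetric] we by linarith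
                ultimately have 3: "\<bar>s6 ''E'' 0\<bar> \<le> EB (Suc t)" unfolding EBS E6 using w0 M1 by linarith
                show ?thesis unfolding comp_step_def using 1 2 3 f6 bst(4) X6 E6 by simp
              qed
              ultimately show "?post s6" using vis1 by simp
            qed
          next
            show "12000 * B.unit_cost + 500 * U \<le> 13000 * U" unfolding ua by simp
          qed
        next
          show "csize (Put ''off'' (Var ''tail'')) * 7 + 13000 * U \<le> 14000 * U" using U1 by simp
        qed
      next
        show "12000 * A.unit_cost + 14000 * U \<le> 27000 * U" unfolding ua by simp
      qed
    next
      show "900 * G * length q + 27000 * U \<le> 28000 * U" using UG[of 900] unfolding lq by linarith
    qed
  next
    show "6000 * (n + 1) * card (Cs ! t) + 28000 * U \<le> 34000 * U" using Un[of 6000] by linarith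
  qed
qed

end

section \<open>The complete program and its preprocessing phase\<close>

definition p_first :: com where
  "p_first = Seq (Put ''ncomp'' (Const 0)) (For ''i'' ''n'' (seqs [Put ''v'' (Cell ''comp'' (Var ''i'')),
     Assign ''first'' (Var ''v'') (Var ''i''),
     If (Less (Var ''ncomp'') (Plus (Var ''v'') (Const 1))) (Put ''ncomp'' (Plus (Var ''v'') (Const 1))) Skip]))"

definition p_pre :: com where
  "p_pre = Seq p_adj (Seq p_deg (Seq p_ord (Seq p_bnd (Seq p_Q (Seq p_res (Seq p_sort (Seq p_rank p_first)))))))"

definition p_main :: com where
  "p_main = Seq (Put ''fail'' (Const 0)) (For ''t'' ''ncomp'' (If (Equal (Var ''fail'') (Const 0)) p_comp Skip))"

definition b_out :: com where
  "b_out = seqs [Put ''y'' (Div (Cell ''X'' (Var ''i'')) (Var ''M'')), Put ''z'' (Mod (Cell ''X'' (Var ''i'')) (Var ''M'')),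
     Assign ''out_num'' (Var ''i'') (Plus (Times (Plus (Times (Var ''y'') (Var ''Q''))
        (Cell ''f'' (Cell ''S'' (Div (Var ''z'') (Var ''n1''))))) (Var ''n1'')) (Mod (Var ''z'') (Var ''n1''))),
     Assign ''out_den'' (Var ''i'') (Times (Var ''Q'') (Var ''n1''))]"

definition p_out :: com where
  "p_out = If (Equal (Var ''fail'') (Const 0)) (Seq (Put ''yes'' (Const 1)) (For ''i'' ''n'' b_out)) (Put ''yes'' (Const 0))"

definition boundrep_program :: com where
  "boundrep_program = Seq p_pre (Seq p_code (Seq p_main p_out))"

lemma wr_pre [simp]: "wr p_adj = {''i'', ''u'', ''v'', ''adj''}" "wr p_deg = {''i'', ''j'', ''deg''}"
  "wr p_ord = {''n1'', ''k'', ''e'', ''i'', ''ord''}" "wr p_bnd = {''i'', ''num'', ''den'', ''j'', ''N'', ''Q''}"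
  "wr p_Q = {''i'', ''Q''}" "wr p_res = {''i'', ''t'', ''A'', ''f''}"
  "wr p_sort = {''d'', ''i'', ''lo'', ''hi'', ''mid'', ''found'', ''len'', ''j'', ''S''}"
  "wr p_rank = {''i'', ''lo'', ''hi'', ''mid'', ''rk''}"
  "wr p_first = {''ncomp'', ''i'', ''v'', ''first''}"
  "wr p_code = {''E0'', ''n1'', ''M'', ''i'', ''L0'', ''E'', ''LC'', ''j'', ''UC''}"
  by (auto simp: p_adj_def p_deg_def p_ord_def p_bnd_def p_Q_def p_res_def p_sort_def p_rank_def p_first_def p_code_def
      p_search_def b_search_def p_insert_def)

lemma wr_main [simp]: "wr p_comp = {''a'', ''st'', ''u'', ''old'', ''i'', ''w'', ''vis'', ''q'', ''tail'', ''zi'', ''head'',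
    ''e1'', ''base'', ''c1'', ''c2'', ''bok'', ''bmx'', ''off'', ''y'', ''LB'', ''fn'', ''ln'', ''j'', ''x'', ''rd'', ''p'', ''z'',
    ''ok'', ''mx'', ''res'', ''fail'', ''X'', ''E''}"
  "wr b_out = {''y'', ''z'', ''out_num'', ''out_den''}"
  by (auto simp: p_comp_def b_out_def)

lemma wr_p_pre: "wr p_pre = {''i'', ''u'', ''v'', ''adj'', ''j'', ''deg'', ''n1'', ''k'', ''e'', ''ord'', ''num'', ''den'', ''N'', ''Q'',
    ''t'', ''A'', ''f'', ''d'', ''lo'', ''hi'', ''mid'', ''found'', ''len'', ''S'', ''rk'', ''ncomp'', ''first''}"
  by (auto simp: p_pre_def)

lemma wr_p_main: "wr p_main = insert ''t'' (wr p_comp)"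
  by (auto simp: p_main_def)

lemma input_size_ge2: "2 \<le> input_size I"
  by (simp add: input_size_def encode_def nbits_def)

context prun
begin

text \<open>The unit in which all phases are measured. The factor \<open>n + 1\<close> instead of
  \<open>n\<close> also pays for constant work when there are no vertices.\<close>

definition V :: nat where "V = (n + 1 + G) * (n + 1)"

lemma V_bounds: "(n + 1) * (n + 1) \<le> V" "G * (n + 1) \<le> V" "r * (n + 1) \<le> V" "n + 1 \<le> V" "1 \<le> V" "r \<le> V"
proof -
  show a: "(n + 1) * (n + 1) \<le> V" and "G * (n + 1) \<le> V" unfolding V_def by (intro mult_le_mono1; simp)+
  show rV: "r * (n + 1) \<le> V" unfolding V_def G_def by (intro mult_le_mono1) simp
  have "1 * (n + 1) \<le> (n + 1) * (n + 1)" by (intro mult_le_mono1) simp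
  from order_trans[OF this a] show "n + 1 \<le> V" by (simp only: mult_1)
  thus "1 \<le> V" by simp
  have "r * 1 \<le> r * (n + 1)" by (intro mult_le_mono2) simp
  thus "r \<le> V" using rV by linarith
qed

definition firsts_ok :: "state \<Rightarrow> bool" where
  "firsts_ok s \<longleftrightarrow> s ''ncomp'' 0 = int (length Cs) \<and> (\<forall>t<length Cs. \<exists>a\<in>Cs ! t. s ''first'' t = int a)"

text \<open>Components are nonempty, so every position of the component order is attained by a
  vertex. Hence each receives a representative, and their number is the largest position plus
  1.\<close>

lemma p_first:
  assumes inp: "inputs s"
  shows "wp p_first s (1000 * (n + 1)) firsts_ok"
proof -
  let ?b = "seqs [Put ''v'' (Cell ''comp'' (Var ''i'')), Assign ''first'' (Var ''v'') (Var ''i''),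
     If (Less (Var ''ncomp'') (Plus (Var ''v'') (Const 1))) (Put ''ncomp'' (Plus (Var ''v'') (Const 1))) Skip]"
  define J1 where "J1 i c \<longleftrightarrow> (\<exists>m\<le>length Cs. c = int m \<and> (\<forall>j<i. comp_index I j < m))" for i and c :: int
  define J2 where "J2 i fa \<longleftrightarrow> (\<forall>j<i. \<exists>a\<in>Cs ! comp_index I j. fa (comp_index I j) = int a)" for i and fa :: "nat \<Rightarrow> int"
  have len: "length Cs \<le> n" by (rule length_Cs)
  have J1S: "J1 (Suc i) (if c < int (comp_index I i) + 1 then int (comp_index I i) + 1 else c)" if J: "J1 i c" and i: "i < n" for i c
  proof -
    from J obtain m where m: "m \<le> length Cs" "c = int m" "\<forall>j<i. comp_index I j < m" unfolding J1_def by blast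
    have ci: "comp_index I i < length Cs" using comp_index[OF i] by blast
    show ?thesis unfolding J1_def
      by (rule exI[of _ "max m (Suc (comp_index I i))"]) (use m ci in \<open>auto simp: less_Suc_eq max_def\<close>)
  qed
  have J2S: "J2 (Suc i) (fa(comp_index I i := int i))" if J: "J2 i fa" and i: "i < n" for i fa
    unfolding J2_def
  proof (intro allI impI)
    fix j assume j: "j < Suc i"
    show "\<exists>a\<in>Cs ! comp_index I j. (fa(comp_index I i := int i)) (comp_index I j) = int a"
    proof (cases "comp_index I j = comp_index I i")
      case True
      have "i \<in> Cs ! comp_index I i" using comp_index[OF i] by blast
      thus ?thesis unfolding True by (intro bexI[of _ i]) simp_all
    next
      case False
      hence "j \<noteq> i" by blast
      hence "j < i" using j by simp
      thus ?thesis using J False unfolding J2_def by simp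
    qed
  qed
  show ?thesis unfolding p_first_def
  proof (rule wp_Seq_sl[OF md_W, where R = "\<lambda>s. s ''ncomp'' 0 = 0"])
    show "sl addr small small (Put ''ncomp'' (Const 0)) s (\<lambda>s. s ''ncomp'' 0 = 0)" by simp
  next
    fix s1 assume z: "s1 ''ncomp'' 0 = 0" and fr1: "\<And>z. z \<notin> wr (Put ''ncomp'' (Const 0)) \<Longrightarrow> s1 z = s z"
    have inp1: "inputs s1" by (rule inputs_frame[OF inp], erule fr1) (simp add: input_names_def)
    show "wp (For ''i'' ''n'' ?b) s1 (900 * (n + 1)) firsts_ok"
    proof (rule wp_For_W[where I = "\<lambda>i s. J1 i (s ''ncomp'' 0) \<and> J2 i (s ''first'')" and N = n])
      show "s1 ''n'' 0 = int n" by (rule inputsD[OF inp1])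
      show "small (int n)" by (rule small_le) simp
      show "J1 0 (store s1 ''i'' 0 0 ''ncomp'' 0) \<and> J2 0 (store s1 ''i'' 0 0 ''first'')"
        using z by (simp add: J1_def J2_def)
      show "csize ?b * 7 * n + 100 * (n + 1) \<le> 900 * (n + 1)" by simp
    next
      fix i s2 assume i: "i < n" and J: "J1 i (s2 ''ncomp'' 0) \<and> J2 i (s2 ''first'')" and ii: "s2 ''i'' 0 = int i"
        and fr2: "\<And>z. z \<notin> insert ''i'' (wr ?b) \<Longrightarrow> s2 z = s1 z"
      have inp2: "inputs s2" by (rule inputs_frame[OF inp1], erule fr2) (simp add: input_names_def)
      define c where "c = comp_index I i"
      have cl: "c < n" using comp_index[OF i] len unfolding c_def by simp
      have e: "s2 ''comp'' i = int c" using inputsD(9)[OF inp2 i] by (simp add: c_def)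
      define m where "m = s2 ''ncomp'' 0"
      have m: "J1 i m" "J2 i (s2 ''first'')" using J by (simp_all add: m_def)
      have sm: "small m" using m(1) small_le len unfolding J1_def by force
      have ss: "small (int i)" "small (int c)" "small (int c + 1)"
        using small_le[of i] small_le[of c] small_le[of "c + 1"] i cl by (simp_all add: add.commute)
      note j1 = J1S[OF m(1) i, folded c_def] and j2 = J2S[OF m(2) i, folded c_def]
      show "sl addr small small ?b s2 (\<lambda>s'. J1 (Suc i) (store s' ''i'' 0 (int (Suc i)) ''ncomp'' 0) \<and>
          J2 (Suc i) (store s' ''i'' 0 (int (Suc i)) ''first''))"
        using ii e ss sm j1 j2 m_def[symmetric] by (cases "m < int c + 1") (simp_all add: addr_def)
    next
      fix s2 assume J: "J1 n (s2 ''ncomp'' 0) \<and> J2 n (s2 ''first'')"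
      then obtain m where m: "m \<le> length Cs" "s2 ''ncomp'' 0 = int m" "\<forall>j<n. comp_index I j < m" unfolding J1_def by blast
      have ex: "\<exists>v<n. comp_index I v = t" if t: "t < length Cs" for t
      proof -
        obtain v where v: "v \<in> Cs ! t" using comp_nonempty[OF t] by blast
        thus ?thesis using comp_index_eq[OF t v] comp_sub[OF t] by blast
      qed
      have "m = length Cs"
      proof (rule ccontr)
        assume "m \<noteq> length Cs"
        hence "m < length Cs" using m(1) by simp
        from ex[OF this] m(3) show False by blast
      qed
      moreover have "\<exists>a\<in>Cs ! t. s2 ''first'' t = int a" if "t < length Cs" for t
        using ex[OF that] J unfolding J2_def by blast
      ultimately show "firsts_ok s2" using m(2) by (simp add: firsts_ok_def)
    qed simp_all
  next
    show "csize (Put ''ncomp'' (Const 0)) * 7 + 900 * (n + 1) \<le> 1000 * (n + 1)" by simp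
  qed
qed

definition prepared :: "nat list \<Rightarrow> (nat \<Rightarrow> nat) \<Rightarrow> state \<Rightarrow> bool" where
  "prepared L rk s \<longleftrightarrow> inputs s \<and> adj_ok s \<and> holds (s ''ord'') ord \<and> residues_ok s \<and> s ''Q'' 0 = Q \<and> firsts_ok s \<and>
     holds (s ''S'') L \<and> s ''d'' 0 = int (length L) \<and> sorted_idx L (2 * n + 1) \<and>
     (\<forall>i<2 * n + 1. s ''rk'' i = int (rk i) \<and> rk i < length L \<and> f (L ! rk i) = f i)"

lemma p_pre:
  assumes inp: "inputs s" and z: "s ''adj'' = (\<lambda>_. 0)" "s ''deg'' = (\<lambda>_. 0)"
  shows "wp p_pre s (30000 * V) (\<lambda>s. \<exists>L rk. prepared L rk s)" (is "wp _ _ _ ?post")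
proof -
  have sq: "(n + 2) * (n + 2) \<le> 4 * V"
  proof -
    have "(n + 2) * (n + 2) \<le> (2 * (n + 1)) * (2 * (n + 1))" by (intro mult_le_mono) simp_all
    also have "\<dots> = 4 * ((n + 1) * (n + 1))" by simp
    finally show ?thesis using V_bounds(1) by linarith
  qed
  have G2: "c * G * (2 * n + 1 + 1) \<le> 2 * c * V" and r2': "c * r * (2 * n + 2) \<le> 2 * c * V" for c
  proof -
    have "c * G * (2 * n + 1 + 1) = 2 * c * (G * (n + 1))" "c * r * (2 * n + 2) = 2 * c * (r * (n + 1))"
      by (simp_all add: algebra_simps)
    thus "c * G * (2 * n + 1 + 1) \<le> 2 * c * V" "c * r * (2 * n + 2) \<le> 2 * c * V"
      using V_bounds(2,3) by (simp_all only: mult_le_mono2)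
  qed
  have s1: "n * n + n + 2 \<le> 2 * V"
  proof -
    have "n * n + n + 2 \<le> 2 * ((n + 1) * (n + 1))" by (simp add: algebra_simps)
    thus ?thesis using V_bounds(1) by linarith
  qed
  show ?thesis unfolding p_pre_def
  proof (rule wp_Seq[OF p_adj[OF inp z(1)]])
    fix s1 assume a1: "adj_ok s1" and fr1: "\<And>z. z \<notin> wr p_adj \<Longrightarrow> s1 z = s z"
    have inp1: "inputs s1" by (rule inputs_frame[OF inp], erule fr1) (simp add: input_names_def)
    have z1: "s1 ''deg'' = (\<lambda>_. 0)" using fr1[of "''deg''"] z(2) by simp
    show "wp (Seq p_deg (Seq p_ord (Seq p_bnd (Seq p_Q (Seq p_res (Seq p_sort (Seq p_rank p_first))))))) s1 (28800 * V) ?post"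
    proof (rule wp_Seq[OF p_deg[OF inp1 z1 a1]])
      fix s2 assume d2: "\<forall>u<n. s2 ''deg'' u = int (dgr u)" and fr2: "\<And>z. z \<notin> wr p_deg \<Longrightarrow> s2 z = s1 z"
      have inp2: "inputs s2" by (rule inputs_frame[OF inp1], erule fr2) (simp add: input_names_def)
      have a2: "adj_ok s2" using a1 fr2[of "''adj''"] by (simp add: adj_ok_def)
      show "wp (Seq p_ord (Seq p_bnd (Seq p_Q (Seq p_res (Seq p_sort (Seq p_rank p_first)))))) s2 (28000 * V) ?post"
      proof (rule wp_Seq[OF p_ord[OF inp2 d2]])
        fix s3 assume o3: "holds (s3 ''ord'') ord" and fr3: "\<And>z. z \<notin> wr p_ord \<Longrightarrow> s3 z = s2 z"
        have inp3: "inputs s3" by (rule inputs_frame[OF inp2], erule fr3) (simp add: input_names_def)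
        have a3: "adj_ok s3" using a2 fr3[of "''adj''"] by (simp add: adj_ok_def)
        show "wp (Seq p_bnd (Seq p_Q (Seq p_res (Seq p_sort (Seq p_rank p_first))))) s3 (26000 * V) ?post"
        proof (rule wp_Seq[OF p_bnd[OF inp3]])
          fix s4 assume b4: "bounds_ok s4 \<and> s4 ''Q'' 0 = 1" and fr4: "\<And>z. z \<notin> wr p_bnd \<Longrightarrow> s4 z = s3 z"
          have inp4: "inputs s4" by (rule inputs_frame[OF inp3], erule fr4) (simp add: input_names_def)
          have k4: "s4 ''adj'' = s3 ''adj''" "s4 ''ord'' = s3 ''ord''" by (rule fr4, simp)+
          show "wp (Seq p_Q (Seq p_res (Seq p_sort (Seq p_rank p_first)))) s4 (24000 * V) ?post"
          proof (rule wp_Seq[OF p_Q[OF conjunct1[OF b4] conjunct2[OF b4]]])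
            fix s5 assume q5: "s5 ''Q'' 0 = Q" and fr5: "\<And>z. z \<notin> wr p_Q \<Longrightarrow> s5 z = s4 z"
            have inp5: "inputs s5" by (rule inputs_frame[OF inp4], erule fr5) (simp add: input_names_def)
            have k5: "s5 ''adj'' = s4 ''adj''" "s5 ''ord'' = s4 ''ord''" "s5 ''num'' = s4 ''num''" "s5 ''den'' = s4 ''den''" "s5 ''N'' = s4 ''N''"
              by (rule fr5, simp)+
            have b5: "bounds_ok s5" using b4 k5 by (simp add: bounds_ok_def)
            show "wp (Seq p_res (Seq p_sort (Seq p_rank p_first))) s5 (23000 * V) ?post"
            proof (rule wp_Seq[OF p_res[OF b5 q5]])
              fix s6 assume r6: "\<forall>i<2 * n + 1. s6 ''A'' i = A i \<and> s6 ''f'' i = f i" and fr6: "\<And>z. z \<notin> wr p_res \<Longrightarrow> s6 z = s5 z"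
              have inp6: "inputs s6" by (rule inputs_frame[OF inp5], erule fr6) (simp add: input_names_def)
              have k6: "s6 ''adj'' = s5 ''adj''" "s6 ''ord'' = s5 ''ord''" "s6 ''N'' = s5 ''N''" "s6 ''Q'' = s5 ''Q''"
                by (rule fr6, simp)+
              have res6: "residues_ok s6" using r6 by (simp add: residues_ok_def)
              have N6: "s6 ''N'' 0 = int (2 * n + 1)" using k6 b5 by (simp add: bounds_ok_def)
              show "wp (Seq p_sort (Seq p_rank p_first)) s6 (22000 * V) ?post"
              proof (rule wp_Seq[OF p_sort[OF res6 N6]])
                fix s7 assume "\<exists>L. holds (s7 ''S'') L \<and> s7 ''d'' 0 = int (length L) \<and> sorted_idx L (2 * n + 1)"
                  and fr7: "\<And>z. z \<notin> wr p_sort \<Longrightarrow> s7 z = s6 z"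
                then obtain L where L: "holds (s7 ''S'') L" "s7 ''d'' 0 = int (length L)" "sorted_idx L (2 * n + 1)" by blast
                have inp7: "inputs s7" by (rule inputs_frame[OF inp6], erule fr7) (simp add: input_names_def)
                have k7: "s7 ''adj'' = s6 ''adj''" "s7 ''ord'' = s6 ''ord''" "s7 ''N'' = s6 ''N''" "s7 ''Q'' = s6 ''Q''"
                    "s7 ''A'' = s6 ''A''" "s7 ''f'' = s6 ''f''"
                  by (rule fr7, simp)+
                have res7: "residues_ok s7" and N7: "s7 ''N'' 0 = int (2 * n + 1)" using res6 N6 k7 by (simp_all add: residues_ok_def)
                show "wp (Seq p_rank p_first) s7 (10000 * V) ?post"
                proof (rule wp_Seq[OF p_rank[OF res7 N7 L]])
                  fix s8 assume rk8: "\<forall>i<2 * n + 1. \<exists>p<length L. s8 ''rk'' i = int p \<and> f (L ! p) = f i"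
                    and fr8: "\<And>z. z \<notin> wr p_rank \<Longrightarrow> s8 z = s7 z"
                  have inp8: "inputs s8" by (rule inputs_frame[OF inp7], erule fr8) (simp add: input_names_def)
                  have k8: "s8 ''adj'' = s7 ''adj''" "s8 ''ord'' = s7 ''ord''" "s8 ''Q'' = s7 ''Q''"
                      "s8 ''A'' = s7 ''A''" "s8 ''f'' = s7 ''f''" "s8 ''S'' = s7 ''S''" "s8 ''d'' = s7 ''d''"
                    by (rule fr8, simp)+
                  show "wp p_first s8 (1000 * V) ?post"
                  proof (rule wp_mono[OF p_first[OF inp8]])
                    show "1000 * (n + 1) \<le> 1000 * V" using V_bounds(4) by (rule mult_le_mono2)
                    fix s9 assume f9: "firsts_ok s9" and fr9: "\<And>z. z \<notin> wr p_first \<Longrightarrow> s9 z = s8 z"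
                    have inp9: "inputs s9" by (rule inputs_frame[OF inp8], erule fr9) (simp add: input_names_def)
                    have k9: "s9 ''adj'' = s8 ''adj''" "s9 ''ord'' = s8 ''ord''" "s9 ''Q'' = s8 ''Q''" "s9 ''rk'' = s8 ''rk''"
                        "s9 ''A'' = s8 ''A''" "s9 ''f'' = s8 ''f''" "s9 ''S'' = s8 ''S''" "s9 ''d'' = s8 ''d''"
                      by (rule fr9, simp)+
                    note k = k9 k8 k7 k6 k5 k4
                    have "adj_ok s9" using a3 k by (simp add: adj_ok_def)
                    moreover have "holds (s9 ''ord'') ord" "holds (s9 ''S'') L" "s9 ''d'' 0 = int (length L)" "s9 ''Q'' 0 = Q"
                      using o3 L q5 k by simp_all
                    moreover have "residues_ok s9" using res7 k by (simp add: residues_ok_def)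
                    moreover have "\<forall>i<2 * n + 1. s9 ''rk'' i = int (nat (s9 ''rk'' i)) \<and> nat (s9 ''rk'' i) < length L \<and> f (L ! nat (s9 ''rk'' i)) = f i"
                    proof (intro allI impI)
                      fix i assume "i < 2 * n + 1"
                      then obtain p where p: "p < length L" "s8 ''rk'' i = int p" "f (L ! p) = f i" using rk8 by blast
                      have "s9 ''rk'' i = int p" using p(2) k9 by simp
                      thus "s9 ''rk'' i = int (nat (s9 ''rk'' i)) \<and> nat (s9 ''rk'' i) < length L \<and> f (L ! nat (s9 ''rk'' i)) = f i"
                        using p by simp
                    qed
                    ultimately have "prepared L (\<lambda>i. nat (s9 ''rk'' i)) s9" using inp9 f9 L(3) unfolding prepared_def by blast
                    thus "?post s9" by blast
                  qed
                next
                  show "4000 * r * (2 * n + 2) + 1000 * V \<le> 10000 * V" using r2'[of 4000] by linarith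
                qed
              next
                show "4000 * r * (2 * n + 2) + 10000 * V \<le> 22000 * V" using r2'[of 4000] by linarith
              qed
            next
              show "200 * G * (2 * n + 1 + 1) + 22000 * V \<le> 23000 * V" using G2[of 200] by linarith
            qed
          next
            show "150 * G * (2 * n + 1 + 1) + 23000 * V \<le> 24000 * V" using G2[of 150] by linarith
          qed
        next
          show "800 * G * (2 * n + 1 + 1) + 24000 * V \<le> 26000 * V" using G2[of 800] by linarith
        qed
      next
        show "500 * ((n + 2) * (n + 2)) + 26000 * V \<le> 28000 * V" using mult_le_mono2[OF sq, of 500] by linarith
      qed
    next
      show "400 * ((n + 1) * (n + 1)) + 28000 * V \<le> 28800 * V" using mult_le_mono2[OF V_bounds(1), of 400] by linarith
    qed
  next
    show "600 * (n * n + n + 2) + 28800 * V \<le> 30000 * V" using mult_le_mono2[OF s1, of 600] by linarith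
  qed
qed

end

section \<open>Placing all components\<close>

context inst
begin

lemma is_solution_cong:
  assumes "\<And>v. v < n \<Longrightarrow> l v = l' v" "is_solution I l"
  shows "is_solution I l'"
proof -
  have lc: "l u = l' u" if "t < length Cs" "u \<in> Cs ! t" for t u
    using assms(1)[of u] comp_sub[OF that(1)] that(2) by auto
  have "left_of (unit_interval (l' u)) (unit_interval (l' v))"
    if h: "Suc t < length Cs" "u \<in> Cs ! t" "v \<in> Cs ! Suc t" for t u v
  proof -
    have "left_of (unit_interval (l u)) (unit_interval (l v))"
      using assms(2) h unfolding is_solution_def respects_order_def by blast
    thus ?thesis unfolding lc[OF Suc_lessD[OF h(1)] h(2)] lc[OF h(1,3)] .
  qed
  moreover have "bounded_rep (vertices I) (edges I) (lbound I) (ubound I) l'"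
    using assms unfolding is_solution_def bounded_rep_def vertices_def by simp
  ultimately show ?thesis unfolding is_solution_def respects_order_def by blast
qed

end

context pmain
begin

text \<open>\<open>grid_sol\<close> restricted to the first \<open>t\<close> components, with the
  rightmost left endpoint and a size bound for the output phase added.\<close>

definition placed :: "nat \<Rightarrow> (nat \<Rightarrow> int) \<Rightarrow> int \<Rightarrow> bool" where
  "placed t X E \<longleftrightarrow>
     (\<forall>s<t. \<forall>u\<in>Cs ! s. \<forall>v\<in>Cs ! s. ad u v \<longleftrightarrow> \<bar>X u - X v\<bar> \<le> M) \<and>
     (\<forall>t'<t. \<forall>s<t'. \<forall>u\<in>Cs ! s. \<forall>v\<in>Cs ! t'. X u + M < X v) \<and>
     (\<forall>s<t. \<forall>v\<in>Cs ! s. LC v \<le> X v \<and> (ufin v \<longrightarrow> X v \<le> UC v) \<and> X v \<le> E \<and> \<bar>X v\<bar> \<le> 2 ^ (7 * r + 2))"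

text \<open>\<open>tight t E\<close>: no solution can have the components from the \<open>t\<close>-th on start at \<open>E + M\<close> or earlier.\<close>

definition tight :: "nat \<Rightarrow> int \<Rightarrow> bool" where
  "tight t E \<longleftrightarrow> (\<forall>g. grid_sol g \<and> (\<forall>v<n. low * M \<le> g v) \<longrightarrow> (\<forall>s. t \<le> s \<and> s < length Cs \<longrightarrow> (\<forall>v\<in>Cs ! s. E + M < g v)))"

definition progress :: "nat \<Rightarrow> state \<Rightarrow> bool" where
  "progress t s \<longleftrightarrow> (if s ''fail'' 0 = 0 then placed t (s ''X'') (s ''E'' 0) \<and> tight t (s ''E'' 0) \<and> \<bar>s ''E'' 0\<bar> \<le> EB t
     else s ''fail'' 0 = 1 \<and> \<not> (\<exists>l. is_solution I l))"

lemma progress_frame: "progress t s \<Longrightarrow> s' ''fail'' = s ''fail'' \<Longrightarrow> s' ''X'' = s ''X'' \<Longrightarrow> s' ''E'' = s ''E'' \<Longrightarrow> progress t s'"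
  by (simp add: progress_def)

text \<open>Tightness supplies the separation from the earlier components, although \<open>g\<close>
  may place those differently from the program.\<close>

lemma grid_sol_fits:
  assumes g: "grid_sol g" "\<forall>v<n. low * M \<le> g v" and E: "tight t E" and t: "t < length Cs"
  shows "fits E (Cs ! t) g"
proof -
  have "E + M < g v" if "v \<in> Cs ! t" for v using E g t that unfolding tight_def by blast
  moreover have "v < n" if "v \<in> Cs ! t" for v using comp_sub[OF t] that by auto
  ultimately show ?thesis using g(1) t unfolding grid_sol_def fits_def lb_def by force
qed

text \<open>The exchange argument of the greedy method. A failure refutes every solution, because by
  tightness its restriction to component \<open>t\<close> would fit. After a success every solution
  has a vertex of this component at the new \<open>E\<close> or further right, so all later
  components start beyond it by more than \<open>M\<close>.\<close>

lemma progress_step: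
  assumes t: "t < length Cs" and p: "progress t s" and fl: "s ''fail'' 0 = 0" and c: "comp_step (s ''E'' 0) t s s'"
  shows "progress (Suc t) s'"
proof (cases "s' ''fail'' 0 = 0")
  case False
  hence f1: "s' ''fail'' 0 = 1" and nf: "\<not> fits (s ''E'' 0) (Cs ! t) g" for g using c unfolding comp_step_def by simp_all
  have ti: "tight t (s ''E'' 0)" using p fl by (simp add: progress_def)
  have "\<not> is_solution I l" for l
  proof
    assume "is_solution I l"
    from solution_imp_grid_sol[OF this] obtain g where "grid_sol g" "\<forall>v<n. low * M \<le> g v" by blast
    from grid_sol_fits[OF this ti t] show False using nf by blast
  qed
  thus ?thesis using f1 by (simp add: progress_def)
next
  case True
  define E where "E = s ''E'' 0"
  define E' where "E' = s' ''E'' 0"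
  define X where "X = s ''X''"
  define X' where "X' = s' ''X''"
  have c: "fits E (Cs ! t) X'" "\<forall>v. v \<notin> Cs ! t \<longrightarrow> X' v = X v" "\<forall>v\<in>Cs ! t. X' v \<le> E' \<and> \<bar>X' v\<bar> \<le> 2 ^ (7 * r + 2)"
      "\<bar>E'\<bar> \<le> EB (Suc t)" "\<forall>g. fits E (Cs ! t) g \<longrightarrow> (\<exists>v\<in>Cs ! t. E' \<le> g v)"
    using c True unfolding comp_step_def E_def E'_def X_def X'_def by simp_all
  have pl: "placed t X E" and ti: "tight t E" using p fl by (simp_all add: progress_def E_def X_def)
  have old: "X' v = X v" if "s < t" "v \<in> Cs ! s" for s v
  proof -
    have "v \<notin> Cs ! t" using comp_disjoint[of s t] that t by auto
    thus ?thesis using c(2) by blast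
  qed
  have new: "E + M + 1 \<le> X' v" "LC v \<le> X' v" "ufin v \<Longrightarrow> X' v \<le> UC v" if "v \<in> Cs ! t" for v
    using c(1) that by (auto simp: fits_def lb_def)
  obtain z where z: "z \<in> Cs ! t" using comp_nonempty[OF t] by blast
  have EE: "E \<le> E'"
  proof -
    have "E + M + 1 \<le> E'" using new(1)[OF z] c(3) z by fastforce
    thus ?thesis using M1 by simp
  qed
  have pl1: "ad u v \<longleftrightarrow> \<bar>X u - X v\<bar> \<le> M" if "s < t" "u \<in> Cs ! s" "v \<in> Cs ! s" for s u v
    using pl that unfolding placed_def by blast
  have pl2: "X u + M < X v" if "t' < t" "s < t'" "u \<in> Cs ! s" "v \<in> Cs ! t'" for t' s u v
    using pl that unfolding placed_def by blast
  have pl3: "LC v \<le> X v \<and> (ufin v \<longrightarrow> X v \<le> UC v) \<and> X v \<le> E \<and> \<bar>X v\<bar> \<le> 2 ^ (7 * r + 2)" if "s < t" "v \<in> Cs ! s" for s v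
    using pl that unfolding placed_def by blast
  have "placed (Suc t) X' E'" unfolding placed_def
  proof (intro conjI allI impI ballI)
    fix s u v assume s: "s < Suc t" and uv: "u \<in> Cs ! s" "v \<in> Cs ! s"
    show "ad u v \<longleftrightarrow> \<bar>X' u - X' v\<bar> \<le> M"
    proof (cases "s = t")
      case True
      thus ?thesis using c(1) uv unfolding fits_def by blast
    next
      case False
      hence "s < t" using s by simp
      thus ?thesis using pl1 uv old by simp
    qed
  next
    fix t' s u v assume h: "t' < Suc t" "s < t'" "u \<in> Cs ! s" "v \<in> Cs ! t'"
    show "X' u + M < X' v"
    proof (cases "t' = t")
      case True
      hence st: "s < t" "v \<in> Cs ! t" using h by simp_all
      have "X u \<le> E" using pl3[OF st(1) h(3)] by blast
      thus ?thesis using new(1)[OF st(2)] old[OF st(1) h(3)] by simp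
    next
      case False
      hence tt: "t' < t" using h(1) by simp
      thus ?thesis using pl2[OF tt h(2-4)] old[OF tt h(4)] old[OF less_trans[OF h(2) tt] h(3)] by simp
    qed
  next
    fix s v assume s: "s < Suc t" and v: "v \<in> Cs ! s"
    have "LC v \<le> X' v \<and> (ufin v \<longrightarrow> X' v \<le> UC v) \<and> X' v \<le> E' \<and> \<bar>X' v\<bar> \<le> 2 ^ (7 * r + 2)"
    proof (cases "s = t")
      case True
      thus ?thesis using new v c(3) by blast
    next
      case False
      hence "s < t" using s by simp
      thus ?thesis using pl3[OF _ v] old[OF _ v] EE by fastforce
    qed
    thus "LC v \<le> X' v" "ufin v \<Longrightarrow> X' v \<le> UC v" "X' v \<le> E'" "\<bar>X' v\<bar> \<le> 2 ^ (7 * r + 2)" by blast+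
  qed
  moreover have "tight (Suc t) E'" unfolding tight_def
  proof (intro allI impI ballI)
    fix g s v assume g: "grid_sol g \<and> (\<forall>v<n. low * M \<le> g v)" and s: "Suc t \<le> s \<and> s < length Cs" and v: "v \<in> Cs ! s"
    obtain u where u: "u \<in> Cs ! t" "E' \<le> g u"
      using grid_sol_fits[OF conjunct1[OF g] conjunct2[OF g] ti t] c(5) by blast
    have st: "t < s" "s < length Cs" using s by simp_all
    hence "g u + M < g v" using conjunct1[OF g] u(1) v unfolding grid_sol_def by blast
    thus "E' + M < g v" using u(2) by simp
  qed
  ultimately show ?thesis using True c(4) by (simp add: progress_def E'_def X'_def)
qed

text \<open>Initially tightness says that no vertex lies left of the substitute lower bound, which
  \<open>solution_imp_grid_sol\<close> guarantees for some grid solution.\<close>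

lemma progress_0:
  assumes "s ''fail'' 0 = 0" "s ''E'' 0 = low * M - M - 1"
  shows "progress 0 s"
proof -
  have "tight 0 (low * M - M - 1)" unfolding tight_def
  proof (intro allI impI ballI)
    fix g s v assume g: "grid_sol g \<and> (\<forall>v<n. low * M \<le> g v)" and s: "0 \<le> s \<and> s < length Cs" and v: "v \<in> Cs ! s"
    have "v < n" using comp_sub s v by blast
    hence "low * M \<le> g v" using g by blast
    thus "low * M - M - 1 + M < g v" by simp
  qed
  moreover have "\<bar>low * M - M - 1\<bar> \<le> EB 0"
  proof -
    define w where "w = int n * M"
    have w: "0 \<le> w" unfolding w_def by (rule nM)
    have "EB 0 = 2 ^ (3 * r + 1) + 2 * w + 2 * int n + 10 * M + 10" unfolding EB_def w_def by (simp add: algebra_simps)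
    thus ?thesis using lowM_abs w M1 by linarith
  qed
  ultimately show ?thesis using assms by (simp add: progress_def placed_def)
qed

lemma firsts_ok_frame: "firsts_ok s \<Longrightarrow> s' ''ncomp'' = s ''ncomp'' \<Longrightarrow> s' ''first'' = s ''first'' \<Longrightarrow> firsts_ok s'"
  by (simp add: firsts_ok_def)

lemma p_main:
  assumes st: "static s" and first: "firsts_ok s" and vis: "s ''vis'' = (\<lambda>_. 0)" and E: "s ''E'' 0 = low * M - M - 1"
  shows "wp p_main s (35000 * V) (progress (length Cs))"
  unfolding p_main_def
proof (rule wp_Seq_sl[OF md_W, where R = "\<lambda>s. s ''fail'' 0 = 0"])
  show "sl addr small small (Put ''fail'' (Const 0)) s (\<lambda>s. s ''fail'' 0 = 0)" by simp
next
  let ?b = "If (Equal (Var ''fail'') (Const 0)) p_comp Skip"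
  let ?T = "\<lambda>t. 34000 * ((n + 1 + G) * card (Cs ! t))"
  fix s1 assume f1: "s1 ''fail'' 0 = 0" and fr1: "\<And>z. z \<notin> wr (Put ''fail'' (Const 0)) \<Longrightarrow> s1 z = s z"
  have st1: "static s1" by (rule static_frame[OF st], erule fr1) (simp add: static_names_def input_names_def)
  have first1: "firsts_ok s1" by (rule firsts_ok_frame[OF first]; rule fr1; simp)
  have k1: "s1 ''vis'' = (\<lambda>_. 0)" "s1 ''E'' 0 = low * M - M - 1" using fr1[of "''vis''"] fr1[of "''E''"] vis E by simp_all
  let ?I = "\<lambda>t s. (\<forall>v<n. 0 \<le> s ''vis'' v \<and> s ''vis'' v \<le> 2 * int t) \<and> progress t s"
  show "wp (For ''t'' ''ncomp'' ?b) s1 (34900 * V) (progress (length Cs))"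
  proof (rule wp_For[where I = ?I and N = "length Cs" and Tb = "\<lambda>t. ?T t + 100"])
    show "s1 ''ncomp'' 0 = int (length Cs)" using first1 by (simp add: firsts_ok_def)
    show "small (int (length Cs))" using length_Cs by (intro small_le) simp
    have "progress 0 (store s1 ''t'' 0 0)" by (rule progress_0) (use f1 k1 in simp_all)
    thus "?I 0 (store s1 ''t'' 0 0)" using k1 by simp
    \<comment> \<open>The cost is linear in the size of the component, and the components partition
      the vertices.\<close>
    have "(\<Sum>t<length Cs. ?T t) = 34000 * ((n + 1 + G) * (\<Sum>t<length Cs. card (Cs ! t)))"
      by (simp only: sum_distrib_left)
    also have "\<dots> \<le> 34000 * ((n + 1 + G) * (n + 1))" using sum_card_le by (intro mult_le_mono2) simp
    finally have "(\<Sum>t<length Cs. ?T t) \<le> 34000 * V" unfolding V_def .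
    moreover have "(\<Sum>t<length Cs. ?T t + 100) = (\<Sum>t<length Cs. ?T t) + length Cs * 100"
      by (simp only: sum.distrib sum_constant card_lessThan of_nat_id)
    moreover have "length Cs + 1 \<le> V" using length_Cs V_bounds(4) by linarith
    moreover have "S' + 100 * (l + 1) \<le> 34900 * v" if "S \<le> 34000 * v" "S' = S + l * 100" "l + 1 \<le> v" for S S' l v :: nat
    proof -
      have "S' + 100 * (l + 1) \<le> S + 200 * (l + 1)" using that(2) by simp
      also have "\<dots> \<le> 34000 * v + 200 * v" using that(1,3) by (intro add_mono mult_le_mono2)
      finally show ?thesis by simp
    qed
    ultimately show "(\<Sum>t<length Cs. ?T t + 100) + 100 * (length Cs + 1) \<le> 34900 * V" by blast
  next
    fix t s2 assume t: "t < length Cs" and I2: "?I t s2" and t2: "s2 ''t'' 0 = int t"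
      and fr2: "\<And>z. z \<notin> insert ''t'' (wr ?b) \<Longrightarrow> s2 z = s1 z"
    have p2: "progress t s2" and v2: "\<forall>v<n. 0 \<le> s2 ''vis'' v \<and> s2 ''vis'' v \<le> 2 * int t" using I2 by simp_all
    have st2: "static s2" by (rule static_frame[OF st1], erule fr2) (simp add: static_names_def input_names_def)
    have first2: "firsts_ok s2" by (rule firsts_ok_frame[OF first1]; rule fr2; simp)
    have fl: "s2 ''fail'' 0 = 0 \<or> s2 ''fail'' 0 = 1" using p2 by (auto simp: progress_def split: if_splits)
    let ?post = "\<lambda>s'. ?I (Suc t) (store s' ''t'' 0 (int (Suc t)))"
    show "wp ?b s2 (?T t + 100) ?post"
    proof (rule wp_If[OF md_W, where Tp = "?T t + 1"])
      show "badm addr small small (Equal (Var ''fail'') (Const 0)) s2" using fl by auto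
    next
      assume "bval (Equal (Var ''fail'') (Const 0)) s2"
      hence f0: "s2 ''fail'' 0 = 0" by simp
      obtain a where a: "a \<in> Cs ! t" "s2 ''first'' t = int a" using first2 t unfolding firsts_ok_def by blast
      have Eb: "\<bar>s2 ''E'' 0\<bar> \<le> EB t" using p2 f0 by (simp add: progress_def)
      show "wp p_comp s2 (?T t + 1) ?post"
      proof (rule wp_mono[OF p_comp[OF t a st2 t2 v2 refl Eb f0]])
        fix s3 assume h: "(\<forall>v<n. 0 \<le> s3 ''vis'' v \<and> s3 ''vis'' v \<le> 2 * int t + 2) \<and> comp_step (s2 ''E'' 0) t s2 s3"
        have "progress (Suc t) s3" by (rule progress_step[OF t p2 f0 conjunct2[OF h]])
        hence "progress (Suc t) (store s3 ''t'' 0 (int (Suc t)))" by (rule progress_frame) simp_all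
        moreover have "2 * int (Suc t) = 2 * int t + 2" by simp
        ultimately show "?post s3" using conjunct1[OF h] by (simp del: of_nat_Suc)
      qed simp
    next
      assume "\<not> bval (Equal (Var ''fail'') (Const 0)) s2"
      hence f1: "s2 ''fail'' 0 \<noteq> 0" by simp
      have "progress (Suc t) s2" using p2 f1 unfolding progress_def by simp
      hence "progress (Suc t) (store s2 ''t'' 0 (int (Suc t)))" by (rule progress_frame) simp_all
      moreover have "\<forall>v<n. 0 \<le> s2 ''vis'' v \<and> s2 ''vis'' v \<le> 2 * int (Suc t)" using v2 by force
      ultimately have "?post s2" by (simp del: of_nat_Suc)
      thus "wp Skip s2 (?T t + 1) ?post" by (rule wp_Skip) simp
    qed simp
  qed simp_all
next
  show "csize (Put ''fail'' (Const 0)) * 7 + 34900 * V \<le> 35000 * V" using V_bounds(5) by simp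
qed

lemma placed_grid_sol: "placed (length Cs) X E \<Longrightarrow> grid_sol X"
proof -
  assume p: "placed (length Cs) X E"
  have "LC v \<le> X v \<and> (ufin v \<longrightarrow> X v \<le> UC v)" if v: "v < n" for v
  proof -
    obtain t where "t < length Cs" "v \<in> Cs ! t" using comp_of[OF v] by blast
    thus ?thesis using p unfolding placed_def by blast
  qed
  thus ?thesis using conjunct1[OF p[unfolded placed_def]] conjunct1[OF conjunct2[OF p[unfolded placed_def]]]
    unfolding grid_sol_def by simp
qed

text \<open>Coordinates have about \<open>7 * r\<close> bits; multiplying by \<open>Q\<close> and by
  \<open>n + 1\<close> adds \<open>r\<close> bits each. The result of about \<open>9 * r\<close>
  bits is the longest number of the whole program.\<close>

lemma out_bounds:
  assumes n1: "1 \<le> n" and X: "\<bar>X\<bar> \<le> 2 ^ (7 * r + 2)"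
  shows "big X" "big (X div M)" "big (X div M * Q)" "0 \<le> g \<Longrightarrow> g < Q \<Longrightarrow> big (X div M * Q + g)"
    "0 \<le> g \<Longrightarrow> g < Q \<Longrightarrow> big ((X div M * Q + g) * int (n + 1))"
    "0 \<le> g \<Longrightarrow> g < Q \<Longrightarrow> \<bar>m\<bar> \<le> int r \<Longrightarrow> big ((X div M * Q + g) * int (n + 1) + m)" "big (Q * int (n + 1))"
proof -
  have r7: "7 \<le> r" "n + 1 \<le> r" using r_ge n1 by simp_all
  have nr: "\<bar>int (n + 1)\<bar> \<le> 2 ^ r" using r7(2) r_le_pow by linarith
  have Qr: "\<bar>Q\<bar> \<le> 2 ^ r" using Q_le Q_pos by simp
  have y: "\<bar>X div M\<bar> \<le> 2 ^ (7 * r + 2)" using abs_div_le[OF M_pos, of X] X by linarith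
  have pe: "(2::int) ^ (7 * r + 2) * 2 ^ r = 2 ^ (8 * r + 2)" "(2::int) ^ (8 * r + 3) * 2 ^ r = 2 ^ (9 * r + 3)"
    "(2::int) ^ r * 2 ^ r = 2 ^ (2 * r)"
    unfolding power_add[symmetric] by (rule arg_cong[of _ _ "\<lambda>k. 2 ^ k"], simp)+
  have yQ: "\<bar>X div M * Q\<bar> \<le> 2 ^ (8 * r + 2)" using abs_mult_le[OF y Qr] unfolding pe .
  have p: "(2::int) ^ (8 * r + 3) = 2 * 2 ^ (8 * r + 2)" "(2::int) ^ (9 * r + 4) = 2 * 2 ^ (9 * r + 3)"
    by (simp_all add: power_add)
  have m: "(2::int) ^ r \<le> 2 ^ (8 * r + 2)" "(2::int) ^ r \<le> 2 ^ (9 * r + 3)" by (intro pow_mono; simp)+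
  have yQg: "\<bar>X div M * Q + g\<bar> \<le> 2 ^ (8 * r + 3)" if "0 \<le> g" "g < Q" for g
    using yQ that Qr p(1) m(1) by linarith
  have yN: "\<bar>(X div M * Q + g) * int (n + 1)\<bar> \<le> 2 ^ (9 * r + 3)" if "0 \<le> g" "g < Q" for g
    using abs_mult_le[OF yQg[OF that] nr] unfolding pe .
  show "big X" by (rule bigI[OF X]) (use r7 in simp)
  show "big (X div M)" by (rule bigI[OF y]) (use r7 in simp)
  show "big (X div M * Q)" by (rule bigI[OF yQ]) (use r7 in simp)
  show "0 \<le> g \<Longrightarrow> g < Q \<Longrightarrow> big (X div M * Q + g)" by (rule bigI[OF yQg]) (use r7 in simp_all)
  show "0 \<le> g \<Longrightarrow> g < Q \<Longrightarrow> big ((X div M * Q + g) * int (n + 1))" by (rule bigI[OF yN]) (use r7 in simp_all)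
  show "big ((X div M * Q + g) * int (n + 1) + m)" if g: "0 \<le> g" "g < Q" "\<bar>m\<bar> \<le> int r"
  proof (rule bigI[where k = "9 * r + 4"])
    show "\<bar>(X div M * Q + g) * int (n + 1) + m\<bar> \<le> 2 ^ (9 * r + 4)"
      using yN[OF g(1,2)] g(3) r_le_pow p(2) m(2) by linarith
    show "9 * r + 4 < 10 * r" using r7 by simp
  qed
  show "big (Q * int (n + 1))"
    by (rule bigI[OF abs_mult_le[OF Qr nr, unfolded pe]]) (use r7 in simp)
qed

lemma p_out:
  assumes st: "static s" and Qs: "s ''Q'' 0 = Q" and res: "residues_ok s" and S: "holds (s ''S'') L"
    and p: "progress (length Cs) s"
  shows "wp p_out s (2000 * V) (correct_output I)"
proof -
  have fl: "s ''fail'' 0 = 0 \<or> s ''fail'' 0 = 1" using p by (auto simp: progress_def split: if_splits)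
  show ?thesis unfolding p_out_def
  proof (rule wp_If[OF md_W, where Tp = "1500 * V"])
    show "badm addr small small (Equal (Var ''fail'') (Const 0)) s" using fl by auto
  next
    assume "\<not> bval (Equal (Var ''fail'') (Const 0)) s"
    hence "\<not> (\<exists>l. is_solution I l)" using p by (simp add: progress_def)
    hence "sl addr small small (Put ''yes'' (Const 0)) s (correct_output I)" by (simp add: correct_output_def)
    from wp_sl[OF md_W this] show "wp (Put ''yes'' (Const 0)) s (1500 * V) (correct_output I)"
      by (rule wp_mono) (use V_bounds(5) in simp_all)
  next
    assume "bval (Equal (Var ''fail'') (Const 0)) s"
    hence pl: "placed (length Cs) (s ''X'') (s ''E'' 0)" using p by (simp add: progress_def)
    define X where "X = s ''X''"
    have sol: "is_solution I (\<lambda>v. real_of_int (dec (X v)) / real_of_int (Q * int (n + 1)))"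
      unfolding X_def by (rule grid_sol_imp_solution[OF placed_grid_sol[OF pl]])
    have Xb: "\<bar>X v\<bar> \<le> 2 ^ (7 * r + 2)" if "v < n" for v
    proof -
      obtain t where "t < length Cs" "v \<in> Cs ! t" using comp_of[OF \<open>v < n\<close>] by blast
      thus ?thesis using pl unfolding placed_def X_def by blast
    qed
    show "wp (Seq (Put ''yes'' (Const 1)) (For ''i'' ''n'' b_out)) s (1500 * V) (correct_output I)"
    proof (rule wp_Seq_sl[OF md_W, where R = "\<lambda>s. s ''yes'' 0 = 1"])
      show "sl addr small small (Put ''yes'' (Const 1)) s (\<lambda>s. s ''yes'' 0 = 1)" by simp
    next
      fix s1 assume y1: "s1 ''yes'' 0 = 1" and fr1: "\<And>z. z \<notin> wr (Put ''yes'' (Const 1)) \<Longrightarrow> s1 z = s z"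
      have st1: "static s1" by (rule static_frame[OF st], erule fr1) (simp add: static_names_def input_names_def)
      have k1: "s1 ''X'' = X" "s1 ''Q'' 0 = Q" "s1 ''S'' = s ''S''" "s1 ''f'' = s ''f''"
        using fr1[of "''X''"] fr1[of "''Q''"] fr1[of "''S''"] fr1[of "''f''"] Qs by (simp_all add: X_def)
      define O1 where "O1 i oa \<longleftrightarrow> (\<forall>j<i. oa j = dec (X j))" for i and oa :: "nat \<Rightarrow> int"
      define O2 where "O2 i oa \<longleftrightarrow> (\<forall>j<i. oa j = Q * int (n + 1))" for i and oa :: "nat \<Rightarrow> int"
      have O1S: "O1 (Suc i) (oa(i := dec (X i)))" if "O1 i oa" for i oa using that by (auto simp: O1_def less_Suc_eq)
      have O2S: "O2 (Suc i) (oa(i := Q * int (n + 1)))" if "O2 i oa" for i oa using that by (auto simp: O2_def less_Suc_eq)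
      show "wp (For ''i'' ''n'' b_out) s1 (1400 * V) (correct_output I)"
      proof (rule wp_For_B[where I = "\<lambda>i s. O1 i (s ''out_num'') \<and> O2 i (s ''out_den'')" and N = n])
        show "s1 ''n'' 0 = int n" using st1 inputsD(1) by (simp add: static_def)
        show "small (int n)" by (rule small_le) simp
        show "O1 0 (store s1 ''i'' 0 0 ''out_num'') \<and> O2 0 (store s1 ''i'' 0 0 ''out_den'')" by (simp add: O1_def O2_def)
        have "csize b_out * G * n + 100 * (n + 1) \<le> 1400 * G * (n + 1)"
          by (rule for_time) (simp_all add: b_out_def G_def)
        also have "\<dots> \<le> 1400 * V" using mult_le_mono2[OF V_bounds(2), of 1400] by (simp only: mult.assoc)
        finally show "csize b_out * G * n + 100 * (n + 1) \<le> 1400 * V" .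
      next
        fix i s2 assume i: "i < n" and J: "O1 i (s2 ''out_num'') \<and> O2 i (s2 ''out_den'')" and ii: "s2 ''i'' 0 = int i"
          and fr2: "\<And>z. z \<notin> insert ''i'' (wr b_out) \<Longrightarrow> s2 z = s1 z"
        have st2: "static s2" by (rule static_frame[OF st1], erule fr2) (simp add: static_names_def input_names_def)
        define N where "N = int (n + 1)"
        have N1: "N = int n + 1" "0 < N" by (simp_all add: N_def)
        have k2: "s2 ''X'' i = X i" "s2 ''Q'' 0 = Q" "s2 ''S'' = s ''S''" "s2 ''f'' = s ''f''" "s2 ''M'' 0 = M" "s2 ''n1'' 0 = N"
          using fr2[of "''X''"] fr2[of "''Q''"] fr2[of "''S''"] fr2[of "''f''"] k1 st2
          by (simp_all add: static_def codes_ok_def N_def)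
        define y where "y = X i div M"
        define z where "z = X i mod M"
        define \<rho> where "\<rho> = nat (z div N)"
        have z0: "0 \<le> z" "z < M" using M_pos by (simp_all add: z_def)
        have rl: "\<rho> < length L" "z div N = int \<rho>" using rem_level[of "X i"] by (simp_all add: \<rho>_def z_def N_def)
        define b where "b = L ! \<rho>"
        have Sb: "s ''S'' \<rho> = int b" using holds_nth[OF S rl(1)] by (simp add: b_def)
        have bn: "b < 2 * n + 1" using L_bound[OF rl(1)] by (simp add: b_def)
        define g where "g = f b"
        have fb: "s ''f'' b = g" using res bn by (simp add: residues_ok_def g_def)
        have gQ: "0 \<le> g" "g < Q" unfolding g_def by (rule f_range)+
        \<comment> \<open>The program evaluates \<open>dec\<close> literally, reading the grid
          fraction of rank \<open>\<rho>\<close> as the residue at index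
          \<open>S \<rho>\<close>.\<close>
        have de: "dec (X i) = (y * Q + g) * N + z mod N"
          by (simp add: dec_def y_def z_def[symmetric] g_def b_def \<rho>_def N_def)
        have n1: "1 \<le> n" using i by simp
        have mN: "0 \<le> z mod N" "z mod N < N" by (rule pos_mod_sign[OF N1(2)], rule pos_mod_bound[OF N1(2)])
        hence mr: "\<bar>z mod N\<bar> \<le> int r" using r_ge unfolding N1(1) by linarith
        note ob = out_bounds[OF n1 Xb[OF i], folded N_def y_def]
        have sz: "small z" using z0 small_M by (simp add: small_def)
        have "z mod N \<le> int n" using mN(2) unfolding N1(1) by simp
        hence "small (int (nat (z mod N)))" by (intro small_le) linarith
        hence zN: "small (z mod N)" using mN(1) by simp
        have "length L \<le> 5 * n + 2" using length_L by simp
        hence ss: "small (int i)" "small (int \<rho>)" "small (int b)" "small N"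
          using small_le[of i] small_le[of \<rho>] small_le[of b] small_le[of "n + 1"] i rl(1) bn
          unfolding N_def by simp_all
        have bg: "big Q" "big g" "big M" "big z"
          using big_r[of Q] Q_le Q_pos big_f[of b] small_big[OF small_M] small_big[OF sz] by (simp_all add: g_def)
        note oo = ob(1,2,3) ob(4,5)[OF gQ] ob(6)[OF gQ mr] ob(7)
        have Mn: "M \<noteq> 0" "N \<noteq> 0" using M_pos N1 by simp_all
        have qN: "Q * int (n + 1) = Q * N" by (simp add: N_def)
        note o1 = O1S[OF conjunct1[OF J], unfolded de] and o2 = O2S[OF conjunct2[OF J], unfolded qN]
        show "sl addr big big b_out s2 (\<lambda>s'. O1 (Suc i) (store s' ''i'' 0 (int (Suc i)) ''out_num'') \<and>
            O2 (Suc i) (store s' ''i'' 0 (int (Suc i)) ''out_den''))"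
          unfolding b_out_def
          using ii k2 y_def[symmetric] z_def[symmetric] rl(2) Sb fb bg oo ss ss[THEN small_big] small_big[OF zN] Mn o1 o2 by (simp add: addr_def)
      next
        fix s2 assume J: "O1 n (s2 ''out_num'') \<and> O2 n (s2 ''out_den'')"
          and fr2: "\<And>z. z \<notin> insert ''i'' (wr b_out) \<Longrightarrow> s2 z = s1 z"
        have out: "s2 ''out_num'' v = dec (X v)" "s2 ''out_den'' v = Q * int (n + 1)" if "v < n" for v
          using J that by (simp_all add: O1_def O2_def)
        have "s2 ''yes'' 0 = 1" using fr2[of "''yes''"] y1 by simp
        moreover have "is_solution I (\<lambda>v. real_of_int (s2 ''out_num'' v) / real_of_int (s2 ''out_den'' v))"
          by (rule is_solution_cong[OF _ sol]) (simp only: out)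
        moreover have "0 < s2 ''out_den'' v" if "v < n" for v using out(2)[OF that] Q_pos by simp
        ultimately show "correct_output I s2" using sol by (auto simp: correct_output_def vertices_def)
      qed simp_all
    next
      show "csize (Put ''yes'' (Const 1)) * 7 + 1400 * V \<le> 1500 * V" using V_bounds(5) by simp
    qed
  next
    show "bsize (Equal (Var ''fail'') (Const 0)) * 7 + 1500 * V \<le> 2000 * V" using V_bounds(5) by simp
  qed
qed

end

section \<open>Assembly of the phases and the final bound\<close>

context prun
begin

lemma boundrep_program: "wp boundrep_program (init_state I) (70000 * V) (correct_output I)"
  unfolding boundrep_program_def
proof (rule wp_Seq[OF p_pre])
  show "inputs (init_state I)" by (simp add: inputs_def)
  show "init_state I ''adj'' = (\<lambda>_. 0)" "init_state I ''deg'' = (\<lambda>_. 0)"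
    by (rule ext, simp add: init_state_def encode_def)+
next
  fix s1 assume "\<exists>L rk. prepared L rk s1" and fr1: "\<And>z. z \<notin> wr p_pre \<Longrightarrow> s1 z = init_state I z"
  then obtain L rk where p: "prepared L rk s1" by blast
  have p': "inputs s1" "adj_ok s1" "holds (s1 ''ord'') ord" "residues_ok s1" "s1 ''Q'' 0 = Q" "firsts_ok s1"
     "holds (s1 ''S'') L" "s1 ''d'' 0 = int (length L)" "sorted_idx L (2 * n + 1)"
     "\<forall>i<2 * n + 1. s1 ''rk'' i = int (rk i) \<and> rk i < length L \<and> f (L ! rk i) = f i"
    using p unfolding prepared_def by blast+
  have rkd: "ranked I (length L) (\<lambda>\<rho>. f (L ! \<rho>)) rk low"
    by (rule ranked_intro[OF p'(9)]) (use p'(10) low_le in blast)+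
  interpret pm: pmain I D L rk
    by (intro pmain.intro prun_axioms rkd pmain_axioms.intro p'(9))
  have v1: "s1 ''vis'' = (\<lambda>_. 0)"
    using fr1[of "''vis''"] by (rule trans[rotated, rotated]) (simp_all add: wr_p_pre init_state_def encode_def fun_eq_iff)
  have rks: "\<forall>i<2 * n + 1. s1 ''rk'' i = int (rk i)" using p'(10) by blast
  show "wp (Seq p_code (Seq p_main p_out)) s1 (40000 * V) (correct_output I)"
  proof (rule wp_Seq[OF pm.p_code[OF p'(1,4,8) rks]])
    fix s2 assume c2: "pm.codes_ok s2 \<and> s2 ''E'' 0 = low * pm.M - pm.M - 1" and fr2: "\<And>z. z \<notin> wr p_code \<Longrightarrow> s2 z = s1 z"
    have k2: "s2 ''adj'' = s1 ''adj''" "s2 ''ord'' = s1 ''ord''" "s2 ''A'' = s1 ''A''" "s2 ''f'' = s1 ''f''" "s2 ''Q'' = s1 ''Q''"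
      "s2 ''S'' = s1 ''S''" "s2 ''vis'' = s1 ''vis''" "s2 ''ncomp'' = s1 ''ncomp''" "s2 ''first'' = s1 ''first''"
      by (rule fr2, simp)+
    have inp2: "inputs s2" by (rule inputs_frame[OF p'(1)], erule fr2) (simp add: input_names_def)
    have st2: "pm.static s2"
      using inp2 c2 p'(2,3) k2 inputsD(1)[OF inp2] by (simp add: pm.static_def pm.graph_ok_def adj_ok_def)
    have first2: "firsts_ok s2" by (rule pm.firsts_ok_frame[OF p'(6) k2(8,9)])
    have res2: "residues_ok s2" using p'(4) k2 by (simp add: residues_ok_def)
    have vis2: "s2 ''vis'' = (\<lambda>_. 0)" using k2(7) v1 by simp
    show "wp (Seq p_main p_out) s2 (38000 * V) (correct_output I)"
    proof (rule wp_Seq[OF pm.p_main[OF st2 first2 vis2 conjunct2[OF c2]]])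
      fix s3 assume p3: "pm.progress (length Cs) s3" and fr3: "\<And>z. z \<notin> wr p_main \<Longrightarrow> s3 z = s2 z"
      have st3: "pm.static s3"
        by (rule pm.static_frame[OF st2], erule fr3) (simp add: pm.static_names_def input_names_def wr_p_main)
      have k3: "s3 ''A'' = s2 ''A''" "s3 ''f'' = s2 ''f''" "s3 ''Q'' = s2 ''Q''" "s3 ''S'' = s2 ''S''"
        by (rule fr3, simp add: wr_p_main)+
      have res3: "residues_ok s3" using res2 k3 by (simp add: residues_ok_def)
      have Q3: "s3 ''Q'' 0 = Q" and S3: "holds (s3 ''S'') L" using p'(5,7) k2 k3 by simp_all
      show "wp p_out s3 (2000 * V) (correct_output I)" by (rule pm.p_out[OF st3 Q3 res3 S3 p3])
    qed simp
  next
    show "1500 * G * (n + 1) + 38000 * V \<le> 40000 * V"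
      using mult_le_mono2[OF V_bounds(2), of 1500] by (simp only: mult.assoc)
  qed
qed simp

end

text \<open>The assumption says that a multiplication of \<open>r\<close>-bit numbers takes at least
  linear time, so that the O(n * r) spent on comparing and moving long numbers is covered by n *
  \<open>D r\<close>. Without vertices the stated bound is 0, but every run takes positive time;
  only the time claim excludes that case.\<close>

theorem mainTheorem13:
  fixes D :: "nat \<Rightarrow> nat"
  assumes "\<exists>k. \<forall>r. r \<le> k * D r"
  shows "\<exists>prog c K. \<forall>I. valid_input I \<longrightarrow>
    (\<exists>t s. exec D c (input_size I) prog (init_state I) t s \<and> correct_output I s \<and>
       (nv I > 0 \<longrightarrow> t \<le> K * ((nv I)\<^sup>2 + nv I * D (input_size I))))"
proof -
  obtain k where k: "\<And>r. r \<le> k * D r" using assms by blast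
  have "\<exists>t s. exec D 11 (input_size I) boundrep_program (init_state I) t s \<and> correct_output I s \<and>
      (nv I > 0 \<longrightarrow> t \<le> 70000 * (22 * k + 8) * ((nv I)\<^sup>2 + nv I * D (input_size I)))" if I: "valid_input I" for I
  proof -
    interpret prun I D by unfold_locales (use I input_size_ge2 in simp_all)
    obtain t s where e: "exec D 11 r boundrep_program (init_state I) t s" "t \<le> 70000 * V" "correct_output I s"
      using boundrep_program unfolding wp_def by blast
    have time: "t \<le> 70000 * (22 * k + 8) * (n\<^sup>2 + n * D r)" if n: "n > 0"
    proof -
      define d where "d = D r"
      define e where "e = k * d"
      have r: "r \<le> e" using k[of r] by (simp add: e_def d_def)
      have "0 < d" using r r2 by (cases d) (simp_all add: e_def)
      \<comment> \<open>The linear part of \<open>G\<close> is absorbed by \<open>e = k * d\<close>,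
        and its constant 1 by a second \<open>d\<close>, which is positive because \<open>r\<close>
        is.\<close>
      hence G: "G \<le> 2 * d + 11 * e" using r by (simp add: G_def d_def[symmetric])
      have "V \<le> (2 * n + (2 * d + 11 * e)) * (2 * n)" unfolding V_def by (rule mult_le_mono) (use n G in simp_all)
      also have "\<dots> = 4 * n\<^sup>2 + (22 * k + 4) * (n * d)" by (simp add: e_def power2_eq_square algebra_simps)
      also have "\<dots> \<le> (22 * k + 8) * n\<^sup>2 + (22 * k + 8) * (n * d)" by (intro add_mono mult_le_mono1) simp_all
      also have "\<dots> = (22 * k + 8) * (n\<^sup>2 + n * d)" by (simp only: add_mult_distrib2)
      finally have "70000 * V \<le> 70000 * ((22 * k + 8) * (n\<^sup>2 + n * d))" by (rule mult_le_mono2)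
      with \<open>t \<le> 70000 * V\<close> show ?thesis by (simp only: d_def mult.assoc)
    qed
    show ?thesis by (intro exI[of _ t] exI[of _ s] conjI impI e(1) e(3) time)
  qed
  thus ?thesis by blast
qed

end
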